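(* Let $(M^{2n},\omega)$ be a compact, connected symplectic Riemannian manifold without boundary, with $n\ge 2$, let $H_0\in C^r(M,\mathbb{R})$ ($r\ge 2$) and let $e_0\in\mathbb{R}$ be such that the Hamiltonian flow $(\varphi^{H_0}_t)_t$ restricted to a connected component $\mathcal{E}_{H_0,e_0}\subset H_0^{-1}(e_0)$ is Anosov. Then there is a $C^r$-open neighborhood $\mathcal{U}$ of $H_0$ and an open neighborhood $V\subset\mathbb{R}$ of $e_0$ such that for every $(H,e)\in\mathcal{U}\times V$ the flow $(\varphi^H_t)_t$ has trivial centralizer on the connected component $\mathcal{E}_{H,e}\subset H^{-1}(e)$ obtained as the analytic continuation of $\mathcal{E}_{H_0,e_0}$; that is, for every $X_K\in\mathcal{Z}^1_\omega(X_H)$ there exists $c\in\mathbb{R}$ such that $X_K(x)=c\,X_H(x)$ for every $x\in\mathcal{E}_{H,e}$.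
   Context: For $H\in C^2(M,\mathbb{R})$ the Hamiltonian vector field $X_H$ is defined by $\omega(X_H(x),v)=DH(x)v$ for all $v\in T_xM$, and $(\varphi^H_t)_t$ is its flow. The Poisson bracket is $\{K,H\}(x)=\frac{d}{dt}K(\varphi^H_t(x))|_{t=0}$, and the Hamiltonian $C^1$-centralizer is $\mathcal{Z}^1_\omega(X_H)=\{X_K:K\in C^2(M,\mathbb{R}),\ \{K,H\}=0\}$. The flow restricted to $\mathcal{E}$ is Anosov if $X_H$ has no zeros on $\mathcal{E}$ (so $\mathcal{E}$ is a compact hypersurface) and $\mathcal{E}$ is a hyperbolic set for the restricted flow: there is a $D\varphi^H_t$-invariant splitting $T\mathcal{E}=E^s\oplus E^0\oplus E^u$ with $E^0$ generated by $X_H$ and constants $C>0$, $\lambda\in(0,1)$ with $\|D\varphi^H_t(x)|_{E^s_x}\|\le C\lambda^t$ and $\|(D\varphi^H_t(x)|_{E^u_x})^{-1}\|\le C\lambda^t$ for all $x\in\mathcal{E}$, $t\ge0$. The (analytic) continuation $\mathcal{E}_{H,e}$ of $\mathcal{E}_{H_0,e_0}$, for $H$ close to $H_0$ and $e$ close to $e_0$, is the unique connected component of $H^{-1}(e)$ contained in a fixed small tubular neighborhood of $\mathcal{E}_{H_0,e_0}$. *)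

theory Defs
  imports "HOL-Analysis.Analysis" "HOL-Library.Extended_Nat"
begin

section \<open>Differentiability classes on open subsets of Euclidean spaces\<close>

text \<open>
  \<open>Ck_on k f S\<close> is meant for open \<open>S\<close>: all derivatives are taken \<open>at x\<close>, not \<open>at x within S\<close>.
\<close>

primrec Ck_on ::
  "nat \<Rightarrow> ('e::euclidean_space \<Rightarrow> 'b::real_normed_vector) \<Rightarrow> 'e set \<Rightarrow> bool" where
  "Ck_on 0 f S \<longleftrightarrow> continuous_on S f"
| "Ck_on (Suc k) f S \<longleftrightarrow>
     (\<forall>x\<in>S. f differentiable at x) \<and>
     (\<forall>v. Ck_on k (\<lambda>x. frechet_derivative f (at x) v) S)"

primrec iter_deriv :: "'e::euclidean_space list \<Rightarrow> ('e \<Rightarrow> real) \<Rightarrow> 'e \<Rightarrow> real" where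
  "iter_deriv [] f = f"
| "iter_deriv (v # vs) f = (\<lambda>x. frechet_derivative (iter_deriv vs f) (at x) v)"


section \<open>Smooth manifolds\<close>

text \<open>
  The manifold is the whole type \<open>'a\<close>; its dimension is that of the model space \<open>'e\<close>.
  Values of a chart map outside the domain of the chart carry no information.
\<close>

type_synonym ('a, 'e) chart = "'a set \<times> ('a \<Rightarrow> 'e)"

abbreviation chart_dom :: "('a, 'e) chart \<Rightarrow> 'a set" where
  "chart_dom c \<equiv> fst c"

abbreviation chart_map :: "('a, 'e) chart \<Rightarrow> 'a \<Rightarrow> 'e" where
  "chart_map c \<equiv> snd c"

abbreviation chart_img :: "('a, 'e) chart \<Rightarrow> 'e set" where
  "chart_img c \<equiv> chart_map c ` chart_dom c"

abbreviation chart_inv :: "('a, 'e) chart \<Rightarrow> 'e \<Rightarrow> 'a" where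
  "chart_inv c \<equiv> inv_into (chart_dom c) (chart_map c)"

definition is_chart :: "('a::topological_space, 'e::euclidean_space) chart \<Rightarrow> bool" where
  "is_chart c \<longleftrightarrow>
     open (chart_dom c) \<and> open (chart_img c) \<and>
     homeomorphism (chart_dom c) (chart_img c) (chart_map c) (chart_inv c)"

definition smooth_atlas :: "('a::topological_space, 'e::euclidean_space) chart set \<Rightarrow> bool" where
  "smooth_atlas A \<longleftrightarrow>
     (\<forall>c\<in>A. is_chart c) \<and>
     (\<Union>c\<in>A. chart_dom c) = UNIV \<and>
     (\<forall>c\<in>A. \<forall>d\<in>A. \<forall>k.
        Ck_on k (chart_map d \<circ> chart_inv c) (chart_map c ` (chart_dom c \<inter> chart_dom d)))"

text \<open>
  A chart of the atlas is selected around every point \<open>p\<close>, and the tangent space at \<open>p\<close> is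
  identified with the model space \<open>'e\<close> through that chart.  Thus a tangent vector at \<open>p\<close>
  is an element of \<open>'e\<close>, a vector field has type \<open>'a \<Rightarrow> 'e\<close>, and a field of bilinear forms
  has type \<open>'a \<Rightarrow> 'e \<Rightarrow> 'e \<Rightarrow> real\<close>.  The selected chart varies arbitrarily with \<open>p\<close>, so
  such a field is smooth if it is smooth after conversion to a fixed chart
  (\<open>coord_vec\<close>, \<open>local_form\<close>).  The metric of \<open>'e\<close> plays no role here.
\<close>

definition chart_at :: "('a, 'e) chart set \<Rightarrow> 'a \<Rightarrow> ('a, 'e) chart" where
  "chart_at A p = (SOME c. c \<in> A \<and> p \<in> chart_dom c)"

text \<open>The tangent vector at \<open>p\<close> that has components \<open>v\<close> in the chart \<open>c\<close>.\<close>

definition coord_vec ::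
  "('a, 'e::euclidean_space) chart set \<Rightarrow> ('a, 'e) chart \<Rightarrow> 'a \<Rightarrow> 'e \<Rightarrow> 'e" where
  "coord_vec A c p v =
     frechet_derivative (chart_map (chart_at A p) \<circ> chart_inv c) (at (chart_map c p)) v"

definition Ck_fun ::
  "('a, 'e::euclidean_space) chart set \<Rightarrow> nat \<Rightarrow> 'a set \<Rightarrow> ('a \<Rightarrow> real) \<Rightarrow> bool" where
  "Ck_fun A k N f \<longleftrightarrow>
     (\<forall>c\<in>A. Ck_on k (f \<circ> chart_inv c) (chart_map c ` (chart_dom c \<inter> N)))"

definition Ck_map ::
  "('a::topological_space, 'e::euclidean_space) chart set \<Rightarrow> nat \<Rightarrow> 'a set \<Rightarrow> ('a \<Rightarrow> 'a) \<Rightarrow> bool" where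
  "Ck_map A k N f \<longleftrightarrow>
     continuous_on N f \<and>
     (\<forall>c\<in>A. \<forall>d\<in>A. Ck_on k (chart_map d \<circ> f \<circ> chart_inv c)
        (chart_map c ` (chart_dom c \<inter> N \<inter> f -` chart_dom d)))"

definition dfun :: "('a, 'e::euclidean_space) chart set \<Rightarrow> ('a \<Rightarrow> real) \<Rightarrow> 'a \<Rightarrow> 'e \<Rightarrow> real" where
  "dfun A h p v =
     frechet_derivative (h \<circ> chart_inv (chart_at A p)) (at (chart_map (chart_at A p) p)) v"

definition tangent_map :: "('a, 'e::euclidean_space) chart set \<Rightarrow> ('a \<Rightarrow> 'a) \<Rightarrow> 'a \<Rightarrow> 'e \<Rightarrow> 'e" where
  "tangent_map A f p v =
     frechet_derivative (chart_map (chart_at A (f p)) \<circ> f \<circ> chart_inv (chart_at A p))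
       (at (chart_map (chart_at A p) p)) v"

text \<open>Continuity of the curve is not implied by the second conjunct, because chart maps are
  arbitrary outside the domain of the chart.\<close>

definition has_velocity ::
  "('a::topological_space, 'e::euclidean_space) chart set \<Rightarrow> (real \<Rightarrow> 'a) \<Rightarrow> real \<Rightarrow> 'e \<Rightarrow> bool" where
  "has_velocity A \<gamma> t v \<longleftrightarrow>
     isCont \<gamma> t \<and>
     ((\<lambda>s. chart_map (chart_at A (\<gamma> t)) (\<gamma> s)) has_vector_derivative v) (at t)"

definition tangent_space ::
  "('a::topological_space, 'e::euclidean_space) chart set \<Rightarrow> 'a set \<Rightarrow> 'a \<Rightarrow> 'e set" where
  "tangent_space A E p =
     {v. \<exists>\<gamma> \<delta>. 0 < \<delta> \<and> (\<forall>t. \<bar>t\<bar> < \<delta> \<longrightarrow> \<gamma> t \<in> E) \<and> \<gamma> 0 = p \<and> has_velocity A \<gamma> 0 v}"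


section \<open>The $C^r$ topology\<close>

definition Cr_functions ::
  "('a, 'e::euclidean_space) chart set \<Rightarrow> enat \<Rightarrow> ('a \<Rightarrow> real) set" where
  "Cr_functions A r = {f. \<forall>k. enat k \<le> r \<longrightarrow> Ck_fun A k UNIV f}"

definition Cr_nbhd ::
  "('a, 'e::euclidean_space) chart set \<Rightarrow> enat \<Rightarrow> ('a \<Rightarrow> real) \<Rightarrow> ('a, 'e) chart \<Rightarrow> 'a set
     \<Rightarrow> nat \<Rightarrow> real \<Rightarrow> ('a \<Rightarrow> real) set" where
  "Cr_nbhd A r f c K k \<epsilon> =
     {h \<in> Cr_functions A r. \<forall>x\<in>K. \<forall>vs. set vs \<subseteq> Basis \<and> length vs \<le> k \<longrightarrow>
        \<bar>iter_deriv vs (h \<circ> chart_inv c) (chart_map c x)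
          - iter_deriv vs (f \<circ> chart_inv c) (chart_map c x)\<bar> < \<epsilon>}"

text \<open>The weak Whitney topology; on a compact manifold it is the usual $C^r$ topology.\<close>

definition Cr_topology ::
  "('a::topological_space, 'e::euclidean_space) chart set \<Rightarrow> enat \<Rightarrow> ('a \<Rightarrow> real) topology" where
  "Cr_topology A r = topology_generated_by
     {Cr_nbhd A r f c K k \<epsilon> | f c K k \<epsilon>.
        f \<in> Cr_functions A r \<and> c \<in> A \<and> compact K \<and> K \<subseteq> chart_dom c \<and> enat k \<le> r \<and> 0 < \<epsilon>}"


section \<open>Symplectic forms and Riemannian metrics\<close>

definition local_form ::
  "('a, 'e::euclidean_space) chart set \<Rightarrow> ('a \<Rightarrow> 'e \<Rightarrow> 'e \<Rightarrow> real) \<Rightarrow> ('a, 'e) chart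
     \<Rightarrow> 'e \<Rightarrow> 'e \<Rightarrow> 'e \<Rightarrow> real" where
  "local_form A B c y u v =
     B (chart_inv c y) (coord_vec A c (chart_inv c y) u) (coord_vec A c (chart_inv c y) v)"

definition smooth_bilinear_field ::
  "('a, 'e::euclidean_space) chart set \<Rightarrow> ('a \<Rightarrow> 'e \<Rightarrow> 'e \<Rightarrow> real) \<Rightarrow> bool" where
  "smooth_bilinear_field A B \<longleftrightarrow>
     (\<forall>p. bilinear (B p)) \<and>
     (\<forall>c\<in>A. \<forall>u v k. Ck_on k (\<lambda>y. local_form A B c y u v) (chart_img c))"

text \<open>In a chart, the value of the exterior derivative of a 2-form on three constant vector
  fields is the cyclic sum of directional derivatives.\<close>

definition closed_2form ::
  "('a, 'e::euclidean_space) chart set \<Rightarrow> ('a \<Rightarrow> 'e \<Rightarrow> 'e \<Rightarrow> real) \<Rightarrow> bool" where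
  "closed_2form A \<omega> \<longleftrightarrow>
     (\<forall>c\<in>A. \<forall>y\<in>chart_img c. \<forall>u v w.
        frechet_derivative (\<lambda>z. local_form A \<omega> c z v w) (at y) u
        + frechet_derivative (\<lambda>z. local_form A \<omega> c z w u) (at y) v
        + frechet_derivative (\<lambda>z. local_form A \<omega> c z u v) (at y) w = 0)"

definition symplectic_form ::
  "('a, 'e::euclidean_space) chart set \<Rightarrow> ('a \<Rightarrow> 'e \<Rightarrow> 'e \<Rightarrow> real) \<Rightarrow> bool" where
  "symplectic_form A \<omega> \<longleftrightarrow>
     smooth_bilinear_field A \<omega> \<and>
     (\<forall>p u v. \<omega> p u v = - \<omega> p v u) \<and>
     (\<forall>p u. (\<forall>v. \<omega> p u v = 0) \<longrightarrow> u = 0) \<and>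
     closed_2form A \<omega>"

definition riemannian_metric ::
  "('a, 'e::euclidean_space) chart set \<Rightarrow> ('a \<Rightarrow> 'e \<Rightarrow> 'e \<Rightarrow> real) \<Rightarrow> bool" where
  "riemannian_metric A g \<longleftrightarrow>
     smooth_bilinear_field A g \<and>
     (\<forall>p u v. g p u v = g p v u) \<and>
     (\<forall>p u. u \<noteq> 0 \<longrightarrow> 0 < g p u u)"

definition gnorm :: "('a \<Rightarrow> 'e \<Rightarrow> 'e \<Rightarrow> real) \<Rightarrow> 'a \<Rightarrow> 'e \<Rightarrow> real" where
  "gnorm g p v = sqrt (g p v v)"


section \<open>Hamiltonian dynamics\<close>

definition ham_field ::
  "('a, 'e::euclidean_space) chart set \<Rightarrow> ('a \<Rightarrow> 'e \<Rightarrow> 'e \<Rightarrow> real) \<Rightarrow> ('a \<Rightarrow> real) \<Rightarrow> 'a \<Rightarrow> 'e" where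
  "ham_field A \<omega> H p = (THE u. \<forall>v. \<omega> p u v = dfun A H p v)"

definition flow ::
  "('a::topological_space, 'e::euclidean_space) chart set \<Rightarrow> ('a \<Rightarrow> 'e) \<Rightarrow> real \<Rightarrow> 'a \<Rightarrow> 'a" where
  "flow A X t p = (THE \<gamma>. \<gamma> 0 = p \<and> (\<forall>s. has_velocity A \<gamma> s (X (\<gamma> s)))) t"

definition ham_flow ::
  "('a::topological_space, 'e::euclidean_space) chart set \<Rightarrow> ('a \<Rightarrow> 'e \<Rightarrow> 'e \<Rightarrow> real)
     \<Rightarrow> ('a \<Rightarrow> real) \<Rightarrow> real \<Rightarrow> 'a \<Rightarrow> 'a" where
  "ham_flow A \<omega> H = flow A (ham_field A \<omega> H)"

definition poisson_bracket ::
  "('a::topological_space, 'e::euclidean_space) chart set \<Rightarrow> ('a \<Rightarrow> 'e \<Rightarrow> 'e \<Rightarrow> real)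
     \<Rightarrow> ('a \<Rightarrow> real) \<Rightarrow> ('a \<Rightarrow> real) \<Rightarrow> 'a \<Rightarrow> real" where
  "poisson_bracket A \<omega> K H p = deriv (\<lambda>t. K (ham_flow A \<omega> H t p)) 0"

text \<open>The Hamiltonian $C^1$-centralizer of \<open>ham_field A \<omega> H\<close>.\<close>

definition ham_centralizer ::
  "('a::topological_space, 'e::euclidean_space) chart set \<Rightarrow> ('a \<Rightarrow> 'e \<Rightarrow> 'e \<Rightarrow> real)
     \<Rightarrow> ('a \<Rightarrow> real) \<Rightarrow> ('a \<Rightarrow> 'e) set" where
  "ham_centralizer A \<omega> H =
     {ham_field A \<omega> K | K. K \<in> Cr_functions A 2 \<and> (\<forall>p. poisson_bracket A \<omega> K H p = 0)}"

definition trivial_centralizer_on ::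
  "('a::topological_space, 'e::euclidean_space) chart set \<Rightarrow> ('a \<Rightarrow> 'e \<Rightarrow> 'e \<Rightarrow> real)
     \<Rightarrow> ('a \<Rightarrow> real) \<Rightarrow> 'a set \<Rightarrow> bool" where
  "trivial_centralizer_on A \<omega> H E \<longleftrightarrow>
     (\<forall>X \<in> ham_centralizer A \<omega> H. \<exists>c::real. \<forall>p\<in>E. X p = c *\<^sub>R ham_field A \<omega> H p)"

definition direct_sum3 :: "'e::real_vector set \<Rightarrow> 'e set \<Rightarrow> 'e set \<Rightarrow> 'e set \<Rightarrow> bool" where
  "direct_sum3 T P Q R \<longleftrightarrow>
     subspace P \<and> subspace Q \<and> subspace R \<and>
     T = {a + b + c | a b c. a \<in> P \<and> b \<in> Q \<and> c \<in> R} \<and>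
     (\<forall>a\<in>P. \<forall>b\<in>Q. \<forall>c\<in>R. a + b + c = 0 \<longrightarrow> a = 0 \<and> b = 0 \<and> c = 0)"

definition hyperbolic_on ::
  "('a::topological_space, 'e::euclidean_space) chart set \<Rightarrow> ('a \<Rightarrow> 'e \<Rightarrow> 'e \<Rightarrow> real)
     \<Rightarrow> ('a \<Rightarrow> 'e \<Rightarrow> 'e \<Rightarrow> real) \<Rightarrow> ('a \<Rightarrow> real) \<Rightarrow> 'a set \<Rightarrow> bool" where
  "hyperbolic_on A \<omega> g H E \<longleftrightarrow>
     (\<exists>Es E0 Eu :: 'a \<Rightarrow> 'e set. \<exists>C \<theta> :: real.
        0 < C \<and> 0 < \<theta> \<and> \<theta> < 1 \<and>
        (\<forall>p\<in>E.
           direct_sum3 (tangent_space A E p) (Es p) (E0 p) (Eu p) \<and>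
           E0 p = span {ham_field A \<omega> H p} \<and>
           (\<forall>t. let D = tangent_map A (ham_flow A \<omega> H t) p; q = ham_flow A \<omega> H t p in
              D ` Es p = Es q \<and> D ` E0 p = E0 q \<and> D ` Eu p = Eu q) \<and>
           (\<forall>t\<ge>0. let D = tangent_map A (ham_flow A \<omega> H t) p; q = ham_flow A \<omega> H t p in
              (\<forall>v\<in>Es p. gnorm g q (D v) \<le> C * \<theta> powr t * gnorm g p v) \<and>
              (\<forall>w\<in>Eu q. gnorm g p (inv_into (Eu p) D w) \<le> C * \<theta> powr t * gnorm g q w))))"

definition anosov_on ::
  "('a::topological_space, 'e::euclidean_space) chart set \<Rightarrow> ('a \<Rightarrow> 'e \<Rightarrow> 'e \<Rightarrow> real)
     \<Rightarrow> ('a \<Rightarrow> 'e \<Rightarrow> 'e \<Rightarrow> real) \<Rightarrow> ('a \<Rightarrow> real) \<Rightarrow> 'a set \<Rightarrow> bool" where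
  "anosov_on A \<omega> g H E \<longleftrightarrow>
     (\<forall>p\<in>E. ham_field A \<omega> H p \<noteq> 0) \<and> hyperbolic_on A \<omega> g H E"


section \<open>Continuation of energy hypersurfaces\<close>

text \<open>
  A regular level hypersurface has trivial normal bundle (its conormal bundle is spanned by
  the differential of the Hamiltonian), so a tubular neighborhood of \<open>E\<close> is an open set \<open>N\<close>
  with a diffeomorphism \<open>N \<rightarrow> E \<times> (-1, 1)\<close> that maps \<open>x \<in> E\<close> to \<open>(x, 0)\<close>.  The components
  of this diffeomorphism are \<open>\<pi>\<close> and \<open>\<sigma>\<close>; injectivity of its derivative makes the inverse
  differentiable, because \<open>N\<close> and \<open>E \<times> (-1, 1)\<close> have the same dimension.
\<close>

definition tubular_neighborhood ::
  "('a::topological_space, 'e::euclidean_space) chart set \<Rightarrow> 'a set \<Rightarrow> 'a set \<Rightarrow> bool" where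
  "tubular_neighborhood A E N \<longleftrightarrow>
     open N \<and> E \<subseteq> N \<and>
     (\<exists>(\<pi> :: 'a \<Rightarrow> 'a) (\<sigma> :: 'a \<Rightarrow> real).
        Ck_map A 1 N \<pi> \<and> Ck_fun A 1 N \<sigma> \<and>
        (\<forall>x\<in>E. \<pi> x = x \<and> \<sigma> x = 0) \<and>
        bij_betw (\<lambda>z. (\<pi> z, \<sigma> z)) N (E \<times> {-1<..<1}) \<and>
        (\<forall>z\<in>N. \<forall>v. tangent_map A \<pi> z v = 0 \<and> dfun A \<sigma> z v = 0 \<longrightarrow> v = 0))"

text \<open>\<open>E\<close> is the unique connected component of the level set that is contained in \<open>N\<close>.\<close>

definition is_continuation ::
  "'a::topological_space set \<Rightarrow> ('a \<Rightarrow> real) \<Rightarrow> real \<Rightarrow> 'a set \<Rightarrow> bool" where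
  "is_continuation N H e E \<longleftrightarrow> {E' \<in> components (H -` {e}). E' \<subseteq> N} = {E}"

end

theory Submission
  imports Defs
begin

text \<open>
  Let \<open>K\<close> commute with \<open>H\<close>.  Then \<open>K\<close> is constant along the Hamiltonian flow of \<open>H\<close>.  The heart of the
  proof is a rigidity property of the energy levels of all \<open>(H, e)\<close> near \<open>(H0, e0)\<close>: if a \<open>C\<^sup>1\<close>
  function \<open>f\<close> near the level is invariant under the flow, then \<open>df\<close> vanishes on the kernel of \<open>dH\<close>.
  Applied to \<open>K\<close> on all nearby levels, it gives \<open>dK = c dH\<close> near the level.  The factor \<open>c\<close> is \<open>C\<^sup>1\<close>,
  since \<open>K\<close> and \<open>H\<close> are \<open>C\<^sup>2\<close>, and invariant, since \<open>dK\<close> and \<open>dH\<close> are.  Rigidity of \<open>c\<close> shows that \<open>c\<close>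
  is locally constant on the level, which is connected; hence \<open>X\<^sub>K = c X\<^sub>H\<close> there with a constant \<open>c\<close>
  (\<open>trivial_centralizer\<close>).

  On the level of \<open>H0\<close> itself rigidity is immediate from hyperbolicity: \<open>df\<close> is bounded and invariant, so it
  vanishes on vectors that the flow contracts in the future or in the past, and it vanishes on the
  Hamiltonian field.  Nearby levels are reached by compactness
  (\<open>sequence_of_non_rigid_levels_absurd\<close>): counterexamples for a sequence converging to
  \<open>(H0, e0)\<close>, normalised at almost maximal unit vectors, contradict the contraction of the limit vector
  at one large but fixed time.

  This takes continuity of the flow and of its derivative in the Hamiltonian.  Both come from one
  statement about displacements, that is, pairs of points of a sequence whose difference quotients
  converge: if fields \<open>G n\<close> converge to \<open>g\<close> in \<open>C\<^sup>1\<close>, then their flows carry displacements to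
  displacements, and the limit vectors satisfy the variational equation of \<open>g\<close> (\<open>displaces_ode\<close>,
  \<open>flow_mdisp\<close>, \<open>tconv_flow\<close>).  For a constant sequence this is differentiability of the flow.

  The tubular neighborhood is a collar swept out by the rescaled gradient \<open>Y\<close> of \<open>H0\<close>, with the energy as
  transversal coordinate (\<open>tubular_neighborhood_tube\<close>).  A Hamiltonian close to \<open>H0\<close> increases along \<open>Y\<close>, so
  its levels in the collar are graphs over \<open>E0\<close>; they are connected, relatively open and closed, and thus
  the continuations of \<open>E0\<close> (\<open>level_continuation\<close>).
\<close>

section \<open>Strict differentiability through sequences\<close>

text \<open>Tangent vectors are handled as limits of difference quotients.  Both end points move, so that on open
  sets the maps which transport displacements are exactly the \<open>C\<^sup>1\<close> maps (\<open>displaces_C1\<close>,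
  \<open>strict_derivative_C1\<close>), and so that the maps themselves may vary along the sequence.\<close>

definition displaces ::
  "(nat \<Rightarrow> 'e::real_normed_vector) \<Rightarrow> (nat \<Rightarrow> 'e) \<Rightarrow> (nat \<Rightarrow> real) \<Rightarrow> 'e \<Rightarrow> 'e \<Rightarrow> bool" where
  "displaces y z h x v \<longleftrightarrow>
     y \<longlonglongrightarrow> x \<and> (\<forall>n. 0 < h n) \<and> h \<longlonglongrightarrow> 0 \<and> (\<lambda>n. (z n - y n) /\<^sub>R h n) \<longlonglongrightarrow> v"

lemma displacesD:
  assumes "displaces y z h x v"
  shows "y \<longlonglongrightarrow> x" "\<And>n. 0 < h n" "h \<longlonglongrightarrow> 0" "(\<lambda>n. (z n - y n) /\<^sub>R h n) \<longlonglongrightarrow> v" "z \<longlonglongrightarrow> x"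
proof -
  show *: "y \<longlonglongrightarrow> x" "\<And>n. 0 < h n" "h \<longlonglongrightarrow> 0" "(\<lambda>n. (z n - y n) /\<^sub>R h n) \<longlonglongrightarrow> v"
    using assms unfolding displaces_def by auto
  have "(\<lambda>n. y n + h n *\<^sub>R ((z n - y n) /\<^sub>R h n)) \<longlonglongrightarrow> x + 0 *\<^sub>R v"
    by (intro tendsto_intros *)
  moreover have "y n + h n *\<^sub>R ((z n - y n) /\<^sub>R h n) = z n" for n
    using *(2)[of n] by simp
  ultimately show "z \<longlonglongrightarrow> x" by simp
qed

lemma displaces_cong:
  assumes "displaces y z h x v" "\<forall>\<^sub>F n in sequentially. y' n = y n" "\<forall>\<^sub>F n in sequentially. z' n = z n"
  shows "displaces y' z' h x v"
proof -
  have "(\<lambda>n. (z' n - y' n) /\<^sub>R h n) \<longlonglongrightarrow> v"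
    by (rule Lim_transform_eventually[OF displacesD(4)[OF assms(1)]])
      (use assms(2,3) in eventually_elim, simp)
  moreover have "y' \<longlonglongrightarrow> x"
    by (rule Lim_transform_eventually[OF displacesD(1)[OF assms(1)]])
      (use assms(2) in eventually_elim, simp)
  ultimately show ?thesis using assms(1) by (simp add: displaces_def)
qed

lemma displaces_subseq:
  assumes "displaces y z h x v" "strict_mono s"
  shows "displaces (y \<circ> s) (z \<circ> s) (h \<circ> s) x v"
  using displacesD[OF assms(1)] LIMSEQ_subseq_LIMSEQ[OF displacesD(1)[OF assms(1)] assms(2)]
    LIMSEQ_subseq_LIMSEQ[OF displacesD(3)[OF assms(1)] assms(2)]
    LIMSEQ_subseq_LIMSEQ[OF displacesD(4)[OF assms(1)] assms(2)]
  unfolding displaces_def by (simp add: o_def)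

lemma displaces_offset:
  assumes "displaces (\<lambda>n. y (n + N)) (\<lambda>n. z (n + N)) (\<lambda>n. h (n + N)) x v" "\<And>n. 0 < h n"
  shows "displaces y z h x v"
  using assms LIMSEQ_offset[of y N x] LIMSEQ_offset[of h N 0] LIMSEQ_offset[of "\<lambda>n. (z n - y n) /\<^sub>R h n" N v]
  unfolding displaces_def by blast

lemma strict_mono_offset: "strict_mono (\<lambda>n. n + N :: nat)"
  by (simp add: strict_mono_def)

lemma displaces_line:
  fixes x v :: "'e::real_normed_vector"
  assumes "\<And>n. 0 < h n" "h \<longlonglongrightarrow> 0" "y \<longlonglongrightarrow> x" "w \<longlonglongrightarrow> v"
  shows "displaces y (\<lambda>n. y n + h n *\<^sub>R w n) h x v"
proof -
  have "h n \<noteq> 0" for n using assms(1)[of n] by simp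
  then have "(\<lambda>n. (y n + h n *\<^sub>R w n - y n) /\<^sub>R h n) = w" by (auto simp: fun_eq_iff)
  then show ?thesis using assms by (simp add: displaces_def)
qed

lemma C1_differentiable: "Ck_on (Suc k) f S \<Longrightarrow> x \<in> S \<Longrightarrow> f differentiable at x"
  by simp

lemma C1_has_derivative:
  "Ck_on (Suc k) f S \<Longrightarrow> x \<in> S \<Longrightarrow> (f has_derivative frechet_derivative f (at x)) (at x)"
  by (simp add: frechet_derivative_works[symmetric])

lemma C1_continuous_on: "Ck_on (Suc k) f S \<Longrightarrow> continuous_on S f"
  by (meson C1_differentiable continuous_at_imp_continuous_on differentiable_imp_continuous_within)

lemma Ck_on_Suc_imp: "Ck_on (Suc k) f S \<Longrightarrow> Ck_on k f S"
proof (induction k arbitrary: f)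
  case 0 then show ?case using C1_continuous_on[of 0] by simp
next
  case (Suc k)
  then show ?case by (metis Ck_on.simps(2))
qed

lemma Ck_on_mono: "Ck_on k f S \<Longrightarrow> j \<le> k \<Longrightarrow> Ck_on j f S"
  by (induction k) (auto simp: le_Suc_eq intro: Ck_on_Suc_imp simp del: Ck_on.simps)

lemma Ck_on_subset: "Ck_on k f S \<Longrightarrow> T \<subseteq> S \<Longrightarrow> Ck_on k f T"
  by (induction k arbitrary: f) (auto intro: continuous_on_subset)

lemma linear_eq_sum_Basis:
  fixes f :: "'e::euclidean_space \<Rightarrow> 'b::real_vector"
  assumes "linear f"
  shows "f v = (\<Sum>b\<in>Basis. (v \<bullet> b) *\<^sub>R f b)"
  by (metis (no_types, lifting) assms euclidean_representation linear_scale linear_sum sum.cong)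

text \<open>The derivative of a \<open>C\<^sup>1\<close> map is jointly continuous in base point and direction, because
  it is a combination of finitely many continuous partial derivatives.\<close>

lemma C1_derivative_tendsto:
  fixes f :: "'e::euclidean_space \<Rightarrow> 'b::real_normed_vector"
  assumes "Ck_on (Suc 0) f S" "open S" "x \<in> S" "(y \<longlongrightarrow> x) F" "(w \<longlongrightarrow> v) F"
  shows "((\<lambda>n. frechet_derivative f (at (y n)) (w n)) \<longlongrightarrow> frechet_derivative f (at x) v) F"
proof -
  have lin: "linear (frechet_derivative f (at u))" if "u \<in> S" for u
    using linear_frechet_derivative C1_differentiable[OF assms(1) that] by blast
  have "((\<lambda>n. \<Sum>b\<in>Basis. (w n \<bullet> b) *\<^sub>R frechet_derivative f (at (y n)) b) \<longlongrightarrow>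
      (\<Sum>b\<in>Basis. (v \<bullet> b) *\<^sub>R frechet_derivative f (at x) b)) F"
  proof (intro tendsto_intros assms)
    fix b
    have "continuous_on S (\<lambda>x. frechet_derivative f (at x) b)" using assms(1) by simp
    then have "isCont (\<lambda>x. frechet_derivative f (at x) b) x"
      using assms(2,3) by (simp add: continuous_on_eq_continuous_at)
    then show "((\<lambda>n. frechet_derivative f (at (y n)) b) \<longlongrightarrow> frechet_derivative f (at x) b) F"
      using assms(4) isCont_tendsto_compose by blast
  qed
  moreover have "\<forall>\<^sub>F n in F. (\<Sum>b\<in>Basis. (w n \<bullet> b) *\<^sub>R frechet_derivative f (at (y n)) b)
      = frechet_derivative f (at (y n)) (w n)"
    using topological_tendstoD[OF assms(4,2,3)]
    by eventually_elim (simp add: linear_eq_sum_Basis[OF lin, symmetric])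
  ultimately show ?thesis
    by (simp add: linear_eq_sum_Basis[OF lin[OF assms(3)], symmetric] Lim_transform_eventually)
qed

lemma C1_onorm_continuous:
  fixes f :: "'e::euclidean_space \<Rightarrow> 'b::real_normed_vector"
  assumes "Ck_on (Suc 0) f S" "open S" "x \<in> S" "0 < e"
  obtains d where "0 < d" "cball x d \<subseteq> S"
    "\<And>y. y \<in> cball x d \<Longrightarrow> onorm (frechet_derivative f (at y) - frechet_derivative f (at x)) \<le> e"
proof -
  let ?D = "\<lambda>y. frechet_derivative f (at y)"
  have lin: "linear (?D u)" if "u \<in> S" for u
    using linear_frechet_derivative C1_differentiable[OF assms(1) that] by blast
  have "continuous_on S (\<lambda>y. \<Sum>b\<in>Basis. norm (?D y b - ?D x b))"
    using assms(1) by (intro continuous_intros) auto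
  then have "isCont (\<lambda>y. \<Sum>b\<in>Basis. norm (?D y b - ?D x b)) x"
    using assms(2,3) by (simp add: continuous_on_eq_continuous_at)
  then obtain d1 where d1: "0 < d1" "\<And>y. dist y x < d1 \<Longrightarrow> (\<Sum>b\<in>Basis. norm (?D y b - ?D x b)) < e"
    using assms(4) unfolding continuous_at_eps_delta
    by (auto simp: dist_real_def sum_nonneg) 
  obtain d2 where d2: "0 < d2" "cball x d2 \<subseteq> S" using assms(2,3) open_contains_cball by blast
  show thesis
  proof
    show "0 < min (d1/2) d2" using d1 d2 by simp
    show sub: "cball x (min (d1/2) d2) \<subseteq> S" using d2 by auto
    fix y assume y: "y \<in> cball x (min (d1/2) d2)"
    then have "y \<in> S" using sub by blast
    then have "bounded_linear (?D y - ?D x)"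
      using lin assms(3) unfolding fun_diff_def
      by (intro linear_conv_bounded_linear[THEN iffD1] linear_compose_sub) auto
    then have "onorm (?D y - ?D x) \<le> (\<Sum>b\<in>Basis. norm ((?D y - ?D x) b))"
      by (rule onorm_componentwise)
    also have "\<dots> < e" using d1(2)[of y] y d1(1) by (auto simp: dist_commute)
    finally show "onorm (?D y - ?D x) \<le> e" by simp
  qed
qed

text \<open>Mean value inequality: a \<open>C\<^sup>1\<close> map transports displacements by its derivative, also when
  both end points of the displacement move.\<close>

lemma displaces_C1:
  fixes f :: "'e::euclidean_space \<Rightarrow> 'b::real_normed_vector"
  assumes "Ck_on (Suc 0) f S" "open S" "x \<in> S" "displaces y z h x v"
  shows "displaces (f \<circ> y) (f \<circ> z) h (f x) (frechet_derivative f (at x) v)"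
proof -
  note d = displacesD[OF assms(4)]
  let ?D = "\<lambda>y. frechet_derivative f (at y)"
  let ?q = "\<lambda>n. (z n - y n) /\<^sub>R h n"
  have lin: "linear (?D x)"
    using linear_frechet_derivative C1_differentiable[OF assms(1,3)] by blast
  have "(\<lambda>n. (f (z n) - f (y n)) /\<^sub>R h n - ?D x (?q n)) \<longlonglongrightarrow> 0"
  proof (rule tendsto_norm_zero_cancel, rule LIMSEQ_I)
    fix e :: real assume "0 < e"
    define e' where "e' = e / (norm v + 2)"
    have e': "0 < e'" using \<open>0 < e\<close> by (simp add: e'_def add_nonneg_pos)
    obtain r where r: "0 < r" "cball x r \<subseteq> S" "\<And>y. y \<in> cball x r \<Longrightarrow> onorm (?D y - ?D x) \<le> e'"
      using C1_onorm_continuous[OF assms(1-3) e'] by metis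
    have "\<forall>\<^sub>F n in sequentially. dist (y n) x < r" "\<forall>\<^sub>F n in sequentially. dist (z n) x < r"
      using d r(1) tendstoD by blast+
    moreover have "\<forall>\<^sub>F n in sequentially. norm (?q n) < norm v + 1"
      using tendsto_norm[OF d(4)] by (rule order_tendstoD) simp
    ultimately have "\<forall>\<^sub>F n in sequentially. norm ((f (z n) - f (y n)) /\<^sub>R h n - ?D x (?q n)) < e"
    proof eventually_elim
      case (elim n)
      have seg: "y n + t *\<^sub>R (z n - y n) \<in> cball x r" if "t \<in> {0..1}" for t
      proof -
        have "y n + t *\<^sub>R (z n - y n) = (1 - t) *\<^sub>R y n + t *\<^sub>R z n" by (simp add: algebra_simps)
        then show ?thesis
          using convex_cball[of x r] elim that unfolding convex_alt
          by (auto simp: dist_commute less_imp_le)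
      qed
      have "norm (f (z n) - f (y n) - ?D x (z n - y n)) \<le> norm (z n - y n) * e'"
      proof (rule differentiable_bound_linearization[OF seg])
        fix u assume "u \<in> cball x r"
        then show "(f has_derivative ?D u) (at u within cball x r)"
          using C1_has_derivative[OF assms(1)] r(2) has_derivative_at_withinI by blast
      qed (use r in auto)
      then have "norm (f (z n) - f (y n) - ?D x (z n - y n)) / h n \<le> norm (z n - y n) * e' / h n"
        using d(2)[of n] by (simp add: divide_right_mono)
      also have "norm (z n - y n) * e' / h n = norm (?q n) * e'"
        using d(2)[of n] by (simp add: divide_inverse)
      also have "\<dots> \<le> (norm v + 1) * e'" using elim e' by (simp add: mult_right_mono)
      also have "\<dots> < (norm v + 2) * e'" using e' by simp
      also have "\<dots> = e" using norm_ge_zero[of v] by (simp add: e'_def del: norm_ge_zero)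
      finally have "norm (f (z n) - f (y n) - ?D x (z n - y n)) / h n < e" .
      moreover have "(f (z n) - f (y n)) /\<^sub>R h n - ?D x (?q n)
          = (f (z n) - f (y n) - ?D x (z n - y n)) /\<^sub>R h n"
        unfolding linear_scale[OF lin, of _ "z n - y n"] scaleR_diff_right[symmetric] ..
      ultimately show ?case using d(2)[of n] by (simp add: divide_inverse mult.commute)
    qed
    then show "\<exists>no. \<forall>n\<ge>no. norm (norm ((f (z n) - f (y n)) /\<^sub>R h n - ?D x (?q n)) - 0) < e"
      by (simp add: eventually_sequentially)
  qed
  moreover have "(\<lambda>n. ?D x (?q n)) \<longlonglongrightarrow> ?D x v"
    using lin d(4) unfolding linear_conv_bounded_linear by (rule bounded_linear.tendsto)
  ultimately have "(\<lambda>n. (f (z n) - f (y n)) /\<^sub>R h n) \<longlonglongrightarrow> 0 + ?D x v"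
    using tendsto_add by fastforce
  moreover have "(\<lambda>n. f (y n)) \<longlonglongrightarrow> f x"
    using C1_continuous_on[OF assms(1)] assms(2,3) d(1)
    by (simp add: continuous_on_eq_continuous_at isCont_tendsto_compose)
  ultimately show ?thesis using d by (simp add: displaces_def o_def)
qed

text \<open>Conversely, a map that transports displacements is differentiable with continuous
  derivative.  Additivity of the derivative comes from concatenating two displacements, which is
  possible since both end points may move.\<close>

context
  fixes f :: "'e::euclidean_space \<Rightarrow> 'b::euclidean_space" and x :: 'e and D :: "'e \<Rightarrow> 'b"
  assumes D: "\<And>y z h v. displaces y z h x v \<Longrightarrow> (\<lambda>n. (f (z n) - f (y n)) /\<^sub>R h n) \<longlonglongrightarrow> D v"
begin

lemma strict_derivative_linear: "linear D"
proof -
  let ?k = "\<lambda>n. inverse (real (Suc n))"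
  have k: "?k \<longlonglongrightarrow> 0" by (rule LIMSEQ_inverse_real_of_nat)
  have k0: "0 < ?k n" for n by simp
  have add: "D (u + v) = D u + D v" for u v
  proof -
    let ?y = "\<lambda>n. x + ?k n *\<^sub>R u"
    have y: "?y \<longlonglongrightarrow> x" using tendsto_add[OF tendsto_const[of x] tendsto_scaleR[OF k tendsto_const[of u]]] by simp
    have 1: "(\<lambda>n. (f (?y n) - f x) /\<^sub>R ?k n) \<longlonglongrightarrow> D u"
      using D[OF displaces_line[OF k0 k tendsto_const tendsto_const]] by simp
    have 2: "(\<lambda>n. (f (?y n + ?k n *\<^sub>R v) - f (?y n)) /\<^sub>R ?k n) \<longlonglongrightarrow> D v"
      using D[OF displaces_line[OF k0 k y tendsto_const]] by simp
    have 3: "(\<lambda>n. (f (x + ?k n *\<^sub>R (u + v)) - f x) /\<^sub>R ?k n) \<longlonglongrightarrow> D (u + v)"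
      using D[OF displaces_line[OF k0 k tendsto_const tendsto_const]] by simp
    show ?thesis
      by (rule LIMSEQ_unique[OF 3]) (use tendsto_add[OF 1 2] in \<open>simp add: algebra_simps\<close>)
  qed
  have pos: "D (c *\<^sub>R v) = c *\<^sub>R D v" if "0 < c" for c v
  proof -
    let ?h = "\<lambda>n. c * ?k n"
    have h: "?h \<longlonglongrightarrow> 0" using tendsto_mult_left[OF k, of c] by simp
    have h0: "0 < ?h n" for n using that by simp
    have 1: "(\<lambda>n. (f (x + ?h n *\<^sub>R v) - f x) /\<^sub>R ?h n) \<longlonglongrightarrow> D v"
      using D[OF displaces_line[OF h0 h tendsto_const tendsto_const]] by simp
    have 2: "(\<lambda>n. (f (x + ?k n *\<^sub>R (c *\<^sub>R v)) - f x) /\<^sub>R ?k n) \<longlonglongrightarrow> D (c *\<^sub>R v)"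
      using D[OF displaces_line[OF k0 k tendsto_const[of x] tendsto_const[of "c *\<^sub>R v"]]] .
    show ?thesis
      by (rule LIMSEQ_unique[OF 2])
        (use tendsto_scaleR[OF tendsto_const[of c] 1] that in \<open>simp add: mult.assoc[symmetric] mult.commute[of _ c]\<close>)
  qed
  have zero: "D 0 = 0" using add[of 0 0] by simp
  have neg: "D (- v) = - D v" for v using add[of v "- v"] zero by (simp add: eq_neg_iff_add_eq_0 add.commute)
  show ?thesis
  proof (rule linearI[OF add])
    fix c :: real and v
    consider "c < 0" | "c = 0" | "0 < c" by linarith
    then show "D (c *\<^sub>R v) = c *\<^sub>R D v"
      using pos[of c v] pos[of "- c" v] neg[of "c *\<^sub>R v"] zero by cases auto
  qed
qed

lemma strict_derivative: "(f has_derivative D) (at x)"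
proof -
  have bl: "bounded_linear D" using strict_derivative_linear by (simp add: linear_conv_bounded_linear)
  have "\<exists>d>0. \<forall>z. norm (z - x) < d \<longrightarrow> norm (f z - f x - D (z - x)) \<le> e * norm (z - x)" if "0 < e" for e
  proof (rule ccontr)
    assume "\<not> ?thesis"
    then have "\<forall>n. \<exists>z. norm (z - x) < inverse (real (Suc n)) \<and> norm (f z - f x - D (z - x)) > e * norm (z - x)"
      by (metis inverse_positive_iff_positive not_le of_nat_0_less_iff zero_less_Suc)
    then obtain z where z: "\<And>n. norm (z n - x) < inverse (real (Suc n))"
        "\<And>n. norm (f (z n) - f x - D (z n - x)) > e * norm (z n - x)"
      by metis
    have "D 0 = 0" using bl by (simp add: linear_simps)
    then have ne: "z n \<noteq> x" for n using z(2)[of n] by auto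
    define h where "h n = norm (z n - x)" for n
    have h0: "0 < h n" for n using ne by (simp add: h_def)
    have h: "h \<longlonglongrightarrow> 0"
      by (rule tendsto_sandwich[OF _ _ tendsto_const LIMSEQ_inverse_real_of_nat])
        (use z(1) h0 in \<open>auto simp: h_def less_imp_le\<close>)
    define u where "u n = (z n - x) /\<^sub>R h n" for n
    have "u n \<in> sphere 0 1" for n using ne[of n] by (simp add: u_def h_def)
    then obtain l s where s: "strict_mono s" "(u \<circ> s) \<longlonglongrightarrow> l"
      using compact_sphere[of "0::'e" 1] unfolding compact_def by metis
    have hs: "(h \<circ> s) \<longlonglongrightarrow> 0" using LIMSEQ_subseq_LIMSEQ[OF h s(1)] .
    have eq: "x + (h \<circ> s) n *\<^sub>R (u \<circ> s) n = z (s n)" for n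
      using h0[of "s n"] by (simp add: u_def)
    have "displaces (\<lambda>n. x) (\<lambda>n. x + (h \<circ> s) n *\<^sub>R (u \<circ> s) n) (h \<circ> s) x l"
      by (rule displaces_line[OF _ hs tendsto_const s(2)]) (use h0 in simp)
    from D[OF this] have "(\<lambda>n. (f (z (s n)) - f x) /\<^sub>R h (s n)) \<longlonglongrightarrow> D l"
      unfolding eq by simp
    moreover have "(\<lambda>n. D ((u \<circ> s) n)) \<longlonglongrightarrow> D l" using bl s(2) by (rule bounded_linear.tendsto)
    ultimately have "(\<lambda>n. norm ((f (z (s n)) - f x) /\<^sub>R h (s n) - D ((u \<circ> s) n))) \<longlonglongrightarrow> norm (D l - D l)"
      by (intro tendsto_intros)
    then have "(\<lambda>n. norm ((f (z (s n)) - f x) /\<^sub>R h (s n) - D ((u \<circ> s) n))) \<longlonglongrightarrow> 0" by simp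
    from order_tendstoD(2)[OF this \<open>0 < e\<close>] obtain n where
      n: "norm ((f (z (s n)) - f x) /\<^sub>R h (s n) - D ((u \<circ> s) n)) < e"
      by (auto simp: eventually_sequentially)
    have "(f (z (s n)) - f x) /\<^sub>R h (s n) - D ((u \<circ> s) n) = (f (z (s n)) - f x - D (z (s n) - x)) /\<^sub>R h (s n)"
      using bl by (simp add: u_def linear_simps scaleR_diff_right)
    then have "norm (f (z (s n)) - f x - D (z (s n) - x)) < e * h (s n)"
      using n h0[of "s n"] by (simp add: inverse_eq_divide divide_less_eq)
    then show False using z(2)[of "s n"] by (simp add: h_def)
  qed
  then show ?thesis using bl unfolding has_derivative_at_alt by blast
qed

end

lemma strict_derivative_C1:
  fixes f :: "'e::euclidean_space \<Rightarrow> 'b::euclidean_space"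
  assumes "open S"
    and D: "\<And>x y z h v. x \<in> S \<Longrightarrow> displaces y z h x v \<Longrightarrow> (\<lambda>n. (f (z n) - f (y n)) /\<^sub>R h n) \<longlonglongrightarrow> D x v"
  shows "Ck_on (Suc 0) f S"
proof -
  have der: "(f has_derivative D x) (at x)" if "x \<in> S" for x
    by (rule strict_derivative) (rule D[OF that])
  then have fd: "frechet_derivative f (at x) = D x" if "x \<in> S" for x
    using frechet_derivative_at that by metis
  have "continuous_on S (\<lambda>x. D x v)" for v
    unfolding continuous_on_sequentially
  proof (intro allI ballI impI)
    fix y x assume x: "x \<in> S" and y: "(\<forall>n. y n \<in> S) \<and> y \<longlonglongrightarrow> x"
    have "\<exists>h. 0 < h \<and> h < inverse (real (Suc n)) \<and>
        norm ((f (y n + h *\<^sub>R v) - f (y n)) /\<^sub>R h - D (y n) v) < inverse (real (Suc n))" for n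
    proof -
      let ?e = "inverse (real (Suc n))"
      have "displaces (\<lambda>k. y n) (\<lambda>k. y n + inverse (real (Suc k)) *\<^sub>R v) (\<lambda>k. inverse (real (Suc k))) (y n) v"
        by (rule displaces_line[OF _ LIMSEQ_inverse_real_of_nat tendsto_const tendsto_const]) simp
      from D[OF _ this]
      have "(\<lambda>k. (f (y n + inverse (real (Suc k)) *\<^sub>R v) - f (y n)) /\<^sub>R inverse (real (Suc k))) \<longlonglongrightarrow> D (y n) v"
        using y by blast
      then have "\<forall>\<^sub>F k in sequentially. dist ((f (y n + inverse (real (Suc k)) *\<^sub>R v) - f (y n)) /\<^sub>R inverse (real (Suc k))) (D (y n) v) < ?e"
        by (rule tendstoD) simp
      moreover have "\<forall>\<^sub>F k in sequentially. inverse (real (Suc k)) < ?e"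
        by (rule order_tendstoD[OF LIMSEQ_inverse_real_of_nat]) simp
      ultimately have "\<forall>\<^sub>F k in sequentially. 0 < inverse (real (Suc k)) \<and> inverse (real (Suc k)) < ?e \<and>
         norm ((f (y n + inverse (real (Suc k)) *\<^sub>R v) - f (y n)) /\<^sub>R inverse (real (Suc k)) - D (y n) v) < ?e"
        by eventually_elim (auto simp: dist_norm)
      then show ?thesis using eventually_happens'[OF sequentially_bot] by fast
    qed
    then obtain h where h: "\<And>n. 0 < h n" "\<And>n. h n < inverse (real (Suc n))"
      "\<And>n. norm ((f (y n + h n *\<^sub>R v) - f (y n)) /\<^sub>R h n - D (y n) v) < inverse (real (Suc n))"
      by metis
    have h0: "h \<longlonglongrightarrow> 0"
      by (rule tendsto_sandwich[OF _ _ tendsto_const LIMSEQ_inverse_real_of_nat])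
        (use h in \<open>auto simp: less_imp_le\<close>)
    have "(\<lambda>n. (f (y n + h n *\<^sub>R v) - f (y n)) /\<^sub>R h n - D (y n) v) \<longlonglongrightarrow> 0"
      by (rule Lim_null_comparison[OF _ LIMSEQ_inverse_real_of_nat])
        (use h in \<open>auto simp: less_imp_le\<close>)
    moreover have "(\<lambda>n. (f (y n + h n *\<^sub>R v) - f (y n)) /\<^sub>R h n) \<longlonglongrightarrow> D x v"
      using D[OF x displaces_line[OF h(1) h0 _ tendsto_const]] y by simp
    ultimately have "(\<lambda>n. D (y n) v) \<longlonglongrightarrow> D x v - 0"
      using tendsto_diff by fastforce
    then show "((\<lambda>x. D x v) \<circ> y) \<longlonglongrightarrow> D x v" by (simp add: o_def)
  qed
  then have "continuous_on S (\<lambda>x. frechet_derivative f (at x) v)" for v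
    using fd by (metis (mono_tags, lifting) continuous_on_cong)
  then show ?thesis using der unfolding Ck_on.simps differentiable_def by blast
qed

section \<open>Ordinary differential equations\<close>

lemma gronwall_forward:
  fixes q :: "real \<Rightarrow> 'e::real_inner"
  assumes der: "\<And>s. 0 \<le> s \<Longrightarrow> s \<le> t \<Longrightarrow> (q has_vector_derivative q' s) (at s)"
    and bd: "\<And>s. 0 \<le> s \<Longrightarrow> s \<le> t \<Longrightarrow> norm (q' s) \<le> L * norm (q s) + e"
    and "0 \<le> L" "0 \<le> e" "0 \<le> t"
  shows "(norm (q t))\<^sup>2 \<le> ((norm (q 0))\<^sup>2 + e\<^sup>2) * exp ((2 * L + 1) * t)"
proof -
  let ?k = "2 * L + 1"
  let ?u = "\<lambda>s. (q s \<bullet> q s + e\<^sup>2) * exp (- ?k * s)"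
  have "?u t \<le> ?u 0"
  proof (rule DERIV_nonpos_imp_nonincreasing[OF \<open>0 \<le> t\<close>])
    fix s assume s: "0 \<le> s" "s \<le> t"
    have "((\<lambda>s. q s \<bullet> q s) has_real_derivative 2 * (q s \<bullet> q' s)) (at s)"
      using has_derivative_inner[OF der[OF s, unfolded has_vector_derivative_def] der[OF s, unfolded has_vector_derivative_def]]
      by (simp add: has_field_derivative_def inner_commute mult_commute_abs algebra_simps)
    then have "(?u has_real_derivative (2 * (q s \<bullet> q' s) - ?k * (q s \<bullet> q s + e\<^sup>2)) * exp (- ?k * s)) (at s)"
      by (auto intro!: derivative_eq_intros simp: algebra_simps)
    moreover have "2 * (q s \<bullet> q' s) - ?k * (q s \<bullet> q s + e\<^sup>2) \<le> 0"
    proof -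
      have "q s \<bullet> q' s \<le> norm (q s) * norm (q' s)" by (rule norm_cauchy_schwarz)
      also have "\<dots> \<le> norm (q s) * (L * norm (q s) + e)" using bd[OF s] by (simp add: mult_left_mono)
      finally have "2 * (q s \<bullet> q' s) \<le> 2 * L * (norm (q s))\<^sup>2 + 2 * norm (q s) * e"
        by (simp add: power2_eq_square algebra_simps)
      moreover have "2 * norm (q s) * e \<le> (norm (q s))\<^sup>2 + e\<^sup>2" by (rule sum_squares_bound)
      moreover have "0 \<le> L * e\<^sup>2" using \<open>0 \<le> L\<close> by simp
      ultimately show ?thesis by (simp add: power2_norm_eq_inner algebra_simps)
    qed
    ultimately show "\<exists>y. (?u has_real_derivative y) (at s) \<and> y \<le> 0"
      using mult_nonpos_nonneg[OF _ exp_ge_zero] by blast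
  qed
  then have "(q t \<bullet> q t + e\<^sup>2) * exp (- ?k * t) * exp (?k * t) \<le> (q 0 \<bullet> q 0 + e\<^sup>2) * exp (?k * t)"
    by (intro mult_right_mono) auto
  then have "q t \<bullet> q t + e\<^sup>2 \<le> (q 0 \<bullet> q 0 + e\<^sup>2) * exp (?k * t)"
    unfolding mult.assoc mult_exp_exp by (simp add: algebra_simps)
  then show ?thesis by (simp add: power2_norm_eq_inner) (smt (verit) zero_le_power2)
qed

text \<open>Gronwall's inequality, in a form that avoids integrals: the derivative of
  \<open>(|q|\<^sup>2 + e\<^sup>2) exp (- (2 L + 1) t)\<close> is nonpositive for positive times.\<close>

lemma gronwall:
  fixes q :: "real \<Rightarrow> 'e::real_inner"
  assumes der: "\<And>s. \<bar>s\<bar> < T \<Longrightarrow> (q has_vector_derivative q' s) (at s)"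
    and bd: "\<And>s. \<bar>s\<bar> < T \<Longrightarrow> norm (q' s) \<le> L * norm (q s) + e"
    and "0 \<le> L" "0 \<le> e" "\<bar>t\<bar> < T"
  shows "(norm (q t))\<^sup>2 \<le> ((norm (q 0))\<^sup>2 + e\<^sup>2) * exp ((2 * L + 1) * T)"
proof -
  have "(norm (q t))\<^sup>2 \<le> ((norm (q 0))\<^sup>2 + e\<^sup>2) * exp ((2 * L + 1) * \<bar>t\<bar>)"
  proof (cases "0 \<le> t")
    case True
    then show ?thesis using gronwall_forward[of t q q' L e] assms by auto
  next
    case False
    have "(norm (q (- (- t))))\<^sup>2 \<le> ((norm (q (- 0)))\<^sup>2 + e\<^sup>2) * exp ((2 * L + 1) * (- t))"
    proof (rule gronwall_forward[of "- t" "\<lambda>s. q (- s)" "\<lambda>s. - q' (- s)" L e])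
      fix s assume s: "0 \<le> s" "s \<le> - t"
      then have "\<bar>- s\<bar> < T" using assms(5) by simp
      have "((q \<circ> uminus) has_vector_derivative (- 1) *\<^sub>R q' (- s)) (at s)"
        by (rule vector_diff_chain_at)
          (use der[OF \<open>\<bar>- s\<bar> < T\<close>] in \<open>auto intro!: derivative_eq_intros simp: has_vector_derivative_def\<close>)
      then show "((\<lambda>s. q (- s)) has_vector_derivative - q' (- s)) (at s)" by (simp add: o_def)
      show "norm (- q' (- s)) \<le> L * norm (q (- s)) + e" using bd[OF \<open>\<bar>- s\<bar> < T\<close>] by simp
    qed (use assms False in auto)
    then show ?thesis using False by simp
  qed
  also have "\<dots> \<le> ((norm (q 0))\<^sup>2 + e\<^sup>2) * exp ((2 * L + 1) * T)"
    using assms(3,5) by (intro mult_left_mono) auto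
  finally show ?thesis .
qed

text \<open>Picard's theorem: for a globally Lipschitz right-hand side the integral operator contracts the
  space of bounded continuous curves; curves are frozen outside of the short time interval.\<close>

lemma picard:
  fixes F :: "real \<Rightarrow> 'e::euclidean_space \<Rightarrow> 'e"
  assumes cont: "continuous_on UNIV (\<lambda>p. F (fst p) (snd p))"
    and lip: "\<And>s x y. norm (F s x - F s y) \<le> L * norm (x - y)" and "0 \<le> L"
    and \<tau>: "\<tau> = 1 / (4 * (L + 1))"
  obtains u where "u 0 = x0" "\<And>t. \<bar>t\<bar> < \<tau> \<Longrightarrow> (u has_vector_derivative F t (u t)) (at t)"
proof -
  have \<tau>0: "0 < \<tau>" using \<open>0 \<le> L\<close> by (simp add: \<tau>)
  define cl where "cl t = max (- \<tau>) (min \<tau> t)" for t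
  have cl: "cl t \<in> {- \<tau>..\<tau>}" "\<bar>t\<bar> \<le> \<tau> \<Longrightarrow> cl t = t" for t using \<tau>0 by (auto simp: cl_def)
  have ccl: "continuous_on UNIV cl" unfolding cl_def by (intro continuous_intros)
  define I where "I v t = integral {- \<tau>..t} (\<lambda>s. F s (apply_bcontfun v s))" for v :: "real \<Rightarrow>\<^sub>C 'e" and t
  have cF: "continuous_on A (\<lambda>s. F s (apply_bcontfun v s))" for v A
  proof -
    have "continuous_on UNIV (\<lambda>s. (s, apply_bcontfun v s))" by (intro continuous_intros) simp
    from continuous_on_compose2[OF cont this] show ?thesis by (auto intro: continuous_on_subset)
  qed
  have int: "(\<lambda>s. F s (apply_bcontfun v s)) integrable_on {a..b}" for v a b
    by (rule integrable_continuous_real[OF cF])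
  have cI: "continuous_on {- \<tau>..\<tau>} (I v)" for v
    unfolding I_def by (rule indefinite_integral_continuous_1[OF int])
  define \<Phi> where "\<Phi> v = Bcontfun (\<lambda>t. x0 + I v (cl t) - I v 0)" for v
  have mem: "(\<lambda>t. x0 + I v (cl t) - I v 0) \<in> bcontfun" for v
  proof -
    have "continuous_on UNIV (\<lambda>t. I v (cl t))"
      by (rule continuous_on_compose2[OF cI ccl]) (use cl(1) in auto)
    moreover have "range (\<lambda>t. x0 + I v (cl t) - I v 0) \<subseteq> (\<lambda>t. x0 + I v t - I v 0) ` {- \<tau>..\<tau>}"
      using cl(1) by auto
    moreover have "compact ((\<lambda>t. x0 + I v t - I v 0) ` {- \<tau>..\<tau>})"
      by (rule compact_continuous_image) (auto intro!: continuous_intros cI)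
    ultimately show ?thesis
      by (auto simp: bcontfun_def intro!: continuous_intros bounded_subset[OF compact_imp_bounded])
  qed
  have app: "apply_bcontfun (\<Phi> v) t = x0 + I v (cl t) - I v 0" for v t
    unfolding \<Phi>_def by (subst Bcontfun_inverse[OF mem]) simp
  have Idist: "norm (I v t - I w t) \<le> 2 * \<tau> * L * dist v w" if "t \<in> {- \<tau>..\<tau>}" for v w t
  proof -
    have "norm (integral {- \<tau>..t} (\<lambda>s. F s (apply_bcontfun v s) - F s (apply_bcontfun w s))) \<le> (L * dist v w) * (t - (- \<tau>))"
    proof (rule integral_bound)
      fix s
      have "norm (F s (apply_bcontfun v s) - F s (apply_bcontfun w s)) \<le> L * dist (apply_bcontfun v s) (apply_bcontfun w s)"
        using lip by (simp add: dist_norm)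
      also have "\<dots> \<le> L * dist v w" using \<open>0 \<le> L\<close> by (intro mult_left_mono dist_bounded)
      finally show "norm (F s (apply_bcontfun v s) - F s (apply_bcontfun w s)) \<le> L * dist v w" .
    qed (use that in \<open>auto intro!: continuous_intros cF\<close>)
    also have "\<dots> \<le> (L * dist v w) * (2 * \<tau>)" using that \<open>0 \<le> L\<close> by (intro mult_left_mono) auto
    finally show ?thesis by (simp add: I_def integral_diff[OF int int, symmetric] mult_ac)
  qed
  have "dist (\<Phi> v) (\<Phi> w) \<le> L / (L + 1) * dist v w" for v w
  proof (rule dist_bound)
    fix t
    have "dist (apply_bcontfun (\<Phi> v) t) (apply_bcontfun (\<Phi> w) t) = norm ((I v (cl t) - I w (cl t)) - (I v 0 - I w 0))"
      by (simp add: app dist_norm algebra_simps)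
    also have "\<dots> \<le> norm (I v (cl t) - I w (cl t)) + norm (I v 0 - I w 0)" by (rule norm_triangle_ineq4)
    also have "\<dots> \<le> 2 * \<tau> * L * dist v w + 2 * \<tau> * L * dist v w"
      by (intro add_mono Idist cl) (use \<tau>0 in auto)
    also have "\<dots> = (4 * \<tau>) * L * dist v w" by simp
    also have "4 * \<tau> = 1 / (L + 1)" using \<open>0 \<le> L\<close> by (simp add: \<tau> field_simps)
    also have "1 / (L + 1) * L * dist v w = L / (L + 1) * dist v w" by simp
    finally show "dist (apply_bcontfun (\<Phi> v) t) (apply_bcontfun (\<Phi> w) t) \<le> L / (L + 1) * dist v w" .
  qed
  then obtain v where v: "\<Phi> v = v"
    using banach_fix_type[of "L / (L + 1)" \<Phi>] \<open>0 \<le> L\<close> by auto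
  show thesis
  proof
    have eq: "apply_bcontfun v t = x0 + I v t - I v 0" if "\<bar>t\<bar> \<le> \<tau>" for t
      using app[of v t] v cl(2)[OF that] by simp
    show "apply_bcontfun v 0 = x0" using eq[of 0] \<tau>0 by simp
    fix t assume t: "\<bar>t\<bar> < \<tau>"
    have "(I v has_vector_derivative F t (apply_bcontfun v t)) (at t within {- \<tau>..\<tau>})"
      unfolding I_def by (rule integral_has_vector_derivative[OF cF]) (use t in auto)
    moreover have "at t within {- \<tau>..\<tau>} = at t" by (rule at_within_interior) (use t in auto)
    ultimately have "(I v has_vector_derivative F t (apply_bcontfun v t)) (at t)" by simp
    then have "((\<lambda>t. x0 + I v t - I v 0) has_vector_derivative F t (apply_bcontfun v t)) (at t)"
      by (auto intro!: derivative_eq_intros)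
    then show "(apply_bcontfun v has_vector_derivative F t (apply_bcontfun v t)) (at t)"
      by (rule has_vector_derivative_transform_within_open[where S="{- \<tau><..<\<tau>}"]) (use t eq in auto)
  qed
qed

text \<open>The existence time depends on the Lipschitz constant, the bound and the radius only, hence it is
  uniform in the initial point and in the vector fields that share these constants.\<close>

lemma local_solution:
  fixes G :: "'e::euclidean_space \<Rightarrow> 'e"
  assumes lip: "\<And>x y. x \<in> cball x0 r \<Longrightarrow> y \<in> cball x0 r \<Longrightarrow> norm (G x - G y) \<le> L * norm (x - y)"
    and bd: "\<And>x. x \<in> cball x0 r \<Longrightarrow> norm (G x) \<le> M" and "0 \<le> L" "0 \<le> M" "0 < r"
    and \<tau>: "\<tau> \<le> 1 / (4 * (L + 1))" "\<tau> \<le> r / (2 * (M + 1))" and y: "y \<in> cball x0 (r / 2)"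
  obtains u where "u 0 = y" "\<And>t. \<bar>t\<bar> < \<tau> \<Longrightarrow> u t \<in> cball x0 r"
    "\<And>t. \<bar>t\<bar> < \<tau> \<Longrightarrow> (u has_vector_derivative G (u t)) (at t)"
proof -
  \<comment> \<open>Composition with the nearest-point projection makes \<open>G\<close> bounded and Lipschitz everywhere.\<close>
  let ?p = "closest_point (cball x0 r)"
  have p: "?p x \<in> cball x0 r" "x \<in> cball x0 r \<Longrightarrow> ?p x = x" for x
    using \<open>0 < r\<close> by (auto intro!: closest_point_in_set closest_point_self simp del: mem_cball)
  have pl: "norm (?p x - ?p y) \<le> norm (x - y)" for x y
    using closest_point_lipschitz[of "cball x0 r" x y] \<open>0 < r\<close> by (simp add: dist_norm)
  define F where "F s x = G (?p x)" for s :: real and x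
  have Fl: "norm (F s x - F s y) \<le> L * norm (x - y)" for s x y
    using lip[OF p(1) p(1)] pl[of x y] \<open>0 \<le> L\<close> unfolding F_def
    by (meson mult_left_mono order_trans)
  have "L-lipschitz_on UNIV (\<lambda>x. G (?p x))"
    using Fl \<open>0 \<le> L\<close> by (auto simp: lipschitz_on_def dist_norm F_def)
  then have "continuous_on UNIV (\<lambda>x. G (?p x))" by (rule lipschitz_on_continuous_on)
  then have cont: "continuous_on UNIV (\<lambda>p. F (fst p) (snd p))"
    unfolding F_def by (rule continuous_on_compose2) (auto intro!: continuous_intros)
  obtain u where u: "u 0 = y" "\<And>t. \<bar>t\<bar> < 1 / (4 * (L + 1)) \<Longrightarrow> (u has_vector_derivative F t (u t)) (at t)"
    using picard[OF cont Fl \<open>0 \<le> L\<close> refl] by metis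
  have stay: "u t \<in> cball x0 r" if t: "\<bar>t\<bar> < \<tau>" for t
  proof -
    have "norm (u t - u 0) \<le> M * norm (t - 0)"
    proof (rule differentiable_bound[of "{- \<bar>t\<bar>..\<bar>t\<bar>}"])
      fix s assume "s \<in> {- \<bar>t\<bar>..\<bar>t\<bar>}"
      then have "\<bar>s\<bar> < 1 / (4 * (L + 1))" using t \<tau> by auto
      from u(2)[OF this] show "(u has_derivative (\<lambda>h. h *\<^sub>R F s (u s))) (at s within {- \<bar>t\<bar>..\<bar>t\<bar>})"
        by (simp add: has_vector_derivative_def has_derivative_at_withinI)
      show "onorm (\<lambda>h. h *\<^sub>R F s (u s)) \<le> M"
        by (rule onorm_le) (use bd[OF p(1)] in \<open>simp add: F_def mult.commute[of M] mult_left_mono\<close>)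
    qed auto
    also have "\<dots> \<le> M * \<tau>" using t \<open>0 \<le> M\<close> by (intro mult_left_mono) auto
    also have "\<dots> \<le> M * (r / (2 * (M + 1)))" using \<tau> \<open>0 \<le> M\<close> by (intro mult_left_mono)
    also have "\<dots> \<le> r / 2" using \<open>0 \<le> M\<close> \<open>0 < r\<close> by (simp add: field_simps)
    finally have "dist (u t) y \<le> r / 2" by (simp add: dist_norm u(1))
    then show ?thesis using y dist_triangle[of x0 "u t" y] by (simp add: dist_commute)
  qed
  show thesis
  proof (rule that[of u])
    fix t :: real assume t: "\<bar>t\<bar> < \<tau>"
    then have "\<bar>t\<bar> < 1 / (4 * (L + 1))" using \<tau> by linarith
    from u(2)[OF this] show "(u has_vector_derivative G (u t)) (at t)"
      using p(2)[OF stay[OF t]] by (simp add: F_def)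
  qed (use u(1) stay in auto)
qed

text \<open>Uniform \<open>C\<^sup>1\<close> convergence.  The derivatives are compared on basis vectors, as in the generators of
  the \<open>C\<^sup>r\<close> topology.\<close>

definition C1_limit :: "(nat \<Rightarrow> 'e::euclidean_space \<Rightarrow> 'b::real_normed_vector) \<Rightarrow> ('e \<Rightarrow> 'b) \<Rightarrow> 'e set \<Rightarrow> bool" where
  "C1_limit G g B \<longleftrightarrow> (\<forall>e>0. \<forall>\<^sub>F n in sequentially. \<forall>y\<in>B. G n differentiable (at y) \<and> norm (G n y - g y) \<le> e \<and>
     (\<forall>b\<in>Basis. norm (frechet_derivative (G n) (at y) b - frechet_derivative g (at y) b) \<le> e))"

lemma C1_limit_const: "Ck_on (Suc 0) g S \<Longrightarrow> B \<subseteq> S \<Longrightarrow> C1_limit (\<lambda>n. g) g B"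
  by (auto simp: C1_limit_def)

lemma C1_limit_subseq: "C1_limit G g B \<Longrightarrow> strict_mono s \<Longrightarrow> C1_limit (\<lambda>n. G (s n)) g B"
  unfolding C1_limit_def using eventually_subseq[of s] by blast

lemma norm_linear_le_sum_Basis:
  fixes f :: "'e::euclidean_space \<Rightarrow> 'b::real_normed_vector"
  assumes "linear f" "\<And>b. b \<in> Basis \<Longrightarrow> norm (f b) \<le> k b"
  shows "norm (f v) \<le> (\<Sum>b\<in>Basis. k b) * norm v"
proof -
  have "norm (f v) \<le> (\<Sum>b\<in>Basis. norm ((v \<bullet> b) *\<^sub>R f b))"
    unfolding linear_eq_sum_Basis[OF assms(1), of v] by (rule norm_sum)
  also have "\<dots> \<le> (\<Sum>b\<in>Basis. norm v * k b)"
    by (intro sum_mono) (auto intro!: mult_mono Basis_le_norm assms(2))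
  finally show ?thesis by (simp add: sum_distrib_left mult.commute)
qed

context
  fixes g :: "'e::euclidean_space \<Rightarrow> 'b::real_normed_vector" and S x0 r
  assumes C1: "Ck_on (Suc 0) g S" and S: "open S" "cball x0 r \<subseteq> S"
begin

private lemma linear_derivative: "x \<in> cball x0 r \<Longrightarrow> linear (frechet_derivative g (at x))"
  using linear_frechet_derivative C1_differentiable[OF C1] S(2) by blast

text \<open>The constants are determined by the limit \<open>g\<close>.  This makes the existence times of flows
  independent of the sequence that approximates \<open>g\<close>.\<close>

lemma C1_limit_Lipschitz:
  obtains L M where "0 \<le> L" "0 \<le> M"
    "\<And>x v. x \<in> cball x0 r \<Longrightarrow> norm (frechet_derivative g (at x) v) \<le> L * norm v"
    "\<And>y z. y \<in> cball x0 r \<Longrightarrow> z \<in> cball x0 r \<Longrightarrow> norm (g y - g z) \<le> L * norm (y - z)"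
    "\<And>G. C1_limit G g (cball x0 r) \<Longrightarrow> \<forall>\<^sub>F n in sequentially. \<forall>y\<in>cball x0 r. norm (G n y) \<le> M \<and>
        (\<forall>z\<in>cball x0 r. norm (G n y - G n z) \<le> L * norm (y - z))"
proof -
  let ?B = "cball x0 r"
  have "\<exists>K. \<forall>x\<in>?B. norm (frechet_derivative g (at x) b) \<le> K" for b
  proof -
    have "continuous_on ?B (\<lambda>x. frechet_derivative g (at x) b)"
      using C1 S(2) by (auto intro: continuous_on_subset)
    then have "bounded ((\<lambda>x. frechet_derivative g (at x) b) ` ?B)"
      by (intro compact_imp_bounded compact_continuous_image) auto
    then show ?thesis by (auto simp: bounded_iff)
  qed
  then obtain K where K: "\<And>b x. x \<in> ?B \<Longrightarrow> norm (frechet_derivative g (at x) b) \<le> K b" by metis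
  have "bounded (g ` ?B)"
    using C1_continuous_on[OF C1] S(2)
    by (intro compact_imp_bounded compact_continuous_image) (auto intro: continuous_on_subset)
  then obtain M0 where M0: "\<And>x. x \<in> ?B \<Longrightarrow> norm (g x) \<le> M0" unfolding bounded_iff by blast
  define L where "L = \<bar>\<Sum>b\<in>(Basis::'e set). K b + 1\<bar>"
  have Dg: "norm (frechet_derivative g (at x) v) \<le> L * norm v" if "x \<in> ?B" for x v
  proof -
    have "norm (frechet_derivative g (at x) v) \<le> (\<Sum>b\<in>Basis. K b + 1) * norm v"
    proof (rule norm_linear_le_sum_Basis[OF linear_derivative[OF that]])
      show "norm (frechet_derivative g (at x) b) \<le> K b + 1" for b using K[OF that, of b] by linarith
    qed
    also have "\<dots> \<le> L * norm v" unfolding L_def by (intro mult_right_mono) auto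
    finally show ?thesis .
  qed
  have lip: "norm (f y - f z) \<le> L * norm (y - z)"
    if "\<And>x. x \<in> ?B \<Longrightarrow> f differentiable (at x)" "\<And>x v. x \<in> ?B \<Longrightarrow> norm (frechet_derivative f (at x) v) \<le> L * norm v"
      "y \<in> ?B" "z \<in> ?B" for f :: "'e \<Rightarrow> 'b" and y z
  proof (rule differentiable_bound[of ?B f "\<lambda>x. frechet_derivative f (at x)"])
    fix x assume x: "x \<in> ?B"
    show "(f has_derivative frechet_derivative f (at x)) (at x within ?B)"
      using that(1)[OF x] frechet_derivative_works has_derivative_at_withinI by blast
    show "onorm (frechet_derivative f (at x)) \<le> L"
      by (rule onorm_bound) (use that(2)[OF x] in \<open>auto simp: L_def\<close>)
  qed (use that in auto)
  have "\<forall>\<^sub>F n in sequentially. \<forall>y\<in>?B. norm (G n y) \<le> \<bar>M0\<bar> + 1 \<and>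
        (\<forall>z\<in>?B. norm (G n y - G n z) \<le> L * norm (y - z))" if lim: "C1_limit G g ?B" for G
    using lim[unfolded C1_limit_def, rule_format, OF zero_less_one]
  proof eventually_elim
    case (elim n)
    have "norm (frechet_derivative (G n) (at x) v) \<le> L * norm v" if "x \<in> ?B" for x v
    proof -
      have "norm (frechet_derivative (G n) (at x) v) \<le> (\<Sum>b\<in>Basis. K b + 1) * norm v"
      proof (rule norm_linear_le_sum_Basis[OF linear_frechet_derivative])
        fix b :: 'e assume "b \<in> Basis"
        then have "norm (frechet_derivative (G n) (at x) b - frechet_derivative g (at x) b) \<le> 1" using elim that by blast
        then show "norm (frechet_derivative (G n) (at x) b) \<le> K b + 1"
          using K[OF that, of b] norm_triangle_sub[of "frechet_derivative (G n) (at x) b" "frechet_derivative g (at x) b"] by linarith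
      qed (use elim that in auto)
      also have "\<dots> \<le> L * norm v" unfolding L_def by (intro mult_right_mono) auto
      finally show ?thesis .
    qed
    then have "norm (G n y - G n z) \<le> L * norm (y - z)" if "y \<in> ?B" "z \<in> ?B" for y z
      using lip[of "G n", OF _ _ that] elim by blast
    moreover have "norm (G n y) \<le> \<bar>M0\<bar> + 1" if "y \<in> ?B" for y
      using M0[OF that] elim that norm_triangle_sub[of "G n y" "g y"] by (smt (verit))
    ultimately show ?case by blast
  qed
  moreover have "norm (g y - g z) \<le> L * norm (y - z)" if "y \<in> ?B" "z \<in> ?B" for y z
    using lip[of g, OF _ Dg that] C1_differentiable[OF C1] S(2) by blast
  ultimately show thesis using that[of L "\<bar>M0\<bar> + 1"] Dg by (simp add: L_def)
qed

text \<open>The error estimate for the variational equation: by convergence of the derivatives and by uniform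
  continuity of the derivative of \<open>g\<close>, all derivatives that enter the mean value inequality are close
  to the one of \<open>g\<close> at \<open>x\<close>.\<close>

lemma C1_limit_linearization:
  assumes lim: "C1_limit G g (cball x0 r)" and "0 < e"
  obtains d where "0 < d"
    "\<forall>\<^sub>F n in sequentially. \<forall>x\<in>cball x0 r. \<forall>y\<in>cball x0 r \<inter> ball x d. \<forall>z\<in>cball x0 r \<inter> ball x d.
       norm (G n z - G n y - frechet_derivative g (at x) (z - y)) \<le> e * norm (z - y)"
proof -
  let ?B = "cball x0 r" and ?k = "real DIM('e)"
  define e' where "e' = e / (2 * ?k)"
  have e': "0 < e'" using \<open>0 < e\<close> by (simp add: e'_def)
  have "\<exists>d>0. \<forall>x\<in>?B. \<forall>y\<in>?B. dist y x < d \<longrightarrow> norm (frechet_derivative g (at y) b - frechet_derivative g (at x) b) < e'" for b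
  proof -
    have "continuous_on ?B (\<lambda>x. frechet_derivative g (at x) b)"
      using C1 S(2) by (auto intro: continuous_on_subset)
    from compact_uniformly_continuous[OF this compact_cball] show ?thesis
      using e' unfolding uniformly_continuous_on_def dist_norm[of "frechet_derivative g _ _"] by blast
  qed
  then obtain d where d: "\<And>b. 0 < d b" "\<And>b x y. x \<in> ?B \<Longrightarrow> y \<in> ?B \<Longrightarrow> dist y x < d b \<Longrightarrow>
      norm (frechet_derivative g (at y) b - frechet_derivative g (at x) b) < e'" by metis
  define d' where "d' = Min (d ` Basis)"
  have d': "0 < d'" "\<And>b. b \<in> Basis \<Longrightarrow> d' \<le> d b" using d(1) by (auto simp: d'_def)
  have "\<forall>\<^sub>F n in sequentially. \<forall>x\<in>?B. \<forall>y\<in>?B \<inter> ball x d'. \<forall>z\<in>?B \<inter> ball x d'.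
       norm (G n z - G n y - frechet_derivative g (at x) (z - y)) \<le> e * norm (z - y)"
    using lim[unfolded C1_limit_def, rule_format, OF e']
  proof eventually_elim
    case (elim n)
    show ?case
    proof (intro ballI)
      fix x y z assume x: "x \<in> ?B" and y: "y \<in> ?B \<inter> ball x d'" and z: "z \<in> ?B \<inter> ball x d'"
      have bx: "bounded_linear (frechet_derivative g (at x))" using linear_derivative[OF x] by (simp add: linear_conv_bounded_linear)
      let ?f = "\<lambda>u. G n u - frechet_derivative g (at x) u"
      have "norm (?f z - ?f y) \<le> e * norm (z - y)"
      proof (rule differentiable_bound[of "?B \<inter> ball x d'" ?f "\<lambda>u v. frechet_derivative (G n) (at u) v - frechet_derivative g (at x) v"])
        show "convex (?B \<inter> ball x d')" by (intro convex_Int convex_cball convex_ball)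
        fix u assume u: "u \<in> ?B \<inter> ball x d'"
        have "(G n has_derivative frechet_derivative (G n) (at u)) (at u)"
          using elim u frechet_derivative_works by blast
        moreover have "(frechet_derivative g (at x) has_derivative frechet_derivative g (at x)) (at u)"
          by (rule bounded_linear_imp_has_derivative[OF bx])
        ultimately show "(?f has_derivative (\<lambda>v. frechet_derivative (G n) (at u) v - frechet_derivative g (at x) v)) (at u within ?B \<inter> ball x d')"
          by (rule has_derivative_at_withinI[OF has_derivative_diff])
        have lu: "linear (\<lambda>v. frechet_derivative (G n) (at u) v - frechet_derivative g (at x) v)"
          using elim u linear_derivative[OF x] linear_frechet_derivative[of "G n" "at u"] by (intro linear_compose_sub) auto
        have "norm (frechet_derivative (G n) (at u) v - frechet_derivative g (at x) v) \<le> (\<Sum>b\<in>(Basis::'e set). 2 * e') * norm v" for v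
        proof (rule norm_linear_le_sum_Basis[OF lu])
          fix b :: 'e assume b: "b \<in> Basis"
          then have "norm (frechet_derivative (G n) (at u) b - frechet_derivative g (at u) b) \<le> e'" using elim u by blast
          moreover have "norm (frechet_derivative g (at u) b - frechet_derivative g (at x) b) < e'"
            using u d'(2)[OF b] by (intro d(2)[OF x]) (auto simp: dist_commute)
          ultimately show "norm (frechet_derivative (G n) (at u) b - frechet_derivative g (at x) b) \<le> 2 * e'"
            using norm_triangle_ineq[of "frechet_derivative (G n) (at u) b - frechet_derivative g (at u) b" "frechet_derivative g (at u) b - frechet_derivative g (at x) b"]
            by simp
        qed
        then show "onorm (\<lambda>v. frechet_derivative (G n) (at u) v - frechet_derivative g (at x) v) \<le> e"
          using \<open>0 < e\<close> by (intro onorm_bound) (auto simp: e'_def)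
      qed (use y z in auto)
      moreover have "?f z - ?f y = G n z - G n y - frechet_derivative g (at x) (z - y)"
        using bx by (simp add: linear_simps)
      ultimately show "norm (G n z - G n y - frechet_derivative g (at x) (z - y)) \<le> e * norm (z - y)" by simp
    qed
  qed
  then show thesis using that d'(1) by blast
qed

end

text \<open>The linear equation along \<open>eta\<close> has the Lipschitz constant of \<open>g\<close>, so Picard's theorem solves it on
  the time interval on which it solves the equation of \<open>g\<close>.\<close>

lemma variational_solution:
  fixes g :: "'e::euclidean_space \<Rightarrow> 'e"
  assumes C1: "Ck_on (Suc 0) g S" and S: "open S" "B \<subseteq> S"
    and Dg: "\<And>x v. x \<in> B \<Longrightarrow> norm (frechet_derivative g (at x) v) \<le> L * norm v" and "0 \<le> L"
    and eta: "continuous_on {- \<tau>..\<tau>} eta" "\<And>t. \<bar>t\<bar> \<le> \<tau> \<Longrightarrow> eta t \<in> B"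
    and \<tau>: "0 < \<tau>" "\<tau> \<le> 1 / (4 * (L + 1))"
  obtains w where "w 0 = v"
    "\<And>t. \<bar>t\<bar> < \<tau> \<Longrightarrow> (w has_vector_derivative frechet_derivative g (at (eta t)) (w t)) (at t)"
proof -
  define cl where "cl t = max (- \<tau>) (min \<tau> t)" for t
  have cl: "cl t \<in> {- \<tau>..\<tau>}" "\<bar>t\<bar> \<le> \<tau> \<Longrightarrow> cl t = t" for t using \<tau> by (auto simp: cl_def)
  have ccl: "continuous_on UNIV cl" unfolding cl_def by (intro continuous_intros)
  define e where "e t = eta (cl t)" for t
  have eB: "e t \<in> B" for t unfolding e_def by (rule eta(2)) (use cl(1)[of t] in auto)
  have ce: "isCont e t" for t
  proof -
    have "continuous_on UNIV e" unfolding e_def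
      by (rule continuous_on_compose2[OF eta(1) ccl]) (use cl(1) in auto)
    then show ?thesis by (simp add: continuous_on_eq_continuous_at)
  qed
  define F where "F t w = frechet_derivative g (at (e t)) w" for t w
  have "continuous_on UNIV (\<lambda>p. F (fst p) (snd p))"
    unfolding F_def
  proof (rule continuous_at_imp_continuous_on, intro ballI)
    fix p :: "real \<times> 'e"
    have "((\<lambda>p. e (fst p)) \<longlongrightarrow> e (fst p)) (at p)"
      using isCont_o2[OF isCont_fst[OF continuous_ident] ce, of p] by (simp add: isCont_def)
    then show "isCont (\<lambda>p. frechet_derivative g (at (e (fst p))) (snd p)) p"
      unfolding isCont_def
      by (intro C1_derivative_tendsto[OF C1 S(1)] tendsto_intros) (use eB S in auto)
  qed
  moreover have "norm (F s x - F s y) \<le> L * norm (x - y)" for s x y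
  proof -
    have "linear (frechet_derivative g (at (e s)))"
      using linear_frechet_derivative C1_differentiable[OF C1] S eB[of s] by blast
    then show ?thesis using Dg[OF eB, of s "x - y"] by (simp add: F_def linear_diff)
  qed
  ultimately obtain w where w: "w 0 = v"
      "\<And>t. \<bar>t\<bar> < 1 / (4 * (L + 1)) \<Longrightarrow> (w has_vector_derivative F t (w t)) (at t)"
    by (rule picard[OF _ _ \<open>0 \<le> L\<close> refl, of F v]) auto
  show thesis
  proof (rule that[of w])
    show "w 0 = v" by (rule w(1))
    fix t assume "\<bar>t\<bar> < \<tau>"
    then show "(w has_vector_derivative frechet_derivative g (at (eta t)) (w t)) (at t)"
      using w(2)[of t] \<tau>(2) cl(2)[of t] by (simp add: F_def e_def)
  qed
qed

text \<open>Displacements are transported by the variational equation, uniformly in the vector field: the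
  difference quotient of two neighbouring solutions of \<open>G n\<close> satisfies the variational equation of \<open>g\<close>
  up to a small error, so Gronwall's inequality applies.  With \<open>G n = g\<close> this says that the flow of
  \<open>g\<close> is strictly differentiable.\<close>

lemma displaces_ode:
  fixes g :: "'e::euclidean_space \<Rightarrow> 'e"
  assumes C1: "Ck_on (Suc 0) g S" and S: "open S" "cball x0 r \<subseteq> S" and lim: "C1_limit G g (cball x0 r)"
    and y: "\<And>n s. \<bar>s\<bar> < \<tau> \<Longrightarrow> y n s \<in> cball x0 r"
      "\<And>n s. \<bar>s\<bar> < \<tau> \<Longrightarrow> (y n has_vector_derivative G n (y n s)) (at s)"
    and z: "\<And>n s. \<bar>s\<bar> < \<tau> \<Longrightarrow> z n s \<in> cball x0 r"
      "\<And>n s. \<bar>s\<bar> < \<tau> \<Longrightarrow> (z n has_vector_derivative G n (z n s)) (at s)"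
    and eta: "\<And>s. \<bar>s\<bar> < \<tau> \<Longrightarrow> eta s \<in> cball x0 r"
      "\<And>s. \<bar>s\<bar> < \<tau> \<Longrightarrow> (eta has_vector_derivative g (eta s)) (at s)"
    and w: "\<And>s. \<bar>s\<bar> < \<tau> \<Longrightarrow> (w has_vector_derivative frechet_derivative g (at (eta s)) (w s)) (at s)"
    and disp: "displaces (\<lambda>n. y n 0) (\<lambda>n. z n 0) h (eta 0) (w 0)"
    and t: "t \<longlonglongrightarrow> t0" "\<bar>t0\<bar> < \<tau>"
  shows "displaces (\<lambda>n. y n (t n)) (\<lambda>n. z n (t n)) h (eta t0) (w t0)"
proof -
  note d = displacesD[OF disp]
  obtain L M where L: "0 \<le> L"
    and Dg: "\<And>x v. x \<in> cball x0 r \<Longrightarrow> norm (frechet_derivative g (at x) v) \<le> L * norm v"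
    and Lg: "\<And>y z. y \<in> cball x0 r \<Longrightarrow> z \<in> cball x0 r \<Longrightarrow> norm (g y - g z) \<le> L * norm (y - z)"
    and LG: "\<forall>\<^sub>F n in sequentially. \<forall>y\<in>cball x0 r. norm (G n y) \<le> M \<and>
        (\<forall>z\<in>cball x0 r. norm (G n y - G n z) \<le> L * norm (y - z))"
    by (rule C1_limit_Lipschitz[OF C1 S]) (use lim in blast)
  define C where "C = exp ((2 * L + 1) * \<tau>)"
  have C: "0 < C" by (simp add: C_def)
  have \<tau>: "0 < \<tau>" using t(2) by linarith
  \<comment> \<open>A sequence of curves converges uniformly to 0 if it does so at time 0 and satisfies the
    hypothesis of Gronwall's inequality with arbitrarily small error.\<close>
  have uniform: "\<forall>\<^sub>F n in sequentially. \<forall>s. \<bar>s\<bar> < \<tau> \<longrightarrow> norm (q n s) < e"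
    if "(\<lambda>n. q n 0) \<longlonglongrightarrow> 0"
      "\<And>n s. \<bar>s\<bar> < \<tau> \<Longrightarrow> (q n has_vector_derivative q' n s) (at s)"
      "\<And>e. 0 < e \<Longrightarrow> \<forall>\<^sub>F n in sequentially. \<forall>s. \<bar>s\<bar> < \<tau> \<longrightarrow> norm (q' n s) \<le> L * norm (q n s) + e"
      "0 < e" for q q' :: "nat \<Rightarrow> real \<Rightarrow> 'e" and e
  proof -
    define e' where "e' = e / (2 * sqrt C)"
    have e': "0 < e'" using C \<open>0 < e\<close> by (simp add: e'_def)
    have e'C: "2 * e'\<^sup>2 * C < e\<^sup>2"
      using C \<open>0 < e\<close> by (simp add: e'_def power_divide power_mult_distrib field_simps)
    have "\<forall>\<^sub>F n in sequentially. norm (q n 0) < e'" using that(1) e' by (simp add: tendsto_iff)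
    with that(3)[OF e'] show ?thesis
    proof eventually_elim
      case (elim n)
      show ?case
      proof (intro allI impI)
        fix s :: real assume s: "\<bar>s\<bar> < \<tau>"
        have "(norm (q n s))\<^sup>2 \<le> ((norm (q n 0))\<^sup>2 + e'\<^sup>2) * C"
          unfolding C_def by (rule gronwall[of \<tau> "q n" "q' n" L e' s]) (use that(2) elim L e' s in auto)
        also have "\<dots> \<le> (e'\<^sup>2 + e'\<^sup>2) * C"
          using elim C by (intro mult_right_mono add_right_mono power_mono) auto
        also have "\<dots> < e\<^sup>2" using e'C by simp
        finally show "norm (q n s) < e" using \<open>0 < e\<close> by (simp add: power_less_imp_less_base)
      qed
    qed
  qed
  have y_eta: "\<forall>\<^sub>F n in sequentially. \<forall>s. \<bar>s\<bar> < \<tau> \<longrightarrow> norm (y n s - eta s) < e" if "0 < e" for e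
  proof (rule uniform[of "\<lambda>n s. y n s - eta s" "\<lambda>n s. G n (y n s) - g (eta s)"])
    show "(\<lambda>n. y n 0 - eta 0) \<longlonglongrightarrow> 0" using d(1) by (simp add: LIM_zero)
    fix e :: real assume "0 < e"
    show "\<forall>\<^sub>F n in sequentially. \<forall>s. \<bar>s\<bar> < \<tau> \<longrightarrow> norm (G n (y n s) - g (eta s)) \<le> L * norm (y n s - eta s) + e"
      using lim[unfolded C1_limit_def, rule_format, OF \<open>0 < e\<close>]
    proof eventually_elim
      case (elim n)
      show ?case
      proof (intro allI impI)
        fix s :: real assume s: "\<bar>s\<bar> < \<tau>"
        have "norm (G n (y n s) - g (y n s)) \<le> e" using elim y(1)[OF s] by blast
        moreover have "norm (g (y n s) - g (eta s)) \<le> L * norm (y n s - eta s)" by (rule Lg[OF y(1)[OF s] eta(1)[OF s]])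
        ultimately show "norm (G n (y n s) - g (eta s)) \<le> L * norm (y n s - eta s) + e"
          using norm_triangle_ineq[of "G n (y n s) - g (y n s)" "g (y n s) - g (eta s)"] by simp
      qed
    qed
  qed (use that y(2) eta(2) in \<open>auto intro!: derivative_eq_intros\<close>)
  define q where "q n s = (z n s - y n s) /\<^sub>R h n" for n s
  have q0: "(\<lambda>n. q n 0) \<longlonglongrightarrow> w 0" using d(4) by (simp add: q_def)
  have dq: "(q n has_vector_derivative (G n (z n s) - G n (y n s)) /\<^sub>R h n) (at s)" if "\<bar>s\<bar> < \<tau>" for n s
    unfolding q_def using y(2)[OF that] z(2)[OF that] by (auto intro!: derivative_eq_intros)
  have zq: "z n s - y n s = h n *\<^sub>R q n s" for n s using d(2)[of n] by (simp add: q_def)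
  define Q where "Q = sqrt ((norm (w 0) + 1)\<^sup>2 * C)"
  have Q: "0 < Q" using C by (simp add: Q_def add_nonneg_eq_0_iff)
  have qQ: "\<forall>\<^sub>F n in sequentially. \<forall>s. \<bar>s\<bar> < \<tau> \<longrightarrow> norm (q n s) \<le> Q"
  proof -
    have "\<forall>\<^sub>F n in sequentially. norm (q n 0) < norm (w 0) + 1"
      using tendsto_norm[OF q0] by (rule order_tendstoD) simp
    with LG show ?thesis
    proof eventually_elim
      case (elim n)
      show ?case
      proof (intro allI impI)
        fix s :: real assume s: "\<bar>s\<bar> < \<tau>"
        have "(norm (q n s))\<^sup>2 \<le> ((norm (q n 0))\<^sup>2 + 0\<^sup>2) * exp ((2 * L + 1) * \<tau>)"
        proof (rule gronwall[of \<tau> "q n" _ L 0 s])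
          fix s :: real assume s: "\<bar>s\<bar> < \<tau>"
          show "(q n has_vector_derivative (G n (z n s) - G n (y n s)) /\<^sub>R h n) (at s)" by (rule dq[OF s])
          have "norm (G n (z n s) - G n (y n s)) \<le> L * norm (z n s - y n s)" using elim y(1)[OF s] z(1)[OF s] by blast
          then show "norm ((G n (z n s) - G n (y n s)) /\<^sub>R h n) \<le> L * norm (q n s) + 0"
            using d(2)[of n] by (simp add: q_def divide_inverse_commute[symmetric] divide_right_mono)
        qed (use L s in auto)
        also have "\<dots> \<le> ((norm (w 0) + 1)\<^sup>2) * C"
          using elim by (auto simp: C_def intro!: mult_right_mono power_mono)
        finally show "norm (q n s) \<le> Q" unfolding Q_def by (rule real_le_rsqrt)
      qed
    qed
  qed
  have q_w: "\<forall>\<^sub>F n in sequentially. \<forall>s. \<bar>s\<bar> < \<tau> \<longrightarrow> norm (q n s - w s) < e" if "0 < e" for e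
  proof (rule uniform[of "\<lambda>n s. q n s - w s" "\<lambda>n s. (G n (z n s) - G n (y n s)) /\<^sub>R h n - frechet_derivative g (at (eta s)) (w s)"])
    show "(\<lambda>n. q n 0 - w 0) \<longlonglongrightarrow> 0" using q0 by (simp add: LIM_zero)
    fix e :: real assume e: "0 < e"
    then have eQ: "0 < e / Q" using Q by simp
    obtain \<delta> where \<delta>: "0 < \<delta>" and
      lin: "\<forall>\<^sub>F n in sequentially. \<forall>x\<in>cball x0 r. \<forall>y\<in>cball x0 r \<inter> ball x \<delta>. \<forall>z\<in>cball x0 r \<inter> ball x \<delta>.
         norm (G n z - G n y - frechet_derivative g (at x) (z - y)) \<le> e / Q * norm (z - y)"
      by (rule C1_limit_linearization[OF C1 S lim eQ])
    have \<delta>2: "0 < \<delta> / 2" using \<delta> by simp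
    have "\<forall>\<^sub>F n in sequentially. h n < \<delta> / (2 * Q)" using d(3) \<delta> Q by (simp add: order_tendstoD)
    then show "\<forall>\<^sub>F n in sequentially. \<forall>s. \<bar>s\<bar> < \<tau> \<longrightarrow> norm ((G n (z n s) - G n (y n s)) /\<^sub>R h n - frechet_derivative g (at (eta s)) (w s))
        \<le> L * norm (q n s - w s) + e"
      using lin qQ y_eta[OF \<delta>2]
    proof eventually_elim
      case (elim n)
      show ?case
      proof (intro allI impI)
        fix s :: real assume s: "\<bar>s\<bar> < \<tau>"
        let ?D = "frechet_derivative g (at (eta s))"
        have lD: "linear ?D" using linear_frechet_derivative C1_differentiable[OF C1] S eta(1)[OF s] by blast
        have "norm (z n s - y n s) = h n * norm (q n s)" using d(2)[of n] by (simp add: zq)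
        also have "\<dots> \<le> h n * Q" using elim s d(2)[of n] by (intro mult_left_mono) auto
        also have "\<dots> < \<delta> / 2" using elim(1) Q by (simp add: field_simps)
        finally have zy: "norm (z n s - y n s) < \<delta> / 2" .
        have ye: "norm (y n s - eta s) < \<delta> / 2" using elim s by blast
        have "norm (z n s - eta s) < \<delta>" using norm_triangle_ineq[of "z n s - y n s" "y n s - eta s"] zy ye by simp
        then have "y n s \<in> cball x0 r \<inter> ball (eta s) \<delta>" "z n s \<in> cball x0 r \<inter> ball (eta s) \<delta>"
          using y(1)[OF s, of n] z(1)[OF s, of n] ye \<delta> by (auto simp: dist_norm norm_minus_commute)
        then have "norm (G n (z n s) - G n (y n s) - ?D (z n s - y n s)) \<le> e / Q * norm (z n s - y n s)"
          using elim(2) eta(1)[OF s] by blast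
        then have "norm (G n (z n s) - G n (y n s) - ?D (z n s - y n s)) / h n \<le> e / Q * norm (z n s - y n s) / h n"
          by (rule divide_right_mono) (use d(2)[of n] in simp)
        also have "\<dots> = e / Q * norm (q n s)" using d(2)[of n] by (simp add: zq)
        also have "\<dots> \<le> e / Q * Q" using elim s e Q by (intro mult_left_mono) auto
        also have "\<dots> = e" using Q by simp
        finally have 1: "norm ((G n (z n s) - G n (y n s)) /\<^sub>R h n - ?D (q n s)) \<le> e"
          using d(2)[of n] linear_scale[OF lD, of "inverse (h n)" "z n s - y n s"]
          by (simp add: q_def divide_inverse_commute scaleR_diff_right[symmetric] del: scaleR_diff_right)
        have 2: "norm (?D (q n s - w s)) \<le> L * norm (q n s - w s)" by (rule Dg[OF eta(1)[OF s]])
        have eq: "(G n (z n s) - G n (y n s)) /\<^sub>R h n - ?D (w s) = ((G n (z n s) - G n (y n s)) /\<^sub>R h n - ?D (q n s)) + ?D (q n s - w s)"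
          by (simp add: linear_diff[OF lD])
        show "norm ((G n (z n s) - G n (y n s)) /\<^sub>R h n - ?D (w s)) \<le> L * norm (q n s - w s) + e"
          unfolding eq by (rule norm_triangle_le) (use 1 2 in linarith)
      qed
    qed
  qed (use that dq w in \<open>auto intro!: derivative_eq_intros\<close>)
  have tT: "\<forall>\<^sub>F n in sequentially. \<bar>t n\<bar> < \<tau>" using tendsto_rabs[OF t(1)] t(2) by (rule order_tendstoD)
  have along: "(\<lambda>n. p n (t n)) \<longlonglongrightarrow> p0 t0"
    if "\<And>e. 0 < e \<Longrightarrow> \<forall>\<^sub>F n in sequentially. \<forall>s. \<bar>s\<bar> < \<tau> \<longrightarrow> norm (p n s - p0 s) < e" "isCont p0 t0"
    for p and p0 :: "real \<Rightarrow> 'e"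
  proof -
    have "(\<lambda>n. p n (t n) - p0 (t n)) \<longlonglongrightarrow> 0"
    proof (rule tendstoI)
      fix e :: real assume "0 < e"
      from that(1)[OF this] tT show "\<forall>\<^sub>F n in sequentially. dist (p n (t n) - p0 (t n)) 0 < e"
        by eventually_elim simp
    qed
    moreover have "(\<lambda>n. p0 (t n)) \<longlonglongrightarrow> p0 t0" using that(2) t(1) by (rule isCont_tendsto_compose)
    ultimately show ?thesis using tendsto_add by fastforce
  qed
  have "(\<lambda>n. y n (t n)) \<longlonglongrightarrow> eta t0"
    by (rule along[OF y_eta]) (use eta(2)[OF t(2)] has_vector_derivative_continuous in auto)
  moreover have "(\<lambda>n. q n (t n)) \<longlonglongrightarrow> w t0"
    by (rule along[OF q_w]) (use w[OF t(2)] has_vector_derivative_continuous in auto)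
  ultimately show ?thesis using d(2,3) by (simp add: displaces_def q_def)
qed

section \<open>Tangent vectors and displacements on a closed manifold\<close>

locale closed_manifold =
  fixes A :: "('a::t2_space, 'e::euclidean_space) chart set"
  assumes atlas: "smooth_atlas A" and compact_UNIV: "compact (UNIV :: 'a set)"
begin

lemma chart_at: "chart_at A p \<in> A" "p \<in> chart_dom (chart_at A p)"
proof -
  have "\<exists>c. c \<in> A \<and> p \<in> chart_dom c" using atlas unfolding smooth_atlas_def by blast
  then have "chart_at A p \<in> A \<and> p \<in> chart_dom (chart_at A p)"
    unfolding chart_at_def by (rule someI_ex)
  then show "chart_at A p \<in> A" "p \<in> chart_dom (chart_at A p)" by auto
qed

context
  fixes c assumes c: "c \<in> A"
begin

private lemma is_chart: "is_chart c" using atlas c by (simp add: smooth_atlas_def)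

lemma open_chart_dom: "open (chart_dom c)" and open_chart_img: "open (chart_img c)"
  using is_chart by (auto simp: is_chart_def)

lemma chart_inv_map [simp]: "p \<in> chart_dom c \<Longrightarrow> chart_inv c (chart_map c p) = p"
  using is_chart by (auto simp: is_chart_def homeomorphism_def)

lemma chart_map_inv [simp]: "y \<in> chart_img c \<Longrightarrow> chart_map c (chart_inv c y) = y"
  using is_chart by (auto simp: is_chart_def homeomorphism_def)

lemma chart_inv_in: "y \<in> chart_img c \<Longrightarrow> chart_inv c y \<in> chart_dom c"
  by (metis inv_into_into)

lemma continuous_chart_map: "continuous_on (chart_dom c) (chart_map c)"
  and continuous_chart_inv: "continuous_on (chart_img c) (chart_inv c)"
  using is_chart by (auto simp: is_chart_def homeomorphism_def)

lemma open_chart_image: "open U \<Longrightarrow> open (chart_map c ` (chart_dom c \<inter> U))"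
proof -
  assume "open U"
  have "chart_map c ` (chart_dom c \<inter> U) = chart_img c \<inter> chart_inv c -` U"
    by (auto simp: image_iff)
  then show ?thesis
    using continuous_open_preimage[OF continuous_chart_inv open_chart_img \<open>open U\<close>] by simp
qed

lemma isCont_chart_map: "p \<in> chart_dom c \<Longrightarrow> isCont (chart_map c) p"
  using continuous_chart_map open_chart_dom by (simp add: continuous_on_eq_continuous_at)

lemma isCont_chart_inv: "y \<in> chart_img c \<Longrightarrow> isCont (chart_inv c) y"
  using continuous_chart_inv continuous_on_eq_continuous_at[OF open_chart_img] by blast

lemma tendsto_chart:
  assumes "x \<in> chart_dom c"
  shows "(y \<longlongrightarrow> x) F \<longleftrightarrow> (\<forall>\<^sub>F n in F. y n \<in> chart_dom c) \<and> ((\<lambda>n. chart_map c (y n)) \<longlongrightarrow> chart_map c x) F"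
    (is "?L \<longleftrightarrow> ?R1 \<and> ?R2")
proof
  assume ?L
  then show "?R1 \<and> ?R2"
    using topological_tendstoD[OF _ open_chart_dom assms] isCont_tendsto_compose[OF isCont_chart_map[OF assms]] by blast
next
  assume R: "?R1 \<and> ?R2"
  have "((\<lambda>n. chart_inv c (chart_map c (y n))) \<longlongrightarrow> chart_inv c (chart_map c x)) F"
    by (rule isCont_tendsto_compose[OF isCont_chart_inv]) (use R assms in auto)
  moreover have "\<forall>\<^sub>F n in F. chart_inv c (chart_map c (y n)) = y n"
    using conjunct1[OF R] by eventually_elim simp
  ultimately show ?L using assms by (simp add: Lim_transform_eventually)
qed

lemma tendsto_chart_inv:
  assumes "(y \<longlongrightarrow> chart_map c x) F" "x \<in> chart_dom c"
  shows "((\<lambda>n. chart_inv c (y n)) \<longlongrightarrow> x) F" "\<forall>\<^sub>F n in F. y n \<in> chart_img c"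
proof -
  show "((\<lambda>n. chart_inv c (y n)) \<longlongrightarrow> x) F"
    using isCont_tendsto_compose[OF isCont_chart_inv assms(1)] assms(2) by simp
  show "\<forall>\<^sub>F n in F. y n \<in> chart_img c"
    using topological_tendstoD[OF assms(1) open_chart_img] assms(2) by simp
qed

end

definition coord_change :: "('a, 'e) chart \<Rightarrow> ('a, 'e) chart \<Rightarrow> 'a \<Rightarrow> 'e \<Rightarrow> 'e" where
  "coord_change c d p v = frechet_derivative (chart_map d \<circ> chart_inv c) (at (chart_map c p)) v"

lemma transition_Ck:
  assumes "c \<in> A" "d \<in> A"
  shows "Ck_on k (chart_map d \<circ> chart_inv c) (chart_map c ` (chart_dom c \<inter> chart_dom d))"
  using atlas assms unfolding smooth_atlas_def by blast

lemma open_overlap: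
  assumes "c \<in> A" "d \<in> A" shows "open (chart_map c ` (chart_dom c \<inter> chart_dom d))"
  using open_chart_image[OF assms(1) open_chart_dom[OF assms(2)]] .

lemma transition_has_derivative:
  assumes "c \<in> A" "d \<in> A" "p \<in> chart_dom c" "p \<in> chart_dom d"
  shows "((chart_map d \<circ> chart_inv c) has_derivative coord_change c d p) (at (chart_map c p))"
  unfolding coord_change_def[abs_def]
  by (rule C1_has_derivative[OF transition_Ck[OF assms(1,2), of "Suc 0"]]) (use assms in auto)

lemma linear_coord_change:
  assumes "c \<in> A" "d \<in> A" "p \<in> chart_dom c" "p \<in> chart_dom d"
  shows "linear (coord_change c d p)"
  using transition_has_derivative[OF assms] has_derivative_linear by blast

lemma coord_change_compose:
  assumes A: "c \<in> A" "d \<in> A" "e \<in> A" and p: "p \<in> chart_dom c" "p \<in> chart_dom d" "p \<in> chart_dom e"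
  shows "coord_change d e p (coord_change c d p v) = coord_change c e p v"
proof -
  have "(((chart_map e \<circ> chart_inv d) \<circ> (chart_map d \<circ> chart_inv c)) has_derivative coord_change d e p \<circ> coord_change c d p) (at (chart_map c p))"
    by (rule diff_chain_at[OF transition_has_derivative])
      (use transition_has_derivative A p in auto)
  then have "((chart_map e \<circ> chart_inv c) has_derivative coord_change d e p \<circ> coord_change c d p) (at (chart_map c p))"
    by (rule has_derivative_transform_within_open[OF _ open_overlap[OF A(1,2)]]) (use A p in auto)
  then have "coord_change d e p \<circ> coord_change c d p = coord_change c e p"
    using has_derivative_unique transition_has_derivative[OF A(1,3) p(1,3)] by blast
  then show ?thesis by (metis comp_apply)
qed

lemma coord_change_self [simp]:
  assumes "c \<in> A" "p \<in> chart_dom c" shows "coord_change c c p v = v"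
proof -
  have "((\<lambda>x. x) has_derivative (\<lambda>x. x)) (at (chart_map c p))" by (rule has_derivative_ident)
  then have "((chart_map c \<circ> chart_inv c) has_derivative (\<lambda>x. x)) (at (chart_map c p))"
    by (rule has_derivative_transform_within_open[OF _ open_chart_img[OF assms(1)]]) (use assms in auto)
  then have "(\<lambda>x. x) = coord_change c c p"
    using has_derivative_unique transition_has_derivative[OF assms(1,1) assms(2,2)] by blast
  then show ?thesis by metis
qed

text \<open>The components in the chart \<open>c\<close> of a tangent vector at \<open>p\<close>; inverse to \<open>coord_vec\<close>.\<close>

definition comps :: "('a, 'e) chart \<Rightarrow> 'a \<Rightarrow> 'e \<Rightarrow> 'e" where
  "comps c p v = coord_change (chart_at A p) c p v"

lemma coord_vec_coord_change: "coord_vec A c p v = coord_change c (chart_at A p) p v"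
  by (simp add: coord_vec_def coord_change_def)

lemma comps_coord_vec [simp]: "c \<in> A \<Longrightarrow> p \<in> chart_dom c \<Longrightarrow> comps c p (coord_vec A c p v) = v"
  and coord_vec_comps [simp]: "c \<in> A \<Longrightarrow> p \<in> chart_dom c \<Longrightarrow> coord_vec A c p (comps c p v) = v"
  by (simp_all add: comps_def coord_vec_coord_change coord_change_compose chart_at)

lemma comps_chart_at [simp]: "comps (chart_at A p) p v = v"
  by (simp add: comps_def chart_at)

lemma linear_comps: "c \<in> A \<Longrightarrow> p \<in> chart_dom c \<Longrightarrow> linear (comps c p)"
  unfolding comps_def[abs_def] by (rule linear_coord_change) (auto simp: chart_at)

lemma linear_coord_vec: "c \<in> A \<Longrightarrow> p \<in> chart_dom c \<Longrightarrow> linear (coord_vec A c p)"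
  unfolding coord_vec_coord_change[abs_def] by (rule linear_coord_change) (auto simp: chart_at)

lemma coord_change_comps: "c \<in> A \<Longrightarrow> d \<in> A \<Longrightarrow> p \<in> chart_dom c \<Longrightarrow> p \<in> chart_dom d \<Longrightarrow> coord_change c d p (comps c p v) = comps d p v"
  by (simp add: comps_def coord_change_compose chart_at)

lemma coord_change_tendsto:
  assumes "c \<in> A" "d \<in> A" "x \<in> chart_dom c" "x \<in> chart_dom d" "(y \<longlongrightarrow> x) F" "(u \<longlongrightarrow> v) F"
  shows "((\<lambda>n. coord_change c d (y n) (u n)) \<longlongrightarrow> coord_change c d x v) F"
  unfolding coord_change_def
proof (rule C1_derivative_tendsto[OF transition_Ck[OF assms(1,2)] open_overlap[OF assms(1,2)] _ _ assms(6)])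
  show "((\<lambda>n. chart_map c (y n)) \<longlongrightarrow> chart_map c x) F"
    using assms(5) tendsto_chart[OF assms(1,3)] by blast
qed (use assms in auto)

subsection \<open>Displacements\<close>

text \<open>Convergence of \<open>z\<close> has to be required: chart maps carry no information outside of the domain of the
  chart.  The choice of the chart at \<open>x\<close> is immaterial (\<open>mdisp_chart\<close>, \<open>mdispI\<close>).\<close>

definition mdisp :: "(nat \<Rightarrow> 'a) \<Rightarrow> (nat \<Rightarrow> 'a) \<Rightarrow> (nat \<Rightarrow> real) \<Rightarrow> 'a \<Rightarrow> 'e \<Rightarrow> bool" where
  "mdisp y z h x v \<longleftrightarrow> y \<longlonglongrightarrow> x \<and> z \<longlonglongrightarrow> x \<and>
     displaces (\<lambda>n. chart_map (chart_at A x) (y n)) (\<lambda>n. chart_map (chart_at A x) (z n)) h (chart_map (chart_at A x) x) v"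

lemma displaces_change_chart:
  assumes "c \<in> A" "d \<in> A" "x \<in> chart_dom c" "x \<in> chart_dom d" "y \<longlonglongrightarrow> x" "z \<longlonglongrightarrow> x"
    and "displaces (\<lambda>n. chart_map c (y n)) (\<lambda>n. chart_map c (z n)) h (chart_map c x) v"
  shows "displaces (\<lambda>n. chart_map d (y n)) (\<lambda>n. chart_map d (z n)) h (chart_map d x) (coord_change c d x v)"
proof -
  have ev: "\<forall>\<^sub>F n in sequentially. chart_map d (w n) = ((chart_map d \<circ> chart_inv c) \<circ> (\<lambda>n. chart_map c (w n))) n"
    if "w \<longlonglongrightarrow> x" for w
    using topological_tendstoD[OF that open_chart_dom[OF assms(1)] assms(3)]
    by eventually_elim (use assms(1) in auto)
  have "displaces ((chart_map d \<circ> chart_inv c) \<circ> (\<lambda>n. chart_map c (y n))) ((chart_map d \<circ> chart_inv c) \<circ> (\<lambda>n. chart_map c (z n)))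
      h ((chart_map d \<circ> chart_inv c) (chart_map c x)) (coord_change c d x v)"
    unfolding coord_change_def
    by (rule displaces_C1[OF transition_Ck[OF assms(1,2)] open_overlap[OF assms(1,2)] _ assms(7)]) (use assms in auto)
  from displaces_cong[OF this ev[OF assms(5)] ev[OF assms(6)]] show ?thesis using assms by simp
qed

lemma mdisp_chart:
  assumes "mdisp y z h x v" "c \<in> A" "x \<in> chart_dom c"
  shows "displaces (\<lambda>n. chart_map c (y n)) (\<lambda>n. chart_map c (z n)) h (chart_map c x) (comps c x v)"
  unfolding comps_def
  by (rule displaces_change_chart) (use assms chart_at in \<open>auto simp: mdisp_def\<close>)

lemma mdispI:
  assumes "c \<in> A" "x \<in> chart_dom c" "y \<longlonglongrightarrow> x" "z \<longlonglongrightarrow> x"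
    "displaces (\<lambda>n. chart_map c (y n)) (\<lambda>n. chart_map c (z n)) h (chart_map c x) u"
  shows "mdisp y z h x (coord_vec A c x u)"
  unfolding mdisp_def coord_vec_coord_change
  using displaces_change_chart[OF assms(1) chart_at(1) assms(2) chart_at(2) assms(3-5)] assms by auto

lemma mdispD:
  assumes "mdisp y z h x v"
  shows "y \<longlonglongrightarrow> x" "z \<longlonglongrightarrow> x" "\<And>n. 0 < h n" "h \<longlonglongrightarrow> 0"
  using assms displacesD unfolding mdisp_def by auto

lemma mdisp_unique:
  assumes "mdisp y z h x v" "mdisp y z h x w" shows "v = w"
  using assms LIMSEQ_unique unfolding mdisp_def displaces_def by blast

lemma mdisp_cong:
  assumes "mdisp y z h x v" "\<forall>\<^sub>F n in sequentially. y' n = y n" "\<forall>\<^sub>F n in sequentially. z' n = z n"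
  shows "mdisp y' z' h x v"
  unfolding mdisp_def
proof (intro conjI)
  show "y' \<longlonglongrightarrow> x" by (rule Lim_transform_eventually[OF mdispD(1)[OF assms(1)]]) (use assms(2) in eventually_elim, simp)
  show "z' \<longlonglongrightarrow> x" by (rule Lim_transform_eventually[OF mdispD(2)[OF assms(1)]]) (use assms(3) in eventually_elim, simp)
  show "displaces (\<lambda>n. chart_map (chart_at A x) (y' n)) (\<lambda>n. chart_map (chart_at A x) (z' n)) h (chart_map (chart_at A x) x) v"
    by (rule displaces_cong[OF _ eventually_mono[OF assms(2)] eventually_mono[OF assms(3)]])
      (use assms(1) in \<open>auto simp: mdisp_def\<close>)
qed

lemma mdisp_chart_inv:
  assumes "c \<in> A" "x \<in> chart_dom c" "displaces y z h (chart_map c x) u"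
  shows "mdisp (\<lambda>n. chart_inv c (y n)) (\<lambda>n. chart_inv c (z n)) h x (coord_vec A c x u)"
proof (rule mdispI[OF assms(1,2)])
  note y = tendsto_chart_inv[OF assms(1) displacesD(1)[OF assms(3)] assms(2)]
  note z = tendsto_chart_inv[OF assms(1) displacesD(5)[OF assms(3)] assms(2)]
  show "(\<lambda>n. chart_inv c (y n)) \<longlonglongrightarrow> x" "(\<lambda>n. chart_inv c (z n)) \<longlonglongrightarrow> x" using y z by auto
  show "displaces (\<lambda>n. chart_map c (chart_inv c (y n))) (\<lambda>n. chart_map c (chart_inv c (z n))) h (chart_map c x) u"
    using displaces_cong[OF assms(3) eventually_mono[OF y(2)] eventually_mono[OF z(2)]] assms(1) by simp
qed

lemma mdisp_exists: obtains z h where "mdisp (\<lambda>n. x) z h x v"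
proof -
  let ?c = "chart_at A x" and ?h = "\<lambda>n. inverse (real (Suc n))"
  have "displaces (\<lambda>n. chart_map ?c x) (\<lambda>n. chart_map ?c x + ?h n *\<^sub>R v) ?h (chart_map ?c x) v"
    by (rule displaces_line[OF _ LIMSEQ_inverse_real_of_nat tendsto_const tendsto_const]) simp
  from mdisp_chart_inv[OF chart_at this] show thesis
    using that chart_at by (simp add: coord_vec_coord_change)
qed

lemma dfun_chart:
  assumes f: "Ck_fun A (Suc 0) N f" "open N" "p \<in> N" and c: "c \<in> A" "p \<in> chart_dom c"
  shows "dfun A f p v = frechet_derivative (f \<circ> chart_inv c) (at (chart_map c p)) (comps c p v)"
proof -
  let ?d = "chart_at A p"
  have der: "((f \<circ> chart_inv c) has_derivative frechet_derivative (f \<circ> chart_inv c) (at (chart_map c p))) (at (chart_map c p))"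
    if "c \<in> A" "p \<in> chart_dom c" for c
  proof (rule C1_has_derivative)
    show "Ck_on (Suc 0) (f \<circ> chart_inv c) (chart_map c ` (chart_dom c \<inter> N))" using f(1) that(1) unfolding Ck_fun_def by blast
  qed (use that f(3) in auto)
  have "((chart_map c \<circ> chart_inv ?d) has_derivative coord_change ?d c p) (at (chart_map ?d p))"
    by (rule transition_has_derivative) (use c chart_at in auto)
  moreover have "((f \<circ> chart_inv c) has_derivative frechet_derivative (f \<circ> chart_inv c) (at (chart_map c p)))
      (at ((chart_map c \<circ> chart_inv ?d) (chart_map ?d p)))"
    using der[OF c] by (simp add: chart_at)
  ultimately have "(((f \<circ> chart_inv c) \<circ> (chart_map c \<circ> chart_inv ?d)) has_derivative
      frechet_derivative (f \<circ> chart_inv c) (at (chart_map c p)) \<circ> coord_change ?d c p) (at (chart_map ?d p))"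
    by (rule diff_chain_at)
  then have "((f \<circ> chart_inv ?d) has_derivative
      frechet_derivative (f \<circ> chart_inv c) (at (chart_map c p)) \<circ> coord_change ?d c p) (at (chart_map ?d p))"
    by (rule has_derivative_transform_within_open[OF _ open_overlap[OF chart_at(1) c(1)]])
      (use c chart_at in auto)
  then have "frechet_derivative (f \<circ> chart_inv ?d) (at (chart_map ?d p)) =
      frechet_derivative (f \<circ> chart_inv c) (at (chart_map c p)) \<circ> coord_change ?d c p"
    by (rule frechet_derivative_at[symmetric])
  then show ?thesis by (simp add: dfun_def comps_def)
qed

lemma linear_dfun:
  assumes f: "Ck_fun A (Suc 0) N f" "p \<in> N"
  shows "linear (dfun A f p)"
  unfolding dfun_def[abs_def]
proof (rule linear_frechet_derivative, rule C1_differentiable)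
  show "Ck_on (Suc 0) (f \<circ> chart_inv (chart_at A p)) (chart_map (chart_at A p) ` (chart_dom (chart_at A p) \<inter> N))"
    using f(1) chart_at(1) unfolding Ck_fun_def by blast
qed (use f(2) chart_at in auto)

lemma mdisp_fun:
  assumes f: "Ck_fun A (Suc 0) N f" "open N" "x \<in> N" and "mdisp y z h x v"
  shows "(\<lambda>n. (f (z n) - f (y n)) / h n) \<longlonglongrightarrow> dfun A f x v"
proof -
  let ?c = "chart_at A x"
  have 1: "displaces ((f \<circ> chart_inv ?c) \<circ> (\<lambda>n. chart_map ?c (y n))) ((f \<circ> chart_inv ?c) \<circ> (\<lambda>n. chart_map ?c (z n))) h
     ((f \<circ> chart_inv ?c) (chart_map ?c x)) (dfun A f x v)"
    unfolding dfun_def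
  proof (rule displaces_C1)
    show "Ck_on (Suc 0) (f \<circ> chart_inv ?c) (chart_map ?c ` (chart_dom ?c \<inter> N))"
      using f(1) chart_at(1) unfolding Ck_fun_def by blast
    show "open (chart_map ?c ` (chart_dom ?c \<inter> N))" by (rule open_chart_image[OF chart_at(1) f(2)])
  qed (use f(3) chart_at assms(4) in \<open>auto simp: mdisp_def\<close>)
  have 2: "\<And>w. w \<longlonglongrightarrow> x \<Longrightarrow> \<forall>\<^sub>F n in sequentially. f (w n) = ((f \<circ> chart_inv ?c) \<circ> (\<lambda>n. chart_map ?c (w n))) n"
    by (rule eventually_mono[OF topological_tendstoD[OF _ open_chart_dom[OF chart_at(1)] chart_at(2)]]) (auto simp: chart_at)
  have "displaces (\<lambda>n. f (y n)) (\<lambda>n. f (z n)) h ((f \<circ> chart_inv ?c) (chart_map ?c x)) (dfun A f x v)"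
    using displaces_cong[OF 1 2[OF mdispD(1)[OF assms(4)]] 2[OF mdispD(2)[OF assms(4)]]] .
  from displacesD(4)[OF this] show ?thesis by (simp add: divide_inverse_commute)
qed

text \<open>The derivative of a map exists in charts as soon as displacements are transported
  (\<open>strict_derivative\<close>); for flows this is the only access to \<open>tangent_map\<close>.\<close>

lemma tangent_map_eqI:
  assumes D: "\<And>y z h v. mdisp y z h x v \<Longrightarrow> mdisp (\<lambda>n. f (y n)) (\<lambda>n. f (z n)) h (f x) (D v)"
  shows "tangent_map A f x v = D v"
proof -
  let ?c = "chart_at A x" and ?d = "chart_at A (f x)"
  have "((chart_map ?d \<circ> f \<circ> chart_inv ?c) has_derivative D) (at (chart_map ?c x))"
  proof (rule strict_derivative)
    fix y z h v assume "displaces y z h (chart_map ?c x) v"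
    from D[OF mdisp_chart_inv[OF chart_at this]]
    have "mdisp (\<lambda>n. f (chart_inv ?c (y n))) (\<lambda>n. f (chart_inv ?c (z n))) h (f x) (D v)"
      by (simp add: coord_vec_coord_change chart_at)
    then show "(\<lambda>n. ((chart_map ?d \<circ> f \<circ> chart_inv ?c) (z n) - (chart_map ?d \<circ> f \<circ> chart_inv ?c) (y n)) /\<^sub>R h n) \<longlonglongrightarrow> D v"
      unfolding mdisp_def using displacesD(4) by fastforce
  qed
  then show ?thesis unfolding tangent_map_def using frechet_derivative_at by metis
qed

subsection \<open>Sequential compactness and continuity\<close>

text \<open>The topology of the type is not known to be first countable.  Sequential arguments become available
  through coordinate balls: a cluster point of the sequence is the limit of a subsequence.\<close>

lemma convergent_subsequence:
  fixes x :: "nat \<Rightarrow> 'a"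
  obtains l s where "strict_mono s" "(x \<circ> s) \<longlonglongrightarrow> l"
proof -
  have "filtermap x sequentially \<noteq> bot" by (simp add: filtermap_bot_iff)
  then obtain l where l: "inf (nhds l) (filtermap x sequentially) \<noteq> bot"
    using compact_UNIV[unfolded compact_filter] by auto
  let ?c = "chart_at A l"
  define W where "W k = {p \<in> chart_dom ?c. dist (chart_map ?c p) (chart_map ?c l) < inverse (real (Suc k))}" for k :: nat
  have W: "\<forall>\<^sub>F p in nhds l. p \<in> W k" for k
  proof -
    have "\<forall>\<^sub>F p in nhds l. dist (chart_map ?c p) (chart_map ?c l) < inverse (real (Suc k))"
      using isCont_chart_map[OF chart_at] unfolding isCont_def tendsto_at_iff_tendsto_nhds by (rule tendstoD) simp
    moreover have "\<forall>\<^sub>F p in nhds l. p \<in> chart_dom ?c"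
      using open_chart_dom[OF chart_at(1)] chart_at(2) by (auto simp: eventually_nhds)
    ultimately show ?thesis by eventually_elim (simp add: W_def)
  qed
  have ex: "\<exists>n>N. x n \<in> W k" for N k
  proof (rule ccontr)
    assume "\<not> ?thesis"
    then have "\<forall>\<^sub>F p in filtermap x sequentially. p \<notin> W k"
      unfolding eventually_filtermap eventually_sequentially by (metis Suc_le_lessD)
    then have "\<forall>\<^sub>F p in inf (nhds l) (filtermap x sequentially). False"
      using W[of k] unfolding eventually_inf by blast
    then show False using l eventually_False by blast
  qed
  obtain s where s: "\<And>k. x (s k) \<in> W k \<and> s k < s (Suc k)"
  proof -
    have "\<exists>s. \<forall>k. x (s k) \<in> W k \<and> s k < s (Suc k)"
      by (rule dependent_nat_choice) (use ex in auto)
    then show thesis using that by blast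
  qed
  have "(\<lambda>k. chart_map ?c ((x \<circ> s) k)) \<longlonglongrightarrow> chart_map ?c l"
  proof (subst tendsto_dist_iff, rule tendsto_sandwich[OF _ _ tendsto_const LIMSEQ_inverse_real_of_nat])
    show "\<forall>\<^sub>F k in sequentially. dist (chart_map ?c ((x \<circ> s) k)) (chart_map ?c l) \<le> inverse (real (Suc k))"
      using s by (auto simp: W_def less_imp_le)
  qed simp
  moreover have "\<forall>k. (x \<circ> s) k \<in> chart_dom ?c" using s by (simp add: W_def)
  ultimately have "(x \<circ> s) \<longlonglongrightarrow> l" unfolding tendsto_chart[OF chart_at, of "x \<circ> s" l] by simp
  then show thesis using that[of s l] s by (simp add: strict_mono_Suc_iff)
qed

lemma isCont_sequentially:
  fixes f :: "'a \<Rightarrow> 'b::topological_space"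
  assumes "\<And>y. y \<longlonglongrightarrow> x \<Longrightarrow> (\<lambda>n. f (y n)) \<longlonglongrightarrow> f x"
  shows "isCont f x"
proof -
  let ?c = "chart_at A x"
  have "isCont (f \<circ> chart_inv ?c) (chart_map ?c x)"
    unfolding continuous_at_sequentially
    using assms[OF tendsto_chart_inv(1)[OF chart_at(1) _ chart_at(2)]] by (simp add: chart_at o_def)
  then have "isCont ((f \<circ> chart_inv ?c) \<circ> chart_map ?c) x"
    by (rule continuous_at_compose[OF isCont_chart_map[OF chart_at]])
  moreover have "\<forall>\<^sub>F p in nhds x. p \<in> chart_dom ?c"
    using open_chart_dom[OF chart_at(1)] chart_at(2) by (auto simp: eventually_nhds)
  then have "\<forall>\<^sub>F p in nhds x. ((f \<circ> chart_inv ?c) \<circ> chart_map ?c) p = f p"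
    by eventually_elim (simp add: chart_at)
  ultimately show ?thesis using isCont_cong by blast
qed

lemma seq_closed_imp_closed:
  fixes S :: "'a set"
  assumes "\<And>x l. (\<forall>n. x n \<in> S) \<Longrightarrow> x \<longlonglongrightarrow> l \<Longrightarrow> l \<in> S"
  shows "closed S"
proof -
  have "open (- S)"
  proof (subst open_subopen, intro ballI)
    fix x assume x: "x \<in> - S"
    let ?c = "chart_at A x"
    have "\<exists>e>0. \<forall>y\<in>ball (chart_map ?c x) e. y \<in> chart_img ?c \<longrightarrow> chart_inv ?c y \<notin> S"
    proof (rule ccontr)
      assume "\<not> ?thesis"
      then have "\<forall>n. \<exists>y\<in>ball (chart_map ?c x) (inverse (real (Suc n))). chart_inv ?c y \<in> S"
        by (metis inverse_positive_iff_positive of_nat_0_less_iff zero_less_Suc)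
      then obtain y where y: "\<And>n. y n \<in> ball (chart_map ?c x) (inverse (real (Suc n)))" "\<And>n. chart_inv ?c (y n) \<in> S" by metis
      have "(\<lambda>n. dist (y n) (chart_map ?c x)) \<longlonglongrightarrow> 0"
        by (rule tendsto_sandwich[OF _ _ tendsto_const LIMSEQ_inverse_real_of_nat])
          (use y(1) in \<open>auto simp: dist_commute less_imp_le\<close>)
      then have "y \<longlonglongrightarrow> chart_map ?c x" using tendsto_dist_iff by blast
      then have "(\<lambda>n. chart_inv ?c (y n)) \<longlonglongrightarrow> x" by (rule tendsto_chart_inv(1)[OF chart_at(1) _ chart_at(2)])
      then show False using assms[of "\<lambda>n. chart_inv ?c (y n)" x] y(2) x by simp
    qed
    then obtain e where e: "0 < e" "\<And>y. y \<in> ball (chart_map ?c x) e \<Longrightarrow> y \<in> chart_img ?c \<Longrightarrow> chart_inv ?c y \<notin> S" by blast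
    let ?T = "chart_dom ?c \<inter> chart_map ?c -` ball (chart_map ?c x) e"
    have "open ?T"
      by (rule continuous_open_preimage[OF continuous_chart_map open_chart_dom open_ball]) (simp_all add: chart_at)
    moreover have "x \<in> ?T" using e(1) chart_at by simp
    moreover have "?T \<subseteq> - S" using e(2) chart_inv_map[OF chart_at(1)] by fastforce
    ultimately show "\<exists>T. open T \<and> x \<in> T \<and> T \<subseteq> - S" by blast
  qed
  then show ?thesis by (simp add: closed_def)
qed

subsection \<open>Convergence of tangent vectors\<close>

text \<open>Convergence in the tangent bundle, read in the chart selected at the limit point.\<close>

definition tconv :: "(nat \<Rightarrow> 'a) \<Rightarrow> (nat \<Rightarrow> 'e) \<Rightarrow> 'a \<Rightarrow> 'e \<Rightarrow> bool" where
  "tconv xs vs x v \<longleftrightarrow> xs \<longlonglongrightarrow> x \<and> (\<lambda>n. comps (chart_at A x) (xs n) (vs n)) \<longlonglongrightarrow> v"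

lemma tconv_chart:
  assumes "tconv xs vs x v" "c \<in> A" "x \<in> chart_dom c"
  shows "(\<lambda>n. comps c (xs n) (vs n)) \<longlonglongrightarrow> comps c x v"
proof -
  let ?d = "chart_at A x"
  have xs: "xs \<longlonglongrightarrow> x" using assms(1) by (simp add: tconv_def)
  have "(\<lambda>n. coord_change ?d c (xs n) (comps ?d (xs n) (vs n))) \<longlonglongrightarrow> coord_change ?d c x v"
    by (rule coord_change_tendsto) (use assms chart_at in \<open>auto simp: tconv_def\<close>)
  moreover have "\<forall>\<^sub>F n in sequentially. coord_change ?d c (xs n) (comps ?d (xs n) (vs n)) = comps c (xs n) (vs n)"
    using topological_tendstoD[OF xs open_chart_dom[OF assms(2)] assms(3)]
      topological_tendstoD[OF xs open_chart_dom[OF chart_at(1)] chart_at(2)]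
    by eventually_elim (use assms(2) chart_at in \<open>auto simp: coord_change_comps\<close>)
  ultimately show ?thesis by (simp add: comps_def Lim_transform_eventually)
qed

lemma tconvI:
  assumes "xs \<longlonglongrightarrow> x" "c \<in> A" "x \<in> chart_dom c" "(\<lambda>n. comps c (xs n) (vs n)) \<longlonglongrightarrow> u"
  shows "tconv xs vs x (coord_vec A c x u)"
proof -
  let ?d = "chart_at A x"
  have "(\<lambda>n. coord_change c ?d (xs n) (comps c (xs n) (vs n))) \<longlonglongrightarrow> coord_change c ?d x u"
    by (rule coord_change_tendsto) (use assms chart_at in auto)
  moreover have "\<forall>\<^sub>F n in sequentially. coord_change c ?d (xs n) (comps c (xs n) (vs n)) = comps ?d (xs n) (vs n)"
    using topological_tendstoD[OF assms(1) open_chart_dom[OF assms(2)] assms(3)]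
      topological_tendstoD[OF assms(1) open_chart_dom[OF chart_at(1)] chart_at(2)]
    by eventually_elim (use assms(2) chart_at in \<open>auto simp: coord_change_comps\<close>)
  ultimately show ?thesis using assms(1) by (simp add: tconv_def coord_vec_coord_change Lim_transform_eventually)
qed

lemma tconv_lin:
  assumes "tconv xs vs x v" "tconv xs ws x w" "(a::nat \<Rightarrow> real) \<longlonglongrightarrow> a0"
  shows "tconv xs (\<lambda>n. vs n + a n *\<^sub>R ws n) x (v + a0 *\<^sub>R w)"
proof -
  let ?c = "chart_at A x"
  have xs: "xs \<longlonglongrightarrow> x" using assms by (simp add: tconv_def)
  have "(\<lambda>n. comps ?c (xs n) (vs n) + a n *\<^sub>R comps ?c (xs n) (ws n)) \<longlonglongrightarrow> v + a0 *\<^sub>R w"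
    using assms by (intro tendsto_intros) (auto simp: tconv_def)
  moreover have "\<forall>\<^sub>F n in sequentially. comps ?c (xs n) (vs n) + a n *\<^sub>R comps ?c (xs n) (ws n) = comps ?c (xs n) (vs n + a n *\<^sub>R ws n)"
    using topological_tendstoD[OF xs open_chart_dom[OF chart_at(1)] chart_at(2)]
  proof eventually_elim
    case (elim n)
    show ?case using linear_comps[OF chart_at(1) elim] by (simp add: linear_add linear_scale)
  qed
  ultimately show ?thesis using xs by (simp add: tconv_def Lim_transform_eventually)
qed

lemma tconv_exists:
  assumes "xs \<longlonglongrightarrow> x" obtains vs where "tconv xs vs x v"
proof
  let ?c = "chart_at A x"
  have "(\<lambda>n. comps ?c (xs n) (coord_vec A ?c (xs n) v)) \<longlonglongrightarrow> v"
    by (rule Lim_transform_eventually[OF tendsto_const])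
      (rule eventually_mono[OF topological_tendstoD[OF assms open_chart_dom[OF chart_at(1)] chart_at(2)]], simp add: chart_at)
  then show "tconv xs (\<lambda>n. coord_vec A ?c (xs n) v) x v" using assms by (simp add: tconv_def)
qed

lemma tconv_dfun:
  assumes f: "Ck_fun A (Suc 0) N f" "open N" "x \<in> N" and "tconv xs vs x v"
  shows "(\<lambda>n. dfun A f (xs n) (vs n)) \<longlonglongrightarrow> dfun A f x v"
proof -
  let ?c = "chart_at A x"
  have xs: "xs \<longlonglongrightarrow> x" using assms by (simp add: tconv_def)
  have "(\<lambda>n. frechet_derivative (f \<circ> chart_inv ?c) (at (chart_map ?c (xs n))) (comps ?c (xs n) (vs n))) \<longlonglongrightarrow>
     frechet_derivative (f \<circ> chart_inv ?c) (at (chart_map ?c x)) v"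
  proof (rule C1_derivative_tendsto)
    show "Ck_on (Suc 0) (f \<circ> chart_inv ?c) (chart_map ?c ` (chart_dom ?c \<inter> N))"
      using f(1) chart_at(1) unfolding Ck_fun_def by blast
    show "open (chart_map ?c ` (chart_dom ?c \<inter> N))" by (rule open_chart_image[OF chart_at(1) f(2)])
    show "(\<lambda>n. chart_map ?c (xs n)) \<longlonglongrightarrow> chart_map ?c x" using xs tendsto_chart[OF chart_at] by blast
  qed (use assms chart_at in \<open>auto simp: tconv_def\<close>)
  moreover have "\<forall>\<^sub>F n in sequentially. frechet_derivative (f \<circ> chart_inv ?c) (at (chart_map ?c (xs n))) (comps ?c (xs n) (vs n))
      = dfun A f (xs n) (vs n)"
    using topological_tendstoD[OF xs open_chart_dom[OF chart_at(1)] chart_at(2)] topological_tendstoD[OF xs f(2,3)]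
    by eventually_elim (rule dfun_chart[OF f(1,2) _ chart_at(1), symmetric])
  ultimately show ?thesis unfolding dfun_def[of A f x v] by (rule Lim_transform_eventually)
qed

lemma bilinear_field_chart:
  assumes \<beta>: "smooth_bilinear_field A \<beta>" and c: "c \<in> A" "p \<in> chart_dom c"
  shows "\<beta> p u v = (\<Sum>i\<in>Basis. (comps c p u \<bullet> i) * (\<Sum>j\<in>Basis. (comps c p v \<bullet> j) * local_form A \<beta> c (chart_map c p) i j))"
proof -
  have bl: "bilinear (\<beta> p)" using \<beta> by (simp add: smooth_bilinear_field_def)
  have l1: "linear (\<lambda>u. \<beta> p (coord_vec A c p u) w)" for w
    using linear_compose[OF linear_coord_vec[OF c], of "\<lambda>u. \<beta> p u w"] bl by (simp add: bilinear_def o_def)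
  have l2: "linear (\<lambda>v. \<beta> p w (coord_vec A c p v))" for w
    using linear_compose[OF linear_coord_vec[OF c], of "\<lambda>v. \<beta> p w v"] bl by (simp add: bilinear_def o_def)
  have "\<beta> p u v = \<beta> p (coord_vec A c p (comps c p u)) (coord_vec A c p (comps c p v))" using c by simp
  also have "\<dots> = (\<Sum>i\<in>Basis. (comps c p u \<bullet> i) * \<beta> p (coord_vec A c p i) (coord_vec A c p (comps c p v)))"
    using linear_eq_sum_Basis[OF l1, of "comps c p u"] by simp
  also have "\<dots> = (\<Sum>i\<in>Basis. (comps c p u \<bullet> i) * (\<Sum>j\<in>Basis. (comps c p v \<bullet> j) * \<beta> p (coord_vec A c p i) (coord_vec A c p j)))"
    using linear_eq_sum_Basis[OF l2, of _ "comps c p v"] by simp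
  finally show ?thesis using c by (simp add: local_form_def)
qed

lemma tconv_bilinear_field:
  assumes \<beta>: "smooth_bilinear_field A \<beta>" and "tconv xs us x u" "tconv xs vs x v"
  shows "(\<lambda>n. \<beta> (xs n) (us n) (vs n)) \<longlonglongrightarrow> \<beta> x u v"
proof -
  let ?c = "chart_at A x"
  have xs: "xs \<longlonglongrightarrow> x" using assms by (simp add: tconv_def)
  have "(\<lambda>n. \<Sum>i\<in>Basis. (comps ?c (xs n) (us n) \<bullet> i) * (\<Sum>j\<in>Basis. (comps ?c (xs n) (vs n) \<bullet> j) * local_form A \<beta> ?c (chart_map ?c (xs n)) i j))
     \<longlonglongrightarrow> (\<Sum>i\<in>Basis. (u \<bullet> i) * (\<Sum>j\<in>Basis. (v \<bullet> j) * local_form A \<beta> ?c (chart_map ?c x) i j))"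
  proof (intro tendsto_intros)
    fix i j
    have "Ck_on 0 (\<lambda>y. local_form A \<beta> ?c y i j) (chart_img ?c)"
      using \<beta> chart_at(1) unfolding smooth_bilinear_field_def by blast
    then have "isCont (\<lambda>y. local_form A \<beta> ?c y i j) (chart_map ?c x)"
      using chart_at(2) continuous_on_eq_continuous_at[OF open_chart_img[OF chart_at(1)]] by auto
    moreover have "(\<lambda>n. chart_map ?c (xs n)) \<longlonglongrightarrow> chart_map ?c x" using xs tendsto_chart[OF chart_at] by blast
    ultimately show "(\<lambda>n. local_form A \<beta> ?c (chart_map ?c (xs n)) i j) \<longlonglongrightarrow> local_form A \<beta> ?c (chart_map ?c x) i j"
      by (rule isCont_tendsto_compose)
  qed (use assms in \<open>auto simp: tconv_def\<close>)
  moreover have "\<forall>\<^sub>F n in sequentially. (\<Sum>i\<in>Basis. (comps ?c (xs n) (us n) \<bullet> i) * (\<Sum>j\<in>Basis. (comps ?c (xs n) (vs n) \<bullet> j) * local_form A \<beta> ?c (chart_map ?c (xs n)) i j))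
      = \<beta> (xs n) (us n) (vs n)"
    by (rule eventually_mono[OF topological_tendstoD[OF xs open_chart_dom[OF chart_at(1)] chart_at(2)]])
      (rule bilinear_field_chart[OF \<beta> chart_at(1), symmetric])
  ultimately show ?thesis
    using bilinear_field_chart[OF \<beta> chart_at, of x u v] by (simp add: Lim_transform_eventually)
qed

text \<open>Compactness of the unit tangent bundle.  The components of the vectors stay bounded: otherwise
  a limit of normalised components would be a nonzero vector of length zero.\<close>

lemma unit_tangent_subsequence:
  fixes xs :: "nat \<Rightarrow> 'a"
  assumes g: "riemannian_metric A g" and unit: "\<And>n. gnorm g (xs n) (vs n) = 1"
  obtains s x v where "strict_mono s" "tconv (xs \<circ> s) (vs \<circ> s) x v" "gnorm g x v = 1"
proof -
  have sm: "smooth_bilinear_field A g" and pos: "\<And>p u. u \<noteq> 0 \<Longrightarrow> 0 < g p u u"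
    using g by (auto simp: riemannian_metric_def)
  have bl: "bilinear (g p)" for p using sm by (simp add: smooth_bilinear_field_def)
  obtain x s1 where s1: "strict_mono s1" "(xs \<circ> s1) \<longlonglongrightarrow> x" by (rule convergent_subsequence[of xs])
  let ?c = "chart_at A x"
  define w where "w = (\<lambda>n. comps ?c (xs (s1 n)) (vs (s1 n)))"
  have "\<exists>K. \<forall>\<^sub>F n in sequentially. norm (w n) \<le> K"
  proof (rule ccontr)
    assume "\<not> ?thesis"
    then have "\<not> (\<forall>n\<ge>Suc N. norm (w n) \<le> real k)" for N k
      unfolding eventually_sequentially by blast
    then have big: "\<exists>n>N. norm (w n) > real k" for N k by (auto simp: not_le Suc_le_eq)
    have "\<exists>r. \<forall>k. norm (w (r k)) > real k \<and> r k < r (Suc k)"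
    proof (rule dependent_nat_choice)
      show "\<exists>n. norm (w n) > real 0" using big by blast
      show "\<exists>m. norm (w m) > real (Suc k) \<and> n < m" for n k using big[of n "Suc k"] by blast
    qed
    then obtain r where r: "\<And>k. norm (w (r k)) > real k" "strict_mono r" by (auto simp: strict_mono_Suc_iff)
    have w0: "norm (w (r k)) > 0" for k using r(1)[of k] by (meson le_less_trans of_nat_0_le_iff)
    define u where "u k = w (r k) /\<^sub>R norm (w (r k))" for k
    have "u k \<in> sphere 0 1" for k using w0[of k] by (simp add: u_def)
    then obtain l q where q: "strict_mono q" "(u \<circ> q) \<longlonglongrightarrow> l" "l \<in> sphere 0 1"
      using compact_sphere[of "0::'e" 1] unfolding compact_def by metis
    define m where "m = s1 \<circ> r \<circ> q"
    have xm: "(\<lambda>k. xs (m k)) \<longlonglongrightarrow> x"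
      using LIMSEQ_subseq_LIMSEQ[OF s1(2) strict_mono_o[OF r(2) q(1)]] by (simp add: m_def o_def)
    let ?a = "\<lambda>k. inverse (norm (w (r (q k))))"
    have "(\<lambda>k. comps ?c (xs (m k)) (?a k *\<^sub>R vs (m k))) \<longlonglongrightarrow> l"
    proof (rule Lim_transform_eventually[OF q(2)], rule eventually_mono[OF topological_tendstoD[OF xm open_chart_dom[OF chart_at(1)] chart_at(2)]])
      fix k assume "xs (m k) \<in> chart_dom ?c"
      from linear_comps[OF chart_at(1) this] show "(u \<circ> q) k = comps ?c (xs (m k)) (?a k *\<^sub>R vs (m k))"
        by (simp add: linear_scale u_def w_def m_def)
    qed
    then have tc: "tconv (\<lambda>k. xs (m k)) (\<lambda>k. ?a k *\<^sub>R vs (m k)) x l" using xm by (simp add: tconv_def)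
    have "(\<lambda>k. g (xs (m k)) (?a k *\<^sub>R vs (m k)) (?a k *\<^sub>R vs (m k))) \<longlonglongrightarrow> g x l l"
      by (rule tconv_bilinear_field[OF sm tc tc])
    moreover have "g (xs (m k)) (?a k *\<^sub>R vs (m k)) (?a k *\<^sub>R vs (m k)) = ?a k * ?a k" for k
    proof -
      have "g (xs (m k)) (vs (m k)) (vs (m k)) = 1" using unit[of "m k"] by (simp add: gnorm_def)
      then show ?thesis using bl[of "xs (m k)"] by (simp add: bilinear_lmul bilinear_rmul)
    qed
    moreover have "?a \<longlonglongrightarrow> 0"
    proof (rule LIMSEQ_imp_Suc, rule Lim_null_comparison)
      show "\<forall>\<^sub>F k in sequentially. norm (?a (Suc k)) \<le> inverse (real (Suc k))"
      proof (rule always_eventually, rule allI)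
        fix k
        have "real (Suc k) \<le> real (q (Suc k))" using seq_suble[OF q(1), of "Suc k"] by linarith
        also have "\<dots> < norm (w (r (q (Suc k))))" by (rule r(1))
        finally show "norm (?a (Suc k)) \<le> inverse (real (Suc k))" by (simp add: le_imp_inverse_le)
      qed
    qed (rule LIMSEQ_inverse_real_of_nat)
    then have "(\<lambda>k. ?a k * ?a k) \<longlonglongrightarrow> 0 * 0" by (intro tendsto_mult)
    ultimately have "g x l l = 0" using LIMSEQ_unique by simp
    moreover have "l \<noteq> 0" using q(3) by auto
    ultimately show False using pos[of l x] by simp
  qed
  then obtain K N where K: "\<And>n. n \<ge> N \<Longrightarrow> norm (w n) \<le> K" by (auto simp: eventually_sequentially)
  then have "w (n + N) \<in> cball 0 K" for n by simp
  then obtain l s2 where s2: "strict_mono s2" "((\<lambda>n. w (n + N)) \<circ> s2) \<longlonglongrightarrow> l"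
    using compact_cball[of "0::'e" K] unfolding compact_def by metis
  define s where "s = (\<lambda>n. s1 (s2 n + N))"
  have s: "strict_mono s" using s1(1) s2(1) by (simp add: s_def strict_mono_def)
  have "(\<lambda>n. xs (s1 (s2 n + N))) \<longlonglongrightarrow> x"
    using LIMSEQ_subseq_LIMSEQ[OF s1(2), of "\<lambda>n. s2 n + N"] s2(1) by (simp add: strict_mono_def o_def)
  then have tc: "tconv (xs \<circ> s) (vs \<circ> s) x l" using s2(2) by (simp add: tconv_def s_def w_def o_def)
  have "(\<lambda>n. gnorm g ((xs \<circ> s) n) ((vs \<circ> s) n)) \<longlonglongrightarrow> gnorm g x l"
    unfolding gnorm_def by (intro tendsto_intros tconv_bilinear_field[OF sm tc tc])
  then have "gnorm g x l = 1" using unit LIMSEQ_unique[OF _ tendsto_const] by simp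
  then show thesis using that s tc by blast
qed

section \<open>Flows of vector fields on a closed manifold\<close>

definition field_rep :: "('a, 'e) chart \<Rightarrow> ('a \<Rightarrow> 'e) \<Rightarrow> 'e \<Rightarrow> 'e" where
  "field_rep c X y = comps c (chart_inv c y) (X (chart_inv c y))"

definition C1_field :: "('a \<Rightarrow> 'e) \<Rightarrow> bool" where
  "C1_field X \<longleftrightarrow> (\<forall>c\<in>A. Ck_on (Suc 0) (field_rep c X) (chart_img c))"

definition field_limit_at :: "('a, 'e) chart \<Rightarrow> 'e \<Rightarrow> real \<Rightarrow> (nat \<Rightarrow> 'a \<Rightarrow> 'e) \<Rightarrow> ('a \<Rightarrow> 'e) \<Rightarrow> bool" where
  "field_limit_at c x r Xs X \<longleftrightarrow> (\<forall>n. C1_field (Xs n)) \<and> C1_limit (\<lambda>n. field_rep c (Xs n)) (field_rep c X) (cball x r)"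

text \<open>One chart around each point is enough, because the notion serves to transport displacements, and
  these do not depend on the chart.\<close>

definition field_limit :: "(nat \<Rightarrow> 'a \<Rightarrow> 'e) \<Rightarrow> ('a \<Rightarrow> 'e) \<Rightarrow> bool" where
  "field_limit Xs X \<longleftrightarrow> C1_field X \<and> (\<forall>p. \<exists>c\<in>A. \<exists>r>0. p \<in> chart_dom c \<and> cball (chart_map c p) r \<subseteq> chart_img c \<and>
     field_limit_at c (chart_map c p) r Xs X)"

lemma cball_in_chart:
  assumes "c \<in> A" "p \<in> chart_dom c"
  obtains r where "0 < r" "cball (chart_map c p) r \<subseteq> chart_img c"
  using open_contains_cball[THEN iffD1, OF open_chart_img[OF assms(1)]] assms by blast

lemma field_limit_const: "C1_field X \<Longrightarrow> field_limit (\<lambda>n. X) X"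
proof -
  assume X: "C1_field X"
  show ?thesis unfolding field_limit_def
  proof (intro conjI allI)
    fix p
    obtain r where r: "0 < r" "cball (chart_map (chart_at A p) p) r \<subseteq> chart_img (chart_at A p)"
      by (rule cball_in_chart[OF chart_at])
    then have "field_limit_at (chart_at A p) (chart_map (chart_at A p) p) r (\<lambda>n. X) X"
      using X chart_at C1_limit_const unfolding field_limit_at_def C1_field_def by blast
    then show "\<exists>c\<in>A. \<exists>r>0. p \<in> chart_dom c \<and> cball (chart_map c p) r \<subseteq> chart_img c \<and>
     field_limit_at c (chart_map c p) r (\<lambda>n. X) X" using r chart_at by blast
  qed (rule X)
qed

lemma field_limit_C1: "field_limit Xs X \<Longrightarrow> C1_field X" "field_limit Xs X \<Longrightarrow> C1_field (Xs n)"
  unfolding field_limit_def field_limit_at_def by blast+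

subsection \<open>Velocities in charts\<close>

lemma eventually_near:
  assumes "isCont \<gamma> (t::real)" "open U" "\<gamma> t \<in> U"
  obtains d where "0 < d" "\<And>s. \<bar>s - t\<bar> < d \<Longrightarrow> \<gamma> s \<in> (U :: 'a set)"
proof -
  have "\<forall>\<^sub>F s in nhds t. \<gamma> s \<in> U"
    using assms(1)[unfolded isCont_def tendsto_at_iff_tendsto_nhds] assms(2,3) by (rule topological_tendstoD)
  then show thesis using that unfolding eventually_nhds_metric dist_real_def by blast
qed

lemma velocity_change_chart:
  assumes "isCont \<gamma> t" and c: "c \<in> A" "\<gamma> t \<in> chart_dom c" and d: "d \<in> A" "\<gamma> t \<in> chart_dom d"
    and der: "((\<lambda>s. chart_map c (\<gamma> s)) has_vector_derivative u) (at t)"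
  shows "((\<lambda>s. chart_map d (\<gamma> s)) has_vector_derivative coord_change c d (\<gamma> t) u) (at t)"
proof -
  have "(((chart_map d \<circ> chart_inv c) \<circ> (\<lambda>s. chart_map c (\<gamma> s))) has_derivative coord_change c d (\<gamma> t) \<circ> (\<lambda>h. h *\<^sub>R u)) (at t)"
    by (rule diff_chain_at[OF der[unfolded has_vector_derivative_def] transition_has_derivative[OF c(1) d(1) c(2) d(2)]])
  moreover have "coord_change c d (\<gamma> t) \<circ> (\<lambda>h. h *\<^sub>R u) = (\<lambda>h. h *\<^sub>R coord_change c d (\<gamma> t) u)"
    using linear_coord_change[OF c(1) d(1) c(2) d(2)] by (auto simp: linear_scale)
  ultimately have der: "(((chart_map d \<circ> chart_inv c) \<circ> (\<lambda>s. chart_map c (\<gamma> s))) has_vector_derivative coord_change c d (\<gamma> t) u) (at t)"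
    by (simp add: has_vector_derivative_def)
  obtain e where e: "0 < e" "\<And>s. \<bar>s - t\<bar> < e \<Longrightarrow> \<gamma> s \<in> chart_dom c"
    by (rule eventually_near[OF assms(1) open_chart_dom[OF c(1)] c(2)]) blast
  show ?thesis
    by (rule has_vector_derivative_transform_within[OF der e(1) UNIV_I]) (use e(2) c(1) in \<open>auto simp: dist_real_def\<close>)
qed

lemma has_velocity_chart:
  assumes "has_velocity A \<gamma> t v" "c \<in> A" "\<gamma> t \<in> chart_dom c"
  shows "((\<lambda>s. chart_map c (\<gamma> s)) has_vector_derivative comps c (\<gamma> t) v) (at t)"
  unfolding comps_def
  by (rule velocity_change_chart) (use assms chart_at in \<open>auto simp: has_velocity_def\<close>)

lemma has_velocityI:
  assumes "isCont \<gamma> t" "c \<in> A" "\<gamma> t \<in> chart_dom c" "((\<lambda>s. chart_map c (\<gamma> s)) has_vector_derivative comps c (\<gamma> t) v) (at t)"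
  shows "has_velocity A \<gamma> t v"
  using velocity_change_chart[OF assms(1-3) chart_at assms(4)] assms
  by (simp add: has_velocity_def coord_change_comps chart_at)

lemma has_velocity_cong:
  assumes "has_velocity A \<gamma> t v" "0 < d" "\<And>s. \<bar>s - t\<bar> < d \<Longrightarrow> \<eta> s = \<gamma> s"
  shows "has_velocity A \<eta> t v"
proof -
  have eq: "\<eta> t = \<gamma> t" using assms by simp
  have "\<forall>\<^sub>F s in nhds t. \<gamma> s = \<eta> s" using assms(2,3) by (auto simp: eventually_nhds_metric dist_real_def)
  then have "isCont \<eta> t" using assms(1) isCont_cong[of \<gamma> \<eta>] by (simp add: has_velocity_def)
  moreover have "((\<lambda>s. chart_map (chart_at A (\<gamma> t)) (\<eta> s)) has_vector_derivative v) (at t)"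
    by (rule has_vector_derivative_transform_within[OF _ assms(2) UNIV_I])
      (use assms in \<open>auto simp: has_velocity_def dist_real_def\<close>)
  ultimately show ?thesis by (simp add: has_velocity_def eq)
qed

lemma has_velocity_shift:
  assumes "has_velocity A \<gamma> (t + a) v" shows "has_velocity A (\<lambda>s. \<gamma> (s + a)) t v"
proof -
  have "isCont (\<lambda>s. \<gamma> (s + a)) t"
    using assms isCont_o2[of t "\<lambda>s. s + a" \<gamma>] by (simp add: has_velocity_def)
  moreover have "(((\<lambda>s. chart_map (chart_at A (\<gamma> (t + a))) (\<gamma> s)) \<circ> (\<lambda>s. s + a)) has_vector_derivative 1 *\<^sub>R v) (at t)"
    by (rule vector_diff_chain_at) (use assms in \<open>auto simp: has_velocity_def intro!: derivative_eq_intros\<close>)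
  ultimately show ?thesis by (simp add: has_velocity_def o_def)
qed

lemma integral_curve_chart:
  assumes "has_velocity A \<gamma> t (X (\<gamma> t))" "c \<in> A" "\<gamma> t \<in> chart_dom c"
  shows "((\<lambda>s. chart_map c (\<gamma> s)) has_vector_derivative field_rep c X (chart_map c (\<gamma> t))) (at t)"
  using has_velocity_chart[OF assms] assms(2,3) by (simp add: field_rep_def)

lemma integral_curve_chart_inv:
  assumes "c \<in> A" "y t \<in> chart_img c" "(y has_vector_derivative field_rep c X (y t)) (at t)"
  shows "has_velocity A (\<lambda>s. chart_inv c (y s)) t (X (chart_inv c (y t)))"
proof (rule has_velocityI[OF _ assms(1)])
  have cont: "isCont y t" using assms(3) by (rule has_vector_derivative_continuous)
  show "isCont (\<lambda>s. chart_inv c (y s)) t" by (rule isCont_o2[OF cont isCont_chart_inv[OF assms(1,2)]])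
  show "chart_inv c (y t) \<in> chart_dom c" by (rule chart_inv_in[OF assms(1,2)])
  have "\<forall>\<^sub>F s in nhds t. y s \<in> chart_img c"
    using cont[unfolded isCont_def tendsto_at_iff_tendsto_nhds] open_chart_img[OF assms(1)] assms(2) by (rule topological_tendstoD)
  then obtain e where e: "0 < e" "\<And>s. dist s t < e \<Longrightarrow> y s \<in> chart_img c" unfolding eventually_nhds_metric by blast
  show "((\<lambda>s. chart_map c (chart_inv c (y s))) has_vector_derivative comps c (chart_inv c (y t)) (X (chart_inv c (y t)))) (at t)"
    by (rule has_vector_derivative_transform_within[OF assms(3)[unfolded field_rep_def] e(1) UNIV_I])
      (use e(2) assms(1) in auto)
qed

lemma velocity_fun:
  assumes f: "Ck_fun A (Suc 0) N f" "open N" "\<gamma> t \<in> N" and "has_velocity A \<gamma> t v"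
  shows "((\<lambda>s. f (\<gamma> s)) has_real_derivative dfun A f (\<gamma> t) v) (at t)"
proof -
  let ?c = "chart_at A (\<gamma> t)"
  have 1: "((f \<circ> chart_inv ?c) has_derivative dfun A f (\<gamma> t)) (at (chart_map ?c (\<gamma> t)))"
    unfolding dfun_def[abs_def]
  proof (rule C1_has_derivative)
    show "Ck_on (Suc 0) (f \<circ> chart_inv ?c) (chart_map ?c ` (chart_dom ?c \<inter> N))"
      using f(1) chart_at(1) unfolding Ck_fun_def by blast
  qed (use f(3) chart_at in auto)
  have "(((f \<circ> chart_inv ?c) \<circ> (\<lambda>s. chart_map ?c (\<gamma> s))) has_derivative dfun A f (\<gamma> t) \<circ> (\<lambda>h. h *\<^sub>R v)) (at t)"
  proof (rule diff_chain_at)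
    show "((\<lambda>s. chart_map ?c (\<gamma> s)) has_derivative (\<lambda>h. h *\<^sub>R v)) (at t)"
      using assms(4) by (simp add: has_velocity_def has_vector_derivative_def)
  qed (rule 1)
  moreover have "dfun A f (\<gamma> t) \<circ> (\<lambda>h. h *\<^sub>R v) = (\<lambda>h. h * dfun A f (\<gamma> t) v)"
    using linear_dfun[OF f(1,3)] by (auto simp: linear_scale)
  ultimately have der: "(((f \<circ> chart_inv ?c) \<circ> (\<lambda>s. chart_map ?c (\<gamma> s))) has_derivative (\<lambda>h. h * dfun A f (\<gamma> t) v)) (at t)" by simp
  have cont: "isCont \<gamma> t" using assms(4) by (simp add: has_velocity_def)
  obtain e where e: "0 < e" "\<And>s. \<bar>s - t\<bar> < e \<Longrightarrow> \<gamma> s \<in> chart_dom ?c"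
    by (rule eventually_near[OF cont open_chart_dom[OF chart_at(1)] chart_at(2)]) blast
  have "((\<lambda>s. f (\<gamma> s)) has_derivative (\<lambda>h. h * dfun A f (\<gamma> t) v)) (at t)"
    by (rule has_derivative_transform_within[OF der e(1) UNIV_I]) (use e(2) chart_at in \<open>auto simp: dist_real_def\<close>)
  then show ?thesis by (simp add: has_field_derivative_def mult.commute[of "dfun _ _ _ _"] mult_commute_abs)
qed

subsection \<open>Existence and uniqueness of integral curves\<close>

lemma integral_curve_unique_local:
  assumes X: "C1_field X" and d: "0 < d"
    and \<gamma>: "\<And>s. \<bar>s - t\<bar> < d \<Longrightarrow> has_velocity A \<gamma> s (X (\<gamma> s))"
    and \<eta>: "\<And>s. \<bar>s - t\<bar> < d \<Longrightarrow> has_velocity A \<eta> s (X (\<eta> s))" and eq: "\<gamma> t = \<eta> t"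
  obtains e where "0 < e" "\<And>s. \<bar>s - t\<bar> < e \<Longrightarrow> \<gamma> s = \<eta> s"
proof -
  let ?c = "chart_at A (\<gamma> t)"
  obtain r where r: "0 < r" "cball (chart_map ?c (\<gamma> t)) r \<subseteq> chart_img ?c" by (rule cball_in_chart[OF chart_at])
  let ?B = "cball (chart_map ?c (\<gamma> t)) r"
  have C1: "Ck_on (Suc 0) (field_rep ?c X) (chart_img ?c)" using X chart_at(1) by (auto simp: C1_field_def)
  obtain L M where L: "0 \<le> L" "\<And>y z. y \<in> ?B \<Longrightarrow> z \<in> ?B \<Longrightarrow> norm (field_rep ?c X y - field_rep ?c X z) \<le> L * norm (y - z)"
    by (rule C1_limit_Lipschitz[OF C1 open_chart_img[OF chart_at(1)] r(2)]) blast
  let ?U = "chart_dom ?c \<inter> chart_map ?c -` ball (chart_map ?c (\<gamma> t)) r"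
  have U: "open ?U"
    by (rule continuous_open_preimage[OF continuous_chart_map open_chart_dom open_ball]) (simp_all add: chart_at)
  have cont: "isCont \<gamma> t" "isCont \<eta> t" using \<gamma>[of t] \<eta>[of t] d by (auto simp: has_velocity_def)
  obtain e1 where e1: "0 < e1" "\<And>s. \<bar>s - t\<bar> < e1 \<Longrightarrow> \<gamma> s \<in> ?U"
    by (rule eventually_near[OF cont(1) U]) (use r(1) chart_at in auto)
  obtain e2 where e2: "0 < e2" "\<And>s. \<bar>s - t\<bar> < e2 \<Longrightarrow> \<eta> s \<in> ?U"
    by (rule eventually_near[OF cont(2) U]) (use r(1) chart_at in \<open>auto simp: eq\<close>)
  define e where "e = min d (min e1 e2)"
  have "\<gamma> (s + t) = \<eta> (s + t)" if s: "\<bar>s\<bar> < e" for s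
  proof -
    let ?f = "\<lambda>\<gamma> s. chart_map ?c (\<gamma> (s + t))"
    have der: "(?f \<gamma> has_vector_derivative field_rep ?c X (?f \<gamma> s)) (at s)"
      if "\<And>s. \<bar>s - t\<bar> < e \<Longrightarrow> has_velocity A \<gamma> s (X (\<gamma> s))" "\<And>s. \<bar>s - t\<bar> < e \<Longrightarrow> \<gamma> s \<in> ?U" "\<bar>s\<bar> < e" for \<gamma> s
    proof -
      have "has_velocity A \<gamma> (s + t) (X (\<gamma> (s + t)))" using that by simp
      from has_velocity_shift[OF this]
      show ?thesis by (rule integral_curve_chart[where \<gamma> = "\<lambda>s. \<gamma> (s + t)"]) (use that(2)[of "s + t"] that(3) chart_at in auto)
    qed
    have in_B: "?f \<gamma> s \<in> ?B" "?f \<eta> s \<in> ?B" if "\<bar>s\<bar> < e" for s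
      using e1(2)[of "s + t"] e2(2)[of "s + t"] that by (auto simp: e_def)
    have "(norm (?f \<gamma> s - ?f \<eta> s))\<^sup>2 \<le> ((norm (?f \<gamma> 0 - ?f \<eta> 0))\<^sup>2 + 0\<^sup>2) * exp ((2 * L + 1) * e)"
    proof (rule gronwall[of e _ "\<lambda>s. field_rep ?c X (?f \<gamma> s) - field_rep ?c X (?f \<eta> s)"])
      fix s assume s: "\<bar>s\<bar> < e"
      show "((\<lambda>s. ?f \<gamma> s - ?f \<eta> s) has_vector_derivative field_rep ?c X (?f \<gamma> s) - field_rep ?c X (?f \<eta> s)) (at s)"
        by (rule has_vector_derivative_diff) (use s \<gamma> \<eta> e1 e2 in \<open>auto simp: e_def intro!: der\<close>)
      show "norm (field_rep ?c X (?f \<gamma> s) - field_rep ?c X (?f \<eta> s)) \<le> L * norm (?f \<gamma> s - ?f \<eta> s) + 0"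
        using L(2)[OF in_B[OF s]] by simp
    qed (use L s in auto)
    then have "?f \<gamma> s = ?f \<eta> s" using eq by simp
    moreover have "\<gamma> (s + t) \<in> ?U" "\<eta> (s + t) \<in> ?U" using e1(2)[of "s + t"] e2(2)[of "s + t"] s by (auto simp: e_def)
    ultimately show ?thesis using chart_inv_map[OF chart_at(1)] by (metis IntD1)
  qed
  from this[of "_ - t"] have "\<And>s. \<bar>s - t\<bar> < e \<Longrightarrow> \<gamma> s = \<eta> s" by simp
  moreover have "0 < e" using d e1 e2 by (simp add: e_def)
  ultimately show thesis using that by blast
qed

text \<open>The set of times at which two integral curves agree is open by Gronwall's inequality and closed by
  the Hausdorff property.\<close>

lemma integral_curve_unique:
  assumes X: "C1_field X"
    and \<gamma>: "\<And>s. a < s \<Longrightarrow> s < b \<Longrightarrow> has_velocity A \<gamma> s (X (\<gamma> s))"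
    and \<eta>: "\<And>s. a < s \<Longrightarrow> s < b \<Longrightarrow> has_velocity A \<eta> s (X (\<eta> s))"
    and t0: "\<gamma> t0 = \<eta> t0" "a < t0" "t0 < b" and t: "a < t" "t < b"
  shows "\<gamma> t = \<eta> t"
proof -
  let ?S = "{s \<in> {a<..<b}. \<gamma> s = \<eta> s}" and ?T = "{s \<in> {a<..<b}. \<gamma> s \<noteq> \<eta> s}"
  have "open ?S"
    unfolding open_dist
  proof
    fix s assume s: "s \<in> ?S"
    define d where "d = min (s - a) (b - s)"
    obtain e where e: "0 < e" "\<And>s'. \<bar>s' - s\<bar> < e \<Longrightarrow> \<gamma> s' = \<eta> s'"
    proof (rule integral_curve_unique_local[OF X, of d s \<gamma> \<eta>])
      show "\<bar>s' - s\<bar> < d \<Longrightarrow> has_velocity A \<gamma> s' (X (\<gamma> s'))" for s' by (rule \<gamma>) (auto simp: d_def)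
      show "\<bar>s' - s\<bar> < d \<Longrightarrow> has_velocity A \<eta> s' (X (\<eta> s'))" for s' by (rule \<eta>) (auto simp: d_def)
    qed (use s in \<open>auto simp: d_def\<close>)
    show "\<exists>e>0. \<forall>y. dist y s < e \<longrightarrow> y \<in> ?S"
      by (rule exI[of _ "min d e"]) (use s e in \<open>auto simp: d_def dist_real_def\<close>)
  qed
  moreover have "open ?T"
    unfolding open_dist
  proof
    fix s assume s: "s \<in> ?T"
    define d where "d = min (s - a) (b - s)"
    obtain U V where UV: "open U" "open V" "\<gamma> s \<in> U" "\<eta> s \<in> V" "U \<inter> V = {}" using s hausdorff[of "\<gamma> s" "\<eta> s"] by auto
    have cont: "isCont \<gamma> s" "isCont \<eta> s" using \<gamma>[of s] \<eta>[of s] s by (auto simp: has_velocity_def)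
    obtain e1 where e1: "0 < e1" "\<And>s'. \<bar>s' - s\<bar> < e1 \<Longrightarrow> \<gamma> s' \<in> U"
      by (rule eventually_near[OF cont(1) UV(1,3)]) blast
    obtain e2 where e2: "0 < e2" "\<And>s'. \<bar>s' - s\<bar> < e2 \<Longrightarrow> \<eta> s' \<in> V"
      by (rule eventually_near[OF cont(2) UV(2,4)]) blast
    have "y \<in> ?T" if "\<bar>y - s\<bar> < min d (min e1 e2)" for y
      using e1(2)[of y] e2(2)[of y] UV(5) that by (auto simp: d_def)
    moreover have "0 < min d (min e1 e2)" using s e1 e2 by (simp add: d_def)
    ultimately show "\<exists>e>0. \<forall>y. dist y s < e \<longrightarrow> y \<in> ?T" unfolding dist_real_def by blast
  qed
  moreover have "?S \<inter> ?T \<inter> {a<..<b} = {}" "{a<..<b} \<subseteq> ?S \<union> ?T" by auto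
  ultimately have "?S \<inter> {a<..<b} = {} \<or> ?T \<inter> {a<..<b} = {}"
    using connected_Ioo[of a b] unfolding connected_def by blast
  then show ?thesis using t0 t by auto
qed

text \<open>The uniform constants of \<open>C1_limit_Lipschitz\<close> give one existence time for all points of the smaller
  ball and for all approximating sequences.\<close>

lemma local_flow_box:
  assumes c: "c \<in> A" "p \<in> chart_dom c" and r: "0 < r" "cball (chart_map c p) r \<subseteq> chart_img c" and X: "C1_field X"
  obtains \<tau> L where "0 < \<tau>" "0 \<le> L" "\<tau> \<le> 1 / (4 * (L + 1))"
    "\<And>x v. x \<in> cball (chart_map c p) r \<Longrightarrow> norm (frechet_derivative (field_rep c X) (at x) v) \<le> L * norm v"
    "\<And>Xs. field_limit_at c (chart_map c p) r Xs X \<Longrightarrow> \<forall>\<^sub>F n in sequentially.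
       \<forall>q. q \<in> chart_dom c \<longrightarrow> chart_map c q \<in> cball (chart_map c p) (r / 2) \<longrightarrow>
         (\<exists>\<gamma>. \<gamma> 0 = q \<and> (\<forall>t. \<bar>t\<bar> < \<tau> \<longrightarrow> has_velocity A \<gamma> t (Xs n (\<gamma> t)) \<and> \<gamma> t \<in> chart_dom c \<and> chart_map c (\<gamma> t) \<in> cball (chart_map c p) r))"
proof -
  let ?B = "cball (chart_map c p) r"
  have C1: "Ck_on (Suc 0) (field_rep c X) (chart_img c)" using X c(1) by (auto simp: C1_field_def)
  obtain L M where L: "0 \<le> L" and M: "0 \<le> M"
    and D: "\<And>x v. x \<in> ?B \<Longrightarrow> norm (frechet_derivative (field_rep c X) (at x) v) \<le> L * norm v"
    and ev: "\<And>G. C1_limit G (field_rep c X) ?B \<Longrightarrow> \<forall>\<^sub>F n in sequentially. \<forall>y\<in>?B. norm (G n y) \<le> M \<and>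
        (\<forall>z\<in>?B. norm (G n y - G n z) \<le> L * norm (y - z))"
    by (rule C1_limit_Lipschitz[OF C1 open_chart_img[OF c(1)] r(2)]) blast
  define \<tau> where "\<tau> = min (1 / (4 * (L + 1))) (r / (2 * (M + 1)))"
  have \<tau>: "0 < \<tau>" "\<tau> \<le> 1 / (4 * (L + 1))" "\<tau> \<le> r / (2 * (M + 1))" using L M r by (auto simp: \<tau>_def)
  have "\<forall>\<^sub>F n in sequentially. \<forall>q. q \<in> chart_dom c \<longrightarrow> chart_map c q \<in> cball (chart_map c p) (r / 2) \<longrightarrow>
         (\<exists>\<gamma>. \<gamma> 0 = q \<and> (\<forall>t. \<bar>t\<bar> < \<tau> \<longrightarrow> has_velocity A \<gamma> t (Xs n (\<gamma> t)) \<and> \<gamma> t \<in> chart_dom c \<and> chart_map c (\<gamma> t) \<in> ?B))"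
    if lim: "field_limit_at c (chart_map c p) r Xs X" for Xs
    using ev[OF conjunct2[OF lim[unfolded field_limit_at_def]]]
  proof eventually_elim
    case (elim n)
    show ?case
    proof (intro allI impI)
      fix q assume q: "q \<in> chart_dom c" "chart_map c q \<in> cball (chart_map c p) (r / 2)"
      obtain u where u: "u 0 = chart_map c q" "\<And>t. \<bar>t\<bar> < \<tau> \<Longrightarrow> u t \<in> ?B"
          "\<And>t. \<bar>t\<bar> < \<tau> \<Longrightarrow> (u has_vector_derivative field_rep c (Xs n) (u t)) (at t)"
        by (rule local_solution[where G="field_rep c (Xs n)", OF _ _ L M r(1) \<tau>(2,3) q(2)]) (use elim in auto)
      have "has_velocity A (\<lambda>s. chart_inv c (u s)) t (Xs n (chart_inv c (u t)))" if "\<bar>t\<bar> < \<tau>" for t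
        by (rule integral_curve_chart_inv[OF c(1) _ u(3)[OF that]]) (use u(2)[OF that] r(2) in blast)
      moreover have "chart_inv c (u t) \<in> chart_dom c" "chart_map c (chart_inv c (u t)) \<in> ?B" if "\<bar>t\<bar> < \<tau>" for t
      proof -
        have "u t \<in> chart_img c" using u(2)[OF that] r(2) by blast
        then show "chart_inv c (u t) \<in> chart_dom c" "chart_map c (chart_inv c (u t)) \<in> ?B"
          using u(2)[OF that] chart_inv_in[OF c(1)] chart_map_inv[OF c(1)] by simp_all
      qed
      ultimately show "\<exists>\<gamma>. \<gamma> 0 = q \<and> (\<forall>t. \<bar>t\<bar> < \<tau> \<longrightarrow> has_velocity A \<gamma> t (Xs n (\<gamma> t)) \<and> \<gamma> t \<in> chart_dom c \<and> chart_map c (\<gamma> t) \<in> ?B)"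
        using u(1) q(1) c(1) by (intro exI[of _ "\<lambda>s. chart_inv c (u s)"]) simp
    qed
  qed
  then show thesis using that[OF \<tau>(1) L \<tau>(2) D] by blast
qed

lemma open_chart_ball:
  assumes "c \<in> A" "p \<in> chart_dom c" "0 < r"
  shows "open {q \<in> chart_dom c. chart_map c q \<in> ball (chart_map c p) r}" "p \<in> {q \<in> chart_dom c. chart_map c q \<in> ball (chart_map c p) r}"
proof -
  have "open (chart_dom c \<inter> chart_map c -` ball (chart_map c p) r)"
    by (rule continuous_open_preimage[OF continuous_chart_map open_chart_dom open_ball]) (use assms in simp_all)
  then show "open {q \<in> chart_dom c. chart_map c q \<in> ball (chart_map c p) r}" by (simp add: vimage_def Int_def)
  show "p \<in> {q \<in> chart_dom c. chart_map c q \<in> ball (chart_map c p) r}" using assms by simp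
qed

text \<open>Compactness turns local lower bounds for existence times into a global one.\<close>

lemma uniform_time:
  assumes "\<And>p. \<exists>W \<tau>. open W \<and> p \<in> W \<and> (0::real) < \<tau> \<and> (\<forall>q\<in>W. P q \<tau>)"
    and mono: "\<And>q \<sigma> \<tau>. P q \<tau> \<Longrightarrow> 0 < \<sigma> \<Longrightarrow> \<sigma> \<le> \<tau> \<Longrightarrow> P q \<sigma>"
  obtains \<tau> where "0 < \<tau>" "\<And>q::'a. P q \<tau>"
proof -
  obtain W \<tau> where W: "\<And>p. open (W p)" "\<And>p. p \<in> W p" "\<And>p. (0::real) < \<tau> p" "\<And>p q. q \<in> W p \<Longrightarrow> P q (\<tau> p)"
    using assms(1) by metis
  obtain F where F: "finite F" "UNIV = (\<Union>p\<in>F. W p)"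
    using compactE_image[OF compact_UNIV, of UNIV W] W(1,2) by (metis UNIV_I UN_iff subset_UNIV subset_antisym subsetI)
  then have "F \<noteq> {}" by auto
  show thesis
  proof
    show "0 < Min (\<tau> ` F)" using F(1) \<open>F \<noteq> {}\<close> W(3) by auto
    fix q
    obtain p where "p \<in> F" "q \<in> W p" using F(2) by blast
    then show "P q (Min (\<tau> ` F))"
      using mono[OF W(4)[of q p]] F(1) \<open>F \<noteq> {}\<close> W(3) by auto
  qed
qed

lemma integral_curve_exists_short:
  assumes X: "C1_field X"
  obtains \<tau> where "0 < \<tau>" "\<And>q. \<exists>\<gamma>. \<gamma> 0 = q \<and> (\<forall>t. \<bar>t\<bar> < \<tau> \<longrightarrow> has_velocity A \<gamma> t (X (\<gamma> t)))"
proof (rule uniform_time[of "\<lambda>q \<tau>. \<exists>\<gamma>. \<gamma> 0 = q \<and> (\<forall>t. \<bar>t\<bar> < \<tau> \<longrightarrow> has_velocity A \<gamma> t (X (\<gamma> t)))"])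
  fix p
  let ?c = "chart_at A p"
  obtain r where r: "0 < r" "cball (chart_map ?c p) r \<subseteq> chart_img ?c" by (rule cball_in_chart[OF chart_at])
  obtain \<tau> L where \<tau>: "0 < \<tau>" and ex: "\<And>Xs. field_limit_at ?c (chart_map ?c p) r Xs X \<Longrightarrow> \<forall>\<^sub>F n in sequentially.
       \<forall>q. q \<in> chart_dom ?c \<longrightarrow> chart_map ?c q \<in> cball (chart_map ?c p) (r / 2) \<longrightarrow>
         (\<exists>\<gamma>. \<gamma> 0 = q \<and> (\<forall>t. \<bar>t\<bar> < \<tau> \<longrightarrow> has_velocity A \<gamma> t (Xs n (\<gamma> t)) \<and> \<gamma> t \<in> chart_dom ?c \<and> chart_map ?c (\<gamma> t) \<in> cball (chart_map ?c p) r))"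
    by (rule local_flow_box[OF chart_at r X]) blast
  have "field_limit_at ?c (chart_map ?c p) r (\<lambda>n. X) X"
    using X chart_at C1_limit_const r(2) unfolding field_limit_at_def C1_field_def by blast
  from ex[OF this] have ex': "\<exists>\<gamma>. \<gamma> 0 = q \<and> (\<forall>t. \<bar>t\<bar> < \<tau> \<longrightarrow> has_velocity A \<gamma> t (X (\<gamma> t)))"
    if "q \<in> chart_dom ?c" "chart_map ?c q \<in> cball (chart_map ?c p) (r / 2)" for q
    using that by (auto simp: eventually_sequentially)
  let ?W = "{q \<in> chart_dom ?c. chart_map ?c q \<in> ball (chart_map ?c p) (r / 2)}"
  have "open ?W" "p \<in> ?W" using open_chart_ball[OF chart_at, of "r / 2" p] r(1) by auto
  moreover have "\<forall>q\<in>?W. \<exists>\<gamma>. \<gamma> 0 = q \<and> (\<forall>t. \<bar>t\<bar> < \<tau> \<longrightarrow> has_velocity A \<gamma> t (X (\<gamma> t)))"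
    using ex' by simp
  ultimately show "\<exists>W \<tau>. open W \<and> p \<in> W \<and> 0 < \<tau> \<and> (\<forall>q\<in>W. \<exists>\<gamma>. \<gamma> 0 = q \<and> (\<forall>t. \<bar>t\<bar> < \<tau> \<longrightarrow> has_velocity A \<gamma> t (X (\<gamma> t))))"
    using \<tau> by blast
next
  fix q \<sigma> \<tau> assume "\<exists>\<gamma>. \<gamma> 0 = q \<and> (\<forall>t. \<bar>t\<bar> < \<tau> \<longrightarrow> has_velocity A \<gamma> t (X (\<gamma> t)))" "\<sigma> \<le> \<tau>"
  then show "\<exists>\<gamma>. \<gamma> 0 = q \<and> (\<forall>t. \<bar>t\<bar> < \<sigma> \<longrightarrow> has_velocity A \<gamma> t (X (\<gamma> t)))"
    using less_le_trans by blast
qed (use that in blast)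

lemma integral_curve_extend:
  assumes X: "C1_field X" and T: "0 < T"
    and ex: "\<And>q. \<exists>\<gamma>. \<gamma> 0 = q \<and> (\<forall>t. \<bar>t\<bar> < T \<longrightarrow> has_velocity A \<gamma> t (X (\<gamma> t)))"
  shows "\<exists>\<gamma>. \<gamma> 0 = q \<and> (\<forall>t. \<bar>t\<bar> < 3 / 2 * T \<longrightarrow> has_velocity A \<gamma> t (X (\<gamma> t)))"
proof -
  \<comment> \<open>Prolong a curve on \<open>(-T, T)\<close> by the curves of the same length through its points at times
    \<open>T/2\<close> and \<open>-T/2\<close>; by uniqueness they agree on the overlaps.\<close>
  let ?a = "T / 2"
  obtain \<gamma> where \<gamma>: "\<gamma> 0 = q" "\<And>t. \<bar>t\<bar> < T \<Longrightarrow> has_velocity A \<gamma> t (X (\<gamma> t))" using ex by blast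
  obtain \<gamma>1 where \<gamma>1: "\<gamma>1 0 = \<gamma> ?a" "\<And>t. \<bar>t\<bar> < T \<Longrightarrow> has_velocity A \<gamma>1 t (X (\<gamma>1 t))" using ex by blast
  obtain \<gamma>2 where \<gamma>2: "\<gamma>2 0 = \<gamma> (- ?a)" "\<And>t. \<bar>t\<bar> < T \<Longrightarrow> has_velocity A \<gamma>2 t (X (\<gamma>2 t))" using ex by blast
  have v1: "has_velocity A (\<lambda>s. \<gamma>1 (s + - ?a)) t (X (\<gamma>1 (t + - ?a)))" if "\<bar>t - ?a\<bar> < T" for t
    by (rule has_velocity_shift) (use \<gamma>1(2)[of "t + - ?a"] that in auto)
  have v2: "has_velocity A (\<lambda>s. \<gamma>2 (s + ?a)) t (X (\<gamma>2 (t + ?a)))" if "\<bar>t + ?a\<bar> < T" for t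
    by (rule has_velocity_shift) (use \<gamma>2(2)[of "t + ?a"] that in auto)
  have eq1: "\<gamma>1 (t + - ?a) = \<gamma> t" if "- ?a < t" "t < T" for t
    by (rule integral_curve_unique[OF X, of "- ?a" T "\<lambda>s. \<gamma>1 (s + - ?a)" \<gamma> ?a]) (use \<gamma> \<gamma>1 v1 that T in auto)
  have eq2: "\<gamma>2 (t + ?a) = \<gamma> t" if "- T < t" "t < ?a" for t
    by (rule integral_curve_unique[OF X, of "- T" ?a "\<lambda>s. \<gamma>2 (s + ?a)" \<gamma> "- ?a"]) (use \<gamma> \<gamma>2 v2 that T in auto)
  define \<eta> where "\<eta> t = (if t < 0 then \<gamma>2 (t + ?a) else \<gamma>1 (t + - ?a))" for t
  have "has_velocity A \<eta> t (X (\<eta> t))" if t: "\<bar>t\<bar> < 3 / 2 * T" for t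
  proof -
    consider "t < 0" | "t = 0" | "0 < t" by linarith
    then show ?thesis
    proof cases
      case 1
      then have "has_velocity A (\<lambda>s. \<gamma>2 (s + ?a)) t (X (\<eta> t))" using v2[of t] t by (simp add: \<eta>_def abs_if split: if_splits)
      then show ?thesis by (rule has_velocity_cong[of _ _ _ "- t"]) (use 1 in \<open>auto simp: \<eta>_def\<close>)
    next
      case 2
      have "has_velocity A \<gamma> t (X (\<eta> t))" using \<gamma>(2)[of 0] eq1[of 0] T 2 by (simp add: \<eta>_def)
      then show ?thesis by (rule has_velocity_cong[of _ _ _ ?a]) (use 2 T eq1 eq2 in \<open>auto simp: \<eta>_def\<close>)
    next
      case 3
      then have "has_velocity A (\<lambda>s. \<gamma>1 (s + - ?a)) t (X (\<eta> t))" using v1[of t] t by (simp add: \<eta>_def abs_if split: if_splits)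
      then show ?thesis by (rule has_velocity_cong[of _ _ _ t]) (use 3 in \<open>auto simp: \<eta>_def\<close>)
    qed
  qed
  moreover have "\<eta> 0 = q" using eq1[of 0] \<gamma>(1) T by (simp add: \<eta>_def)
  ultimately show ?thesis by blast
qed

lemma integral_curve_exists_long:
  assumes X: "C1_field X"
  shows "\<exists>\<gamma>. \<gamma> 0 = q \<and> (\<forall>t. \<bar>t\<bar> < T \<longrightarrow> has_velocity A \<gamma> t (X (\<gamma> t)))"
proof -
  obtain \<tau> where \<tau>: "0 < \<tau>" "\<And>q. \<exists>\<gamma>. \<gamma> 0 = q \<and> (\<forall>t. \<bar>t\<bar> < \<tau> \<longrightarrow> has_velocity A \<gamma> t (X (\<gamma> t)))"
    by (rule integral_curve_exists_short[OF X]) blast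
  have "\<exists>\<gamma>. \<gamma> 0 = q \<and> (\<forall>t. \<bar>t\<bar> < (3 / 2) ^ n * \<tau> \<longrightarrow> has_velocity A \<gamma> t (X (\<gamma> t)))" for n q
  proof (induction n arbitrary: q)
    case 0 then show ?case using \<tau>(2) by simp
  next
    case (Suc n)
    show ?case using integral_curve_extend[OF X _ Suc.IH, of q] \<tau>(1) by (simp add: mult.assoc)
  qed
  moreover obtain n where "T / \<tau> < (3 / 2) ^ n" using real_arch_pow[of "3 / 2" "T / \<tau>"] by auto
  then have "T < (3 / 2) ^ n * \<tau>" using \<tau>(1) by (simp add: divide_less_eq)
  ultimately show ?thesis by (meson less_trans)
qed

lemma integral_curve_exists:
  assumes X: "C1_field X"
  shows "\<exists>\<gamma>. \<gamma> 0 = q \<and> (\<forall>t. has_velocity A \<gamma> t (X (\<gamma> t)))"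
proof -
  obtain g where g: "\<And>T. g T 0 = q" "\<And>T t. \<bar>t\<bar> < T \<Longrightarrow> has_velocity A (g T) t (X (g T t))"
    using integral_curve_exists_long[OF X] by metis
  have eq: "g T t = g T' t" if "\<bar>t\<bar> < T" "\<bar>t\<bar> < T'" for T T' t
    by (rule integral_curve_unique[OF X, of "- min T T'" "min T T'" "g T" "g T'" 0]) (use g that in auto)
  define \<gamma> where "\<gamma> t = g (\<bar>t\<bar> + 1) t" for t
  have "has_velocity A \<gamma> t (X (\<gamma> t))" for t
  proof -
    have "has_velocity A (g (\<bar>t\<bar> + 1)) t (X (\<gamma> t))" using g(2)[of t "\<bar>t\<bar> + 1"] by (simp add: \<gamma>_def)
    then show ?thesis
      by (rule has_velocity_cong[of _ _ _ 1]) (auto simp: \<gamma>_def intro!: eq)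
  qed
  moreover have "\<gamma> 0 = q" using g(1) by (simp add: \<gamma>_def)
  ultimately show ?thesis by blast
qed

subsection \<open>The flow\<close>

context
  fixes X assumes X: "C1_field X"
begin

lemma flow_unique:
  assumes "\<And>s. \<bar>s\<bar> < T \<Longrightarrow> has_velocity A \<gamma> s (X (\<gamma> s))" "\<bar>t\<bar> < T"
  shows "flow A X t (\<gamma> 0) = \<gamma> t"
proof -
  obtain \<eta> where \<eta>: "\<eta> 0 = \<gamma> 0" "\<And>s. has_velocity A \<eta> s (X (\<eta> s))" using integral_curve_exists[OF X] by blast
  have "(THE \<eta>. \<eta> 0 = \<gamma> 0 \<and> (\<forall>s. has_velocity A \<eta> s (X (\<eta> s)))) = \<eta>"
  proof (rule the_equality)
    fix \<zeta> assume \<zeta>: "\<zeta> 0 = \<gamma> 0 \<and> (\<forall>s. has_velocity A \<zeta> s (X (\<zeta> s)))"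
    show "\<zeta> = \<eta>"
    proof
      fix t
      show "\<zeta> t = \<eta> t" by (rule integral_curve_unique[OF X, of "- \<bar>t\<bar> - 1" "\<bar>t\<bar> + 1" \<zeta> \<eta> 0]) (use \<zeta> \<eta> in auto)
    qed
  qed (use \<eta> in auto)
  then have "flow A X t (\<gamma> 0) = \<eta> t" by (simp add: flow_def)
  also have "\<dots> = \<gamma> t"
    by (rule integral_curve_unique[OF X, of "- T" T \<eta> \<gamma> 0]) (use assms \<eta> in auto)
  finally show ?thesis .
qed

lemma flow_0 [simp]: "flow A X 0 p = p"
  and flow_velocity: "has_velocity A (\<lambda>t. flow A X t p) t (X (flow A X t p))"
proof -
  obtain \<eta> where \<eta>: "\<eta> 0 = p" "\<And>s. has_velocity A \<eta> s (X (\<eta> s))" using integral_curve_exists[OF X] by blast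
  have "flow A X t p = \<eta> t" for t
    using flow_unique[of "\<bar>t\<bar> + 1" \<eta> t] \<eta> by simp
  then show "flow A X 0 p = p" "has_velocity A (\<lambda>t. flow A X t p) t (X (flow A X t p))" using \<eta> by auto
qed

lemma flow_add: "flow A X (s + t) p = flow A X s (flow A X t p)"
proof -
  let ?\<gamma> = "\<lambda>s. flow A X (s + t) p"
  have "has_velocity A ?\<gamma> u (X (?\<gamma> u))" for u by (rule has_velocity_shift[OF flow_velocity])
  from flow_unique[of "\<bar>s\<bar> + 1" ?\<gamma> s, OF this] show ?thesis by simp
qed

lemma flow_uminus [simp]: "flow A X (- t) (flow A X t p) = p" "flow A X t (flow A X (- t) p) = p"
  using flow_add[of "- t" t p] flow_add[of t "- t" p] by simp_all

end

subsection \<open>Transport of displacements and tangent vectors by flows\<close>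

text \<open>The quantification over \<open>Xs\<close> stands inside: the limit vector solves the variational equation of
  \<open>X\<close>, whatever the approximating fields are.\<close>

lemma flow_mdisp_local:
  assumes c: "c \<in> A" "p \<in> chart_dom c" and r: "0 < r" "cball (chart_map c p) r \<subseteq> chart_img c" and X: "C1_field X"
  obtains \<tau> W where "0 < \<tau>" "open W" "p \<in> W"
    "\<And>x t0 v. x \<in> W \<Longrightarrow> \<bar>t0\<bar> < \<tau> \<Longrightarrow> flow A X t0 x \<in> chart_dom c \<and>
       (\<exists>w. \<forall>Xs y z h t. field_limit_at c (chart_map c p) r Xs X \<longrightarrow> mdisp y z h x v \<longrightarrow> t \<longlonglongrightarrow> t0 \<longrightarrow>
         mdisp (\<lambda>n. flow A (Xs n) (t n) (y n)) (\<lambda>n. flow A (Xs n) (t n) (z n)) h (flow A X t0 x) w)"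
proof -
  let ?B = "cball (chart_map c p) r" and ?G = "field_rep c X"
  have C1: "Ck_on (Suc 0) ?G (chart_img c)" using X c(1) by (auto simp: C1_field_def)
  obtain \<tau> L where \<tau>: "0 < \<tau>" and L: "0 \<le> L" "\<tau> \<le> 1 / (4 * (L + 1))"
    and D: "\<And>x v. x \<in> ?B \<Longrightarrow> norm (frechet_derivative ?G (at x) v) \<le> L * norm v"
    and ex: "\<And>Xs. field_limit_at c (chart_map c p) r Xs X \<Longrightarrow> \<forall>\<^sub>F n in sequentially.
       \<forall>q. q \<in> chart_dom c \<longrightarrow> chart_map c q \<in> cball (chart_map c p) (r / 2) \<longrightarrow>
         (\<exists>\<gamma>. \<gamma> 0 = q \<and> (\<forall>t. \<bar>t\<bar> < \<tau> \<longrightarrow> has_velocity A \<gamma> t (Xs n (\<gamma> t)) \<and> \<gamma> t \<in> chart_dom c \<and> chart_map c (\<gamma> t) \<in> ?B))"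
    by (rule local_flow_box[OF c r X]) blast
  let ?W = "{q \<in> chart_dom c. chart_map c q \<in> ball (chart_map c p) (r / 2)}"
  have W: "open ?W" "p \<in> ?W" using open_chart_ball[OF c, of "r / 2"] r(1) by auto
  have stay: "\<forall>\<^sub>F n in sequentially. \<forall>q\<in>?W. \<forall>t. \<bar>t\<bar> < \<tau> \<longrightarrow> flow A (Xs n) t q \<in> chart_dom c \<and> chart_map c (flow A (Xs n) t q) \<in> ?B"
    if lim: "field_limit_at c (chart_map c p) r Xs X" for Xs
    using ex[OF lim]
  proof eventually_elim
    case (elim n)
    show ?case
    proof (intro ballI allI impI)
      fix q t assume q: "q \<in> ?W" and t: "\<bar>t\<bar> < \<tau>"
      then obtain \<gamma> where \<gamma>: "\<gamma> 0 = q" "\<And>t. \<bar>t\<bar> < \<tau> \<Longrightarrow> has_velocity A \<gamma> t (Xs n (\<gamma> t))"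
          "\<And>t. \<bar>t\<bar> < \<tau> \<Longrightarrow> \<gamma> t \<in> chart_dom c \<and> chart_map c (\<gamma> t) \<in> ?B"
        using elim[rule_format, of q] by auto
      have "C1_field (Xs n)" using lim by (simp add: field_limit_at_def)
      from flow_unique[OF this, of \<tau> \<gamma> t] have "flow A (Xs n) t q = \<gamma> t" using \<gamma>(1,2) t by simp
      then show "flow A (Xs n) t q \<in> chart_dom c \<and> chart_map c (flow A (Xs n) t q) \<in> ?B" using \<gamma>(3)[OF t] by simp
    qed
  qed
  have const: "field_limit_at c (chart_map c p) r (\<lambda>n. X) X"
    using X c(1) C1_limit_const r(2) unfolding field_limit_at_def C1_field_def by blast
  have stayX: "flow A X t q \<in> chart_dom c" "chart_map c (flow A X t q) \<in> ?B" if "q \<in> ?W" "\<bar>t\<bar> < \<tau>" for q t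
    using stay[OF const] that by (auto simp: eventually_sequentially)
  have ode: "((\<lambda>t. chart_map c (flow A Y t q)) has_vector_derivative field_rep c Y (chart_map c (flow A Y t q))) (at t)"
    if "C1_field Y" "flow A Y t q \<in> chart_dom c" for Y q t
    by (rule integral_curve_chart[where \<gamma> = "\<lambda>t. flow A Y t q" and X = Y, OF flow_velocity[OF that(1)] c(1) that(2)])
  show thesis
  proof (rule that[OF _ W])
    show "0 < \<tau> / 2" using \<tau> by simp
    fix x t0 v assume x: "x \<in> ?W" and t0: "\<bar>t0\<bar> < \<tau> / 2"
    let ?\<eta> = "\<lambda>t. chart_map c (flow A X t x)"
    have c\<eta>: "continuous_on {- (\<tau> / 2)..\<tau> / 2} ?\<eta>"
    proof (rule continuous_at_imp_continuous_on, intro ballI)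
      fix t assume "t \<in> {- (\<tau> / 2)..\<tau> / 2}"
      then have "\<bar>t\<bar> < \<tau>" using \<tau> by auto
      then show "isCont ?\<eta> t" using ode[OF X stayX(1)[OF x]] has_vector_derivative_continuous by blast
    qed
    have \<eta>B: "?\<eta> t \<in> ?B" if "\<bar>t\<bar> \<le> \<tau> / 2" for t by (rule stayX(2)[OF x]) (use that \<tau> in auto)
    have \<tau>2: "0 < \<tau> / 2" "\<tau> / 2 \<le> 1 / (4 * (L + 1))" using \<tau> L(2) by simp_all
    have "\<exists>w. w 0 = comps c x v \<and> (\<forall>t. \<bar>t\<bar> < \<tau> / 2 \<longrightarrow>
        (w has_vector_derivative frechet_derivative ?G (at (?\<eta> t)) (w t)) (at t))"
      by (rule variational_solution[OF C1 open_chart_img[OF c(1)] r(2) D L(1) c\<eta> \<eta>B \<tau>2, of "comps c x v"]) auto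
    then obtain w where w: "w 0 = comps c x v"
        "\<And>t. \<bar>t\<bar> < \<tau> / 2 \<Longrightarrow> (w has_vector_derivative frechet_derivative ?G (at (?\<eta> t)) (w t)) (at t)"
      by auto
    have fin: "flow A X t0 x \<in> chart_dom c" by (rule stayX(1)[OF x]) (use t0 \<tau> in auto)
    have "mdisp (\<lambda>n. flow A (Xs n) (t n) (y n)) (\<lambda>n. flow A (Xs n) (t n) (z n)) h (flow A X t0 x) (coord_vec A c (flow A X t0 x) (w t0))"
      if lim: "field_limit_at c (chart_map c p) r Xs X" and d: "mdisp y z h x v" and t: "t \<longlonglongrightarrow> t0" for Xs y z h t
    proof -
      have "\<forall>\<^sub>F n in sequentially. y n \<in> ?W" "\<forall>\<^sub>F n in sequentially. z n \<in> ?W" "\<forall>\<^sub>F n in sequentially. \<bar>t n\<bar> < \<tau> / 2"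
        using topological_tendstoD[OF mdispD(1)[OF d] W(1) x] topological_tendstoD[OF mdispD(2)[OF d] W(1) x]
          order_tendstoD(2)[OF tendsto_rabs[OF t] t0] by auto
      with stay[OF lim] have "\<forall>\<^sub>F n in sequentially. y n \<in> ?W \<and> z n \<in> ?W \<and> \<bar>t n\<bar> < \<tau> / 2 \<and>
         (\<forall>q\<in>?W. \<forall>t. \<bar>t\<bar> < \<tau> \<longrightarrow> flow A (Xs n) t q \<in> chart_dom c \<and> chart_map c (flow A (Xs n) t q) \<in> ?B)"
        by eventually_elim blast
      then obtain N where N: "\<And>n. N \<le> n \<Longrightarrow> y n \<in> ?W" "\<And>n. N \<le> n \<Longrightarrow> z n \<in> ?W" "\<And>n. N \<le> n \<Longrightarrow> \<bar>t n\<bar> < \<tau> / 2"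
          "\<And>n q t. N \<le> n \<Longrightarrow> q \<in> ?W \<Longrightarrow> \<bar>t\<bar> < \<tau> \<Longrightarrow> flow A (Xs n) t q \<in> chart_dom c"
          "\<And>n q t. N \<le> n \<Longrightarrow> q \<in> ?W \<Longrightarrow> \<bar>t\<bar> < \<tau> \<Longrightarrow> chart_map c (flow A (Xs n) t q) \<in> ?B"
        unfolding eventually_sequentially by blast
      have Xs: "C1_field (Xs n)" for n using lim by (simp add: field_limit_at_def)
      have limN: "C1_limit (\<lambda>n. field_rep c (Xs (n + N))) ?G ?B"
        by (rule C1_limit_subseq[OF _ strict_mono_offset, where G = "\<lambda>n. field_rep c (Xs n)"])
          (use lim in \<open>simp add: field_limit_at_def\<close>)
      let ?F = "\<lambda>q n s. chart_map c (flow A (Xs (n + N)) s (q (n + N)))"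
      have tN: "(\<lambda>n. t (n + N)) \<longlonglongrightarrow> t0" using LIMSEQ_ignore_initial_segment[OF t] .
      have disp: "displaces (\<lambda>n. ?F y n (t (n + N))) (\<lambda>n. ?F z n (t (n + N))) (\<lambda>n. h (n + N)) (?\<eta> t0) (w t0)"
      proof (rule displaces_ode[OF C1 open_chart_img[OF c(1)] r(2) limN, where \<tau> = "\<tau> / 2"])
        fix s :: real and n assume "\<bar>s\<bar> < \<tau> / 2"
        then have s: "\<bar>s\<bar> < \<tau>" using \<tau> by simp
        show "?F y n s \<in> ?B" "?F z n s \<in> ?B" using N(1,2,5) s by simp_all
        show "(?F y n has_vector_derivative field_rep c (Xs (n + N)) (?F y n s)) (at s)"
          "(?F z n has_vector_derivative field_rep c (Xs (n + N)) (?F z n s)) (at s)"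
          by (rule ode[OF Xs N(4)]; use N(1,2) s in simp)+
      next
        fix s :: real assume "\<bar>s\<bar> < \<tau> / 2"
        then have s: "\<bar>s\<bar> < \<tau>" using \<tau> by simp
        show "?\<eta> s \<in> ?B" by (rule stayX(2)[OF x s])
        show "(?\<eta> has_vector_derivative ?G (?\<eta> s)) (at s)" by (rule ode[OF X stayX(1)[OF x s]])
      next
        have "displaces (\<lambda>n. chart_map c (y n)) (\<lambda>n. chart_map c (z n)) h (chart_map c x) (comps c x v)"
          by (rule mdisp_chart[OF d c(1)]) (use x in auto)
        from displaces_subseq[OF this strict_mono_offset]
        show "displaces (\<lambda>n. ?F y n 0) (\<lambda>n. ?F z n 0) (\<lambda>n. h (n + N)) (?\<eta> 0) (w 0)"
          using Xs X by (simp add: w(1) o_def)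
      qed (use w(2) tN t0 in auto)
      have disp: "displaces (\<lambda>n. chart_map c (flow A (Xs n) (t n) (y n))) (\<lambda>n. chart_map c (flow A (Xs n) (t n) (z n))) h
         (chart_map c (flow A X t0 x)) (w t0)"
        by (rule displaces_offset[OF disp mdispD(3)[OF d]])
      have "(\<lambda>n. flow A (Xs n) (t n) (q n)) \<longlonglongrightarrow> flow A X t0 x"
        if "\<And>n. N \<le> n \<Longrightarrow> q n \<in> ?W" "(\<lambda>n. chart_map c (flow A (Xs n) (t n) (q n))) \<longlonglongrightarrow> chart_map c (flow A X t0 x)" for q
      proof -
        have "flow A (Xs n) (t n) (q n) \<in> chart_dom c" if "N \<le> n" for n
          by (rule N(4)[OF that \<open>\<And>n. N \<le> n \<Longrightarrow> q n \<in> ?W\<close>[OF that]]) (use N(3)[OF that] \<tau> in simp)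
        then have "\<forall>\<^sub>F n in sequentially. flow A (Xs n) (t n) (q n) \<in> chart_dom c" unfolding eventually_sequentially by blast
        with that(2) show ?thesis using tendsto_chart[OF c(1) fin] by blast
      qed
      from this[OF N(1) displacesD(1)[OF disp]] this[OF N(2) displacesD(5)[OF disp]]
      show ?thesis by (rule mdispI[OF c(1) fin _ _ disp])
    qed
    then show "flow A X t0 x \<in> chart_dom c \<and> (\<exists>w. \<forall>Xs y z h t. field_limit_at c (chart_map c p) r Xs X \<longrightarrow> mdisp y z h x v \<longrightarrow> t \<longlonglongrightarrow> t0 \<longrightarrow>
         mdisp (\<lambda>n. flow A (Xs n) (t n) (y n)) (\<lambda>n. flow A (Xs n) (t n) (z n)) h (flow A X t0 x) w)"
      using fin by blast
  qed
qed

text \<open>For the constant sequence this is strict differentiability of the flow at \<open>x\<close>; in general it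
  contains the convergence of the flows and of their derivatives.\<close>

definition transports :: "(nat \<Rightarrow> 'a \<Rightarrow> 'e) \<Rightarrow> ('a \<Rightarrow> 'e) \<Rightarrow> 'a \<Rightarrow> real \<Rightarrow> bool" where
  "transports Xs X x t0 \<longleftrightarrow> (\<forall>v y z h t. mdisp y z h x v \<longrightarrow> t \<longlonglongrightarrow> t0 \<longrightarrow>
     mdisp (\<lambda>n. flow A (Xs n) (t n) (y n)) (\<lambda>n. flow A (Xs n) (t n) (z n)) h (flow A X t0 x) (tangent_map A (flow A X t0) x v))"

text \<open>The chain rule.  The constant sequence is carried along because it identifies the composite of the
  two derivatives with the derivative of the flow at the total time.\<close>

lemma transports_add:
  assumes X: "C1_field X" "\<And>n. C1_field (Xs n)"
    and Xs: "transports Xs X x t1" "transports Xs X (flow A X t1 x) t2"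
    and X2: "transports (\<lambda>n. X) X x t1" "transports (\<lambda>n. X) X (flow A X t1 x) t2"
  shows "transports Xs X x (t2 + t1)"
proof -
  let ?w = "\<lambda>v. tangent_map A (flow A X t2) (flow A X t1 x) (tangent_map A (flow A X t1) x v)"
  have compose: "mdisp (\<lambda>n. flow A (Ys n) (t n) (y n)) (\<lambda>n. flow A (Ys n) (t n) (z n)) h (flow A X (t2 + t1) x) (?w v)"
    if "transports Ys X x t1" "transports Ys X (flow A X t1 x) t2" "\<And>n. C1_field (Ys n)" "mdisp y z h x v" "t \<longlonglongrightarrow> t2 + t1" for Ys v y z h t
  proof -
    have "(\<lambda>n. t n - t1) \<longlonglongrightarrow> t2 + t1 - t1" by (intro tendsto_intros that)
    then have tm: "(\<lambda>n. t n - t1) \<longlonglongrightarrow> t2" by simp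
    note that(2)[unfolded transports_def, rule_format, OF that(1)[unfolded transports_def, rule_format, OF that(4) tendsto_const] tm]
    then show ?thesis using that(3) X(1) by (simp add: flow_add[symmetric])
  qed
  have "tangent_map A (flow A X (t2 + t1)) x v = ?w v" for v
    by (rule tangent_map_eqI) (rule compose[OF X2 X(1) _ tendsto_const])
  then show ?thesis using compose[OF Xs X(2)] unfolding transports_def by simp
qed

lemma transports_flow:
  assumes lim: "field_limit Xs X" shows "transports Xs X x t"
proof -
  note X = field_limit_C1[OF lim]
  define P where "P x \<tau> \<longleftrightarrow> (\<forall>t. \<bar>t\<bar> < \<tau> \<longrightarrow> transports Xs X x t \<and> transports (\<lambda>n. X) X x t)" for x \<tau>
  have "\<exists>W \<tau>. open W \<and> p \<in> W \<and> 0 < \<tau> \<and> (\<forall>q\<in>W. P q \<tau>)" for p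
  proof -
    obtain c r where c: "c \<in> A" "p \<in> chart_dom c" and r: "0 < r" "cball (chart_map c p) r \<subseteq> chart_img c"
      and limc: "field_limit_at c (chart_map c p) r Xs X"
      using lim unfolding field_limit_def by blast
    have limX: "field_limit_at c (chart_map c p) r (\<lambda>n. X) X"
      using X(1) c(1) C1_limit_const r(2) unfolding field_limit_at_def C1_field_def by blast
    obtain \<tau> W where \<tau>: "0 < \<tau>" and W: "open W" "p \<in> W"
      and loc: "\<And>x t0 v. x \<in> W \<Longrightarrow> \<bar>t0\<bar> < \<tau> \<Longrightarrow> flow A X t0 x \<in> chart_dom c \<and>
       (\<exists>w. \<forall>Xs y z h t. field_limit_at c (chart_map c p) r Xs X \<longrightarrow> mdisp y z h x v \<longrightarrow> t \<longlonglongrightarrow> t0 \<longrightarrow>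
         mdisp (\<lambda>n. flow A (Xs n) (t n) (y n)) (\<lambda>n. flow A (Xs n) (t n) (z n)) h (flow A X t0 x) w)"
      by (rule flow_mdisp_local[OF c r X(1)]) blast
    have "P q \<tau>" if q: "q \<in> W" for q
      unfolding P_def
    proof (intro allI impI)
      fix t0 :: real assume t0: "\<bar>t0\<bar> < \<tau>"
      have "\<exists>w. \<forall>v Xs y z h t. field_limit_at c (chart_map c p) r Xs X \<longrightarrow> mdisp y z h q v \<longrightarrow> t \<longlonglongrightarrow> t0 \<longrightarrow>
         mdisp (\<lambda>n. flow A (Xs n) (t n) (y n)) (\<lambda>n. flow A (Xs n) (t n) (z n)) h (flow A X t0 q) (w v)"
        by (rule choice) (use loc[OF q t0] in blast)
      then obtain w where w: "\<And>v Xs y z h t. field_limit_at c (chart_map c p) r Xs X \<Longrightarrow> mdisp y z h q v \<Longrightarrow> t \<longlonglongrightarrow> t0 \<Longrightarrow>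
         mdisp (\<lambda>n. flow A (Xs n) (t n) (y n)) (\<lambda>n. flow A (Xs n) (t n) (z n)) h (flow A X t0 q) (w v)"
        by blast
      have "tangent_map A (flow A X t0) q v = w v" for v
        by (rule tangent_map_eqI) (rule w[OF limX _ tendsto_const])
      then show "transports Xs X q t0 \<and> transports (\<lambda>n. X) X q t0"
        unfolding transports_def using w[OF limc] w[OF limX] by simp
    qed
    then show ?thesis using \<tau> W by blast
  qed
  moreover have "P q \<sigma>" if "P q \<tau>" "\<sigma> \<le> \<tau>" for q \<sigma> \<tau> using that unfolding P_def by force
  ultimately obtain \<tau> where \<tau>: "0 < \<tau>" "\<And>q. P q \<tau>" by (rule uniform_time[of P]) blast+
  \<comment> \<open>Any time is a sum of finitely many short times.\<close>
  obtain k :: nat where k: "\<bar>t\<bar> / \<tau> < real k" using reals_Archimedean2 by blast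
  then have k0: "0 < k" using \<tau>(1) by (metis abs_ge_zero divide_nonneg_pos gr0I not_less of_nat_0)
  define s where "s = t / real k"
  have s: "\<bar>s\<bar> < \<tau>" using k k0 \<tau>(1) by (simp add: s_def field_simps)
  have "transports Xs X x (real j * s) \<and> transports (\<lambda>n. X) X x (real j * s)" for j x
  proof (induction j)
    case 0 then show ?case using \<tau> by (simp add: P_def)
  next
    case (Suc j)
    have *: "transports Xs X q s" "transports (\<lambda>n. X) X q s" for q using \<tau>(2) s by (auto simp: P_def)
    have "transports Xs X x (s + real j * s)" "transports (\<lambda>n. X) X x (s + real j * s)"
      using transports_add[of X Xs x "real j * s" s] transports_add[of X "\<lambda>n. X" x "real j * s" s] X * Suc by blast+
    then show ?case by (simp add: algebra_simps)
  qed
  from this[of x k] show ?thesis using k0 by (simp add: s_def)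
qed

lemma flow_mdisp:
  assumes "field_limit Xs X" "mdisp y z h x v" "t \<longlonglongrightarrow> t0"
  shows "mdisp (\<lambda>n. flow A (Xs n) (t n) (y n)) (\<lambda>n. flow A (Xs n) (t n) (z n)) h (flow A X t0 x) (tangent_map A (flow A X t0) x v)"
  using transports_flow[OF assms(1)] assms(2,3) unfolding transports_def by blast

lemma tangent_map_flow_0: "C1_field X \<Longrightarrow> tangent_map A (flow A X t) x 0 = 0"
proof -
  assume X: "C1_field X"
  have c: "mdisp (\<lambda>n. q) (\<lambda>n. q) (\<lambda>n. inverse (real (Suc n))) q 0" for q
    unfolding mdisp_def displaces_def using LIMSEQ_inverse_real_of_nat by simp
  show ?thesis
    by (rule mdisp_unique[OF flow_mdisp[OF field_limit_const[OF X] c tendsto_const] c])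
qed

lemma mdisp_exists_along:
  assumes "y \<longlonglongrightarrow> x" obtains z h where "mdisp y z h x v"
proof -
  let ?c = "chart_at A x" and ?h = "\<lambda>n. inverse (real (Suc n))"
  have "(\<lambda>n. chart_map ?c (y n)) \<longlonglongrightarrow> chart_map ?c x" using assms tendsto_chart[OF chart_at] by blast
  then have "displaces (\<lambda>n. chart_map ?c (y n)) (\<lambda>n. chart_map ?c (y n) + ?h n *\<^sub>R v) ?h (chart_map ?c x) v"
    by (intro displaces_line[OF _ LIMSEQ_inverse_real_of_nat _ tendsto_const]) auto
  from mdisp_chart_inv[OF chart_at this]
  have d: "mdisp (\<lambda>n. chart_inv ?c (chart_map ?c (y n))) (\<lambda>n. chart_inv ?c (chart_map ?c (y n) + ?h n *\<^sub>R v)) ?h x v"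
    by (simp add: coord_vec_coord_change chart_at)
  have ev: "\<forall>\<^sub>F n in sequentially. y n = chart_inv ?c (chart_map ?c (y n))"
    by (rule eventually_mono[OF topological_tendstoD[OF assms open_chart_dom[OF chart_at(1)] chart_at(2)]]) (simp add: chart_at)
  have "mdisp y (\<lambda>n. chart_inv ?c (chart_map ?c (y n) + ?h n *\<^sub>R v)) ?h x v"
    by (rule mdisp_cong[OF d ev]) simp
  then show thesis by (rule that)
qed

lemma flow_tendsto:
  assumes "field_limit Xs X" "y \<longlonglongrightarrow> x" "t \<longlonglongrightarrow> t0"
  shows "(\<lambda>n. flow A (Xs n) (t n) (y n)) \<longlonglongrightarrow> flow A X t0 x"
proof -
  obtain z h where "mdisp y z h x 0" by (rule mdisp_exists_along[OF assms(2)])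
  from flow_mdisp[OF assms(1) this assms(3)] show ?thesis by (rule mdispD)
qed

text \<open>A displacement of the time contributes a multiple of the vector field, by the mean value theorem
  along the orbit.\<close>

lemma flow_mdisp_time:
  assumes X: "C1_field X" and d: "mdisp y z h x v" and t: "s \<longlonglongrightarrow> t0" "t \<longlonglongrightarrow> t0" "(\<lambda>n. (t n - s n) / h n) \<longlonglongrightarrow> \<theta>"
  shows "mdisp (\<lambda>n. flow A X (s n) (y n)) (\<lambda>n. flow A X (t n) (z n)) h (flow A X t0 x)
    (tangent_map A (flow A X t0) x v + \<theta> *\<^sub>R X (flow A X t0 x))"
proof -
  let ?q = "flow A X t0 x" and ?c = "chart_at A (flow A X t0 x)"
  note lim = field_limit_const[OF X]
  have d1: "mdisp (\<lambda>n. flow A X (s n) (y n)) (\<lambda>n. flow A X (s n) (z n)) h ?q (tangent_map A (flow A X t0) x v)"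
    by (rule flow_mdisp[OF lim d t(1)])
  let ?b = "\<lambda>n. flow A X (s n) (z n)" and ?\<delta> = "\<lambda>n. t n - s n"
  have b: "?b \<longlonglongrightarrow> ?q" using d1 by (rule mdispD)
  have \<delta>: "?\<delta> \<longlonglongrightarrow> 0" using tendsto_diff[OF t(2,1)] by simp
  obtain r where r: "0 < r" "cball (chart_map ?c ?q) r \<subseteq> chart_img ?c" by (rule cball_in_chart[OF chart_at])
  obtain \<tau> W where \<tau>: "0 < \<tau>" and W: "open W" "?q \<in> W"
    and box: "\<And>x t0. x \<in> W \<Longrightarrow> \<bar>t0\<bar> < \<tau> \<Longrightarrow> flow A X t0 x \<in> chart_dom ?c"
    by (rule flow_mdisp_local[OF chart_at r X]) blast
  have C1: "Ck_on (Suc 0) (field_rep ?c X) (chart_img ?c)" using X chart_at(1) by (auto simp: C1_field_def)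
  have cont: "isCont (field_rep ?c X) (chart_map ?c ?q)"
    using C1_continuous_on[OF C1] continuous_on_eq_continuous_at[OF open_chart_img[OF chart_at(1)]] chart_at by blast
  have ev: "\<forall>\<^sub>F n in sequentially. ?b n \<in> W" "\<forall>\<^sub>F n in sequentially. \<bar>?\<delta> n\<bar> < \<tau>"
    using topological_tendstoD[OF b W] order_tendstoD(2)[OF tendsto_rabs[OF \<delta>]] \<tau> by auto
  let ?u = "\<lambda>n s. chart_map ?c (flow A X s (?b n))"
  have "(\<lambda>n. ((?u n (?\<delta> n) - ?u n 0) /\<^sub>R h n) \<bullet> i) \<longlonglongrightarrow> (\<theta> *\<^sub>R X ?q) \<bullet> i" for i
  proof -
    \<comment> \<open>Mean value theorem for the coordinate \<open>i\<close>.\<close>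
    have "\<exists>\<xi>. \<bar>\<xi>\<bar> \<le> \<bar>?\<delta> n\<bar> \<and> (?b n \<in> W \<and> \<bar>?\<delta> n\<bar> < \<tau> \<longrightarrow> (?u n (?\<delta> n) - ?u n 0) \<bullet> i = ?\<delta> n * (field_rep ?c X (?u n \<xi>) \<bullet> i))" for n
    proof (cases "?b n \<in> W \<and> \<bar>?\<delta> n\<bar> < \<tau>")
      case True
      have der: "((\<lambda>s. ?u n s \<bullet> i) has_real_derivative field_rep ?c X (?u n s) \<bullet> i) (at s)" if "\<bar>s\<bar> \<le> \<bar>?\<delta> n\<bar>" for s
      proof -
        have "(?u n has_vector_derivative field_rep ?c X (?u n s)) (at s)"
          by (rule integral_curve_chart[where \<gamma> = "\<lambda>s. flow A X s (?b n)" and X = X, OF flow_velocity[OF X] chart_at(1)])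
              (rule box, use True that in auto)
        from has_derivative_inner_left[OF this[unfolded has_vector_derivative_def], of i]
        show ?thesis by (simp add: has_field_derivative_def mult_commute_abs mult.commute)
      qed
      consider "?\<delta> n = 0" | "0 < ?\<delta> n" | "?\<delta> n < 0" by linarith
      then show ?thesis
      proof cases
        case 1 then show ?thesis by (intro exI[of _ 0]) simp
      next
        case 2
        then obtain \<xi> where "0 < \<xi>" "\<xi> < ?\<delta> n" "?u n (?\<delta> n) \<bullet> i - ?u n 0 \<bullet> i = (?\<delta> n - 0) * (field_rep ?c X (?u n \<xi>) \<bullet> i)"
          using MVT2[OF 2, of "\<lambda>s. ?u n s \<bullet> i" "\<lambda>s. field_rep ?c X (?u n s) \<bullet> i"] der by auto
        then show ?thesis by (intro exI[of _ \<xi>]) (simp add: inner_diff_left)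
      next
        case 3
        then obtain \<xi> where "?\<delta> n < \<xi>" "\<xi> < 0" "?u n 0 \<bullet> i - ?u n (?\<delta> n) \<bullet> i = (0 - ?\<delta> n) * (field_rep ?c X (?u n \<xi>) \<bullet> i)"
          using MVT2[OF 3, of "\<lambda>s. ?u n s \<bullet> i" "\<lambda>s. field_rep ?c X (?u n s) \<bullet> i"] der by auto
        then show ?thesis by (intro exI[of _ \<xi>]) (simp add: inner_diff_left algebra_simps)
      qed
    qed (auto intro: exI[of _ 0])
    then obtain \<xi> where \<xi>: "\<And>n. \<bar>\<xi> n\<bar> \<le> \<bar>?\<delta> n\<bar>"
      "\<And>n. ?b n \<in> W \<Longrightarrow> \<bar>?\<delta> n\<bar> < \<tau> \<Longrightarrow> (?u n (?\<delta> n) - ?u n 0) \<bullet> i = ?\<delta> n * (field_rep ?c X (?u n (\<xi> n)) \<bullet> i)" by metis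
    have "\<xi> \<longlonglongrightarrow> 0" using Lim_null_comparison[OF _ tendsto_rabs_zero[OF \<delta>], of \<xi>] \<xi>(1) by simp
    from flow_tendsto[OF lim b this] have "(\<lambda>n. flow A X (\<xi> n) (?b n)) \<longlonglongrightarrow> ?q" using X by simp
    from conjunct2[OF iffD1[OF tendsto_chart[OF chart_at] this]]
    have "(\<lambda>n. ?u n (\<xi> n)) \<longlonglongrightarrow> chart_map ?c ?q" .
    then have "(\<lambda>n. field_rep ?c X (?u n (\<xi> n))) \<longlonglongrightarrow> field_rep ?c X (chart_map ?c ?q)" by (rule isCont_tendsto_compose[OF cont])
    then have "(\<lambda>n. (?\<delta> n / h n) * (field_rep ?c X (?u n (\<xi> n)) \<bullet> i)) \<longlonglongrightarrow> \<theta> * (field_rep ?c X (chart_map ?c ?q) \<bullet> i)"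
      by (intro tendsto_intros t(3))
    moreover have "field_rep ?c X (chart_map ?c ?q) = X ?q" by (simp add: field_rep_def chart_at)
    moreover have "\<forall>\<^sub>F n in sequentially. (?\<delta> n / h n) * (field_rep ?c X (?u n (\<xi> n)) \<bullet> i) = ((?u n (?\<delta> n) - ?u n 0) /\<^sub>R h n) \<bullet> i"
      using ev by eventually_elim (simp add: \<xi>(2) divide_inverse mult_ac)
    ultimately show ?thesis by (simp add: Lim_transform_eventually)
  qed
  then have "(\<lambda>n. (?u n (?\<delta> n) - ?u n 0) /\<^sub>R h n) \<longlonglongrightarrow> \<theta> *\<^sub>R X ?q"
    using tendsto_componentwise_iff[of "\<lambda>n. (?u n (?\<delta> n) - ?u n 0) /\<^sub>R h n" "\<theta> *\<^sub>R X ?q" sequentially] by blast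
  moreover have "?u n (?\<delta> n) = chart_map ?c (flow A X (t n) (z n))" "?u n 0 = chart_map ?c (flow A X (s n) (z n))" for n
    using X by (simp_all add: flow_add[symmetric])
  ultimately have "(\<lambda>n. (chart_map ?c (flow A X (t n) (z n)) - chart_map ?c (flow A X (s n) (z n))) /\<^sub>R h n) \<longlonglongrightarrow> \<theta> *\<^sub>R X ?q" by simp
  from tendsto_add[OF displacesD(4)[OF conjunct2[OF conjunct2[OF d1[unfolded mdisp_def]]]] this]
  have "(\<lambda>n. (chart_map ?c (flow A X (t n) (z n)) - chart_map ?c (flow A X (s n) (y n))) /\<^sub>R h n) \<longlonglongrightarrow>
     tangent_map A (flow A X t0) x v + \<theta> *\<^sub>R X ?q"
    by (simp add: scaleR_diff_right algebra_simps)
  moreover have "(\<lambda>n. flow A X (t n) (z n)) \<longlonglongrightarrow> ?q" by (rule flow_tendsto[OF lim mdispD(2)[OF d] t(2)])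
  ultimately show ?thesis using d1 unfolding mdisp_def displaces_def by blast
qed

end

section \<open>Fields dual to differentials\<close>

lemma C1_onI:
  assumes "\<And>x. x \<in> S \<Longrightarrow> (f has_derivative f' x) (at x)" "\<And>v. continuous_on S (\<lambda>x. f' x v)"
  shows "Ck_on (Suc 0) f S"
proof -
  have "frechet_derivative f (at x) = f' x" if "x \<in> S" for x
    using frechet_derivative_at[OF assms(1)[OF that]] by simp
  then have "continuous_on S (\<lambda>x. frechet_derivative f (at x) v)" for v
    using assms(2)[of v] by (simp cong: continuous_on_cong)
  then show ?thesis using assms(1) unfolding Ck_on.simps differentiable_def by blast
qed

lemma C1_continuous_derivative: "Ck_on (Suc 0) f S \<Longrightarrow> continuous_on S (\<lambda>x. frechet_derivative f (at x) v)"
  by simp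

lemma C1_cong:
  assumes "Ck_on (Suc 0) f S" "open S" "\<And>x. x \<in> S \<Longrightarrow> f x = g x"
  shows "Ck_on (Suc 0) g S"
  by (rule C1_onI[OF has_derivative_transform_within_open[OF C1_has_derivative[OF assms(1)] assms(2)]])
    (use assms in auto)

lemma C1_scaleR_has_derivative:
  fixes f :: "'e::euclidean_space \<Rightarrow> real" and g :: "'e \<Rightarrow> 'b::real_normed_vector"
  assumes "f differentiable at x" "g differentiable at x"
  shows "((\<lambda>x. f x *\<^sub>R g x) has_derivative
    (\<lambda>v. f x *\<^sub>R frechet_derivative g (at x) v + frechet_derivative f (at x) v *\<^sub>R g x)) (at x)"
  using assms unfolding frechet_derivative_works by (rule has_derivative_scaleR)

lemma C1_scaleR:
  fixes f :: "'e::euclidean_space \<Rightarrow> real" and g :: "'e \<Rightarrow> 'b::real_normed_vector"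
  assumes "Ck_on (Suc 0) f S" "Ck_on (Suc 0) g S"
  shows "Ck_on (Suc 0) (\<lambda>x. f x *\<^sub>R g x) S"
proof (rule C1_onI[OF C1_scaleR_has_derivative])
  show "continuous_on S (\<lambda>x. f x *\<^sub>R frechet_derivative g (at x) v + frechet_derivative f (at x) v *\<^sub>R g x)" for v
    by (intro continuous_on_add continuous_on_scaleR C1_continuous_on[OF assms(1)] C1_continuous_on[OF assms(2)]
        C1_continuous_derivative[OF assms(1)] C1_continuous_derivative[OF assms(2)])
qed (use assms C1_differentiable in blast)+

lemma C1_sum:
  assumes "finite I" "\<And>i. i \<in> I \<Longrightarrow> Ck_on (Suc 0) (f i) S"
  shows "Ck_on (Suc 0) (\<lambda>x. \<Sum>i\<in>I. f i x) S"
proof (rule C1_onI)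
  fix x assume "x \<in> S"
  then show "((\<lambda>x. \<Sum>i\<in>I. f i x) has_derivative (\<lambda>v. \<Sum>i\<in>I. frechet_derivative (f i) (at x) v)) (at x)"
    using C1_has_derivative[OF assms(2)] by (intro has_derivative_sum) blast
qed (use assms in \<open>auto intro!: continuous_intros\<close>)

lemma C1_inner:
  assumes "Ck_on (Suc 0) f S" shows "Ck_on (Suc 0) (\<lambda>x. f x \<bullet> b) S"
proof (rule C1_onI)
  fix x assume "x \<in> S"
  then show "((\<lambda>x. f x \<bullet> b) has_derivative (\<lambda>v. frechet_derivative f (at x) v \<bullet> b)) (at x)"
    by (rule has_derivative_inner_left[OF C1_has_derivative[OF assms]])
qed (use assms in \<open>auto intro!: continuous_intros\<close>)

lemma C1_real_compose:
  fixes f :: "'e::euclidean_space \<Rightarrow> real"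
  assumes "Ck_on (Suc 0) f S" "\<And>x. x \<in> S \<Longrightarrow> (\<phi> has_real_derivative \<phi>' (f x)) (at (f x))" "continuous_on (f ` S) \<phi>'"
  shows "Ck_on (Suc 0) (\<lambda>x. \<phi> (f x)) S"
proof (rule C1_onI)
  fix x assume x: "x \<in> S"
  have "((\<phi> \<circ> f) has_derivative ((*) (\<phi>' (f x))) \<circ> frechet_derivative f (at x)) (at x)"
    by (rule diff_chain_at[OF C1_has_derivative[OF assms(1) x]])
      (use assms(2)[OF x] in \<open>simp add: has_field_derivative_def\<close>)
  then show "((\<lambda>x. \<phi> (f x)) has_derivative (\<lambda>v. \<phi>' (f x) * frechet_derivative f (at x) v)) (at x)"
    by (simp add: o_def)
next
  fix v
  have "continuous_on S (\<lambda>x. \<phi>' (f x))"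
    by (rule continuous_on_compose2[OF assms(3) C1_continuous_on[OF assms(1)]]) simp
  then show "continuous_on S (\<lambda>x. \<phi>' (f x) * frechet_derivative f (at x) v)"
    using C1_continuous_derivative[OF assms(1)] by (rule continuous_on_mult)
qed

lemma C1_limit_cong:
  assumes "C1_limit G g B" "open S" "B \<subseteq> S" "\<And>n x. x \<in> S \<Longrightarrow> G n x = G' n x" "\<And>x. x \<in> S \<Longrightarrow> g x = g' x"
    "\<And>x. x \<in> B \<Longrightarrow> g differentiable at x"
  shows "C1_limit G' g' B"
  unfolding C1_limit_def
proof (intro allI impI)
  fix e :: real assume "0 < e"
  from assms(1)[unfolded C1_limit_def, rule_format, OF this]
  show "\<forall>\<^sub>F n in sequentially. \<forall>y\<in>B. G' n differentiable (at y) \<and> norm (G' n y - g' y) \<le> e \<and>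
     (\<forall>b\<in>Basis. norm (frechet_derivative (G' n) (at y) b - frechet_derivative g' (at y) b) \<le> e)"
  proof eventually_elim
    case (elim n)
    show ?case
    proof
      fix y assume y: "y \<in> B"
      then have yS: "y \<in> S" using assms(3) by blast
      have dG: "(G n has_derivative frechet_derivative (G n) (at y)) (at y)"
        using elim y frechet_derivative_works by blast
      have dG': "(G' n has_derivative frechet_derivative (G n) (at y)) (at y)"
        by (rule has_derivative_transform_within_open[OF dG assms(2) yS assms(4)])
      have dg: "(g has_derivative frechet_derivative g (at y)) (at y)"
        using assms(6)[OF y] frechet_derivative_works by blast
      have dg': "(g' has_derivative frechet_derivative g (at y)) (at y)"
        by (rule has_derivative_transform_within_open[OF dg assms(2) yS assms(5)])
      show "G' n differentiable (at y) \<and> norm (G' n y - g' y) \<le> e \<and>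
         (\<forall>b\<in>Basis. norm (frechet_derivative (G' n) (at y) b - frechet_derivative g' (at y) b) \<le> e)"
        using elim y dG' frechet_derivative_at[OF dG'] frechet_derivative_at[OF dg'] assms(4,5)[OF yS]
        unfolding differentiable_def by auto
    qed
  qed
qed

lemma C1_limit_scaleR:
  fixes g :: "'e::euclidean_space \<Rightarrow> real" and J :: "'e \<Rightarrow> 'b::real_normed_vector"
  assumes lim: "C1_limit G g B" and g: "Ck_on (Suc 0) g S" and J: "Ck_on (Suc 0) J S" and B: "compact B" "B \<subseteq> S"
  shows "C1_limit (\<lambda>n x. G n x *\<^sub>R J x) (\<lambda>x. g x *\<^sub>R J x) B"
  unfolding C1_limit_def
proof (intro allI impI)
  fix e :: real assume e: "0 < e"
  have bounded: "\<exists>K. \<forall>x\<in>B. norm (f x) \<le> K" if "continuous_on S f" for f :: "'e \<Rightarrow> 'b"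
    using compact_imp_bounded[OF compact_continuous_image[OF continuous_on_subset[OF that B(2)] B(1)]]
    unfolding bounded_iff by auto
  obtain K0 where K0: "\<And>x. x \<in> B \<Longrightarrow> norm (J x) \<le> K0" using bounded[OF C1_continuous_on[OF J]] by blast
  have "\<exists>K. \<forall>x\<in>B. norm (frechet_derivative J (at x) b) \<le> K" for b
    by (rule bounded[OF C1_continuous_derivative[OF J]])
  then obtain K1 where K1: "\<And>b x. x \<in> B \<Longrightarrow> norm (frechet_derivative J (at x) b) \<le> K1 b" by metis
  define K where "K = 1 + \<bar>K0\<bar> + (\<Sum>b\<in>Basis. \<bar>K1 b\<bar>)"
  have K: "0 < K" "x \<in> B \<Longrightarrow> norm (J x) \<le> K" "x \<in> B \<Longrightarrow> b \<in> Basis \<Longrightarrow> norm (frechet_derivative J (at x) b) \<le> K" for x b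
  proof -
    have s: "0 \<le> (\<Sum>b\<in>(Basis::'e set). \<bar>K1 b\<bar>)" by (simp add: sum_nonneg)
    then show "0 < K" unfolding K_def by linarith
    show "norm (J x) \<le> K" if "x \<in> B" unfolding K_def using K0[OF that] s by linarith
    show "norm (frechet_derivative J (at x) b) \<le> K" if "x \<in> B" "b \<in> Basis"
    proof -
      have "\<bar>K1 b\<bar> \<le> (\<Sum>b\<in>(Basis::'e set). \<bar>K1 b\<bar>)" by (rule member_le_sum) (use that in auto)
      then show ?thesis unfolding K_def using K1[OF that(1), of b] by linarith
    qed
  qed
  define e' where "e' = e / (2 * K)"
  have e': "0 < e'" using e K(1) by (simp add: e'_def)
  from lim[unfolded C1_limit_def, rule_format, OF e']
  show "\<forall>\<^sub>F n in sequentially. \<forall>y\<in>B. (\<lambda>x. G n x *\<^sub>R J x) differentiable (at y) \<and> norm (G n y *\<^sub>R J y - g y *\<^sub>R J y) \<le> e \<and>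
     (\<forall>b\<in>Basis. norm (frechet_derivative (\<lambda>x. G n x *\<^sub>R J x) (at y) b - frechet_derivative (\<lambda>x. g x *\<^sub>R J x) (at y) b) \<le> e)"
  proof eventually_elim
    case (elim n)
    show ?case
    proof
      fix y assume y: "y \<in> B"
      have dJ: "J differentiable at y" and dg: "g differentiable at y"
        using C1_differentiable[OF J] C1_differentiable[OF g] y B(2) by blast+
      have dG: "G n differentiable at y" and G0: "norm (G n y - g y) \<le> e'"
        and G1: "\<And>b. b \<in> Basis \<Longrightarrow> norm (frechet_derivative (G n) (at y) b - frechet_derivative g (at y) b) \<le> e'"
        using elim y by auto
      have 1: "norm ((G n y - g y) *\<^sub>R w) \<le> e / 2" if "norm w \<le> K" for w :: 'b
      proof -
        have "norm ((G n y - g y) *\<^sub>R w) \<le> e' * K" using G0 that e' by (auto intro!: mult_mono)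
        then show ?thesis using K(1) by (simp add: e'_def)
      qed
      have 2: "norm ((frechet_derivative (G n) (at y) b - frechet_derivative g (at y) b) *\<^sub>R J y) \<le> e / 2" if "b \<in> Basis" for b
      proof -
        have "norm ((frechet_derivative (G n) (at y) b - frechet_derivative g (at y) b) *\<^sub>R J y) \<le> e' * K"
          using G1[OF that] K(2)[OF y] e' by (auto intro!: mult_mono)
        then show ?thesis using K(1) by (simp add: e'_def)
      qed
      have "norm (frechet_derivative (\<lambda>x. G n x *\<^sub>R J x) (at y) b - frechet_derivative (\<lambda>x. g x *\<^sub>R J x) (at y) b) \<le> e" if "b \<in> Basis" for b
      proof -
        have "frechet_derivative (\<lambda>x. G n x *\<^sub>R J x) (at y) b - frechet_derivative (\<lambda>x. g x *\<^sub>R J x) (at y) b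
            = (G n y - g y) *\<^sub>R frechet_derivative J (at y) b + (frechet_derivative (G n) (at y) b - frechet_derivative g (at y) b) *\<^sub>R J y"
          unfolding frechet_derivative_at[OF C1_scaleR_has_derivative[OF dG dJ], symmetric]
            frechet_derivative_at[OF C1_scaleR_has_derivative[OF dg dJ], symmetric]
          by (simp add: algebra_simps)
        then show ?thesis using norm_triangle_mono[OF 1[OF K(3)[OF y that]] 2[OF that]] by simp
      qed
      moreover have "norm (G n y *\<^sub>R J y - g y *\<^sub>R J y) \<le> e"
        using 1[OF K(2)[OF y]] e by (simp add: scaleR_left_diff_distrib)
      moreover have "(\<lambda>x. G n x *\<^sub>R J x) differentiable at y"
        using C1_scaleR_has_derivative[OF dG dJ] unfolding differentiable_def by blast
      ultimately show "(\<lambda>x. G n x *\<^sub>R J x) differentiable (at y) \<and> norm (G n y *\<^sub>R J y - g y *\<^sub>R J y) \<le> e \<and>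
         (\<forall>b\<in>Basis. norm (frechet_derivative (\<lambda>x. G n x *\<^sub>R J x) (at y) b - frechet_derivative (\<lambda>x. g x *\<^sub>R J x) (at y) b) \<le> e)"
        by blast
    qed
  qed
qed

lemma C1_limit_sum:
  fixes g :: "'i \<Rightarrow> 'e::euclidean_space \<Rightarrow> 'b::real_normed_vector"
  assumes I: "finite I" and lim: "\<And>i. i \<in> I \<Longrightarrow> C1_limit (G i) (g i) B"
    and g: "\<And>i x. i \<in> I \<Longrightarrow> x \<in> B \<Longrightarrow> g i differentiable at x"
  shows "C1_limit (\<lambda>n x. \<Sum>i\<in>I. G i n x) (\<lambda>x. \<Sum>i\<in>I. g i x) B"
  unfolding C1_limit_def
proof (intro allI impI)
  fix e :: real assume e: "0 < e"
  define e' where "e' = e / (real (card I) + 1)"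
  have e': "0 < e'" "real (card I) * e' \<le> e" using e by (simp_all add: e'_def field_simps)
  have "\<forall>\<^sub>F n in sequentially. \<forall>i\<in>I. \<forall>y\<in>B. G i n differentiable (at y) \<and> norm (G i n y - g i y) \<le> e' \<and>
     (\<forall>b\<in>Basis. norm (frechet_derivative (G i n) (at y) b - frechet_derivative (g i) (at y) b) \<le> e')"
    using lim[unfolded C1_limit_def, rule_format, OF _ e'(1)] by (simp add: eventually_ball_finite_distrib[OF I])
  then show "\<forall>\<^sub>F n in sequentially. \<forall>y\<in>B. (\<lambda>x. \<Sum>i\<in>I. G i n x) differentiable (at y) \<and> norm ((\<Sum>i\<in>I. G i n y) - (\<Sum>i\<in>I. g i y)) \<le> e \<and>
     (\<forall>b\<in>Basis. norm (frechet_derivative (\<lambda>x. \<Sum>i\<in>I. G i n x) (at y) b - frechet_derivative (\<lambda>x. \<Sum>i\<in>I. g i x) (at y) b) \<le> e)"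
  proof eventually_elim
    case (elim n)
    show ?case
    proof
      fix y assume y: "y \<in> B"
      have dG: "((\<lambda>x. \<Sum>i\<in>I. G i n x) has_derivative (\<lambda>v. \<Sum>i\<in>I. frechet_derivative (G i n) (at y) v)) (at y)"
        by (rule has_derivative_sum) (use elim y frechet_derivative_works in blast)
      have dg: "((\<lambda>x. \<Sum>i\<in>I. g i x) has_derivative (\<lambda>v. \<Sum>i\<in>I. frechet_derivative (g i) (at y) v)) (at y)"
        by (rule has_derivative_sum) (use g y frechet_derivative_works in blast)
      have small: "norm ((\<Sum>i\<in>I. u i) - (\<Sum>i\<in>I. w i)) \<le> e" if "\<And>i. i \<in> I \<Longrightarrow> norm (u i - w i) \<le> e'" for u w :: "'i \<Rightarrow> 'b"
      proof -
        have "norm (\<Sum>i\<in>I. u i - w i) \<le> (\<Sum>i\<in>I. e')" by (rule sum_norm_le) (use that in auto)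
        then show ?thesis using e'(2) by (simp add: sum_subtractf)
      qed
      show "(\<lambda>x. \<Sum>i\<in>I. G i n x) differentiable (at y) \<and> norm ((\<Sum>i\<in>I. G i n y) - (\<Sum>i\<in>I. g i y)) \<le> e \<and>
         (\<forall>b\<in>Basis. norm (frechet_derivative (\<lambda>x. \<Sum>i\<in>I. G i n x) (at y) b - frechet_derivative (\<lambda>x. \<Sum>i\<in>I. g i x) (at y) b) \<le> e)"
        unfolding frechet_derivative_at[OF dG, symmetric] frechet_derivative_at[OF dg, symmetric]
      proof (intro conjI ballI)
        show "(\<lambda>x. \<Sum>i\<in>I. G i n x) differentiable (at y)" using dG unfolding differentiable_def by blast
        show "norm ((\<Sum>i\<in>I. G i n y) - (\<Sum>i\<in>I. g i y)) \<le> e" by (rule small) (use elim y in blast)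
        fix b :: 'e assume "b \<in> Basis"
        then show "norm ((\<Sum>i\<in>I. frechet_derivative (G i n) (at y) b) - (\<Sum>i\<in>I. frechet_derivative (g i) (at y) b)) \<le> e"
          by (intro small) (use elim y in blast)
      qed
    qed
  qed
qed

subsection \<open>Linear systems with \<open>C\<^sup>1\<close> coefficients\<close>

text \<open>The limit \<open>B\<close> is bounded below and \<open>Bn n\<close> is close to it, so the solutions of the linear systems
  stay bounded and converge.\<close>

lemma inverse_tendsto:
  fixes B :: "'e::euclidean_space \<Rightarrow> 'e" and Bn :: "nat \<Rightarrow> 'e \<Rightarrow> 'e"
  assumes B: "linear B" "inj B" and Bn: "\<And>n. linear (Bn n)" "\<And>k. (\<lambda>n. Bn n k) \<longlonglongrightarrow> B k" and R: "(\<lambda>n. Bn n (u n)) \<longlonglongrightarrow> B r"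
  shows "u \<longlonglongrightarrow> r"
proof -
  obtain m where m: "0 < m" "\<And>x. m * norm x \<le> norm (B x)" using linear_inj_bounded_below_pos[OF B] by blast
  define \<epsilon> where "\<epsilon> n = (\<Sum>k\<in>Basis. norm (Bn n k - B k))" for n
  have \<epsilon>: "\<epsilon> \<longlonglongrightarrow> (\<Sum>k\<in>(Basis::'e set). norm (B k - B k))" unfolding \<epsilon>_def by (intro tendsto_intros Bn)
  then have \<epsilon>0: "\<epsilon> \<longlonglongrightarrow> 0" by simp
  define \<delta> where "\<delta> n = norm (Bn n (u n) - B r)" for n
  have \<delta>0: "\<delta> \<longlonglongrightarrow> 0" unfolding \<delta>_def using tendsto_norm_zero[OF LIM_zero[OF R]] .
  have key: "m * norm (u n - r) \<le> \<epsilon> n * norm (u n - r) + \<epsilon> n * norm r + \<delta> n" for n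
  proof -
    have "norm (Bn n (u n) - B (u n)) \<le> \<epsilon> n * norm (u n)"
      unfolding \<epsilon>_def by (rule norm_linear_le_sum_Basis[where f="\<lambda>x. Bn n x - B x"]) (auto intro: linear_compose_sub Bn B)
    moreover have "norm (u n) \<le> norm (u n - r) + norm r" by (metis norm_triangle_sub add.commute)
    moreover have "0 \<le> \<epsilon> n" by (simp add: \<epsilon>_def sum_nonneg)
    ultimately have "norm (Bn n (u n) - B (u n)) \<le> \<epsilon> n * (norm (u n - r) + norm r)"
      by (meson mult_left_mono order_trans)
    moreover have "norm (B (u n) - B r) \<le> norm (Bn n (u n) - B (u n)) + \<delta> n"
      unfolding \<delta>_def by (metis dist_norm dist_commute dist_triangle)
    ultimately show ?thesis using m(2)[of "u n - r"] linear_diff[OF B(1), of "u n" r] by (simp add: algebra_simps)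
  qed
  have "(\<lambda>n. (\<epsilon> n * norm r + \<delta> n) * (2 / m)) \<longlonglongrightarrow> (0 * norm r + 0) * (2 / m)" by (intro tendsto_intros \<epsilon>0 \<delta>0)
  then have lim: "(\<lambda>n. (\<epsilon> n * norm r + \<delta> n) * (2 / m)) \<longlonglongrightarrow> 0" by simp
  have "\<forall>\<^sub>F n in sequentially. \<epsilon> n < m / 2" by (rule order_tendstoD(2)[OF \<epsilon>0]) (use m(1) in simp)
  then have "\<forall>\<^sub>F n in sequentially. norm (u n - r) \<le> (\<epsilon> n * norm r + \<delta> n) * (2 / m)"
  proof eventually_elim
    case (elim n)
    have "\<epsilon> n * norm (u n - r) \<le> m / 2 * norm (u n - r)" using elim by (intro mult_right_mono) auto
    then have "m / 2 * norm (u n - r) \<le> \<epsilon> n * norm r + \<delta> n" using key[of n] by simp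
    then show ?case using m(1) by (simp add: field_simps)
  qed
  from Lim_null_comparison[OF this lim] show ?thesis by (simp add: LIM_zero_iff)
qed

text \<open>Cramer's rule without determinants: solutions of a regular linear system with \<open>C\<^sup>1\<close> coefficients
  are shown to transport displacements.\<close>

lemma dual_basis_C1:
  fixes b :: "'e::euclidean_space \<Rightarrow> 'e \<Rightarrow> 'e \<Rightarrow> real"
  assumes S: "open S" and C1: "\<And>u v. Ck_on (Suc 0) (\<lambda>y. b y u v) S" and bil: "\<And>y. y \<in> S \<Longrightarrow> bilinear (b y)"
    and nondeg: "\<And>y u. y \<in> S \<Longrightarrow> (\<And>v. b y u v = 0) \<Longrightarrow> u = 0"
  obtains J where "\<And>w. Ck_on (Suc 0) (J w) S" "\<And>y w v. y \<in> S \<Longrightarrow> b y (J w y) v = w \<bullet> v"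
proof -
  define B where "B y u = (\<Sum>j\<in>Basis. b y u j *\<^sub>R j)" for y u
  have Bj: "B y u \<bullet> j = b y u j" if "j \<in> Basis" for y u j
    using that by (simp add: B_def inner_sum_left inner_Basis if_distrib cong: if_cong)
  have l1: "linear (\<lambda>u. b y u v)" and l2: "linear (\<lambda>v. b y u v)" if "y \<in> S" for y u v
    using bil[OF that] by (auto simp: bilinear_def)
  have Bin: "B y u \<bullet> v = b y u v" if "y \<in> S" for y u v
  proof -
    have "B y u \<bullet> v = (\<Sum>j\<in>Basis. (v \<bullet> j) * b y u j)"
      using euclidean_inner[of "B y u" v] Bj by (simp add: mult.commute)
    then show ?thesis using linear_eq_sum_Basis[OF l2[OF that], of u v] by simp
  qed
  have lB: "linear (B y)" if "y \<in> S" for y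
    unfolding B_def[abs_def]
    by (rule linearI) (simp_all add: linear_add[OF l1[OF that]] linear_scale[OF l1[OF that]] scaleR_left_distrib sum.distrib scaleR_sum_right)
  have injB: "inj (B y)" if "y \<in> S" for y
    unfolding linear_injective_0[OF lB[OF that]]
    using nondeg[OF that] Bin[OF that] by (metis inner_zero_left)
  have "\<exists>J. \<forall>w. \<forall>y\<in>S. B y (J w y) = w"
    using linear_injective_imp_surjective[OF lB injB]
    by (intro exI[of _ "\<lambda>w y. inv (B y) w"]) (simp add: surj_f_inv_f)
  then obtain J where J: "\<And>w y. y \<in> S \<Longrightarrow> B y (J w y) = w" by blast
  have evB: "(\<lambda>n. B (y n) k) \<longlonglongrightarrow> B x k" if "x \<in> S" "y \<longlonglongrightarrow> x" for x y k
    unfolding B_def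
  proof (intro tendsto_intros)
    fix j
    have "isCont (\<lambda>y. b y k j) x" using C1_continuous_on[OF C1] S that(1) by (simp add: continuous_on_eq_continuous_at)
    then show "(\<lambda>n. b (y n) k j) \<longlonglongrightarrow> b x k j" using that(2) by (rule isCont_tendsto_compose)
  qed
  define B' where "B' y = (if y \<in> S then B y else id)" for y
  have lB': "linear (B' y)" for y using lB by (simp add: B'_def linear_id)
  have B'k: "(\<lambda>n. B' (y n) k) \<longlonglongrightarrow> B x k" if "x \<in> S" "y \<longlonglongrightarrow> x" for x y k
    by (rule Lim_transform_eventually[OF evB[OF that]])
      (use topological_tendstoD[OF that(2) S that(1)] in \<open>eventually_elim, simp add: B'_def\<close>)
  have Jlim: "(\<lambda>n. J w (y n)) \<longlonglongrightarrow> J w x" if x: "x \<in> S" and y: "y \<longlonglongrightarrow> x" for w x y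
  proof (rule inverse_tendsto[OF lB[OF x] injB[OF x] lB' B'k[OF x y]])
    show "(\<lambda>n. B' (y n) (J w (y n))) \<longlonglongrightarrow> B x (J w x)"
      by (rule Lim_transform_eventually[OF tendsto_const])
        (use topological_tendstoD[OF y S x] in \<open>eventually_elim, simp add: B'_def J x\<close>)
  qed
  \<comment> \<open>Differentiating \<open>B y (J w y) = w\<close> gives the derivative of \<open>J w\<close>.\<close>
  define Q where "Q x w v = (\<Sum>j\<in>Basis. (\<Sum>k\<in>Basis. (J w x \<bullet> k) * frechet_derivative (\<lambda>y. b y k j) (at x) v) *\<^sub>R j)" for x w v
  have "Ck_on (Suc 0) (J w) S" for w
  proof (rule strict_derivative_C1[OF S])
    fix x y z h v assume x: "x \<in> S" and d: "displaces y z h x v"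
    note dd = displacesD[OF d]
    have ev: "\<forall>\<^sub>F n in sequentially. y n \<in> S \<and> z n \<in> S"
      using topological_tendstoD[OF dd(1) S x] topological_tendstoD[OF dd(5) S x] by eventually_elim simp
    have "B x (J (- Q x w v) x) = - Q x w v" by (rule J[OF x])
    moreover have "(\<lambda>n. - (\<Sum>j\<in>Basis. (\<Sum>k\<in>Basis. (J w (y n) \<bullet> k) * ((b (z n) k j - b (y n) k j) /\<^sub>R h n)) *\<^sub>R j)) \<longlonglongrightarrow> - Q x w v"
      unfolding Q_def
    proof (intro tendsto_intros Jlim x dd(1))
      fix j k
      from displacesD(4)[OF displaces_C1[OF C1 S x d, of k j]]
      show "(\<lambda>n. (b (z n) k j - b (y n) k j) /\<^sub>R h n) \<longlonglongrightarrow> frechet_derivative (\<lambda>y. b y k j) (at x) v" by simp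
    qed
    moreover have "\<forall>\<^sub>F n in sequentially. - (\<Sum>j\<in>Basis. (\<Sum>k\<in>Basis. (J w (y n) \<bullet> k) * ((b (z n) k j - b (y n) k j) /\<^sub>R h n)) *\<^sub>R j)
        = B' (z n) ((J w (z n) - J w (y n)) /\<^sub>R h n)"
      using ev
    proof eventually_elim
      case (elim n)
      have exp: "B u (J w (y n)) = (\<Sum>j\<in>Basis. (\<Sum>k\<in>Basis. (J w (y n) \<bullet> k) * b u k j) *\<^sub>R j)" if "u \<in> S" for u
        unfolding B_def using linear_eq_sum_Basis[OF l1[OF that], where v = "J w (y n)"] by simp
      have "B (z n) (J w (z n) - J w (y n)) = - (B (z n) (J w (y n)) - B (y n) (J w (y n)))"
        using elim J by (simp add: linear_diff[OF lB])
      also have "\<dots> = - (\<Sum>j\<in>Basis. (\<Sum>k\<in>Basis. (J w (y n) \<bullet> k) * (b (z n) k j - b (y n) k j)) *\<^sub>R j)"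
        using elim by (simp add: exp right_diff_distrib sum_subtractf scaleR_left_diff_distrib)
      finally have "B (z n) ((J w (z n) - J w (y n)) /\<^sub>R h n) = - (\<Sum>j\<in>Basis. (\<Sum>k\<in>Basis. (J w (y n) \<bullet> k) * (b (z n) k j - b (y n) k j)) *\<^sub>R j) /\<^sub>R h n"
        using elim by (simp add: linear_scale[OF lB])
      also have "\<dots> = - (\<Sum>j\<in>Basis. (\<Sum>k\<in>Basis. (J w (y n) \<bullet> k) * ((b (z n) k j - b (y n) k j) /\<^sub>R h n)) *\<^sub>R j)"
        by (simp add: scaleR_sum_right sum_distrib_left mult_ac)
      finally show ?case using elim by (simp add: B'_def)
    qed
    ultimately have "(\<lambda>n. B' (z n) ((J w (z n) - J w (y n)) /\<^sub>R h n)) \<longlonglongrightarrow> B x (J (- Q x w v) x)"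
      by (simp add: Lim_transform_eventually)
    then show "(\<lambda>n. (J w (z n) - J w (y n)) /\<^sub>R h n) \<longlonglongrightarrow> J (- Q x w v) x"
      by (rule inverse_tendsto[OF lB[OF x] injB[OF x] lB' B'k[OF x dd(5)]])
  qed
  moreover have "b y (J w y) v = w \<bullet> v" if "y \<in> S" for y w v using Bin[OF that, of "J w y" v] J[OF that] by simp
  ultimately show thesis using that by blast
qed

subsection \<open>Hamiltonian and gradient fields\<close>

text \<open>The derivatives are taken along lists of basis vectors, as in the generators of the \<open>C\<^sup>r\<close> topology.\<close>

definition C2_limit :: "(nat \<Rightarrow> 'e::euclidean_space \<Rightarrow> real) \<Rightarrow> ('e \<Rightarrow> real) \<Rightarrow> 'e set \<Rightarrow> bool" where
  "C2_limit f g B \<longleftrightarrow> (\<forall>e>0. \<forall>\<^sub>F n in sequentially. \<forall>y\<in>B. \<forall>vs. set vs \<subseteq> Basis \<and> length vs \<le> 2 \<longrightarrow>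
     \<bar>iter_deriv vs (f n) y - iter_deriv vs g y\<bar> < e)"

lemma C2_limit_partial:
  assumes lim: "C2_limit f g B" and f: "\<And>n. Ck_on 2 (f n) S" and "B \<subseteq> S" and i: "i \<in> Basis"
  shows "C1_limit (\<lambda>n y. frechet_derivative (f n) (at y) i) (\<lambda>y. frechet_derivative g (at y) i) B"
  unfolding C1_limit_def
proof (intro allI impI)
  fix e :: real assume "0 < e"
  from lim[unfolded C2_limit_def, rule_format, OF this]
  show "\<forall>\<^sub>F n in sequentially. \<forall>y\<in>B. (\<lambda>y. frechet_derivative (f n) (at y) i) differentiable (at y) \<and>
      norm (frechet_derivative (f n) (at y) i - frechet_derivative g (at y) i) \<le> e \<and>
     (\<forall>b\<in>Basis. norm (frechet_derivative (\<lambda>y. frechet_derivative (f n) (at y) i) (at y) b - frechet_derivative (\<lambda>y. frechet_derivative g (at y) i) (at y) b) \<le> e)"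
  proof eventually_elim
    case (elim n)
    show ?case
    proof (intro ballI conjI)
      fix y assume y: "y \<in> B"
      show "(\<lambda>y. frechet_derivative (f n) (at y) i) differentiable (at y)"
        using f[of n] y assms(3) by (auto simp: numeral_2_eq_2)
      show "norm (frechet_derivative (f n) (at y) i - frechet_derivative g (at y) i) \<le> e"
        using elim[rule_format, OF y, of "[i]"] i by simp
      fix b :: 'a assume "b \<in> Basis"
      then show "norm (frechet_derivative (\<lambda>y. frechet_derivative (f n) (at y) i) (at y) b - frechet_derivative (\<lambda>y. frechet_derivative g (at y) i) (at y) b) \<le> e"
        using elim[rule_format, OF y, of "[b, i]"] i by simp
    qed
  qed
qed

context closed_manifold
begin

lemma Ck_fun_mono: "Ck_fun A k N f \<Longrightarrow> j \<le> k \<Longrightarrow> Ck_fun A j N f"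
  unfolding Ck_fun_def using Ck_on_mono by blast

lemma Ck_fun_subset: "Ck_fun A k N f \<Longrightarrow> N' \<subseteq> N \<Longrightarrow> Ck_fun A k N' f"
  unfolding Ck_fun_def by (meson Ck_on_subset Int_mono image_mono subset_refl)

lemma C1_fun_isCont:
  assumes "Ck_fun A (Suc 0) N f" "open N" "x \<in> N" shows "isCont f x"
proof (rule isCont_sequentially)
  fix y assume y: "y \<longlonglongrightarrow> x"
  let ?c = "chart_at A x"
  have "Ck_on (Suc 0) (f \<circ> chart_inv ?c) (chart_map ?c ` (chart_dom ?c \<inter> N))"
    using assms(1) chart_at(1) unfolding Ck_fun_def by blast
  then have "isCont (f \<circ> chart_inv ?c) (chart_map ?c x)"
    using C1_continuous_on continuous_on_eq_continuous_at[OF open_chart_image[OF chart_at(1) assms(2)]] chart_at assms(3) by blast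
  from isCont_tendsto_compose[OF this conjunct2[OF iffD1[OF tendsto_chart[OF chart_at] y]]]
  have "(\<lambda>n. f (chart_inv ?c (chart_map ?c (y n)))) \<longlonglongrightarrow> f x" by (simp add: chart_at)
  then show "(\<lambda>n. f (y n)) \<longlonglongrightarrow> f x"
    by (rule Lim_transform_eventually)
      (rule eventually_mono[OF conjunct1[OF iffD1[OF tendsto_chart[OF chart_at] y]]], simp add: chart_at)
qed

lemma dfun_coord_vec:
  assumes "Ck_fun A (Suc 0) N f" "open N" "p \<in> N" "c \<in> A" "p \<in> chart_dom c"
  shows "dfun A f p (coord_vec A c p v) = frechet_derivative (f \<circ> chart_inv c) (at (chart_map c p)) v"
  using dfun_chart[OF assms] assms(4,5) by simp

lemma dfun_field_C1:
  assumes f: "Ck_fun A 2 N f" "open N" and X: "C1_field X"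
  shows "Ck_fun A (Suc 0) N (\<lambda>p. dfun A f p (X p))"
  unfolding Ck_fun_def
proof
  fix c assume c: "c \<in> A"
  let ?S = "chart_map c ` (chart_dom c \<inter> N)" and ?f = "f \<circ> chart_inv c"
  have f1: "Ck_fun A (Suc 0) N f" using Ck_fun_mono[OF f(1)] by simp
  have f2: "Ck_on (Suc (Suc 0)) ?f ?S" using f(1) c by (simp add: Ck_fun_def numeral_2_eq_2)
  have S: "open ?S" "?S \<subseteq> chart_img c" using open_chart_image[OF c f(2)] by auto
  have "Ck_on (Suc 0) (field_rep c X) ?S" using X c S(2) Ck_on_subset unfolding C1_field_def by blast
  then have "Ck_on (Suc 0) (\<lambda>y. \<Sum>b\<in>Basis. (field_rep c X y \<bullet> b) *\<^sub>R frechet_derivative ?f (at y) b) ?S"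
    using f2 by (intro C1_sum C1_scaleR C1_inner) auto
  then show "Ck_on (Suc 0) ((\<lambda>p. dfun A f p (X p)) \<circ> chart_inv c) ?S"
  proof (rule C1_cong[OF _ S(1)])
    fix y assume "y \<in> ?S"
    then obtain p where p: "p \<in> chart_dom c" "p \<in> N" "y = chart_map c p" by blast
    have "linear (frechet_derivative ?f (at y))"
      using f2 \<open>y \<in> ?S\<close> linear_frechet_derivative by auto
    from linear_eq_sum_Basis[OF this, of "field_rep c X y"]
    show "(\<Sum>b\<in>Basis. (field_rep c X y \<bullet> b) *\<^sub>R frechet_derivative ?f (at y) b) = ((\<lambda>p. dfun A f p (X p)) \<circ> chart_inv c) y"
      using dfun_chart[OF f1 f(2) p(2) c p(1), of "X p"] p c by (simp add: field_rep_def)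
  qed
qed

lemma C1_fun_compose:
  assumes f: "Ck_fun A (Suc 0) N f" "open N" and "\<And>x. x \<in> N \<Longrightarrow> (\<phi> has_real_derivative \<phi>' (f x)) (at (f x))" "continuous_on (f ` N) \<phi>'"
  shows "Ck_fun A (Suc 0) N (\<lambda>p. \<phi> (f p))"
  unfolding Ck_fun_def
proof
  fix c assume c: "c \<in> A"
  have "Ck_on (Suc 0) (\<lambda>x. \<phi> ((f \<circ> chart_inv c) x)) (chart_map c ` (chart_dom c \<inter> N))"
  proof (rule C1_real_compose[where f = "f \<circ> chart_inv c" and \<phi> = \<phi> and \<phi>' = \<phi>'])
    show "Ck_on (Suc 0) (f \<circ> chart_inv c) (chart_map c ` (chart_dom c \<inter> N))" using f c unfolding Ck_fun_def by blast
    show "continuous_on ((f \<circ> chart_inv c) ` chart_map c ` (chart_dom c \<inter> N)) \<phi>'"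
      by (rule continuous_on_subset[OF assms(4)]) (use c in auto)
  qed (use assms(3) c in auto)
  then show "Ck_on (Suc 0) ((\<lambda>p. \<phi> (f p)) \<circ> chart_inv c) (chart_map c ` (chart_dom c \<inter> N))" by (simp add: o_def)
qed

lemma C1_fun_mult:
  assumes "Ck_fun A (Suc 0) N f" "Ck_fun A (Suc 0) N g"
  shows "Ck_fun A (Suc 0) N (\<lambda>p. f p * g p)"
  unfolding Ck_fun_def
proof
  fix c assume c: "c \<in> A"
  have "Ck_on (Suc 0) (f \<circ> chart_inv c) (chart_map c ` (chart_dom c \<inter> N))" "Ck_on (Suc 0) (g \<circ> chart_inv c) (chart_map c ` (chart_dom c \<inter> N))"
    using assms c unfolding Ck_fun_def by blast+
  from C1_scaleR[OF this] show "Ck_on (Suc 0) ((\<lambda>p. f p * g p) \<circ> chart_inv c) (chart_map c ` (chart_dom c \<inter> N))" by (simp add: o_def)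
qed

lemma C1_field_scale:
  assumes "Ck_fun A (Suc 0) UNIV f" "C1_field X"
  shows "C1_field (\<lambda>p. f p *\<^sub>R X p)"
  unfolding C1_field_def
proof
  fix c assume c: "c \<in> A"
  have f: "Ck_on (Suc 0) (f \<circ> chart_inv c) (chart_img c)" using assms(1) c unfolding Ck_fun_def by force
  have X: "Ck_on (Suc 0) (field_rep c X) (chart_img c)" using assms(2) c unfolding C1_field_def by blast
  from C1_scaleR[OF f X]
  show "Ck_on (Suc 0) (field_rep c (\<lambda>p. f p *\<^sub>R X p)) (chart_img c)"
  proof (rule C1_cong[OF _ open_chart_img[OF c]])
    fix y assume "y \<in> chart_img c"
    then show "(f \<circ> chart_inv c) y *\<^sub>R field_rep c X y = field_rep c (\<lambda>p. f p *\<^sub>R X p) y"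
      using linear_comps[OF c chart_inv_in[OF c]] by (simp add: field_rep_def linear_scale)
  qed
qed

text \<open>With a symplectic form for \<open>\<beta>\<close>, \<open>ham_field\<close> is the Hamiltonian field; with a Riemannian metric it
  is the gradient.\<close>

context
  fixes \<beta> :: "'a \<Rightarrow> 'e \<Rightarrow> 'e \<Rightarrow> real"
  assumes \<beta>: "smooth_bilinear_field A \<beta>" and nondeg: "\<And>p u. (\<forall>v. \<beta> p u v = 0) \<Longrightarrow> u = 0"
begin

private lemma bil: "bilinear (\<beta> p)" using \<beta> by (simp add: smooth_bilinear_field_def)

private lemma nondeg_eq: "(\<And>v. \<beta> p u v = \<beta> p u' v) \<Longrightarrow> u = u'"
  using nondeg[of p "u - u'"] bil[of p] by (simp add: bilinear_lsub)

private lemma local_form_bilinear: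
  assumes c: "c \<in> A" and y: "y \<in> chart_img c"
  shows "bilinear (local_form A \<beta> c y)"
proof -
  have l: "linear (coord_vec A c (chart_inv c y))" by (rule linear_coord_vec[OF c chart_inv_in[OF c y]])
  show ?thesis
    unfolding bilinear_def local_form_def
    using linear_compose[OF l, of "\<lambda>u. \<beta> (chart_inv c y) u _"] linear_compose[OF l, of "\<lambda>v. \<beta> (chart_inv c y) _ v"] bil[of "chart_inv c y"]
    by (auto simp: bilinear_def o_def)
qed

lemma dual_frame:
  assumes c: "c \<in> A"
  obtains J where "\<And>w. Ck_on (Suc 0) (J w) (chart_img c)" "\<And>y w v. y \<in> chart_img c \<Longrightarrow> local_form A \<beta> c y (J w y) v = w \<bullet> v"
proof (rule dual_basis_C1[OF open_chart_img[OF c], of "local_form A \<beta> c"])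
  show "Ck_on (Suc 0) (\<lambda>y. local_form A \<beta> c y u v) (chart_img c)" for u v
    using \<beta> c unfolding smooth_bilinear_field_def by blast
  show "bilinear (local_form A \<beta> c y)" if "y \<in> chart_img c" for y by (rule local_form_bilinear[OF c that])
  show "u = 0" if y: "y \<in> chart_img c" and u: "\<And>v. local_form A \<beta> c y u v = 0" for y u
  proof -
    have p: "chart_inv c y \<in> chart_dom c" by (rule chart_inv_in[OF c y])
    have "\<beta> (chart_inv c y) (coord_vec A c (chart_inv c y) u) v = 0" for v
      using u[of "comps c (chart_inv c y) v"] c p by (simp add: local_form_def)
    then have "coord_vec A c (chart_inv c y) u = 0" using nondeg by blast
    then show "u = 0" using comps_coord_vec[OF c p, of u] linear_0[OF linear_comps[OF c p]] by simp
  qed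
qed blast

lemma ham_field_eqI:
  assumes "\<And>v. \<beta> p u v = dfun A H p v" shows "ham_field A \<beta> H p = u"
  unfolding ham_field_def
proof (rule the_equality)
  fix u' assume "\<forall>v. \<beta> p u' v = dfun A H p v"
  then show "u' = u" by (intro nondeg_eq[of p]) (simp add: assms)
qed (use assms in blast)

lemma ham_field_eq:
  assumes H: "Ck_fun A (Suc 0) N H" "open N" "p \<in> N"
  shows "\<beta> p (ham_field A \<beta> H p) v = dfun A H p v"
proof -
  let ?c = "chart_at A p" and ?y = "chart_map (chart_at A p) p"
  obtain J where J: "\<And>y w v. y \<in> chart_img ?c \<Longrightarrow> local_form A \<beta> ?c y (J w y) v = w \<bullet> v" by (rule dual_frame[OF chart_at(1)]) blast
  define w where "w = (\<Sum>i\<in>Basis. dfun A H p i *\<^sub>R i)"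
  have "\<beta> p (J w ?y) v = dfun A H p v" for v
  proof -
    have "\<beta> p (J w ?y) v = w \<bullet> v" using J[of ?y w v] by (simp add: local_form_def coord_vec_coord_change chart_at)
    also have "\<dots> = dfun A H p v"
      using linear_eq_sum_Basis[OF linear_dfun[OF H(1,3)], of v] by (simp add: w_def inner_sum_left inner_sum_right inner_commute mult.commute)
    finally show ?thesis .
  qed
  then show ?thesis using ham_field_eqI[of p "J w ?y" H] by simp
qed

text \<open>In a chart the field is a combination of a \<open>C\<^sup>1\<close> frame with the partial derivatives of \<open>H\<close> as
  coefficients.  Hence it loses one derivative, and \<open>C\<^sup>2\<close> convergence of functions gives \<open>C\<^sup>1\<close>
  convergence of fields.\<close>

lemma ham_field_rep:
  assumes c: "c \<in> A" and J: "\<And>y w v. y \<in> chart_img c \<Longrightarrow> local_form A \<beta> c y (J w y) v = w \<bullet> v"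
    and H: "Ck_fun A (Suc 0) UNIV H" and y: "y \<in> chart_img c"
  shows "field_rep c (ham_field A \<beta> H) y = (\<Sum>i\<in>Basis. frechet_derivative (H \<circ> chart_inv c) (at y) i *\<^sub>R J i y)"
proof -
  let ?p = "chart_inv c y" and ?u = "\<Sum>i\<in>Basis. frechet_derivative (H \<circ> chart_inv c) (at y) i *\<^sub>R J i y"
  have p: "?p \<in> chart_dom c" by (rule chart_inv_in[OF c y])
  have lin: "linear (frechet_derivative (H \<circ> chart_inv c) (at y))"
    using H c y linear_frechet_derivative unfolding Ck_fun_def by fastforce
  have "\<beta> ?p (coord_vec A c ?p ?u) v = dfun A H ?p v" for v
  proof -
    let ?v = "comps c ?p v"
    have l: "linear (\<lambda>u. local_form A \<beta> c y u ?v)" using local_form_bilinear[OF c y] by (simp add: bilinear_def)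
    have "\<beta> ?p (coord_vec A c ?p ?u) v = local_form A \<beta> c y ?u ?v" using c p by (simp add: local_form_def)
    also have "\<dots> = (\<Sum>i\<in>Basis. frechet_derivative (H \<circ> chart_inv c) (at y) i * (i \<bullet> ?v))"
      using linear_sum[OF l, of "\<lambda>i. frechet_derivative (H \<circ> chart_inv c) (at y) i *\<^sub>R J i y" Basis] linear_scale[OF l] J[OF y] by simp
    also have "\<dots> = frechet_derivative (H \<circ> chart_inv c) (at y) ?v"
      using linear_eq_sum_Basis[OF lin, of ?v] by (simp add: inner_commute mult.commute)
    also have "\<dots> = dfun A H ?p v" using dfun_chart[OF H open_UNIV UNIV_I c p, of v] c y by simp
    finally show ?thesis .
  qed
  from ham_field_eqI[OF this] show ?thesis using c p by (simp add: field_rep_def)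
qed

lemma ham_field_C1:
  assumes H: "Ck_fun A 2 UNIV H" shows "C1_field (ham_field A \<beta> H)"
  unfolding C1_field_def
proof
  fix c assume c: "c \<in> A"
  obtain J where J: "\<And>w. Ck_on (Suc 0) (J w) (chart_img c)" "\<And>y w v. y \<in> chart_img c \<Longrightarrow> local_form A \<beta> c y (J w y) v = w \<bullet> v"
    by (rule dual_frame[OF c]) blast
  have H1: "Ck_fun A (Suc 0) UNIV H" using Ck_fun_mono[OF H] by simp
  have "Ck_on (Suc (Suc 0)) (H \<circ> chart_inv c) (chart_img c)" using H c unfolding Ck_fun_def numeral_2_eq_2 by force
  then have "Ck_on (Suc 0) (\<lambda>y. \<Sum>i\<in>Basis. frechet_derivative (H \<circ> chart_inv c) (at y) i *\<^sub>R J i y) (chart_img c)"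
    by (intro C1_sum C1_scaleR J) auto
  then show "Ck_on (Suc 0) (field_rep c (ham_field A \<beta> H)) (chart_img c)"
    by (rule C1_cong[OF _ open_chart_img[OF c]]) (rule ham_field_rep[OF c J(2) H1, symmetric])
qed

lemma ham_field_limit:
  assumes Hn: "\<And>n. Ck_fun A 2 UNIV (Hn n)" and H: "Ck_fun A 2 UNIV H"
    and near: "\<And>p. \<exists>c\<in>A. \<exists>r>0. p \<in> chart_dom c \<and> cball (chart_map c p) r \<subseteq> chart_img c \<and>
      C2_limit (\<lambda>n. Hn n \<circ> chart_inv c) (H \<circ> chart_inv c) (cball (chart_map c p) r)"
  shows "field_limit (\<lambda>n. ham_field A \<beta> (Hn n)) (ham_field A \<beta> H)"
  unfolding field_limit_def
proof (intro conjI allI)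
  show "C1_field (ham_field A \<beta> H)" by (rule ham_field_C1[OF H])
  fix p
  obtain c r where c: "c \<in> A" and r: "0 < r" "p \<in> chart_dom c" "cball (chart_map c p) r \<subseteq> chart_img c"
    and lim: "C2_limit (\<lambda>n. Hn n \<circ> chart_inv c) (H \<circ> chart_inv c) (cball (chart_map c p) r)"
    using near by blast
  let ?B = "cball (chart_map c p) r" and ?S = "chart_img c"
  obtain J where J: "\<And>w. Ck_on (Suc 0) (J w) ?S" "\<And>y w v. y \<in> ?S \<Longrightarrow> local_form A \<beta> c y (J w y) v = w \<bullet> v"
    by (rule dual_frame[OF c]) blast
  have C2: "Ck_on 2 (K \<circ> chart_inv c) ?S" if "Ck_fun A 2 UNIV K" for K
    using that c unfolding Ck_fun_def by force
  have H1: "Ck_on (Suc 0) (\<lambda>y. frechet_derivative (H \<circ> chart_inv c) (at y) i) ?S" for i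
    using C2[OF H] by (simp add: numeral_2_eq_2)
  have "C1_limit (\<lambda>n y. frechet_derivative (Hn n \<circ> chart_inv c) (at y) i *\<^sub>R J i y) (\<lambda>y. frechet_derivative (H \<circ> chart_inv c) (at y) i *\<^sub>R J i y) ?B"
    if "i \<in> Basis" for i
    by (rule C1_limit_scaleR[OF C2_limit_partial[OF lim C2[OF Hn] r(3) that] H1 J(1) compact_cball r(3)])
  moreover have d: "(\<lambda>y. frechet_derivative (H \<circ> chart_inv c) (at y) i *\<^sub>R J i y) differentiable at y" if "y \<in> ?B" for i y
    using C1_differentiable[OF C1_scaleR[OF H1 J(1)]] that r(3) by blast
  ultimately have "C1_limit (\<lambda>n y. \<Sum>i\<in>Basis. frechet_derivative (Hn n \<circ> chart_inv c) (at y) i *\<^sub>R J i y)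
      (\<lambda>y. \<Sum>i\<in>Basis. frechet_derivative (H \<circ> chart_inv c) (at y) i *\<^sub>R J i y) ?B"
    by (intro C1_limit_sum) auto
  then have "C1_limit (\<lambda>n. field_rep c (ham_field A \<beta> (Hn n))) (field_rep c (ham_field A \<beta> H)) ?B"
  proof (rule C1_limit_cong[OF _ open_chart_img[OF c] r(3)])
    show "(\<lambda>y. \<Sum>i\<in>Basis. frechet_derivative (H \<circ> chart_inv c) (at y) i *\<^sub>R J i y) differentiable at y" if "y \<in> ?B" for y
      by (rule differentiable_sum) (use d[OF that] in auto)
  qed (use ham_field_rep[OF c J(2)] Ck_fun_mono[OF H] Ck_fun_mono[OF Hn] in auto)
  then have "field_limit_at c (chart_map c p) r (\<lambda>n. ham_field A \<beta> (Hn n)) (ham_field A \<beta> H)"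
    unfolding field_limit_at_def using ham_field_C1[OF Hn] by blast
  then show "\<exists>c\<in>A. \<exists>r>0. p \<in> chart_dom c \<and> cball (chart_map c p) r \<subseteq> chart_img c \<and>
     field_limit_at c (chart_map c p) r (\<lambda>n. ham_field A \<beta> (Hn n)) (ham_field A \<beta> H)" using c r by blast
qed

end

end

section \<open>Collars of regular energy levels\<close>

lemma DERIV_max_square: "((\<lambda>x::real. (max 0 x)\<^sup>2) has_real_derivative 2 * max 0 x) (at x)"
proof -
  consider "0 < x" | "x < 0" | "x = 0" by linarith
  then show ?thesis
  proof cases
    case 1
    have "((\<lambda>x::real. x\<^sup>2) has_real_derivative 2 * x) (at x)" by (auto intro!: derivative_eq_intros)
    then have "((\<lambda>x::real. (max 0 x)\<^sup>2) has_real_derivative 2 * x) (at x)"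
      by (rule has_field_derivative_transform_within_open[of _ _ _ "{0<..}"]) (use 1 in auto)
    then show ?thesis using 1 by simp
  next
    case 2
    have "((\<lambda>x::real. 0) has_real_derivative 0) (at x)" by simp
    then have "((\<lambda>x::real. (max 0 x)\<^sup>2) has_real_derivative 0) (at x)"
      by (rule has_field_derivative_transform_within_open[of _ _ _ "{..<0}"]) (use 2 in auto)
    then show ?thesis using 2 by simp
  next
    case 3
    have "((\<lambda>h::real. ((max 0 (0 + h))\<^sup>2 - (max 0 0)\<^sup>2) / h) \<longlongrightarrow> 0) (at 0)"
    proof (rule Lim_null_comparison[OF always_eventually])
      show "\<forall>h::real. norm (((max 0 (0 + h))\<^sup>2 - (max 0 0)\<^sup>2) / h) \<le> \<bar>h\<bar>"
        by (auto simp: max_def power2_eq_square)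
      show "((\<lambda>h::real. \<bar>h\<bar>) \<longlongrightarrow> 0) (at 0)" by (rule tendsto_rabs_zero[OF tendsto_ident_at])
    qed
    then show ?thesis using 3 by (simp add: DERIV_def)
  qed
qed

context closed_manifold
begin

lemma closed_imp_compact: "closed S \<Longrightarrow> compact (S :: 'a set)"
  using compact_Int_closed[OF compact_UNIV] by simp

text \<open>Near a regular level the gradient can be rescaled so that it increases the function at unit
  speed.  The factor \<open>1 / (s + (max 0 (m - s))\<^sup>2)\<close> is \<open>C\<^sup>1\<close> in \<open>s \<ge> 0\<close> and equals \<open>1 / s\<close> for \<open>s \<ge> m\<close>.\<close>

lemma unit_speed_field:
  assumes g: "riemannian_metric A g" and H: "Ck_fun A 2 UNIV H" and E: "closed E"
    and regular: "\<And>p. p \<in> E \<Longrightarrow> \<exists>v. dfun A H p v \<noteq> 0"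
  obtains Y Q where "C1_field Y" "open Q" "E \<subseteq> Q" "\<And>p. p \<in> Q \<Longrightarrow> dfun A H p (Y p) = 1"
proof -
  have sm: "smooth_bilinear_field A g" and pos: "\<And>p u. u \<noteq> 0 \<Longrightarrow> 0 < g p u u"
    using g by (auto simp: riemannian_metric_def)
  have bl: "bilinear (g p)" for p using sm by (simp add: smooth_bilinear_field_def)
  have nondeg: "u = 0" if "\<forall>v. g p u v = 0" for p u using that pos[of u p] by (metis less_irrefl)
  have H1: "Ck_fun A (Suc 0) UNIV H" using Ck_fun_mono[OF H] by simp
  let ?G = "ham_field A g H"
  define s where "s p = dfun A H p (?G p)" for p
  have G: "C1_field ?G" by (rule ham_field_C1[OF sm nondeg H]) 
  have Gg: "g p (?G p) v = dfun A H p v" for p v by (rule ham_field_eq[OF sm nondeg H1 open_UNIV UNIV_I])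
  have s_C1: "Ck_fun A (Suc 0) UNIV s" unfolding s_def by (rule dfun_field_C1[OF H open_UNIV G])
  have s_eq: "s p = g p (?G p) (?G p)" for p by (simp add: s_def Gg)
  have s0: "0 \<le> s p" for p using pos[of "?G p" p] bl[of p] by (cases "?G p = 0") (auto simp: s_eq bilinear_lzero)
  have spos: "0 < s p" if "p \<in> E" for p
  proof -
    obtain v where "dfun A H p v \<noteq> 0" using regular[OF \<open>p \<in> E\<close>] by blast
    then have "?G p \<noteq> 0" using Gg[of p v] bl[of p] by (metis bilinear_lzero)
    then show ?thesis using pos s_eq by simp
  qed
  have s_cont: "continuous_on UNIV s"
    by (rule continuous_at_imp_continuous_on) (use C1_fun_isCont[OF s_C1 open_UNIV] in auto)
  obtain m where m: "0 < m" "\<And>p. p \<in> E \<Longrightarrow> m < s p"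
  proof (cases "E = {}")
    case True then show thesis using that[of 1] by simp
  next
    case False
    obtain p where p: "p \<in> E" "\<And>q. q \<in> E \<Longrightarrow> s p \<le> s q"
      using continuous_attains_inf[OF closed_imp_compact[OF E] False continuous_on_subset[OF s_cont subset_UNIV]] by blast
    show thesis
    proof (rule that[of "s p / 2"])
      show "s p / 2 < s q" if "q \<in> E" for q using p(2)[OF that] spos[OF p(1)] by linarith
    qed (use spos[OF p(1)] in simp)
  qed
  define \<rho> where "\<rho> x = inverse (x + (max 0 (m - x))\<^sup>2)" for x :: real
  have den: "0 < x + (max 0 (m - x))\<^sup>2" if "0 \<le> x" for x using that m(1) by (cases "x = 0") (auto simp: add_pos_nonneg)
  define Y where "Y p = \<rho> (s p) *\<^sub>R ?G p" for p
  have "Ck_fun A (Suc 0) UNIV (\<lambda>p. \<rho> (s p))"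
  proof (rule C1_fun_compose[OF s_C1 open_UNIV])
    fix p
    have d: "((\<lambda>x. x + (max 0 (m - x))\<^sup>2) has_real_derivative 1 + 2 * max 0 (m - s p) * (0 - 1)) (at (s p))"
      by (intro DERIV_add DERIV_ident DERIV_chain'[OF DERIV_diff[OF DERIV_const DERIV_ident] DERIV_max_square])
    show "(\<rho> has_real_derivative - (inverse (s p + (max 0 (m - s p))\<^sup>2) * (1 - 2 * max 0 (m - s p)) * inverse (s p + (max 0 (m - s p))\<^sup>2))) (at (s p))"
      unfolding \<rho>_def using DERIV_inverse'[OF d] den[OF s0[of p]] by simp
  next
    show "continuous_on (range s) (\<lambda>x. - (inverse (x + (max 0 (m - x))\<^sup>2) * (1 - 2 * max 0 (m - x)) * inverse (x + (max 0 (m - x))\<^sup>2)))"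
      using den s0 by (intro continuous_intros) (auto simp: less_le)
  qed
  then have "C1_field Y" unfolding Y_def by (rule C1_field_scale[OF _ G])
  moreover have "open (s -` {m<..})" by (rule open_vimage[OF open_greaterThan s_cont])
  moreover have "E \<subseteq> s -` {m<..}" using m(2) by auto
  moreover have "dfun A H p (Y p) = 1" if "p \<in> s -` {m<..}" for p
  proof -
    have "dfun A H p (Y p) = \<rho> (s p) * s p"
      using linear_scale[OF linear_dfun[OF H1 UNIV_I]] by (simp add: Y_def s_def)
    then show ?thesis using that m(1) by (simp add: \<rho>_def max_def)
  qed
  ultimately show thesis by (rule that)
qed

text \<open>Otherwise points of \<open>K\<close> that leave \<open>U\<close> at times tending to zero would accumulate at a point of \<open>K\<close>
  outside of \<open>U\<close>.\<close>

lemma flow_stays: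
  assumes X: "C1_field X" and K: "closed K" and U: "open U" "K \<subseteq> U"
  obtains d where "0 < d" "\<And>p t. p \<in> K \<Longrightarrow> \<bar>t\<bar> \<le> d \<Longrightarrow> flow A X t p \<in> U"
proof -
  have "\<exists>d>0. \<forall>p\<in>K. \<forall>t. \<bar>t\<bar> \<le> d \<longrightarrow> flow A X t p \<in> U"
  proof (rule ccontr)
    assume neg: "\<not> ?thesis"
    have "\<exists>p t. p \<in> K \<and> \<bar>t\<bar> \<le> inverse (real (Suc n)) \<and> flow A X t p \<notin> U" for n
      using neg[unfolded not_ex, rule_format, of "inverse (real (Suc n))"] by auto
    then obtain p t where p: "\<And>n. p n \<in> K" "\<And>n. \<bar>t n\<bar> \<le> inverse (real (Suc n))" "\<And>n. flow A X (t n) (p n) \<notin> U" by metis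
    have t: "t \<longlonglongrightarrow> 0" by (rule Lim_null_comparison[OF _ LIMSEQ_inverse_real_of_nat]) (use p(2) in simp)
    obtain q s where s: "strict_mono s" "(p \<circ> s) \<longlonglongrightarrow> q" by (rule convergent_subsequence[of p])
    have "q \<in> K" by (rule closed_sequentially[OF K _ s(2)]) (use p in simp)
    have "(\<lambda>n. flow A X (t (s n)) ((p \<circ> s) n)) \<longlonglongrightarrow> flow A X 0 q"
      by (rule flow_tendsto[OF field_limit_const[OF X] s(2)]) (use LIMSEQ_subseq_LIMSEQ[OF t s(1)] in \<open>simp add: o_def\<close>)
    then have "(\<lambda>n. flow A X (t (s n)) (p (s n))) \<longlonglongrightarrow> q" using X by simp
    from topological_tendstoD[OF this U(1)] \<open>q \<in> K\<close> U(2) show False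
      using p(3) by (auto simp: eventually_sequentially)
  qed
  then show thesis using that by blast
qed

end

text \<open>A component \<open>E0\<close> of an energy level and a field \<open>Y\<close> that increases the energy at unit speed near it.
  The pieces of orbits of \<open>Y\<close> of length less than \<open>\<delta>\<close> on both sides of \<open>E0\<close> form the collar.\<close>

locale level_collar = closed_manifold A for A :: "('a::t2_space, 'e::euclidean_space) chart set" +
  fixes H0 :: "'a \<Rightarrow> real" and e0 :: real and E0 :: "'a set" and Y :: "'a \<Rightarrow> 'e" and Q :: "'a set" and \<delta> :: real
  assumes H0_C2: "Ck_fun A 2 UNIV H0" and E0: "E0 \<in> components (H0 -` {e0})"
    and Y: "C1_field Y" and Q: "open Q" "E0 \<subseteq> Q" and unit: "\<And>p. p \<in> Q \<Longrightarrow> dfun A H0 p (Y p) = 1"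
    and \<delta>: "0 < \<delta>" and stays: "\<And>p t. p \<in> E0 \<Longrightarrow> \<bar>t\<bar> \<le> \<delta> \<Longrightarrow> flow A Y t p \<in> Q"
begin

abbreviation \<psi> where "\<psi> \<equiv> flow A Y"

definition tube :: "real \<Rightarrow> 'a set" where "tube d = {\<psi> t p | t p. p \<in> E0 \<and> \<bar>t\<bar> < d}"

definition ctube :: "real \<Rightarrow> 'a set" where "ctube d = {\<psi> t p | t p. p \<in> E0 \<and> \<bar>t\<bar> \<le> d}"

text \<open>Slides a point along \<open>Y\<close> to the energy \<open>e0\<close>.\<close>

definition proj :: "'a \<Rightarrow> 'a" where "proj z = \<psi> (- (H0 z - e0)) z"

lemma H0_C1: "Ck_fun A (Suc 0) UNIV H0" using Ck_fun_mono[OF H0_C2] by simp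

lemma H0_isCont: "isCont H0 p" by (rule C1_fun_isCont[OF H0_C1 open_UNIV UNIV_I])

lemma H0_cont: "continuous_on UNIV H0"
  by (rule continuous_at_imp_continuous_on) (use H0_isCont in auto)

lemma E0_level: "p \<in> E0 \<Longrightarrow> H0 p = e0" using in_components_subset[OF E0] by auto

lemma E0_closed: "closed E0" by (rule closed_components[OF closed_vimage[OF closed_singleton H0_cont] E0])

lemma E0_nonempty: "E0 \<noteq> {}" using in_components_nonempty[OF E0] .

lemma \<psi>_tendsto: "y \<longlonglongrightarrow> x \<Longrightarrow> t \<longlonglongrightarrow> t0 \<Longrightarrow> (\<lambda>n. \<psi> (t n) (y n)) \<longlonglongrightarrow> \<psi> t0 x"
  by (rule flow_tendsto[OF field_limit_const[OF Y]])

lemmas \<psi>_simps [simp] = flow_0[OF Y] flow_uminus[OF Y]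

lemma H0_along:
  assumes "\<And>s. \<bar>s\<bar> \<le> \<bar>t\<bar> \<Longrightarrow> \<psi> s p \<in> Q"
  shows "H0 (\<psi> t p) = H0 p + t"
proof -
  have d: "((\<lambda>s. H0 (\<psi> s p) - s) has_real_derivative 1 - 1) (at s)" if "\<bar>s\<bar> \<le> \<bar>t\<bar>" for s
    by (rule DERIV_diff[OF _ DERIV_ident])
      (use velocity_fun[OF H0_C1 open_UNIV UNIV_I flow_velocity[OF Y], of p s] unit[OF assms[OF that]] in simp)
  have "\<exists>c. \<forall>s\<in>{- \<bar>t\<bar>..\<bar>t\<bar>}. H0 (\<psi> s p) - s = c"
  proof (rule has_derivative_zero_constant)
    fix s assume s: "s \<in> {- \<bar>t\<bar>..\<bar>t\<bar>}"
    have "((*) (0::real)) = (\<lambda>h. 0)" by auto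
    then show "((\<lambda>s. H0 (\<psi> s p) - s) has_derivative (\<lambda>h. 0)) (at s within {- \<bar>t\<bar>..\<bar>t\<bar>})"
      using d[of s] s by (auto simp: has_field_derivative_def intro: has_derivative_at_withinI)
  qed simp
  then obtain c where "\<And>s. s \<in> {- \<bar>t\<bar>..\<bar>t\<bar>} \<Longrightarrow> H0 (\<psi> s p) - s = c" by blast
  moreover have "t \<in> {- \<bar>t\<bar>..\<bar>t\<bar>}" "0 \<in> {- \<bar>t\<bar>..\<bar>t\<bar>}" by (simp_all, linarith)
  ultimately have "H0 (\<psi> t p) - t = H0 (\<psi> 0 p) - 0" by blast
  then show ?thesis by simp
qed

lemma H0_tube: "p \<in> E0 \<Longrightarrow> \<bar>t\<bar> \<le> \<delta> \<Longrightarrow> H0 (\<psi> t p) = e0 + t"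
  using H0_along[of t p] stays E0_level by simp

lemma proj_\<psi>: "p \<in> E0 \<Longrightarrow> \<bar>t\<bar> \<le> \<delta> \<Longrightarrow> proj (\<psi> t p) = p"
  by (simp add: proj_def H0_tube)

lemma proj_tendsto: "y \<longlonglongrightarrow> x \<Longrightarrow> (\<lambda>n. proj (y n)) \<longlonglongrightarrow> proj x"
  unfolding proj_def by (intro \<psi>_tendsto tendsto_intros isCont_tendsto_compose[OF H0_isCont])

lemma proj_isCont: "isCont proj x"
  by (rule isCont_sequentially) (rule proj_tendsto)

text \<open>A component of a regular level is open in the level: moving along \<open>Y\<close> retracts a small coordinate
  ball onto a connected part of the level.\<close>

lemma E0_isolated: obtains W where "open W" "E0 \<subseteq> W" "W \<inter> H0 -` {e0} \<subseteq> E0"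
proof -
  have "\<exists>W. open W \<and> x \<in> W \<and> W \<inter> H0 -` {e0} \<subseteq> E0" if x: "x \<in> E0" for x
  proof -
    let ?c = "chart_at A x"
    have xO: "x \<in> Q" using Q(2) x by blast
    have "open (chart_map ?c ` (chart_dom ?c \<inter> Q))" by (rule open_chart_image[OF chart_at(1) Q(1)])
    moreover have "chart_map ?c x \<in> chart_map ?c ` (chart_dom ?c \<inter> Q)" using xO chart_at by blast
    ultimately obtain r where r: "0 < r" "cball (chart_map ?c x) r \<subseteq> chart_map ?c ` (chart_dom ?c \<inter> Q)"
      using open_contains_cball by blast
    let ?K = "chart_inv ?c ` cball (chart_map ?c x) r"
    have sub: "cball (chart_map ?c x) r \<subseteq> chart_img ?c" using r(2) by blast
    have cK: "continuous_on (cball (chart_map ?c x) r) (chart_inv ?c)"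
      by (rule continuous_on_subset[OF continuous_chart_inv[OF chart_at(1)] sub])
    have "compact ?K" by (rule compact_continuous_image[OF cK compact_cball])
    then have "closed ?K" by (rule compact_imp_closed)
    moreover have KO: "?K \<subseteq> Q" using r(2) chart_at(1) by force
    ultimately obtain d where d: "0 < d" "\<And>p t. p \<in> ?K \<Longrightarrow> \<bar>t\<bar> \<le> d \<Longrightarrow> \<psi> t p \<in> Q"
      by (rule flow_stays[OF Y _ Q(1)]) blast
    have "isCont (H0 \<circ> chart_inv ?c) (chart_map ?c x)"
      by (rule continuous_at_compose[OF isCont_chart_inv[OF chart_at(1)] H0_isCont]) (simp add: chart_at)
    then obtain r2 where r2: "0 < r2" "\<And>y. dist y (chart_map ?c x) < r2 \<Longrightarrow> \<bar>H0 (chart_inv ?c y) - e0\<bar> < d"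
      using d(1) E0_level[OF x] chart_at unfolding continuous_at_eps_delta dist_real_def by (auto simp: o_def)
    define B where "B = ball (chart_map ?c x) (min r r2)"
    have B: "y \<in> B \<Longrightarrow> chart_inv ?c y \<in> ?K" "y \<in> B \<Longrightarrow> \<bar>H0 (chart_inv ?c y) - e0\<bar> < d" for y
      using r2(2)[of y] by (auto simp: B_def dist_commute)
    let ?C = "proj ` chart_inv ?c ` B"
    have "connected ?C"
    proof (rule connected_continuous_image, rule continuous_at_imp_continuous_on)
      show "connected (chart_inv ?c ` B)"
        by (rule connected_continuous_image[OF continuous_on_subset[OF cK]]) (auto simp: B_def)
    qed (use proj_isCont in auto)
    moreover have "?C \<subseteq> H0 -` {e0}"
    proof clarify
      fix y assume y: "y \<in> B"
      let ?q = "chart_inv ?c y"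
      have "H0 (\<psi> (- (H0 ?q - e0)) ?q) = H0 ?q + - (H0 ?q - e0)"
        by (rule H0_along) (use d(2)[OF B(1)[OF y]] B(2)[OF y] in auto)
      then show "proj ?q \<in> H0 -` {e0}" by (simp add: proj_def)
    qed
    moreover have "x \<in> ?C"
    proof -
      have "chart_map ?c x \<in> B" using r r2 by (simp add: B_def)
      moreover have "proj x = x" using E0_level[OF x] by (simp add: proj_def)
      ultimately show ?thesis using chart_inv_map[OF chart_at] by (metis image_eqI)
    qed
    ultimately have "?C \<subseteq> E0" using components_maximal[OF E0] x by blast
    moreover have "q \<in> ?C" if "q \<in> chart_dom ?c" "chart_map ?c q \<in> B" "H0 q = e0" for q
    proof -
      have "proj q = q" using that(3) by (simp add: proj_def)
      then show ?thesis using chart_inv_map[OF chart_at(1) that(1)] that(2) by (metis image_eqI)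
    qed
    ultimately have "{q \<in> chart_dom ?c. chart_map ?c q \<in> B} \<inter> H0 -` {e0} \<subseteq> E0" by blast
    moreover have "open {q \<in> chart_dom ?c. chart_map ?c q \<in> B}" "x \<in> {q \<in> chart_dom ?c. chart_map ?c q \<in> B}"
      unfolding B_def using open_chart_ball[OF chart_at, of "min r r2" x] r(1) r2(1) by simp_all
    ultimately show ?thesis by blast
  qed
  then obtain W where W: "\<And>x. x \<in> E0 \<Longrightarrow> open (W x) \<and> x \<in> W x \<and> W x \<inter> H0 -` {e0} \<subseteq> E0" by metis
  show thesis by (rule that[of "\<Union>x\<in>E0. W x"]) (use W in auto)
qed

text \<open>A point near \<open>\<psi> s p\<close> flows back to a point near \<open>p\<close>, which slides into the level along \<open>Y\<close>, and
  hence into \<open>E0\<close> by \<open>E0_isolated\<close>.\<close>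

lemma tube_eventually:
  assumes p: "p \<in> E0" and s: "\<bar>s\<bar> < d" and z: "z \<longlonglongrightarrow> \<psi> s p"
  shows "\<forall>\<^sub>F n in sequentially. z n \<in> tube d"
proof -
  obtain W where W: "open W" "E0 \<subseteq> W" "W \<inter> H0 -` {e0} \<subseteq> E0" by (rule E0_isolated)
  \<comment> \<open>A closed neighbourhood of \<open>p\<close> whose short orbits stay in \<open>Q\<close>.\<close>
  let ?c = "chart_at A p"
  have pO: "p \<in> Q" using Q(2) p by blast
  have "open (chart_map ?c ` (chart_dom ?c \<inter> Q))" by (rule open_chart_image[OF chart_at(1) Q(1)])
  moreover have "chart_map ?c p \<in> chart_map ?c ` (chart_dom ?c \<inter> Q)" using pO chart_at by blast
  ultimately obtain r where r: "0 < r" "cball (chart_map ?c p) r \<subseteq> chart_map ?c ` (chart_dom ?c \<inter> Q)"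
    using open_contains_cball by blast
  let ?K = "chart_inv ?c ` cball (chart_map ?c p) r"
  have sub: "cball (chart_map ?c p) r \<subseteq> chart_img ?c" using r(2) by blast
  have "compact ?K"
    by (rule compact_continuous_image[OF continuous_on_subset[OF continuous_chart_inv[OF chart_at(1)] sub] compact_cball])
  then have "closed ?K" by (rule compact_imp_closed)
  moreover have KO: "?K \<subseteq> Q" using r(2) chart_at(1) by force
  ultimately obtain e where e: "0 < e" "\<And>p t. p \<in> ?K \<Longrightarrow> \<bar>t\<bar> \<le> e \<Longrightarrow> \<psi> t p \<in> Q"
    by (rule flow_stays[OF Y _ Q(1)]) blast
  let ?W = "{q \<in> chart_dom ?c. chart_map ?c q \<in> ball (chart_map ?c p) r}"
  have nb: "open ?W" "p \<in> ?W" using open_chart_ball[OF chart_at r(1)] by auto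
  have WK: "?W \<subseteq> ?K"
  proof
    fix q assume q: "q \<in> ?W"
    then have "q = chart_inv ?c (chart_map ?c q)" by (simp add: chart_at)
    moreover have "chart_map ?c q \<in> cball (chart_map ?c p) r" using q by auto
    ultimately show "q \<in> ?K" by (rule image_eqI)
  qed
  define y where "y n = \<psi> (- s) (z n)" for n
  have y: "y \<longlonglongrightarrow> p" using \<psi>_tendsto[OF z tendsto_const, of "- s"] by (simp add: y_def[abs_def])
  have Hy: "(\<lambda>n. H0 (y n) - e0) \<longlonglongrightarrow> 0"
    using tendsto_diff[OF isCont_tendsto_compose[OF H0_isCont y] tendsto_const, of e0] E0_level[OF p] by simp
  have py: "(\<lambda>n. proj (y n)) \<longlonglongrightarrow> p" using proj_tendsto[OF y] E0_level[OF p] by (simp add: proj_def)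
  have "(\<lambda>n. \<bar>s + (H0 (y n) - e0)\<bar>) \<longlonglongrightarrow> \<bar>s + 0\<bar>" by (intro tendsto_intros Hy)
  then have "\<forall>\<^sub>F n in sequentially. \<bar>s + (H0 (y n) - e0)\<bar> < d" by (rule order_tendstoD) (use s in simp)
  moreover have "\<forall>\<^sub>F n in sequentially. \<bar>H0 (y n) - e0\<bar> < e" using tendsto_rabs[OF Hy] by (rule order_tendstoD) (use e in simp)
  moreover have "\<forall>\<^sub>F n in sequentially. y n \<in> ?W" using topological_tendstoD[OF y nb] .
  moreover have "\<forall>\<^sub>F n in sequentially. proj (y n) \<in> W" using topological_tendstoD[OF py W(1)] W(2) p by blast
  ultimately show ?thesis
  proof eventually_elim
    case (elim n)
    have "H0 (\<psi> (- (H0 (y n) - e0)) (y n)) = H0 (y n) + - (H0 (y n) - e0)"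
      by (rule H0_along) (use e(2)[of "y n"] WK elim in auto)
    then have "proj (y n) \<in> E0" using W(3) elim by (auto simp: proj_def)
    moreover have "z n = \<psi> (s + (H0 (y n) - e0)) (proj (y n))"
      by (simp add: proj_def y_def flow_add[OF Y, symmetric])
    ultimately show ?case using elim unfolding tube_def by blast
  qed
qed

lemma open_tube: "open (tube d)"
proof -
  have "closed (- tube d)"
  proof (rule seq_closed_imp_closed)
    fix x l assume x: "\<forall>n. x n \<in> - tube d" and l: "x \<longlonglongrightarrow> l"
    show "l \<in> - tube d"
    proof
      assume "l \<in> tube d"
      then obtain t p where "l = \<psi> t p" "p \<in> E0" "\<bar>t\<bar> < d" by (auto simp: tube_def)
      from tube_eventually[OF this(2,3)] l this(1) show False using x by (auto simp: eventually_sequentially)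
    qed
  qed
  then show ?thesis by (simp add: closed_def)
qed

lemma ctube_subseq:
  assumes "\<And>n. x n \<in> ctube (d n)" "d \<longlonglongrightarrow> d0"
  obtains s l where "strict_mono s" "(x \<circ> s) \<longlonglongrightarrow> l" "l \<in> ctube d0"
proof -
  have "\<forall>n. \<exists>t p. x n = \<psi> t p \<and> p \<in> E0 \<and> \<bar>t\<bar> \<le> d n" using assms(1) by (auto simp: ctube_def)
  then obtain t p where tp: "\<And>n. x n = \<psi> (t n) (p n)" "\<And>n. p n \<in> E0" "\<And>n. \<bar>t n\<bar> \<le> d n" by metis
  obtain q s1 where s1: "strict_mono s1" "(p \<circ> s1) \<longlonglongrightarrow> q" by (rule convergent_subsequence[of p])
  have q: "q \<in> E0" by (rule closed_sequentially[OF E0_closed _ s1(2)]) (use tp in simp)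
  obtain K where K: "\<And>n. \<bar>d n\<bar> \<le> K" using convergent_imp_Bseq[of d] assms(2) unfolding convergent_def Bseq_def by (auto simp: real_norm_def)
  have "(t \<circ> s1) n \<in> {- K..K}" for n using tp(3)[of "s1 n"] K[of "s1 n"] by auto
  then obtain t0 s2 where s2: "strict_mono s2" "((t \<circ> s1) \<circ> s2) \<longlonglongrightarrow> t0"
    using compact_Icc[of "- K" K] unfolding compact_def by metis
  have "(\<lambda>n. \<bar>t (s1 (s2 n))\<bar>) \<longlonglongrightarrow> \<bar>t0\<bar>" using tendsto_rabs[OF s2(2)] by (simp add: o_def)
  moreover have "(\<lambda>n. d (s1 (s2 n))) \<longlonglongrightarrow> d0"
    using LIMSEQ_subseq_LIMSEQ[OF assms(2) strict_mono_o[OF s1(1) s2(1)]] by (simp add: o_def)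
  ultimately have t0: "\<bar>t0\<bar> \<le> d0" by (rule LIMSEQ_le) (use tp(3) in blast)
  have "(\<lambda>n. \<psi> (((t \<circ> s1) \<circ> s2) n) (((p \<circ> s1) \<circ> s2) n)) \<longlonglongrightarrow> \<psi> t0 q"
    by (rule \<psi>_tendsto[OF LIMSEQ_subseq_LIMSEQ[OF s1(2) s2(1)] s2(2)])
  then have "(x \<circ> (s1 \<circ> s2)) \<longlonglongrightarrow> \<psi> t0 q" by (simp add: o_def tp(1))
  then show thesis using that[OF strict_mono_o[OF s1(1) s2(1)]] q t0 by (auto simp: ctube_def)
qed

lemma closed_ctube: "closed (ctube d)"
proof (rule seq_closed_imp_closed)
  fix x l assume x: "\<forall>n. x n \<in> ctube d" and l: "x \<longlonglongrightarrow> l"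
  obtain s l' where "strict_mono s" "(x \<circ> s) \<longlonglongrightarrow> l'" "l' \<in> ctube d"
    by (rule ctube_subseq[of x "\<lambda>n. d" d]) (use x in auto)
  then show "l \<in> ctube d" using LIMSEQ_unique[OF LIMSEQ_subseq_LIMSEQ[OF l]] by metis
qed

lemma E0_subset_tube: "0 < d \<Longrightarrow> E0 \<subseteq> tube d"
  unfolding tube_def by (force intro: exI[of _ 0])

lemma tube_ctube: "tube d \<subseteq> ctube d" by (force simp: tube_def ctube_def)

subsection \<open>The collar is a tubular neighborhood\<close>

lemma proj_mdisp:
  assumes "mdisp y z h x v"
  shows "mdisp (\<lambda>n. proj (y n)) (\<lambda>n. proj (z n)) h (proj x)
    (tangent_map A (\<psi> (- (H0 x - e0))) x v + (- dfun A H0 x v) *\<^sub>R Y (proj x))"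
  unfolding proj_def
proof (rule flow_mdisp_time[OF Y assms])
  show "(\<lambda>n. - (H0 (y n) - e0)) \<longlonglongrightarrow> - (H0 x - e0)" "(\<lambda>n. - (H0 (z n) - e0)) \<longlonglongrightarrow> - (H0 x - e0)"
    by (intro tendsto_intros isCont_tendsto_compose[OF H0_isCont] mdispD[OF assms])+
  have "(\<lambda>n. - ((H0 (z n) - H0 (y n)) / h n)) \<longlonglongrightarrow> - dfun A H0 x v"
    by (intro tendsto_intros mdisp_fun[OF H0_C1 open_UNIV UNIV_I assms])
  then show "(\<lambda>n. (- (H0 (z n) - e0) - - (H0 (y n) - e0)) / h n) \<longlonglongrightarrow> - dfun A H0 x v"
    by (simp add: minus_divide_left[symmetric] del: minus_divide_left) (simp add: minus_divide_left)
qed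

lemma proj_C1: "Ck_map A 1 U proj" if U: "open U"
  unfolding Ck_map_def
proof (intro conjI ballI)
  show "continuous_on U proj" by (rule continuous_at_imp_continuous_on) (use proj_isCont in auto)
  fix c d assume c: "c \<in> A" and d: "d \<in> A"
  let ?S = "chart_map c ` (chart_dom c \<inter> U \<inter> proj -` chart_dom d)"
  have "open (proj -` chart_dom d)"
    by (rule open_vimage[OF open_chart_dom[OF d]]) (rule continuous_at_imp_continuous_on, use proj_isCont in auto)
  then have "open (chart_map c ` (chart_dom c \<inter> (U \<inter> proj -` chart_dom d)))" by (intro open_chart_image[OF c] open_Int U)
  then have S: "open ?S" by (simp add: Int_assoc)
  define D where "D y v = (let x = chart_inv c y; w = coord_vec A c x v in
     comps d (proj x) (tangent_map A (\<psi> (- (H0 x - e0))) x w + (- dfun A H0 x w) *\<^sub>R Y (proj x)))" for y v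
  have "Ck_on (Suc 0) (chart_map d \<circ> proj \<circ> chart_inv c) ?S"
  proof (rule strict_derivative_C1[OF S, of _ D])
    fix y' y z h v assume "y' \<in> ?S" and disp: "displaces y z h y' v"
    then obtain x where x: "x \<in> chart_dom c" "proj x \<in> chart_dom d" "y' = chart_map c x" by blast
    have "mdisp (\<lambda>n. chart_inv c (y n)) (\<lambda>n. chart_inv c (z n)) h x (coord_vec A c x v)"
      by (rule mdisp_chart_inv[OF c x(1)]) (use disp x(3) in simp)
    from displacesD(4)[OF mdisp_chart[OF proj_mdisp[OF this] d x(2)]]
    show "(\<lambda>n. ((chart_map d \<circ> proj \<circ> chart_inv c) (z n) - (chart_map d \<circ> proj \<circ> chart_inv c) (y n)) /\<^sub>R h n) \<longlonglongrightarrow> D y' v"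
      using c x by (simp add: D_def Let_def)
  qed
  then show "Ck_on 1 (chart_map d \<circ> proj \<circ> chart_inv c) ?S" by simp
qed

lemma tubular_neighborhood_tube: "tubular_neighborhood A E0 (tube \<delta>)"
  unfolding tubular_neighborhood_def
proof (intro conjI exI[of _ proj] exI[of _ "\<lambda>z. (H0 z - e0) / \<delta>"])
  let ?\<sigma> = "\<lambda>z. (H0 z - e0) / \<delta>"
  show "open (tube \<delta>)" "E0 \<subseteq> tube \<delta>" using open_tube E0_subset_tube[OF \<delta>] by auto
  show "Ck_map A 1 (tube \<delta>) proj" by (rule proj_C1[OF open_tube])
  have \<sigma>: "Ck_fun A (Suc 0) (tube \<delta>) ?\<sigma>"
    by (rule C1_fun_compose[OF Ck_fun_subset[OF H0_C1 subset_UNIV] open_tube, where \<phi> = "\<lambda>x. (x - e0) / \<delta>" and \<phi>' = "\<lambda>x. 1 / \<delta>"])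
      (use \<delta> in \<open>auto intro!: derivative_eq_intros\<close>)
  then show "Ck_fun A 1 (tube \<delta>) ?\<sigma>" by simp
  show "\<forall>x\<in>E0. proj x = x \<and> ?\<sigma> x = 0" using E0_level by (simp add: proj_def)
  show "bij_betw (\<lambda>z. (proj z, ?\<sigma> z)) (tube \<delta>) (E0 \<times> {-1<..<1})"
  proof (rule bij_betw_byWitness[where f' = "\<lambda>(p, u). \<psi> (\<delta> * u) p"])
    show "\<forall>z\<in>tube \<delta>. (\<lambda>(p, u). \<psi> (\<delta> * u) p) (proj z, ?\<sigma> z) = z"
      using \<delta> by (auto simp: tube_def proj_\<psi> H0_tube)
    have b: "\<bar>\<delta> * u\<bar> < \<delta>" if "- 1 < u" "u < 1" for u using that \<delta> by (simp add: abs_mult abs_less_iff)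
    show "\<forall>a'\<in>E0 \<times> {- 1<..<1}. (\<lambda>z. (proj z, ?\<sigma> z)) ((\<lambda>(p, u). \<psi> (\<delta> * u) p) a') = a'"
      using \<delta> b by (auto simp: proj_\<psi> H0_tube less_imp_le)
    show "(\<lambda>z. (proj z, ?\<sigma> z)) ` tube \<delta> \<subseteq> E0 \<times> {- 1<..<1}"
      using \<delta> by (auto simp: tube_def proj_\<psi> H0_tube field_simps)
    show "(\<lambda>(p, u). \<psi> (\<delta> * u) p) ` (E0 \<times> {- 1<..<1}) \<subseteq> tube \<delta>"
    proof clarify
      fix p u assume "p \<in> E0" "u \<in> {- 1<..<1 :: real}"
      then show "\<psi> (\<delta> * u) p \<in> tube \<delta>" using b[of u] unfolding tube_def by fastforce
    qed
  qed
  show "\<forall>z\<in>tube \<delta>. \<forall>v. tangent_map A proj z v = 0 \<and> dfun A ?\<sigma> z v = 0 \<longrightarrow> v = 0"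
  proof (intro ballI allI impI)
    fix x v assume x: "x \<in> tube \<delta>" and v: "tangent_map A proj x v = 0 \<and> dfun A ?\<sigma> x v = 0"
    obtain z h where d: "mdisp (\<lambda>n. x) z h x v" by (rule mdisp_exists)
    \<comment> \<open>The pair \<open>(proj, H0)\<close> has the left inverse \<open>(p, e) \<mapsto> \<psi> (e - e0) p\<close>, which also transports
      displacements.\<close>
    have "tangent_map A proj x v = tangent_map A (\<psi> (- (H0 x - e0))) x v + (- dfun A H0 x v) *\<^sub>R Y (proj x)"
      by (rule tangent_map_eqI[OF proj_mdisp])
    then have p: "mdisp (\<lambda>n. proj x) (\<lambda>n. proj (z n)) h (proj x) 0" using proj_mdisp[OF d] v by simp
    have "(\<lambda>n. \<delta> * ((?\<sigma> (z n) - ?\<sigma> x) / h n)) \<longlonglongrightarrow> \<delta> * dfun A ?\<sigma> x v"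
      by (intro tendsto_intros mdisp_fun[OF \<sigma> open_tube x d])
    then have q: "(\<lambda>n. ((H0 (z n) - e0) - (H0 x - e0)) / h n) \<longlonglongrightarrow> 0"
      using v \<delta> by (simp add: diff_divide_distrib[symmetric])
    have "mdisp (\<lambda>n. \<psi> (H0 x - e0) (proj x)) (\<lambda>n. \<psi> (H0 (z n) - e0) (proj (z n))) h (\<psi> (H0 x - e0) (proj x))
       (tangent_map A (\<psi> (H0 x - e0)) (proj x) 0 + 0 *\<^sub>R Y (\<psi> (H0 x - e0) (proj x)))"
      by (rule flow_mdisp_time[OF Y p tendsto_const _ q])
        (intro tendsto_intros isCont_tendsto_compose[OF H0_isCont] mdispD[OF d])
    moreover have "\<psi> (H0 u - e0) (proj u) = u" for u by (simp add: proj_def flow_add[OF Y, symmetric])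
    ultimately have "mdisp (\<lambda>n. x) z h x 0" by (simp add: tangent_map_flow_0[OF Y])
    then show "v = 0" using mdisp_unique[OF d] by simp
  qed
qed

end

section \<open>Continuation of the energy surface\<close>

context closed_manifold
begin

definition C2_converges :: "(nat \<Rightarrow> 'a \<Rightarrow> real) \<Rightarrow> ('a \<Rightarrow> real) \<Rightarrow> bool" where
  "C2_converges Hs H \<longleftrightarrow> (\<forall>n. Ck_fun A 2 UNIV (Hs n)) \<and> Ck_fun A 2 UNIV H \<and>
     (\<forall>p. \<exists>c\<in>A. \<exists>r>0. p \<in> chart_dom c \<and> cball (chart_map c p) r \<subseteq> chart_img c \<and>
        C2_limit (\<lambda>n. Hs n \<circ> chart_inv c) (H \<circ> chart_inv c) (cball (chart_map c p) r))"

lemma C2_converges_subseq: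
  assumes "C2_converges Hs H" "strict_mono s" shows "C2_converges (\<lambda>n. Hs (s n)) H"
proof -
  have "C2_limit (\<lambda>n. f (s n)) g B" if "C2_limit f g B" for f :: "nat \<Rightarrow> 'e \<Rightarrow> real" and g B
    using that eventually_subseq[OF assms(2)] unfolding C2_limit_def by blast
  from this[of "\<lambda>n. Hs n \<circ> chart_inv _"] show ?thesis using assms(1) unfolding C2_converges_def by blast
qed

lemma C2_converges_C2: "C2_converges Hs H \<Longrightarrow> Ck_fun A 2 UNIV (Hs n)" "C2_converges Hs H \<Longrightarrow> Ck_fun A 2 UNIV H"
  unfolding C2_converges_def by blast+

lemma C2_converges_near:
  assumes conv: "C2_converges Hs H" and xs: "xs \<longlonglongrightarrow> x"
  obtains c where "c \<in> A" "x \<in> chart_dom c"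
    "\<And>e. 0 < e \<Longrightarrow> \<forall>\<^sub>F n in sequentially. xs n \<in> chart_dom c \<and> (\<forall>vs. set vs \<subseteq> Basis \<and> length vs \<le> 2 \<longrightarrow>
       \<bar>iter_deriv vs (Hs n \<circ> chart_inv c) (chart_map c (xs n)) - iter_deriv vs (H \<circ> chart_inv c) (chart_map c (xs n))\<bar> < e)"
proof -
  obtain c r where c: "c \<in> A" "x \<in> chart_dom c" and r: "0 < r" "cball (chart_map c x) r \<subseteq> chart_img c"
    and lim: "C2_limit (\<lambda>n. Hs n \<circ> chart_inv c) (H \<circ> chart_inv c) (cball (chart_map c x) r)"
    using conv unfolding C2_converges_def by blast
  have ev: "\<forall>\<^sub>F n in sequentially. xs n \<in> {q \<in> chart_dom c. chart_map c q \<in> ball (chart_map c x) r}"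
    using topological_tendstoD[OF xs] open_chart_ball[OF c r(1)] by blast
  show thesis
  proof (rule that[OF c])
    fix e :: real assume "0 < e"
    from ev lim[unfolded C2_limit_def, rule_format, OF this]
    show "\<forall>\<^sub>F n in sequentially. xs n \<in> chart_dom c \<and> (\<forall>vs. set vs \<subseteq> Basis \<and> length vs \<le> 2 \<longrightarrow>
       \<bar>iter_deriv vs (Hs n \<circ> chart_inv c) (chart_map c (xs n)) - iter_deriv vs (H \<circ> chart_inv c) (chart_map c (xs n))\<bar> < e)"
      by eventually_elim auto
  qed
qed

lemma C2_converges_tendsto:
  assumes conv: "C2_converges Hs H" and xs: "xs \<longlonglongrightarrow> x"
  shows "(\<lambda>n. Hs n (xs n)) \<longlonglongrightarrow> H x"
proof -
  obtain c where c: "c \<in> A" "x \<in> chart_dom c" and near: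
    "\<And>e. 0 < e \<Longrightarrow> \<forall>\<^sub>F n in sequentially. xs n \<in> chart_dom c \<and> (\<forall>vs. set vs \<subseteq> Basis \<and> length vs \<le> 2 \<longrightarrow>
       \<bar>iter_deriv vs (Hs n \<circ> chart_inv c) (chart_map c (xs n)) - iter_deriv vs (H \<circ> chart_inv c) (chart_map c (xs n))\<bar> < e)"
    by (rule C2_converges_near[OF assms]) blast
  have H1: "Ck_fun A (Suc 0) UNIV H" using Ck_fun_mono[OF C2_converges_C2(2)[OF conv]] by simp
  have "(\<lambda>n. Hs n (xs n) - H (xs n)) \<longlonglongrightarrow> 0"
  proof (rule tendstoI)
    fix e :: real assume "0 < e"
    from near[OF this] show "\<forall>\<^sub>F n in sequentially. dist (Hs n (xs n) - H (xs n)) 0 < e"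
    proof eventually_elim
      case (elim n)
      from conjunct2[OF elim, rule_format, of "[]"] conjunct1[OF elim] show ?case using c by (simp add: dist_real_def)
    qed
  qed
  from tendsto_add[OF this isCont_tendsto_compose[OF C1_fun_isCont[OF H1 open_UNIV UNIV_I] xs]] show ?thesis by simp
qed

lemma C2_converges_dfun:
  assumes conv: "C2_converges Hs H" and v: "tconv xs vs x v"
  shows "(\<lambda>n. dfun A (Hs n) (xs n) (vs n)) \<longlonglongrightarrow> dfun A H x v"
proof -
  have xs: "xs \<longlonglongrightarrow> x" using v by (simp add: tconv_def)
  obtain c where c: "c \<in> A" "x \<in> chart_dom c" and near:
    "\<And>e. 0 < e \<Longrightarrow> \<forall>\<^sub>F n in sequentially. xs n \<in> chart_dom c \<and> (\<forall>vs. set vs \<subseteq> Basis \<and> length vs \<le> 2 \<longrightarrow>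
       \<bar>iter_deriv vs (Hs n \<circ> chart_inv c) (chart_map c (xs n)) - iter_deriv vs (H \<circ> chart_inv c) (chart_map c (xs n))\<bar> < e)"
    by (rule C2_converges_near[OF conv xs]) blast
  have H1: "Ck_fun A (Suc 0) UNIV (Hs n)" "Ck_fun A (Suc 0) UNIV H" for n
    using Ck_fun_mono[OF C2_converges_C2(1)[OF conv]] Ck_fun_mono[OF C2_converges_C2(2)[OF conv]] by simp_all
  have expand: "dfun A K p u = (\<Sum>b\<in>Basis. (comps c p u \<bullet> b) * frechet_derivative (K \<circ> chart_inv c) (at (chart_map c p)) b)"
    if "Ck_fun A (Suc 0) UNIV K" "p \<in> chart_dom c" for K p u
  proof -
    have "linear (frechet_derivative (K \<circ> chart_inv c) (at (chart_map c p)))"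
      using that c(1) linear_frechet_derivative unfolding Ck_fun_def by fastforce
    from linear_eq_sum_Basis[OF this, of "comps c p u"] show ?thesis
      using dfun_chart[OF that(1) open_UNIV UNIV_I c(1) that(2)] by simp
  qed
  let ?D = "\<lambda>n b. frechet_derivative (Hs n \<circ> chart_inv c) (at (chart_map c (xs n))) b - frechet_derivative (H \<circ> chart_inv c) (at (chart_map c (xs n))) b"
  have D: "(\<lambda>n. ?D n b) \<longlonglongrightarrow> 0" if "b \<in> Basis" for b
  proof (rule tendstoI)
    fix e :: real assume "0 < e"
    from near[OF this] show "\<forall>\<^sub>F n in sequentially. dist (?D n b) 0 < e"
    proof eventually_elim
      case (elim n)
      from conjunct2[OF elim, rule_format, of "[b]"] show ?case using that by (simp add: dist_real_def)
    qed
  qed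
  have "(\<lambda>n. \<Sum>b\<in>Basis. (comps c (xs n) (vs n) \<bullet> b) * ?D n b) \<longlonglongrightarrow> (\<Sum>b\<in>Basis. (comps c x v \<bullet> b) * 0)"
    by (intro tendsto_intros tconv_chart[OF v c] D)
  moreover have "\<forall>\<^sub>F n in sequentially. (\<Sum>b\<in>Basis. (comps c (xs n) (vs n) \<bullet> b) * ?D n b) = dfun A (Hs n) (xs n) (vs n) - dfun A H (xs n) (vs n)"
    using topological_tendstoD[OF xs open_chart_dom[OF c(1)] c(2)]
    by eventually_elim (simp add: expand H1 right_diff_distrib sum_subtractf)
  ultimately have "(\<lambda>n. dfun A (Hs n) (xs n) (vs n) - dfun A H (xs n) (vs n)) \<longlonglongrightarrow> 0"
    by (simp add: Lim_transform_eventually)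
  from tendsto_add[OF this tconv_dfun[OF H1(2) open_UNIV UNIV_I v]] show ?thesis by simp
qed

lemma C1_field_tconv:
  assumes lim: "field_limit Xs X" and xs: "xs \<longlonglongrightarrow> x"
  shows "tconv xs (\<lambda>n. Xs n (xs n)) x (X x)"
proof -
  obtain c r where c: "c \<in> A" "x \<in> chart_dom c" and r: "0 < r" "cball (chart_map c x) r \<subseteq> chart_img c"
    and lc: "field_limit_at c (chart_map c x) r Xs X"
    using lim unfolding field_limit_def by blast
  have X: "Ck_on (Suc 0) (field_rep c X) (chart_img c)" using field_limit_C1(1)[OF lim] c(1) by (simp add: C1_field_def)
  have cx: "(\<lambda>n. chart_map c (xs n)) \<longlonglongrightarrow> chart_map c x" using tendsto_chart[OF c] xs by blast
  have cont: "isCont (field_rep c X) (chart_map c x)"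
    using C1_continuous_on[OF X] continuous_on_eq_continuous_at[OF open_chart_img[OF c(1)]] c by blast
  have ev: "\<forall>\<^sub>F n in sequentially. xs n \<in> {q \<in> chart_dom c. chart_map c q \<in> ball (chart_map c x) r}"
    using topological_tendstoD[OF xs] open_chart_ball[OF c r(1)] by blast
  have "(\<lambda>n. field_rep c (Xs n) (chart_map c (xs n)) - field_rep c X (chart_map c (xs n))) \<longlonglongrightarrow> 0"
  proof (rule tendstoI)
    fix e :: real assume "0 < e"
    then have "0 < e / 2" by simp
    from ev conjunct2[OF lc[unfolded field_limit_at_def], unfolded C1_limit_def, rule_format, OF this]
    show "\<forall>\<^sub>F n in sequentially. dist (field_rep c (Xs n) (chart_map c (xs n)) - field_rep c X (chart_map c (xs n))) 0 < e"
    proof eventually_elim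
      case (elim n)
      then have "norm (field_rep c (Xs n) (chart_map c (xs n)) - field_rep c X (chart_map c (xs n))) \<le> e / 2" by auto
      then show ?case using \<open>0 < e\<close> by simp
    qed
  qed
  from tendsto_add[OF this isCont_tendsto_compose[OF cont cx]]
  have "(\<lambda>n. field_rep c (Xs n) (chart_map c (xs n))) \<longlonglongrightarrow> comps c x (X x)" using c by (simp add: field_rep_def)
  moreover have "\<forall>\<^sub>F n in sequentially. field_rep c (Xs n) (chart_map c (xs n)) = comps c (xs n) (Xs n (xs n))"
    using ev by eventually_elim (use c in \<open>simp add: field_rep_def\<close>)
  ultimately have "(\<lambda>n. comps c (xs n) (Xs n (xs n))) \<longlonglongrightarrow> comps c x (X x)" by (rule Lim_transform_eventually)
  from tconvI[OF xs c this] show ?thesis using c by simp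
qed

lemma C2_converges_uniform:
  assumes conv: "C2_converges Hs H" and "0 < e"
  shows "\<forall>\<^sub>F n in sequentially. \<forall>p. \<bar>Hs n p - H p\<bar> < e"
proof (rule ccontr)
  assume neg: "\<not> ?thesis"
  obtain s :: "nat \<Rightarrow> nat" where s: "strict_mono s" "\<forall>n. \<not> (\<forall>p. \<bar>Hs (s n) p - H p\<bar> < e)" using not_eventually_sequentiallyD[OF neg] by blast
  then obtain p where p: "\<And>n. \<not> \<bar>Hs (s n) (p n) - H (p n)\<bar> < e" by metis
  obtain l r where r: "strict_mono r" "(p \<circ> r) \<longlonglongrightarrow> l" by (rule convergent_subsequence[of p])
  have H1: "Ck_fun A (Suc 0) UNIV H" using Ck_fun_mono[OF C2_converges_C2(2)[OF conv]] by simp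
  have "(\<lambda>n. Hs (s (r n)) ((p \<circ> r) n)) \<longlonglongrightarrow> H l"
    using C2_converges_tendsto[OF C2_converges_subseq[OF conv strict_mono_o[OF s(1) r(1)]] r(2)] by simp
  moreover have "(\<lambda>n. H ((p \<circ> r) n)) \<longlonglongrightarrow> H l" by (rule isCont_tendsto_compose[OF C1_fun_isCont[OF H1 open_UNIV UNIV_I] r(2)])
  ultimately have "(\<lambda>n. \<bar>Hs (s (r n)) ((p \<circ> r) n) - H ((p \<circ> r) n)\<bar>) \<longlonglongrightarrow> \<bar>H l - H l\<bar>" by (intro tendsto_intros)
  then have "\<forall>\<^sub>F n in sequentially. \<bar>Hs (s (r n)) ((p \<circ> r) n) - H ((p \<circ> r) n)\<bar> < e"
    by (rule order_tendstoD) (use \<open>0 < e\<close> in simp)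
  then show False using p by (auto simp: eventually_sequentially)
qed

end

context level_collar
begin

lemma transversal_eventually:
  assumes conv: "C2_converges Hs H0"
  shows "\<forall>\<^sub>F n in sequentially. \<forall>p\<in>ctube \<delta>. 1 / 2 < dfun A (Hs n) p (Y p)"
proof (rule ccontr)
  assume neg: "\<not> ?thesis"
  obtain s :: "nat \<Rightarrow> nat" where s: "strict_mono s" "\<forall>n. \<not> (\<forall>p\<in>ctube \<delta>. 1 / 2 < dfun A (Hs (s n)) p (Y p))" using not_eventually_sequentiallyD[OF neg] by blast
  then obtain p where p: "\<And>n. p n \<in> ctube \<delta>" "\<And>n. \<not> 1 / 2 < dfun A (Hs (s n)) (p n) (Y (p n))" by metis
  obtain r l where r: "strict_mono r" "(p \<circ> r) \<longlonglongrightarrow> l" "l \<in> ctube \<delta>"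
    by (rule ctube_subseq[of p "\<lambda>n. \<delta>" \<delta>]) (use p(1) in auto)
  have "l \<in> Q" using r(3) stays by (auto simp: ctube_def)
  have "(\<lambda>n. dfun A (Hs (s (r n))) ((p \<circ> r) n) (Y ((p \<circ> r) n))) \<longlonglongrightarrow> dfun A H0 l (Y l)"
    using C2_converges_dfun[OF C2_converges_subseq[OF conv strict_mono_o[OF s(1) r(1)]] C1_field_tconv[OF field_limit_const[OF Y] r(2)]] by simp
  then have "\<forall>\<^sub>F n in sequentially. 1 / 2 < dfun A (Hs (s (r n))) ((p \<circ> r) n) (Y ((p \<circ> r) n))"
    by (rule order_tendstoD) (use unit[OF \<open>l \<in> Q\<close>] in simp)
  then show False using p(2) by (auto simp: eventually_sequentially)
qed

text \<open>A Hamiltonian that increases along \<open>Y\<close> and is close to \<open>H0\<close> has exactly one point of energy \<open>e\<close>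
  on each orbit of \<open>Y\<close> in the collar, so its level is a graph over \<open>E0\<close>.\<close>

definition level :: "('a \<Rightarrow> real) \<Rightarrow> real \<Rightarrow> 'a set" where
  "level H e = H -` {e} \<inter> tube \<delta>"

context
  fixes H e d
  assumes H: "Ck_fun A (Suc 0) UNIV H" and inc: "\<And>p. p \<in> ctube \<delta> \<Longrightarrow> 1 / 2 < dfun A H p (Y p)"
    and near: "\<And>p. \<bar>H p - H0 p\<bar> < d / 2" and e: "\<bar>e - e0\<bar> < d / 2" and d: "0 < d" "d < \<delta>"
begin

private lemma increasing: "H (\<psi> s p) < H (\<psi> t p)" if "p \<in> E0" "- \<delta> \<le> s" "s < t" "t \<le> \<delta>" for p s t
proof (rule DERIV_pos_imp_increasing[OF \<open>s < t\<close>])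
  fix u assume "s \<le> u" "u \<le> t"
  then have "\<psi> u p \<in> ctube \<delta>" using that unfolding ctube_def by force
  then have "0 < dfun A H (\<psi> u p) (Y (\<psi> u p))" using inc by (meson half_gt_zero less_trans zero_less_one)
  then show "\<exists>y. ((\<lambda>t. H (\<psi> t p)) has_real_derivative y) (at u) \<and> 0 < y"
    using velocity_fun[OF H open_UNIV UNIV_I flow_velocity[OF Y], of p u] by blast
qed

private lemma ends: "H (\<psi> (- d) p) < e" "e < H (\<psi> d p)" if "p \<in> E0" for p
proof -
  have "H0 (\<psi> d p) = e0 + d" "H0 (\<psi> (- d) p) = e0 + - d" by (rule H0_tube[OF that]; use d in simp)+
  then show "H (\<psi> (- d) p) < e" "e < H (\<psi> d p)"
    using near[of "\<psi> (- d) p"] near[of "\<psi> d p"] e unfolding abs_less_iff by linarith+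
qed

private lemma H_cont: "continuous_on UNIV H"
  by (rule continuous_at_imp_continuous_on) (use C1_fun_isCont[OF H open_UNIV] in auto)

private lemma level_unique: "\<bar>s\<bar> < d" if "p \<in> E0" "\<bar>s\<bar> < \<delta>" "H (\<psi> s p) = e" for s p
proof -
  have s: "- \<delta> < s" "s < \<delta>" using that(2) by auto
  have "s < d"
  proof (rule ccontr)
    assume "\<not> s < d"
    then have "d = s \<or> H (\<psi> d p) < H (\<psi> s p)" using increasing[OF that(1), of d s] s d by linarith
    then show False using ends(2)[OF that(1)] that(3) by auto
  qed
  moreover have "- d < s"
  proof (rule ccontr)
    assume "\<not> - d < s"
    then have "s = - d \<or> H (\<psi> s p) < H (\<psi> (- d) p)" using increasing[OF that(1), of s "- d"] s d by linarith
    then show False using ends(1)[OF that(1)] that(3) by auto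
  qed
  ultimately show ?thesis by simp
qed

lemma level_ctube: "level H e = H -` {e} \<inter> ctube d"
proof
  show "level H e \<subseteq> H -` {e} \<inter> ctube d"
    using level_unique unfolding level_def tube_def ctube_def by (force simp: less_imp_le)
  show "H -` {e} \<inter> ctube d \<subseteq> level H e"
    using d unfolding level_def tube_def ctube_def by force
qed

lemma level_compact: "compact (level H e)"
  unfolding level_ctube
  by (intro closed_imp_compact closed_Int closed_ctube closed_vimage[OF closed_singleton H_cont])

private lemma proj_level: "proj ` level H e = E0"
proof
  show "proj ` level H e \<subseteq> E0" by (auto simp: level_def tube_def proj_\<psi>)
  show "E0 \<subseteq> proj ` level H e"
  proof
    fix p assume p: "p \<in> E0"
    have "isCont (\<lambda>t. H (\<psi> t p)) t" for t
      using velocity_fun[OF H open_UNIV UNIV_I flow_velocity[OF Y], of p t] DERIV_isCont by blast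
    then obtain t where t: "- d \<le> t" "t \<le> d" "H (\<psi> t p) = e"
      using IVT[of "\<lambda>t. H (\<psi> t p)" "- d" e d] ends[OF p] d by (auto simp: less_imp_le)
    then have "\<psi> t p \<in> level H e" using p d unfolding level_def tube_def by force
    moreover have "proj (\<psi> t p) = p" by (rule proj_\<psi>[OF p]) (use t d in auto)
    ultimately show "p \<in> proj ` level H e" by (metis image_eqI)
  qed
qed

private lemma proj_inj: "inj_on proj (level H e)"
proof (rule inj_onI)
  fix x y assume "x \<in> level H e" "y \<in> level H e" and eq: "proj x = proj y"
  then obtain s p t q where x: "x = \<psi> s p" "p \<in> E0" "\<bar>s\<bar> < \<delta>" "H x = e" and y: "y = \<psi> t q" "q \<in> E0" "\<bar>t\<bar> < \<delta>" "H y = e"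
    unfolding level_def tube_def by blast
  then have "p = q" using eq by (simp add: proj_\<psi>)
  have "- \<delta> < s" "s < \<delta>" "- \<delta> < t" "t < \<delta>" using x(3) y(3) by auto
  moreover have "H (\<psi> s p) = H (\<psi> t p)" using x(1,4) y(1,4) \<open>p = q\<close> by simp
  ultimately have "s = t" using increasing[OF x(2), of s t] increasing[OF x(2), of t s] by linarith
  then show "x = y" using x y \<open>p = q\<close> by simp
qed

lemma level_connected: "connected (level H e)"
proof -
  let ?g = "inv_into (level H e) proj"
  have "continuous_on (proj ` level H e) ?g"
    by (rule continuous_on_inv[OF _ level_compact])
      (use proj_isCont proj_inj in \<open>auto intro: continuous_at_imp_continuous_on\<close>)
  moreover have "?g ` proj ` level H e = level H e" by (rule inv_into_image_cancel[OF proj_inj subset_refl])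
  ultimately show ?thesis
    using connected_continuous_image[of E0 ?g] in_components_connected[OF E0] by (simp add: proj_level)
qed

lemma level_component: "level H e \<in> components (H -` {e})"
  unfolding in_components_maximal
proof (intro conjI allI impI)
  show ne: "level H e \<noteq> {}" using proj_level E0_nonempty by blast
  show "level H e \<subseteq> H -` {e}" by (auto simp: level_def)
  show "connected (level H e)" by (rule level_connected)
  fix C assume C: "C \<noteq> {} \<and> level H e \<subseteq> C \<and> C \<subseteq> H -` {e} \<and> connected C"
  \<comment> \<open>The level in the collar is relatively open and closed.\<close>
  have "open (- level H e)" using compact_imp_closed[OF level_compact] by (simp add: closed_def)
  moreover have "C \<subseteq> tube \<delta> \<union> - level H e" by (auto simp: level_def)
  moreover have "tube \<delta> \<inter> - level H e \<inter> C = {}" using C by (auto simp: level_def)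
  ultimately have "tube \<delta> \<inter> C = {} \<or> - level H e \<inter> C = {}"
    using connectedD[of C "tube \<delta>" "- level H e"] C open_tube by blast
  moreover have "tube \<delta> \<inter> C \<noteq> {}" using ne C by (auto simp: level_def)
  ultimately show "C = level H e" using C by blast
qed

lemma level_continuation:
  assumes "ctube d \<subseteq> N" "N \<subseteq> tube \<delta>"
  shows "is_continuation N H e (level H e)"
proof -
  have "level H e \<subseteq> N" using assms(1) level_ctube by blast
  moreover have "E' = level H e" if "E' \<in> components (H -` {e})" "E' \<subseteq> N" for E'
  proof -
    have "E' \<subseteq> level H e" using in_components_subset[OF that(1)] that(2) assms(2) by (auto simp: level_def)
    then show ?thesis using components_eq[OF that(1) level_component] in_components_nonempty[OF that(1)] by blast
  qed
  ultimately show ?thesis using level_component unfolding is_continuation_def by blast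
qed

end

end

section \<open>Rigidity of invariant functions\<close>

context closed_manifold
begin

text \<open>Derivatives of converging flows converge: replace the derivatives by difference quotients along
  a sufficiently fast diagonal sequence.\<close>

lemma tconv_flow:
  assumes lim: "field_limit Xs X" and v: "tconv xs vs x v"
  shows "tconv (\<lambda>n. flow A (Xs n) T (xs n)) (\<lambda>n. tangent_map A (flow A (Xs n) T) (xs n) (vs n)) (flow A X T x) (tangent_map A (flow A X T) x v)"
proof -
  let ?c = "chart_at A x" and ?y = "flow A X T x" and ?F = "\<lambda>n. flow A (Xs n) T"
  let ?d = "chart_at A (flow A X T x)"
  have xs: "xs \<longlonglongrightarrow> x" using v by (simp add: tconv_def)
  have F: "(\<lambda>n. ?F n (xs n)) \<longlonglongrightarrow> ?y" by (rule flow_tendsto[OF lim xs tendsto_const])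
  define u where "u n = comps ?c (xs n) (vs n)" for n
  have u: "u \<longlonglongrightarrow> v" using v by (simp add: tconv_def u_def[abs_def])
  let ?h = "\<lambda>k. inverse (real (Suc k))"
  define z where "z n k = chart_inv ?c (chart_map ?c (xs n) + ?h k *\<^sub>R u n)" for n k
  let ?q = "\<lambda>n k. (chart_map ?d (?F n (z n k)) - chart_map ?d (?F n (xs n))) /\<^sub>R ?h k"
  let ?w = "\<lambda>n. comps ?d (?F n (xs n)) (tangent_map A (?F n) (xs n) (vs n))"
  have quotient: "(\<lambda>k. ?q n k) \<longlonglongrightarrow> ?w n" if n: "xs n \<in> chart_dom ?c" "?F n (xs n) \<in> chart_dom ?d" for n
  proof -
    have "displaces (\<lambda>k. chart_map ?c (xs n)) (\<lambda>k. chart_map ?c (xs n) + ?h k *\<^sub>R u n) ?h (chart_map ?c (xs n)) (u n)"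
      by (rule displaces_line[OF _ LIMSEQ_inverse_real_of_nat tendsto_const tendsto_const]) simp
    from mdisp_chart_inv[OF chart_at(1) n(1) this]
    have "mdisp (\<lambda>k. xs n) (z n) ?h (xs n) (vs n)" using n(1) by (simp add: z_def[abs_def] u_def chart_at)
    from flow_mdisp[OF field_limit_const[OF field_limit_C1(2)[OF lim, of n]] this tendsto_const, of T]
    have "mdisp (\<lambda>k. ?F n (xs n)) (\<lambda>k. ?F n (z n k)) ?h (?F n (xs n)) (tangent_map A (?F n) (xs n) (vs n))" .
    from displacesD(4)[OF mdisp_chart[OF this chart_at(1) n(2)]] show ?thesis .
  qed
  have "\<exists>k\<ge>n. xs n \<in> chart_dom ?c \<longrightarrow> ?F n (xs n) \<in> chart_dom ?d \<longrightarrow> norm (?q n k - ?w n) < ?h n" for n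
  proof (cases "xs n \<in> chart_dom ?c \<and> ?F n (xs n) \<in> chart_dom ?d")
    case True
    then have ev: "\<forall>\<^sub>F k in sequentially. dist (?q n k) (?w n) < ?h n" using tendstoD[OF quotient[of n], of "?h n"] by simp
    show ?thesis using eventually_conj[OF ev eventually_ge_at_top[of n]] unfolding dist_norm eventually_sequentially by blast
  qed auto
  then obtain k where k: "\<And>n. n \<le> k n"
    "\<And>n. xs n \<in> chart_dom ?c \<Longrightarrow> ?F n (xs n) \<in> chart_dom ?d \<Longrightarrow> norm (?q n (k n) - ?w n) < ?h n" by metis
  have h0: "(\<lambda>n. ?h (k n)) \<longlonglongrightarrow> 0"
    by (rule Lim_null_comparison[OF _ LIMSEQ_inverse_real_of_nat]) (use k(1) in \<open>simp add: le_imp_inverse_le\<close>)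
  have cx: "(\<lambda>n. chart_map ?c (xs n)) \<longlonglongrightarrow> chart_map ?c x" using tendsto_chart[OF chart_at] xs by blast
  have "displaces (\<lambda>n. chart_map ?c (xs n)) (\<lambda>n. chart_map ?c (xs n) + ?h (k n) *\<^sub>R u n) (\<lambda>n. ?h (k n)) (chart_map ?c x) v"
    by (rule displaces_line[OF _ h0 cx u]) simp
  from mdisp_chart_inv[OF chart_at this]
  have d: "mdisp (\<lambda>n. chart_inv ?c (chart_map ?c (xs n))) (\<lambda>n. z n (k n)) (\<lambda>n. ?h (k n)) x v"
    by (simp add: coord_vec_coord_change chart_at z_def)
  have "\<forall>\<^sub>F n in sequentially. xs n = chart_inv ?c (chart_map ?c (xs n))"
    by (rule eventually_mono[OF topological_tendstoD[OF xs open_chart_dom[OF chart_at(1)] chart_at(2)]]) (simp add: chart_at)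
  then have "mdisp xs (\<lambda>n. z n (k n)) (\<lambda>n. ?h (k n)) x v" by (rule mdisp_cong[OF d]) simp
  from displacesD(4)[OF mdisp_chart[OF flow_mdisp[OF lim this tendsto_const] chart_at(1) chart_at(2)]]
  have q: "(\<lambda>n. ?q n (k n)) \<longlonglongrightarrow> tangent_map A (flow A X T) x v" by simp
  have "(\<lambda>n. ?q n (k n) - ?w n) \<longlonglongrightarrow> 0"
  proof (rule Lim_null_comparison[OF _ LIMSEQ_inverse_real_of_nat])
    show "\<forall>\<^sub>F n in sequentially. norm (?q n (k n) - ?w n) \<le> ?h n"
      using topological_tendstoD[OF xs open_chart_dom[OF chart_at(1)] chart_at(2)]
        topological_tendstoD[OF F open_chart_dom[OF chart_at(1)] chart_at(2)]
      by eventually_elim (rule less_imp_le[OF k(2)])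
  qed
  from tendsto_diff[OF q this] have "?w \<longlonglongrightarrow> tangent_map A (flow A X T) x v" by simp
  then show ?thesis using F by (simp add: tconv_def)
qed

context
  fixes X assumes X: "C1_field X"
begin

lemma tangent_map_flow_uminus:
  "tangent_map A (flow A X (- t)) (flow A X t x) (tangent_map A (flow A X t) x v) = v"
proof -
  obtain z h where d: "mdisp (\<lambda>n. x) z h x v" by (rule mdisp_exists)
  note lim = field_limit_const[OF X]
  from flow_mdisp[OF lim flow_mdisp[OF lim d tendsto_const, of t] tendsto_const, of "- t"]
  have "mdisp (\<lambda>n. x) z h x (tangent_map A (flow A X (- t)) (flow A X t x) (tangent_map A (flow A X t) x v))"
    using X by simp
  from mdisp_unique[OF this d] show ?thesis .
qed

lemma tangent_map_flow_time0: "tangent_map A (flow A X 0) x v = v"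
  by (rule tangent_map_eqI) (simp add: X)

context
  fixes f U
  assumes f: "Ck_fun A (Suc 0) U f" "open U"
    and inv: "\<And>p t. p \<in> U \<Longrightarrow> flow A X t p \<in> U" "\<And>p t. p \<in> U \<Longrightarrow> f (flow A X t p) = f p"
begin

lemma invariant_dfun:
  assumes p: "p \<in> U"
  shows "dfun A f (flow A X t p) (tangent_map A (flow A X t) p v) = dfun A f p v"
proof -
  obtain z h where d: "mdisp (\<lambda>n. p) z h p v" by (rule mdisp_exists)
  have d': "mdisp (\<lambda>n. flow A X t p) (\<lambda>n. flow A X t (z n)) h (flow A X t p) (tangent_map A (flow A X t) p v)"
    by (rule flow_mdisp[OF field_limit_const[OF X] d tendsto_const])
  have "\<forall>\<^sub>F n in sequentially. (f (z n) - f p) / h n = (f (flow A X t (z n)) - f (flow A X t p)) / h n"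
    using topological_tendstoD[OF mdispD(2)[OF d] f(2) p] by eventually_elim (simp add: inv(2) p)
  from Lim_transform_eventually[OF mdisp_fun[OF f p d] this] show ?thesis
    by (rule LIMSEQ_unique[OF mdisp_fun[OF f inv(1)[OF p] d']])
qed

lemma invariant_dfun_field:
  assumes p: "p \<in> U" shows "dfun A f p (X p) = 0"
proof -
  have "((\<lambda>s. f (flow A X s p)) has_real_derivative dfun A f (flow A X 0 p) (X (flow A X 0 p))) (at 0)"
    by (rule velocity_fun[OF f inv(1)[OF p] flow_velocity[OF X]])
  then show ?thesis using DERIV_unique[OF _ DERIV_const] inv(2)[OF p] X by simp
qed

end

end

text \<open>The invariant function lives on a neighbourhood of \<open>E\<close>.  Rigidity is applied to a first integral, which
  is defined everywhere, and then to a factor of proportionality, which is defined in the collar.\<close>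

definition rigid :: "('a \<Rightarrow> 'e) \<Rightarrow> ('a \<Rightarrow> real) \<Rightarrow> 'a set \<Rightarrow> bool" where
  "rigid X H E \<longleftrightarrow> (\<forall>f U. open U \<longrightarrow> E \<subseteq> U \<longrightarrow> Ck_fun A (Suc 0) U f \<longrightarrow>
     (\<forall>p\<in>U. \<forall>t. flow A X t p \<in> U \<and> f (flow A X t p) = f p) \<longrightarrow>
     (\<forall>p\<in>E. \<forall>v. dfun A H p v = 0 \<longrightarrow> dfun A f p v = 0))"

context
  fixes \<omega> :: "'a \<Rightarrow> 'e \<Rightarrow> 'e \<Rightarrow> real"
  assumes \<omega>: "symplectic_form A \<omega>"
begin

lemma symplectic_bilinear: "smooth_bilinear_field A \<omega>" and symplectic_nondeg: "(\<forall>v. \<omega> p u v = 0) \<Longrightarrow> u = 0"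
  using \<omega> unfolding symplectic_form_def by blast+

context
  fixes H assumes H: "Ck_fun A 2 UNIV H"
begin

lemma ham_C1: "C1_field (ham_field A \<omega> H)"
  by (rule ham_field_C1[OF symplectic_bilinear symplectic_nondeg H])

lemma ham_dfun: "\<omega> p (ham_field A \<omega> H p) v = dfun A H p v"
  by (rule ham_field_eq[OF symplectic_bilinear symplectic_nondeg Ck_fun_mono[OF H] open_UNIV UNIV_I]) simp_all

lemma dfun_ham: "dfun A H p (ham_field A \<omega> H p) = 0"
proof -
  have "\<omega> p (ham_field A \<omega> H p) (ham_field A \<omega> H p) = - \<omega> p (ham_field A \<omega> H p) (ham_field A \<omega> H p)"
    using \<omega> unfolding symplectic_form_def by blast
  then show ?thesis by (simp add: ham_dfun)
qed

lemma first_integral: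
  assumes K: "Ck_fun A (Suc 0) UNIV K" "\<And>p. dfun A K p (ham_field A \<omega> H p) = 0"
  shows "K (ham_flow A \<omega> H t p) = K p"
proof -
  have "((\<lambda>s. K (flow A (ham_field A \<omega> H) s p)) has_real_derivative 0) (at s)" for s
    using velocity_fun[OF K(1) open_UNIV UNIV_I flow_velocity[OF ham_C1], of p s] K(2) by simp
  from DERIV_isconst_all[OF allI, OF this, of t 0] show ?thesis
    using ham_C1 by (simp add: ham_flow_def)
qed

lemma energy_conserved: "H (ham_flow A \<omega> H t p) = H p"
proof (rule first_integral[OF _ dfun_ham])
  show "Ck_fun A (Suc 0) UNIV H" by (rule Ck_fun_mono[OF H]) simp
qed

text \<open>Orbits are connected and stay in their energy level.\<close>

lemma component_invariant:
  assumes E: "E \<in> components (H -` {e})" and p: "p \<in> E"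
  shows "ham_flow A \<omega> H t p \<in> E"
proof -
  have cont: "continuous_on UNIV (\<lambda>s. ham_flow A \<omega> H s p)"
    using flow_velocity[OF ham_C1, of p] by (auto simp: ham_flow_def has_velocity_def intro: continuous_at_imp_continuous_on)
  have "connected (range (\<lambda>s. ham_flow A \<omega> H s p))" by (rule connected_continuous_image[OF cont connected_UNIV])
  moreover have "range (\<lambda>s. ham_flow A \<omega> H s p) \<subseteq> H -` {e}"
    using energy_conserved in_components_subset[OF E] p by auto
  moreover have "p \<in> range (\<lambda>s. ham_flow A \<omega> H s p)"
    using ham_C1 by (intro range_eqI[of _ _ 0]) (simp add: ham_flow_def)
  ultimately show ?thesis using components_maximal[OF E] p by blast
qed

end

end

context
  fixes g :: "'a \<Rightarrow> 'e \<Rightarrow> 'e \<Rightarrow> real"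
  assumes g: "riemannian_metric A g"
begin

private lemma metric_bilinear: "bilinear (g p)" and metric_smooth: "smooth_bilinear_field A g"
  using g by (auto simp: riemannian_metric_def smooth_bilinear_field_def)

lemma gnorm_zero: "gnorm g p 0 = 0"
  using metric_bilinear[of p] by (simp add: gnorm_def bilinear_lzero)

lemma gnorm_pos: "v \<noteq> 0 \<Longrightarrow> 0 < gnorm g p v"
  using g by (simp add: gnorm_def riemannian_metric_def)

lemma gnorm_scale: "gnorm g p (c *\<^sub>R v) = \<bar>c\<bar> * gnorm g p v"
  using metric_bilinear[of p] by (simp add: gnorm_def bilinear_lmul bilinear_rmul real_sqrt_mult mult.assoc[symmetric])

lemma gnorm_tconv: "tconv xs vs x v \<Longrightarrow> (\<lambda>n. gnorm g (xs n) (vs n)) \<longlonglongrightarrow> gnorm g x v"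
  unfolding gnorm_def by (intro tendsto_real_sqrt tconv_bilinear_field[OF metric_smooth])

text \<open>The supremum of \<open>df\<close> over the unit vectors in the kernel of \<open>dH\<close> is finite by compactness of the unit
  tangent bundle.  A direction with half of this value is good enough for the normalisation.\<close>

lemma almost_maximal_direction:
  assumes E: "closed E" "E \<subseteq> U" and f: "Ck_fun A (Suc 0) U f" "open U" and H: "Ck_fun A (Suc 0) UNIV H"
    and ex: "p0 \<in> E" "dfun A H p0 v0 = 0" "dfun A f p0 v0 \<noteq> 0"
  obtains M x v where "0 < M" "x \<in> E" "dfun A H x v = 0" "gnorm g x v = 1" "M / 2 \<le> dfun A f x v"
    "\<And>p v. p \<in> E \<Longrightarrow> dfun A H p v = 0 \<Longrightarrow> \<bar>dfun A f p v\<bar> \<le> M * gnorm g p v"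
proof -
  have lf: "linear (dfun A f p)" if "p \<in> E" for p using linear_dfun[OF f(1)] that E(2) by blast
  have lH: "linear (dfun A H p)" for p by (rule linear_dfun[OF H UNIV_I])
  define S where "S = {\<bar>dfun A f p v\<bar> | p v. p \<in> E \<and> dfun A H p v = 0 \<and> gnorm g p v = 1}"
  have "\<exists>B. \<forall>s\<in>S. s \<le> B"
  proof (rule ccontr)
    assume neg: "\<not> ?thesis"
    have "\<exists>p v. p \<in> E \<and> gnorm g p v = 1 \<and> real n < \<bar>dfun A f p v\<bar>" for n
      using neg[unfolded not_ex, rule_format, of "real n"] by (auto simp: S_def not_le)
    then obtain p v where pv: "\<And>n. p n \<in> E" "\<And>n. gnorm g (p n) (v n) = 1" "\<And>n. real n < \<bar>dfun A f (p n) (v n)\<bar>" by metis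
    obtain s x w where s: "strict_mono s" "tconv (p \<circ> s) (v \<circ> s) x w" by (rule unit_tangent_subsequence[OF g pv(2)])
    have "x \<in> E" by (rule closed_sequentially[OF E(1), of "p \<circ> s"]) (use pv(1) s(2) in \<open>auto simp: tconv_def\<close>)
    then have "(\<lambda>n. \<bar>dfun A f ((p \<circ> s) n) ((v \<circ> s) n)\<bar>) \<longlonglongrightarrow> \<bar>dfun A f x w\<bar>"
      by (intro tendsto_rabs tconv_dfun[OF f _ s(2)]) (use E(2) in blast)
    then obtain N where N: "\<And>n. N \<le> n \<Longrightarrow> \<bar>dfun A f (p (s n)) (v (s n))\<bar> < \<bar>dfun A f x w\<bar> + 1"
      using order_tendstoD(2)[of _ "\<bar>dfun A f x w\<bar>" sequentially "\<bar>dfun A f x w\<bar> + 1"] unfolding eventually_sequentially by auto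
    obtain m :: nat where m: "\<bar>dfun A f x w\<bar> + 1 < real m" using reals_Archimedean2 by blast
    let ?n = "max N m"
    have "real m \<le> real (s ?n)" using seq_suble[OF s(1), of ?n] by linarith
    then show False using N[of ?n] pv(3)[of "s ?n"] m by simp
  qed
  then have bdd: "bdd_above S" unfolding bdd_above_def by blast
  have unit: "gnorm g p (v /\<^sub>R gnorm g p v) = 1" if "v \<noteq> 0" for p v
    using gnorm_pos[OF that, of p] by (simp add: gnorm_scale)
  have v0: "v0 \<noteq> 0" using ex linear_0[OF lf[OF ex(1)]] by auto
  let ?u = "v0 /\<^sub>R gnorm g p0 v0"
  have uS: "\<bar>dfun A f p0 ?u\<bar> \<in> S"
    using ex unit[OF v0] unfolding S_def by (force simp: linear_scale[OF lH])
  have u0: "0 < \<bar>dfun A f p0 ?u\<bar>" using ex gnorm_pos[OF v0, of p0] by (simp add: linear_scale[OF lf])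
  define M where "M = Sup S"
  have M: "0 < M" using u0 cSup_upper[OF uS bdd] by (simp add: M_def)
  have "\<exists>s\<in>S. M / 2 < s" using less_cSupD[of S "M / 2"] uS M by (auto simp: M_def)
  then obtain x v where x: "x \<in> E" "dfun A H x v = 0" "gnorm g x v = 1" "M / 2 < \<bar>dfun A f x v\<bar>" by (auto simp: S_def)
  have bound: "\<bar>dfun A f p v\<bar> \<le> M * gnorm g p v" if p: "p \<in> E" and k: "dfun A H p v = 0" for p v
  proof (cases "v = 0")
    case True then show ?thesis using linear_0[OF lf[OF p]] by (simp add: gnorm_zero)
  next
    case False
    have "\<bar>dfun A f p (v /\<^sub>R gnorm g p v)\<bar> \<in> S"
      using p k unit[OF False, of p] unfolding S_def by (force simp: linear_scale[OF lH])
    then have "\<bar>dfun A f p (v /\<^sub>R gnorm g p v)\<bar> \<le> M" unfolding M_def by (rule cSup_upper[OF _ bdd])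
    then show ?thesis using gnorm_pos[OF False, of p] by (simp add: linear_scale[OF lf[OF p]] abs_mult divide_inverse_commute[symmetric] field_simps)
  qed
  show thesis
  proof (cases "0 \<le> dfun A f x v")
    case True
    show thesis by (rule that[OF M x(1,2,3) _ bound]) (use x(4) True in auto)
  next
    case False
    show thesis
      by (rule that[OF M x(1), of "- v", OF _ _ _ bound])
        (use x False gnorm_scale[of x "- 1" v] in \<open>auto simp: linear_neg[OF lH] linear_neg[OF lf[OF x(1)]]\<close>)
  qed
qed

end

end

context level_collar
begin

text \<open>A curve in \<open>E0\<close> whose velocity is a given vector of the kernel is obtained by sliding a coordinate
  line into \<open>E0\<close>.\<close>

lemma tangent_space_kernel:
  assumes x: "x \<in> E0" shows "tangent_space A E0 x = {v. dfun A H0 x v = 0}"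
proof (intro set_eqI iffI)
  fix v assume "v \<in> tangent_space A E0 x"
  then obtain \<gamma> d where \<gamma>: "0 < d" "\<And>t. \<bar>t\<bar> < d \<Longrightarrow> \<gamma> t \<in> E0" "\<gamma> 0 = x" "has_velocity A \<gamma> 0 v"
    unfolding tangent_space_def by blast
  have "((\<lambda>s. H0 (\<gamma> s)) has_real_derivative dfun A H0 (\<gamma> 0) v) (at 0)"
    by (rule velocity_fun[OF H0_C1 open_UNIV UNIV_I \<gamma>(4)])
  moreover have "((\<lambda>s. H0 (\<gamma> s)) has_real_derivative 0) (at 0)"
    by (rule has_field_derivative_transform_within_open[of "\<lambda>s. e0" _ _ "{- d<..<d}"])
      (use \<gamma>(1) E0_level[OF \<gamma>(2)] in \<open>auto simp: abs_less_iff\<close>)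
  ultimately show "v \<in> {v. dfun A H0 x v = 0}" using DERIV_unique \<gamma>(3) by blast
next
  fix v assume "v \<in> {v. dfun A H0 x v = 0}"
  then have v: "dfun A H0 x v = 0" by simp
  let ?c = "chart_at A x"
  have px: "proj x = x" using E0_level[OF x] by (simp add: proj_def)
  define \<gamma> where "\<gamma> t = proj (chart_inv ?c (chart_map ?c x + t *\<^sub>R v))" for t :: real
  have \<gamma>0: "\<gamma> 0 = x" by (simp add: \<gamma>_def chart_at px)
  let ?l = "\<lambda>t::real. chart_map ?c x + t *\<^sub>R v"
  have l: "isCont ?l 0" by (intro continuous_intros)
  have il: "isCont (\<lambda>t. chart_inv ?c (?l t)) 0" by (rule isCont_o2[OF l isCont_chart_inv[OF chart_at(1)]]) (simp add: chart_at)
  have c\<gamma>: "isCont \<gamma> 0" unfolding \<gamma>_def by (rule isCont_o2[OF il proj_isCont])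
  obtain d where d: "0 < d" "\<And>t. \<bar>t - 0\<bar> < d \<Longrightarrow> chart_inv ?c (?l t) \<in> tube \<delta>"
    by (rule eventually_near[OF il open_tube, of \<delta>]) (use E0_subset_tube[OF \<delta>] x in \<open>auto simp: chart_at\<close>)
  have "\<gamma> t \<in> E0" if "\<bar>t\<bar> < d" for t
    using d(2)[of t] that proj_\<psi> unfolding \<gamma>_def tube_def by auto
  moreover have "has_velocity A \<gamma> 0 v"
  proof -
    have "((chart_map ?c \<circ> proj \<circ> chart_inv ?c) has_derivative (\<lambda>v. v + (- dfun A H0 x v) *\<^sub>R Y x)) (at (chart_map ?c x))"
    proof (rule strict_derivative)
      fix y z h u assume "displaces y z h (chart_map ?c x) u"
      from proj_mdisp[OF mdisp_chart_inv[OF chart_at this]]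
      have "mdisp (\<lambda>n. proj (chart_inv ?c (y n))) (\<lambda>n. proj (chart_inv ?c (z n))) h x (u + (- dfun A H0 x u) *\<^sub>R Y x)"
        using E0_level[OF x] px by (simp add: coord_vec_coord_change chart_at tangent_map_flow_time0[OF Y])
      from displacesD(4)[OF mdisp_chart[OF this chart_at]]
      show "(\<lambda>n. ((chart_map ?c \<circ> proj \<circ> chart_inv ?c) (z n) - (chart_map ?c \<circ> proj \<circ> chart_inv ?c) (y n)) /\<^sub>R h n) \<longlonglongrightarrow> u + (- dfun A H0 x u) *\<^sub>R Y x"
        by simp
    qed
    then have D: "((chart_map ?c \<circ> proj \<circ> chart_inv ?c) has_derivative (\<lambda>v. v + (- dfun A H0 x v) *\<^sub>R Y x)) (at (?l 0))" by simp
    have L: "(?l has_derivative (\<lambda>t. t *\<^sub>R v)) (at 0)" by (auto intro!: derivative_eq_intros)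
    have "linear (dfun A H0 x)" by (rule linear_dfun[OF H0_C1 UNIV_I])
    then have "(\<lambda>v. v + (- dfun A H0 x v) *\<^sub>R Y x) \<circ> (\<lambda>t. t *\<^sub>R v) = (\<lambda>t. t *\<^sub>R v)"
      using v by (auto simp: linear_scale)
    with diff_chain_at[OF L D] show ?thesis
      unfolding has_velocity_def has_vector_derivative_def using c\<gamma> \<gamma>0 by (simp add: o_def \<gamma>_def)
  qed
  ultimately show "v \<in> tangent_space A E0 x" unfolding tangent_space_def using d(1) \<gamma>0 by blast
qed

end

lemma powr_small:
  assumes "0 < \<theta>" "\<theta> < 1" "0 < e" obtains t where "0 \<le> t" "K * \<theta> powr t < (e::real)"
proof -
  have "(\<lambda>n. K * \<theta> ^ n) \<longlonglongrightarrow> K * 0" using assms by (intro tendsto_intros LIMSEQ_realpow_zero) auto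
  then have "\<forall>\<^sub>F n in sequentially. K * \<theta> ^ n < e" by (rule order_tendstoD) (use assms in simp)
  then obtain n where "K * \<theta> ^ n < e" by (auto simp: eventually_sequentially)
  then show thesis using that[of "real n"] assms by (simp add: powr_realpow)
qed

locale anosov_collar = level_collar A H0 e0 E0 Y Q \<delta>
  for A :: "('a::t2_space, 'e::euclidean_space) chart set" and H0 e0 E0 Y Q \<delta> +
  fixes \<omega> g :: "'a \<Rightarrow> 'e \<Rightarrow> 'e \<Rightarrow> real"
  assumes \<omega>: "symplectic_form A \<omega>" and g: "riemannian_metric A g" and hyp: "hyperbolic_on A \<omega> g H0 E0"
begin

abbreviation \<phi> where "\<phi> \<equiv> ham_flow A \<omega> H0"

lemma \<phi>_flow: "\<phi> = flow A (ham_field A \<omega> H0)" by (simp add: ham_flow_def)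

text \<open>Stable vectors shrink in the future and unstable vectors in the past.  A single time at which the
  vector is short is all that the argument below takes from hyperbolicity.\<close>

definition shrinks :: "'a \<Rightarrow> 'e \<Rightarrow> bool" where
  "shrinks x w \<longleftrightarrow> (\<forall>e>0. \<exists>T. gnorm g (\<phi> T x) (tangent_map A (\<phi> T) x w) < e)"

lemma anosov_splitting:
  assumes x: "x \<in> E0" and v: "dfun A H0 x v = 0"
  obtains a b \<xi> where "v = a + \<xi> *\<^sub>R ham_field A \<omega> H0 x + b" "dfun A H0 x a = 0" "dfun A H0 x b = 0" "shrinks x a" "shrinks x b"
proof -
  obtain Es Ec Eu :: "'a \<Rightarrow> 'e set" and C \<theta> where
    h: "0 < C \<and> 0 < \<theta> \<and> \<theta> < 1 \<and> (\<forall>p\<in>E0. direct_sum3 (tangent_space A E0 p) (Es p) (Ec p) (Eu p) \<and>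
      Ec p = span {ham_field A \<omega> H0 p} \<and>
      (\<forall>t. tangent_map A (\<phi> t) p ` Es p = Es (\<phi> t p) \<and> tangent_map A (\<phi> t) p ` Ec p = Ec (\<phi> t p) \<and> tangent_map A (\<phi> t) p ` Eu p = Eu (\<phi> t p)) \<and>
      (\<forall>t\<ge>0. (\<forall>v\<in>Es p. gnorm g (\<phi> t p) (tangent_map A (\<phi> t) p v) \<le> C * \<theta> powr t * gnorm g p v) \<and>
         (\<forall>w\<in>Eu (\<phi> t p). gnorm g p (inv_into (Eu p) (tangent_map A (\<phi> t) p) w) \<le> C * \<theta> powr t * gnorm g (\<phi> t p) w)))"
    using hyp[unfolded hyperbolic_on_def Let_def] by (elim exE) (rule that)
  have \<theta>: "0 < \<theta>" "\<theta> < 1" using h by auto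
  note h' = bspec[OF h[THEN conjunct2, THEN conjunct2, THEN conjunct2]]
  have split: "direct_sum3 (tangent_space A E0 p) (Es p) (Ec p) (Eu p)"
    and Ec: "Ec p = span {ham_field A \<omega> H0 p}"
    and inv: "tangent_map A (\<phi> t) p ` Eu p = Eu (\<phi> t p)" if "p \<in> E0" for p t
    by (rule h'[OF that, THEN conjunct1])
      (rule h'[OF that, THEN conjunct2, THEN conjunct1],
       rule h'[OF that, THEN conjunct2, THEN conjunct2, THEN conjunct1, THEN spec, THEN conjunct2, THEN conjunct2])
  have stab: "gnorm g (\<phi> t p) (tangent_map A (\<phi> t) p v) \<le> C * \<theta> powr t * gnorm g p v"
    if "p \<in> E0" "0 \<le> t" "v \<in> Es p" for p t v
    using h'[OF that(1), THEN conjunct2, THEN conjunct2, THEN conjunct2] that(2,3) by blast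
  have unst: "gnorm g p (inv_into (Eu p) (tangent_map A (\<phi> t) p) w) \<le> C * \<theta> powr t * gnorm g (\<phi> t p) w"
    if "p \<in> E0" "0 \<le> t" "w \<in> Eu (\<phi> t p)" for p t w
    using h'[OF that(1), THEN conjunct2, THEN conjunct2, THEN conjunct2] that(2,3) by blast
  have XC1: "C1_field (ham_field A \<omega> H0)" by (rule ham_C1[OF \<omega> H0_C2])
  have ds: "subspace (Es x)" "subspace (Ec x)" "subspace (Eu x)"
    and T: "tangent_space A E0 x = {a + b + c | a b c. a \<in> Es x \<and> b \<in> Ec x \<and> c \<in> Eu x}"
    using split[OF x] by (auto simp: direct_sum3_def)
  have "v \<in> tangent_space A E0 x" using tangent_space_kernel[OF x] v by simp
  then obtain a k b where abk: "v = a + k + b" "a \<in> Es x" "k \<in> Ec x" "b \<in> Eu x" unfolding T by blast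
  obtain \<xi> where \<xi>: "k = \<xi> *\<^sub>R ham_field A \<omega> H0 x" using abk(3) Ec[OF x] by (auto simp: span_singleton)
  have z: "0 \<in> Es x" "0 \<in> Ec x" "0 \<in> Eu x" using ds subspace_0 by auto
  have "a + 0 + 0 \<in> tangent_space A E0 x" "0 + 0 + b \<in> tangent_space A E0 x" unfolding T using abk z by blast+
  then have ker: "dfun A H0 x a = 0" "dfun A H0 x b = 0" using tangent_space_kernel[OF x] by simp_all
  have "shrinks x a"
    unfolding shrinks_def
  proof (intro allI impI)
    fix e :: real assume "0 < e"
    then obtain t where t: "0 \<le> t" "(C * gnorm g x a) * \<theta> powr t < e" by (rule powr_small[OF \<theta>])
    then show "\<exists>T. gnorm g (\<phi> T x) (tangent_map A (\<phi> T) x a) < e"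
      using stab[OF x t(1) abk(2)] by (intro exI[of _ t]) (simp add: mult_ac)
  qed
  moreover have "shrinks x b"
    unfolding shrinks_def
  proof (intro allI impI)
    fix e :: real assume "0 < e"
    then obtain t where t: "0 \<le> t" "(C * gnorm g x b) * \<theta> powr t < e" by (rule powr_small[OF \<theta>])
    let ?p = "\<phi> (- t) x" and ?b = "tangent_map A (\<phi> (- t)) x b"
    have p: "?p \<in> E0" by (rule component_invariant[OF \<omega> H0_C2 E0 x])
    have px: "\<phi> t ?p = x" using XC1 by (simp add: \<phi>_flow)
    have bp: "?b \<in> Eu ?p" using inv[OF x, of "- t"] abk(4) by blast
    have bb: "tangent_map A (\<phi> t) ?p ?b = b"
      using tangent_map_flow_uminus[OF XC1, of "- t" x b] by (simp add: \<phi>_flow)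
    \<comment> \<open>The backward derivative inverts the forward derivative on the unstable space.\<close>
    have "inj_on (tangent_map A (\<phi> t) ?p) (Eu ?p)"
      by (rule inj_on_inverseI[where g = "tangent_map A (\<phi> (- t)) x"])
        (use tangent_map_flow_uminus[OF XC1, of t ?p] px in \<open>simp add: \<phi>_flow\<close>)
    then have "inv_into (Eu ?p) (tangent_map A (\<phi> t) ?p) b = ?b" using inv_into_f_f[OF _ bp] bb by metis
    then have "gnorm g ?p ?b \<le> C * \<theta> powr t * gnorm g x b" using unst[OF p t(1), of b] abk(4) px by simp
    then show "\<exists>T. gnorm g (\<phi> T x) (tangent_map A (\<phi> T) x b) < e"
      using t(2) by (intro exI[of _ "- t"]) (simp add: mult_ac)
  qed
  ultimately show thesis using that abk(1) \<xi> ker by blast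
qed

text \<open>Rigidity passes from \<open>E0\<close> to nearby levels by compactness.  Almost maximal directions of counterexamples
  accumulate at a tangent vector of \<open>E0\<close>.  Its stable and its unstable part are limits of vectors in
  the kernels of the differentials of \<open>Hs n\<close>.  The flows of \<open>Hs n\<close> make these vectors short at a
  fixed time, so the invariant functions vary little along them, compared with the maximum.\<close>

lemma sequence_of_non_rigid_levels_absurd:
  assumes conv: "C2_converges Hs H0" and es: "es \<longlonglongrightarrow> e0"
    and inc: "\<And>n p. p \<in> ctube \<delta> \<Longrightarrow> 1 / 2 < dfun A (Hs n) p (Y p)"
    and closed: "\<And>n. closed (level (Hs n) (es n))"
    and invar: "\<And>n p t. p \<in> level (Hs n) (es n) \<Longrightarrow> ham_flow A \<omega> (Hs n) t p \<in> level (Hs n) (es n)"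
    and nonrigid: "\<And>n. \<not> rigid (ham_field A \<omega> (Hs n)) (Hs n) (level (Hs n) (es n))"
  shows False
proof -
  let ?X = "\<lambda>n. ham_field A \<omega> (Hs n)" and ?Z = "ham_field A \<omega> H0"
  let ?E = "\<lambda>n. level (Hs n) (es n)"
  have C2: "Ck_fun A 2 UNIV (Hs n)" for n by (rule C2_converges_C2(1)[OF conv])
  have C1: "Ck_fun A (Suc 0) UNIV (Hs n)" for n using Ck_fun_mono[OF C2] by simp
  have lH: "linear (dfun A (Hs n) p)" for n p by (rule linear_dfun[OF C1 UNIV_I])
  have X: "C1_field (?X n)" for n by (rule ham_C1[OF \<omega> C2])
  have "\<forall>n. \<exists>f U p v. open U \<and> ?E n \<subseteq> U \<and> Ck_fun A (Suc 0) U f \<and>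
      (\<forall>p\<in>U. \<forall>t. flow A (?X n) t p \<in> U \<and> f (flow A (?X n) t p) = f p) \<and> p \<in> ?E n \<and> dfun A (Hs n) p v = 0 \<and> dfun A f p v \<noteq> 0"
  proof (rule allI, rule ccontr)
    fix n assume neg: "\<not> (\<exists>f U p v. open U \<and> ?E n \<subseteq> U \<and> Ck_fun A (Suc 0) U f \<and>
      (\<forall>p\<in>U. \<forall>t. flow A (?X n) t p \<in> U \<and> f (flow A (?X n) t p) = f p) \<and> p \<in> ?E n \<and> dfun A (Hs n) p v = 0 \<and> dfun A f p v \<noteq> 0)"
    have "rigid (?X n) (Hs n) (?E n)"
      unfolding rigid_def
    proof (intro allI impI ballI, rule ccontr)
      fix f U p v
      assume "open U" "?E n \<subseteq> U" "Ck_fun A (Suc 0) U f" "\<forall>p\<in>U. \<forall>t. flow A (?X n) t p \<in> U \<and> f (flow A (?X n) t p) = f p"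
        "p \<in> ?E n" "dfun A (Hs n) p v = 0" "dfun A f p v \<noteq> 0"
      then show False using neg[unfolded not_ex, rule_format, of U f p v] by (simp only: simp_thms)
    qed
    then show False using nonrigid by blast
  qed
  then obtain f U p v where U: "\<And>n. open (U n)" "\<And>n. ?E n \<subseteq> U n" and f: "\<And>n. Ck_fun A (Suc 0) (U n) (f n)"
    and finv: "\<And>n p t. p \<in> U n \<Longrightarrow> flow A (?X n) t p \<in> U n" "\<And>n p t. p \<in> U n \<Longrightarrow> f n (flow A (?X n) t p) = f n p"
    and bad: "\<And>n. p n \<in> ?E n" "\<And>n. dfun A (Hs n) (p n) (v n) = 0" "\<And>n. dfun A (f n) (p n) (v n) \<noteq> 0"
    by metis
  \<comment> \<open>Normalise: unit vectors \<open>w n\<close> in the kernel of \<open>dH\<close> on which \<open>df\<close> is at least half as large as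
    it can be.\<close>
  have "\<forall>n. \<exists>M x w. 0 < M \<and> x \<in> ?E n \<and> dfun A (Hs n) x w = 0 \<and> gnorm g x w = 1 \<and> M / 2 \<le> dfun A (f n) x w \<and>
    (\<forall>p v. p \<in> ?E n \<longrightarrow> dfun A (Hs n) p v = 0 \<longrightarrow> \<bar>dfun A (f n) p v\<bar> \<le> M * gnorm g p v)"
  proof
    fix n
    show "\<exists>M x w. 0 < M \<and> x \<in> ?E n \<and> dfun A (Hs n) x w = 0 \<and> gnorm g x w = 1 \<and> M / 2 \<le> dfun A (f n) x w \<and>
      (\<forall>p v. p \<in> ?E n \<longrightarrow> dfun A (Hs n) p v = 0 \<longrightarrow> \<bar>dfun A (f n) p v\<bar> \<le> M * gnorm g p v)"
      by (rule almost_maximal_direction[OF g closed U(2) f U(1) C1 bad]) blast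
  qed
  then obtain M x w where M: "\<And>n. 0 < M n" and x: "\<And>n. x n \<in> ?E n" and w: "\<And>n. dfun A (Hs n) (x n) (w n) = 0" "\<And>n. gnorm g (x n) (w n) = 1"
    "\<And>n. M n / 2 \<le> dfun A (f n) (x n) (w n)"
    and bound: "\<And>n p v. p \<in> ?E n \<Longrightarrow> dfun A (Hs n) p v = 0 \<Longrightarrow> \<bar>dfun A (f n) p v\<bar> \<le> M n * gnorm g p v"
    by metis
  obtain s l a where s: "strict_mono s" and tc: "tconv (x \<circ> s) (w \<circ> s) l a"
    by (rule unit_tangent_subsequence[OF g w(2)])
  let ?x = "x \<circ> s" and ?H = "\<lambda>n. Hs (s n)" and ?\<alpha> = "\<lambda>n v. dfun A (f (s n)) (x (s n)) v / M (s n)"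
  have convs: "C2_converges ?H H0" by (rule C2_converges_subseq[OF conv s])
  have xl: "?x \<longlonglongrightarrow> l" using tc by (simp add: tconv_def)
  have xc: "x n \<in> ctube \<delta>" for n using x[of n] tube_ctube[of \<delta>] by (auto simp: level_def)
  have lE: "l \<in> E0"
  proof -
    have "l \<in> ctube \<delta>" by (rule closed_sequentially[OF closed_ctube _ xl]) (use xc in simp)
    then obtain t p where tp: "l = \<psi> t p" "p \<in> E0" "\<bar>t\<bar> \<le> \<delta>" by (auto simp: ctube_def)
    have "(\<lambda>n. ?H n (?x n)) \<longlonglongrightarrow> H0 l" by (rule C2_converges_tendsto[OF convs xl])
    moreover have "?H n (?x n) = es (s n)" for n using x[of "s n"] by (simp add: level_def)
    ultimately have "(\<lambda>n. es (s n)) \<longlonglongrightarrow> H0 l" by simp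
    moreover have "(\<lambda>n. es (s n)) \<longlonglongrightarrow> e0" using LIMSEQ_subseq_LIMSEQ[OF es s] by (simp add: o_def)
    ultimately have "H0 l = e0" by (rule LIMSEQ_unique)
    then have "t = 0" using H0_tube[OF tp(2,3)] tp(1) by simp
    then show ?thesis using tp by simp
  qed
  have a0: "dfun A H0 l a = 0"
    using C2_converges_dfun[OF convs tc] w(1) LIMSEQ_unique[OF _ tendsto_const] by simp
  have lim: "field_limit (\<lambda>n. ?X (s n)) ?Z"
    using convs unfolding C2_converges_def
    by (intro ham_field_limit[OF symplectic_bilinear[OF \<omega>] symplectic_nondeg[OF \<omega>]]) blast+
  have lin: "linear (?\<alpha> n)" for n
    using linear_compose_scale_right[OF linear_dfun[OF f[of "s n"] subsetD[OF U(2) x]], of "1 / M (s n)"] by simp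
  \<comment> \<open>Vectors in the kernel of \<open>dH0\<close> are limits of vectors in the kernels.\<close>
  have approx: "\<exists>us. tconv ?x us l u \<and> (\<forall>n. dfun A (?H n) (?x n) (us n) = 0)" if u: "dfun A H0 l u = 0" for u
  proof -
    obtain vs where vs: "tconv ?x vs l u" by (rule tconv_exists[OF xl])
    have yt: "tconv ?x (\<lambda>n. Y (?x n)) l (Y l)" by (rule C1_field_tconv[OF field_limit_const[OF Y] xl])
    let ?c = "\<lambda>n. - (dfun A (?H n) (?x n) (vs n) / dfun A (?H n) (?x n) (Y (?x n)))"
    have "dfun A H0 l (Y l) = 1" using unit Q(2) lE by blast
    then have "?c \<longlonglongrightarrow> - (dfun A H0 l u / dfun A H0 l (Y l))"
      by (intro tendsto_intros C2_converges_dfun[OF convs vs] C2_converges_dfun[OF convs yt]) simp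
    then have "?c \<longlonglongrightarrow> 0" using u by simp
    from tconv_lin[OF vs yt this] have "tconv ?x (\<lambda>n. vs n + ?c n *\<^sub>R Y (?x n)) l u" by simp
    moreover have "dfun A (?H n) (?x n) (vs n + ?c n *\<^sub>R Y (?x n)) = 0" for n
      using inc[OF xc[of "s n"], of "s n"] linear_add[OF lH, of "s n" "x (s n)" "vs n" "?c n *\<^sub>R Y (x (s n))"]
        linear_scale[OF lH, of "s n" "x (s n)" "?c n" "Y (x (s n))"] by simp
    ultimately show ?thesis by blast
  qed
  \<comment> \<open>Move the vectors along the flow to a time where their limit is short; \<open>df\<close> is invariant.\<close>
  have small: "(\<lambda>n. ?\<alpha> n (us n)) \<longlonglongrightarrow> 0"
    if us: "tconv ?x us l u" "\<And>n. dfun A (?H n) (?x n) (us n) = 0" and u: "shrinks l u" for us u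
  proof (rule tendstoI)
    fix e :: real assume "0 < e"
    then obtain T where T: "gnorm g (\<phi> T l) (tangent_map A (\<phi> T) l u) < e" using u unfolding shrinks_def by blast
    let ?F = "\<lambda>n. flow A (?X (s n)) T"
    have "(\<lambda>n. gnorm g (?F n (?x n)) (tangent_map A (?F n) (?x n) (us n))) \<longlonglongrightarrow> gnorm g (\<phi> T l) (tangent_map A (\<phi> T) l u)"
      unfolding \<phi>_flow by (rule gnorm_tconv[OF g tconv_flow[OF lim us(1)]])
    then have "\<forall>\<^sub>F n in sequentially. gnorm g (?F n (?x n)) (tangent_map A (?F n) (?x n) (us n)) < e"
      using T by (rule order_tendstoD)
    then show "\<forall>\<^sub>F n in sequentially. dist (?\<alpha> n (us n)) 0 < e"
    proof eventually_elim
      case (elim n)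
      let ?q = "?F n (?x n)" and ?w = "tangent_map A (?F n) (?x n) (us n)"
      have qE: "?q \<in> ?E (s n)" using invar[OF x[of "s n"], of T] by (simp add: ham_flow_def)
      have "dfun A (?H n) ?q ?w = dfun A (?H n) (?x n) (us n)"
        by (rule invariant_dfun[OF X C1 open_UNIV]) (use energy_conserved[OF \<omega> C2] in \<open>auto simp: ham_flow_def\<close>)
      then have "\<bar>dfun A (f (s n)) ?q ?w\<bar> \<le> M (s n) * gnorm g ?q ?w" using bound[OF qE] us(2) by simp
      moreover have "dfun A (f (s n)) ?q ?w = dfun A (f (s n)) (?x n) (us n)"
        by (rule invariant_dfun[OF X f U(1) finv]) (use U(2) x in auto)
      ultimately have "\<bar>?\<alpha> n (us n)\<bar> \<le> gnorm g ?q ?w"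
        using M[of "s n"] by (simp add: abs_divide divide_le_eq mult.commute)
      then show ?case using elim by (simp add: dist_real_def)
    qed
  qed
  obtain b c \<xi> where split: "a = b + \<xi> *\<^sub>R ?Z l + c" "dfun A H0 l b = 0" "dfun A H0 l c = 0" "shrinks l b" "shrinks l c"
    by (rule anosov_splitting[OF lE a0])
  obtain bs where bs: "tconv ?x bs l b" "\<And>n. dfun A (?H n) (?x n) (bs n) = 0" using approx[OF split(2)] by blast
  obtain cs where cs: "tconv ?x cs l c" "\<And>n. dfun A (?H n) (?x n) (cs n) = 0" using approx[OF split(3)] by blast
  have Xs: "tconv ?x (\<lambda>n. ?X (s n) (?x n)) l (?Z l)" by (rule C1_field_tconv[OF lim xl])
  have HX: "dfun A (?H n) (?x n) (?X (s n) (?x n)) = 0" for n by (rule dfun_ham[OF \<omega> C2])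
  have \<alpha>X: "?\<alpha> n (?X (s n) (?x n)) = 0" for n
  proof -
    have "dfun A (f (s n)) (x (s n)) (?X (s n) (x (s n))) = 0"
      by (rule invariant_dfun_field[OF X f U(1) finv]) (use U(2) x in auto)
    then show ?thesis by simp
  qed
  let ?r = "\<lambda>n. w (s n) + (- 1) *\<^sub>R bs n + (- 1) *\<^sub>R cs n + (- \<xi>) *\<^sub>R ?X (s n) (?x n)"
  have "tconv ?x ?r l (a + (- 1) *\<^sub>R b + (- 1) *\<^sub>R c + (- \<xi>) *\<^sub>R ?Z l)"
    using tconv_lin[OF tconv_lin[OF tconv_lin[OF tc bs(1) tendsto_const] cs(1) tendsto_const] Xs tendsto_const] by (simp only: o_def)
  then have r: "tconv ?x ?r l 0" by (simp add: split(1) algebra_simps)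
  have rker: "dfun A (?H n) (?x n) (?r n) = 0" for n
    using w(1)[of "s n"] bs(2)[of n] cs(2)[of n] HX[of n]
    by (simp only: linear_add[OF lH] linear_scale[OF lH] o_def) simp
  have "shrinks l 0"
    unfolding shrinks_def by (intro allI impI exI[of _ 0]) (simp add: \<phi>_flow tangent_map_flow_0[OF ham_C1[OF \<omega> H0_C2]] gnorm_zero[OF g])
  then have lim0: "(\<lambda>n. ?\<alpha> n (?r n) + ?\<alpha> n (bs n) + ?\<alpha> n (cs n)) \<longlonglongrightarrow> 0 + 0 + 0"
    by (intro tendsto_add small[OF r rker] small[OF bs] small[OF cs] split)
  have "?\<alpha> n (?r n) + ?\<alpha> n (bs n) + ?\<alpha> n (cs n) = ?\<alpha> n (w (s n))" for n
    using \<alpha>X[of n] by (simp only: linear_add[OF lin] linear_scale[OF lin]) simp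
  then have "(\<lambda>n. ?\<alpha> n (w (s n))) \<longlonglongrightarrow> 0" using lim0 by simp
  then have "\<forall>\<^sub>F n in sequentially. ?\<alpha> n (w (s n)) < 1 / 2" by (rule order_tendstoD) simp
  then obtain n where "?\<alpha> n (w (s n)) < 1 / 2" by (auto simp: eventually_sequentially)
  then show False using w(3)[of "s n"] M[of "s n"] by (simp add: divide_less_eq)
qed

end

section \<open>Functions whose differential vanishes along a level\<close>

text \<open>Local constancy in coordinates.  Two nearby points \<open>y1\<close>, \<open>y2\<close> of the level are joined inside the
  level by \<open>s \<mapsto> y1 + s (y2 - y1) + u s w\<close>, where \<open>w\<close> is transversal.  The correction \<open>u\<close> need only be
  Lipschitz: along such a curve the increment of \<open>k\<close> is a multiple of the increment of \<open>h\<close>, which is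
  zero, up to higher order.\<close>

lemma constant_near_on_level:
  fixes h k :: "'e::euclidean_space \<Rightarrow> real"
  assumes S: "open S" "x \<in> S" and h: "Ck_on (Suc 0) h S" and k: "Ck_on (Suc 0) k S"
    and w: "0 < frechet_derivative h (at x) w"
    and level_prop: "\<And>y v. y \<in> S \<Longrightarrow> h y = h x \<Longrightarrow> frechet_derivative h (at y) v = 0 \<Longrightarrow> frechet_derivative k (at y) v = 0"
  obtains d where "0 < d" "\<And>y. y \<in> ball x d \<Longrightarrow> h y = h x \<Longrightarrow> k y = k x"
proof -
  let ?Dh = "\<lambda>y. frechet_derivative h (at y)" and ?Dk = "\<lambda>y. frechet_derivative k (at y)"
  define m where "m = ?Dh x w / 2"
  have m: "0 < m" using w by (simp add: m_def)
  have "isCont (\<lambda>y. ?Dh y w) x" using C1_continuous_derivative[OF h] S by (simp add: continuous_on_eq_continuous_at)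
  then obtain r0 where r0: "0 < r0" "\<And>y. dist y x < r0 \<Longrightarrow> \<bar>?Dh y w - ?Dh x w\<bar> < m"
    using m unfolding continuous_at_eps_delta dist_real_def by blast
  obtain r1 where r1: "0 < r1" "cball x r1 \<subseteq> S" using S open_contains_cball by blast
  define r where "r = min (r0 / 2) r1"
  have r: "0 < r" "cball x r \<subseteq> S" using r0 r1 by (auto simp: r_def)
  have mw: "m \<le> ?Dh y w" if "y \<in> cball x r" for y
  proof -
    have "\<bar>?Dh y w - ?Dh x w\<bar> < m" by (rule r0(2)) (use that r0(1) in \<open>auto simp: r_def dist_commute\<close>)
    then show ?thesis unfolding m_def abs_less_iff by linarith
  qed
  obtain L M where L: "0 \<le> L" and Lh: "\<And>y z. y \<in> cball x r \<Longrightarrow> z \<in> cball x r \<Longrightarrow> norm (h y - h z) \<le> L * norm (y - z)"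
    by (rule C1_limit_Lipschitz[OF h S(1) r(2)]) blast
  have w0: "w \<noteq> 0"
    using w linear_0[OF linear_frechet_derivative[OF C1_differentiable[OF h S(2)]]] by auto
  define \<eta> where "\<eta> = r / (2 * norm w)"
  have \<eta>: "0 < \<eta>" "\<eta> * norm w = r / 2" using r w0 by (simp_all add: \<eta>_def)
  define d where "d = min (r / 2) (m * \<eta> / (L + 1))"
  have d: "0 < d" "d \<le> r / 2" "L * d < m * \<eta>"
  proof -
    show "0 < d" using r m \<eta> L by (simp add: d_def)
    show "d \<le> r / 2" unfolding d_def by (rule min.cobounded1)
    have "L * d \<le> L * (m * \<eta> / (L + 1))" using L by (intro mult_left_mono) (auto simp: d_def)
    also have "\<dots> < m * \<eta>" using L m \<eta> by (simp add: field_simps)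
    finally show "L * d < m * \<eta>" .
  qed
  have "k y = k x" if y: "y \<in> ball x d" "h y = h x" for y
  proof -
    define \<beta> where "\<beta> s = x + s *\<^sub>R (y - x)" for s :: real
    have \<beta>d: "norm (\<beta> s - x) \<le> d" if "s \<in> {0..1}" for s
    proof -
      have "\<bar>s\<bar> * norm (y - x) \<le> 1 * d" using that y(1) by (intro mult_mono) (auto simp: dist_norm norm_minus_commute)
      then show ?thesis by (simp add: \<beta>_def)
    qed
    have inB: "\<beta> s + u *\<^sub>R w \<in> cball x r" if "s \<in> {0..1}" "\<bar>u\<bar> \<le> \<eta>" for s u
    proof -
      have "norm (\<beta> s + u *\<^sub>R w - x) \<le> norm (\<beta> s - x) + norm (u *\<^sub>R w)"
        using norm_triangle_ineq[of "\<beta> s - x" "u *\<^sub>R w"] by (simp add: algebra_simps)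
      also have "\<dots> \<le> r / 2 + r / 2"
        using \<beta>d[OF that(1)] d(2) mult_right_mono[OF that(2) norm_ge_zero[of w]] \<eta>(2) by (intro add_mono) auto
      finally show ?thesis by (simp add: dist_norm norm_minus_commute)
    qed
    \<comment> \<open>\<open>h\<close> grows at least at rate \<open>m\<close> in the direction \<open>w\<close>.\<close>
    have grow: "m * (u' - u) \<le> h (\<beta> s + u' *\<^sub>R w) - h (\<beta> s + u *\<^sub>R w)" if "s \<in> {0..1}" "- \<eta> \<le> u" "u \<le> u'" "u' \<le> \<eta>" for s u u'
    proof (cases "u = u'")
      case False
      then have "u < u'" using that by simp
      have der: "((\<lambda>u. h (\<beta> s + u *\<^sub>R w)) has_real_derivative ?Dh (\<beta> s + \<zeta> *\<^sub>R w) w) (at \<zeta>)" if "u \<le> \<zeta>" "\<zeta> \<le> u'" for \<zeta>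
      proof -
        have in_S: "\<beta> s + \<zeta> *\<^sub>R w \<in> S" using inB[of s \<zeta>] \<open>s \<in> {0..1}\<close> that \<open>- \<eta> \<le> u\<close> \<open>u' \<le> \<eta>\<close> r(2) by (auto simp: abs_le_iff)
        have "((\<lambda>u. \<beta> s + u *\<^sub>R w) has_derivative (\<lambda>t. t *\<^sub>R w)) (at \<zeta>)" by (auto intro!: derivative_eq_intros)
        from diff_chain_at[OF this C1_has_derivative[OF h in_S]]
        have "((\<lambda>u. h (\<beta> s + u *\<^sub>R w)) has_derivative ?Dh (\<beta> s + \<zeta> *\<^sub>R w) \<circ> (\<lambda>t. t *\<^sub>R w)) (at \<zeta>)" by (simp add: o_def)
        moreover have "?Dh (\<beta> s + \<zeta> *\<^sub>R w) \<circ> (\<lambda>t. t *\<^sub>R w) = (*) (?Dh (\<beta> s + \<zeta> *\<^sub>R w) w)"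
          using linear_frechet_derivative[OF C1_differentiable[OF h in_S]] by (auto simp: linear_scale)
        ultimately show ?thesis by (simp add: has_field_derivative_def)
      qed
      from MVT2[OF \<open>u < u'\<close> der] obtain \<zeta> where \<zeta>: "u < \<zeta>" "\<zeta> < u'"
        "h (\<beta> s + u' *\<^sub>R w) - h (\<beta> s + u *\<^sub>R w) = (u' - u) * ?Dh (\<beta> s + \<zeta> *\<^sub>R w) w" by blast
      have "m \<le> ?Dh (\<beta> s + \<zeta> *\<^sub>R w) w" by (rule mw[OF inB]) (use \<zeta> that in \<open>auto simp: abs_le_iff\<close>)
      then show ?thesis using \<zeta>(3) \<open>u < u'\<close> by (simp add: mult.commute[of m] mult_left_mono)
    qed simp
    have "\<exists>u. \<bar>u\<bar> \<le> \<eta> \<and> h (\<beta> s + u *\<^sub>R w) = h x" if s: "s \<in> {0..1}" for s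
    proof -
      have "norm (h (\<beta> s + 0 *\<^sub>R w) - h x) \<le> L * norm (\<beta> s + 0 *\<^sub>R w - x)"
        by (rule Lh[OF inB[OF s]]) (use \<eta> r in auto)
      also have "\<dots> \<le> L * d" using \<beta>d[OF s] L by (simp add: mult_left_mono)
      finally have h0: "\<bar>h (\<beta> s) - h x\<bar> < m * \<eta>" using d(3) by simp
      have "h (\<beta> s + (- \<eta>) *\<^sub>R w) \<le> h x" "h x \<le> h (\<beta> s + \<eta> *\<^sub>R w)"
        using grow[OF s, of "- \<eta>" 0] grow[OF s, of 0 \<eta>] h0 \<eta>(1) by (auto simp: abs_less_iff)
      moreover have "continuous_on {- \<eta>..\<eta>} (\<lambda>u. h (\<beta> s + u *\<^sub>R w))"
        by (rule continuous_on_compose2[OF C1_continuous_on[OF h]])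
          (use inB[OF s] r(2) in \<open>auto intro!: continuous_intros simp: abs_le_iff\<close>)
      ultimately obtain u where "- \<eta> \<le> u" "u \<le> \<eta>" "h (\<beta> s + u *\<^sub>R w) = h x"
        using IVT'[of "\<lambda>u. h (\<beta> s + u *\<^sub>R w)" "- \<eta>" "h x" \<eta>] \<eta>(1) by auto
      then show ?thesis by (intro exI[of _ u]) (simp add: abs_le_iff)
    qed
    then obtain u where u: "\<And>s. s \<in> {0..1} \<Longrightarrow> \<bar>u s\<bar> \<le> \<eta>" "\<And>s. s \<in> {0..1} \<Longrightarrow> h (\<beta> s + u s *\<^sub>R w) = h x" by metis
    define \<gamma> where "\<gamma> s = \<beta> s + u s *\<^sub>R w" for s
    have \<gamma>B: "\<gamma> s \<in> cball x r" if "s \<in> {0..1}" for s unfolding \<gamma>_def using inB[OF that u(1)[OF that]] .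
    have unique: "m * \<bar>u s - u'\<bar> \<le> \<bar>h (\<beta> s + u' *\<^sub>R w) - h x\<bar>" if "s \<in> {0..1}" "\<bar>u'\<bar> \<le> \<eta>" for s u'
    proof (cases "u s \<le> u'")
      case True
      then show ?thesis using grow[OF that(1) _ True] u[OF that(1)] that(2) by (simp add: abs_le_iff abs_if split: if_splits)
    next
      case False
      then show ?thesis using grow[OF that(1), of u' "u s"] u[OF that(1)] that(2) by (simp add: abs_le_iff abs_if split: if_splits)
    qed
    define K where "K = norm (y - x) + L * norm (y - x) / m * norm w"
    have lip: "norm (\<gamma> s - \<gamma> s') \<le> K * \<bar>s - s'\<bar>" if s: "s \<in> {0..1}" and s': "s' \<in> {0..1}" for s s'
    proof -
      have \<beta>\<beta>: "\<beta> s - \<beta> s' = (s - s') *\<^sub>R (y - x)" by (simp add: \<beta>_def algebra_simps)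
      have "m * \<bar>u s - u s'\<bar> \<le> \<bar>h (\<beta> s + u s' *\<^sub>R w) - h x\<bar>" by (rule unique[OF s u(1)[OF s']])
      also have "\<dots> = norm (h (\<beta> s + u s' *\<^sub>R w) - h (\<beta> s' + u s' *\<^sub>R w))" using u(2)[OF s'] by simp
      also have "\<dots> \<le> L * norm ((\<beta> s + u s' *\<^sub>R w) - (\<beta> s' + u s' *\<^sub>R w))"
        by (rule Lh[OF inB[OF s u(1)[OF s']] inB[OF s' u(1)[OF s']]])
      also have "\<dots> = L * (\<bar>s - s'\<bar> * norm (y - x))" by (simp add: \<beta>\<beta>)
      finally have "\<bar>u s - u s'\<bar> \<le> L * norm (y - x) / m * \<bar>s - s'\<bar>" using m by (simp add: field_simps)
      then have "\<bar>u s - u s'\<bar> * norm w \<le> L * norm (y - x) / m * \<bar>s - s'\<bar> * norm w" by (intro mult_right_mono) auto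
      moreover have "\<gamma> s - \<gamma> s' = (s - s') *\<^sub>R (y - x) + (u s - u s') *\<^sub>R w"
        using \<beta>\<beta> by (simp add: \<gamma>_def algebra_simps)
      then have "norm (\<gamma> s - \<gamma> s') \<le> \<bar>s - s'\<bar> * norm (y - x) + \<bar>u s - u s'\<bar> * norm w"
        using norm_triangle_ineq[of "(s - s') *\<^sub>R (y - x)" "(u s - u s') *\<^sub>R w"] by simp
      ultimately show ?thesis by (simp add: K_def algebra_simps)
    qed
    have K0: "0 \<le> K" using L m by (simp add: K_def)
    \<comment> \<open>\<open>Dk = \<mu> Dh\<close> at points of the level, and \<open>h\<close> is constant along \<open>\<gamma>\<close>.\<close>
    have "((\<lambda>s. k (\<gamma> s)) has_derivative (\<lambda>t. 0)) (at s within {0..1})" if s: "s \<in> {0..1}" for s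
      unfolding has_derivative_within_alt
    proof (intro conjI allI impI)
      fix e :: real assume e: "0 < e"
      let ?p = "\<gamma> s"
      have pS: "?p \<in> S" using \<gamma>B[OF s] r(2) by blast
      have hp: "h ?p = h x" using u(2)[OF s] by (simp add: \<gamma>_def)
      have dw: "0 < ?Dh ?p w" using mw[OF \<gamma>B[OF s]] m by linarith
      define \<mu> where "\<mu> = ?Dk ?p w / ?Dh ?p w"
      have lh: "linear (?Dh ?p)" and lk: "linear (?Dk ?p)"
        using linear_frechet_derivative[OF C1_differentiable[OF h pS]] linear_frechet_derivative[OF C1_differentiable[OF k pS]] by auto
      have Dk: "?Dk ?p v = \<mu> * ?Dh ?p v" for v
      proof -
        have "?Dh ?p (v - (?Dh ?p v / ?Dh ?p w) *\<^sub>R w) = 0" using dw by (simp add: linear_diff[OF lh] linear_scale[OF lh])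
        from level_prop[OF pS hp this] show ?thesis by (simp add: linear_diff[OF lk] linear_scale[OF lk] \<mu>_def)
      qed
      have der: "((\<lambda>q. k q - \<mu> * h q) has_derivative (\<lambda>v. 0)) (at ?p)"
        using has_derivative_diff[OF C1_has_derivative[OF k pS] has_derivative_mult_right[OF C1_has_derivative[OF h pS], of \<mu>]] Dk by simp
      define e' where "e' = e / (K + 1)"
      have e': "0 < e'" "e' * K \<le> e" using e K0 by (simp_all add: e'_def field_simps)
      obtain \<rho> where \<rho>: "0 < \<rho>" "\<And>q. norm (q - ?p) < \<rho> \<Longrightarrow> \<bar>(k q - \<mu> * h q) - (k ?p - \<mu> * h ?p)\<bar> \<le> e' * norm (q - ?p)"
        using der[unfolded has_derivative_at_alt] e'(1) by auto
      have "\<bar>k (\<gamma> s') - k ?p\<bar> \<le> e * \<bar>s' - s\<bar>" if s': "s' \<in> {0..1}" "\<bar>s' - s\<bar> < \<rho> / (K + 1)" for s'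
      proof -
        have nl: "norm (\<gamma> s' - ?p) \<le> K * \<bar>s' - s\<bar>" by (rule lip[OF s'(1) s])
        also have "\<dots> \<le> (K + 1) * \<bar>s' - s\<bar>" by (intro mult_right_mono) auto
        also have "\<dots> < \<rho>" using s'(2) K0 by (simp add: field_simps)
        finally have "\<bar>(k (\<gamma> s') - \<mu> * h (\<gamma> s')) - (k ?p - \<mu> * h ?p)\<bar> \<le> e' * norm (\<gamma> s' - ?p)" by (rule \<rho>(2))
        moreover have "h (\<gamma> s') = h ?p" using u(2)[OF s'(1)] hp by (simp add: \<gamma>_def)
        moreover have "e' * norm (\<gamma> s' - ?p) \<le> e' * (K * \<bar>s' - s\<bar>)" using nl e'(1) by (intro mult_left_mono) auto
        moreover have "e' * (K * \<bar>s' - s\<bar>) \<le> e * \<bar>s' - s\<bar>" using mult_right_mono[OF e'(2), of "\<bar>s' - s\<bar>"] by (simp add: mult.assoc)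
        ultimately show ?thesis by simp
      qed
      then show "\<exists>\<rho>>0. \<forall>s'\<in>{0..1}. norm (s' - s) < \<rho> \<longrightarrow> norm (k (\<gamma> s') - k (\<gamma> s) - 0) \<le> e * norm (s' - s)"
        using \<rho>(1) K0 by (intro exI[of _ "\<rho> / (K + 1)"]) auto
    qed simp
    from has_derivative_zero_constant[OF _ this] have "k (\<gamma> 0) = k (\<gamma> 1)" by force
    moreover have "u 0 = 0" using unique[of 0 0] \<eta>(1) m by (simp add: \<beta>_def mult_le_0_iff)
    moreover have "u 1 = 0" using unique[of 1 0] \<eta>(1) m y(2) by (simp add: \<beta>_def mult_le_0_iff)
    ultimately show ?thesis by (simp add: \<gamma>_def \<beta>_def)
  qed
  then show thesis using that d(1) by blast
qed

context closed_manifold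
begin

lemma constant_on_level:
  assumes H: "Ck_fun A (Suc 0) UNIV H" and T: "open T" and conn: "connected (H -` {e} \<inter> T)"
    and f: "Ck_fun A (Suc 0) U f" "open U" "H -` {e} \<inter> T \<subseteq> U"
    and regular: "\<And>p. p \<in> H -` {e} \<inter> T \<Longrightarrow> \<exists>v. dfun A H p v \<noteq> 0"
    and ker: "\<And>p v. p \<in> H -` {e} \<inter> T \<Longrightarrow> dfun A H p v = 0 \<Longrightarrow> dfun A f p v = 0"
  shows "f constant_on (H -` {e} \<inter> T)"
proof (rule locally_constant_imp_constant[OF conn])
  let ?E = "H -` {e} \<inter> T"
  fix x assume x: "x \<in> ?E"
  let ?c = "chart_at A x"
  let ?S = "chart_map ?c ` (chart_dom ?c \<inter> (U \<inter> T))" and ?h = "H \<circ> chart_inv ?c" and ?k = "f \<circ> chart_inv ?c"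
  have S: "open ?S" by (rule open_chart_image[OF chart_at(1) open_Int[OF f(2) T]])
  have xS: "chart_map ?c x \<in> ?S" using x f(3) chart_at by blast
  have h: "Ck_on (Suc 0) ?h ?S" and k: "Ck_on (Suc 0) ?k ?S"
    using H f(1) chart_at(1) Ck_on_subset[of _ _ _ ?S] unfolding Ck_fun_def by blast+
  obtain v where v: "dfun A H x v \<noteq> 0" using regular[OF x] by blast
  have "dfun A H x (- v) = - dfun A H x v" by (rule linear_neg[OF linear_dfun[OF H UNIV_I]])
  then obtain w where w: "0 < dfun A H x w" using v by (metis neg_0_less_iff_less not_less_iff_gr_or_eq)
  obtain d where d: "0 < d" "\<And>y. y \<in> ball (chart_map ?c x) d \<Longrightarrow> ?h y = ?h (chart_map ?c x) \<Longrightarrow> ?k y = ?k (chart_map ?c x)"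
  proof (rule constant_near_on_level[OF S xS h k, of w])
    show "0 < frechet_derivative ?h (at (chart_map ?c x)) w" using w by (simp add: dfun_def)
    fix y v assume y: "y \<in> ?S" "?h y = ?h (chart_map ?c x)" "frechet_derivative ?h (at y) v = 0"
    then obtain q where q: "q \<in> chart_dom ?c" "q \<in> U" "q \<in> T" "y = chart_map ?c q" by blast
    then have qE: "q \<in> ?E" using y(2) x chart_at by simp
    show "frechet_derivative ?k (at y) v = 0"
      using ker[OF qE, of "coord_vec A ?c q v"] y(3) q(4)
        dfun_coord_vec[OF H open_UNIV UNIV_I chart_at(1) q(1)] dfun_coord_vec[OF f(1,2) q(2) chart_at(1) q(1)] by simp
  qed blast
  let ?W = "{q \<in> chart_dom ?c. chart_map ?c q \<in> ball (chart_map ?c x) d}"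
  have W: "open ?W" "x \<in> ?W" using open_chart_ball[OF chart_at d(1)] by auto
  have "f q = f x" if "q \<in> ?E \<inter> ?W" for q
    using d(2)[of "chart_map ?c q"] that x by (simp add: chart_at)
  then show "\<exists>T'. openin (top_of_set ?E) T' \<and> x \<in> T' \<and> (\<forall>q\<in>T'. f q = f x)"
    using x W openin_open_Int[OF W(1), of ?E] by blast
qed

end

context level_collar
begin

text \<open>If all levels with energy near \<open>e\<close> are rigid, then \<open>dK = c dH\<close> on an invariant neighbourhood of
  the level, so that the factor \<open>c\<close> is itself an invariant function, to which rigidity applies once
  more.\<close>

lemma trivial_centralizer:
  assumes \<omega>: "symplectic_form A \<omega>" and H: "Ck_fun A 2 UNIV H" and inc: "\<And>p. p \<in> ctube \<delta> \<Longrightarrow> 1 / 2 < dfun A H p (Y p)"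
    and V: "open V" "e \<in> V" and comp: "\<And>e. e \<in> V \<Longrightarrow> level H e \<in> components (H -` {e})"
    and rig: "\<And>e. e \<in> V \<Longrightarrow> rigid (ham_field A \<omega> H) H (level H e)"
  shows "trivial_centralizer_on A \<omega> H (level H e)"
  unfolding trivial_centralizer_on_def
proof
  let ?X = "ham_field A \<omega> H"
  have H1: "Ck_fun A (Suc 0) UNIV H" using Ck_fun_mono[OF H] by simp
  have lH: "linear (dfun A H p)" for p by (rule linear_dfun[OF H1 UNIV_I])
  have X: "C1_field ?X" by (rule ham_C1[OF \<omega> H])
  fix Z assume "Z \<in> ham_centralizer A \<omega> H"
  then obtain K where Z: "Z = ham_field A \<omega> K" and K: "K \<in> Cr_functions A 2" and PB: "\<And>p. poisson_bracket A \<omega> K H p = 0"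
    by (auto simp: ham_centralizer_def)
  have K2: "Ck_fun A 2 UNIV K" using K by (simp add: Cr_functions_def numeral_eq_enat)
  then have K1: "Ck_fun A (Suc 0) UNIV K" using Ck_fun_mono by fastforce
  have lK: "linear (dfun A K p)" for p by (rule linear_dfun[OF K1 UNIV_I])
  have "dfun A K p (?X p) = 0" for p
  proof -
    have "((\<lambda>s. K (flow A ?X s p)) has_real_derivative dfun A K (flow A ?X 0 p) (?X (flow A ?X 0 p))) (at 0)"
      by (rule velocity_fun[OF K1 open_UNIV UNIV_I flow_velocity[OF X]])
    from DERIV_imp_deriv[OF this] PB[of p] show ?thesis
      using X by (simp add: poisson_bracket_def ham_flow_def)
  qed
  then have Kinv: "K (flow A ?X t p) = K p" for t p using first_integral[OF \<omega> H K1] by (simp add: ham_flow_def)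
  have Hinv: "H (flow A ?X t p) = H p" for t p using energy_conserved[OF \<omega> H] by (simp add: ham_flow_def)
  define c where "c p = dfun A K p (Y p) / dfun A H p (Y p)" for p
  define U where "U = tube \<delta> \<inter> H -` V"
  have H_cont: "continuous_on UNIV H"
    by (rule continuous_at_imp_continuous_on) (use C1_fun_isCont[OF H1 open_UNIV] in auto)
  have U: "open U" unfolding U_def by (intro open_Int open_tube open_vimage V H_cont)
  have U_level: "p \<in> level H (H p) \<and> H p \<in> V" if "p \<in> U" for p using that by (auto simp: U_def level_def)
  have HY: "0 < dfun A H p (Y p)" if "p \<in> tube \<delta>" for p
    using inc[of p] that tube_ctube by force
  have K_c: "dfun A K p v = c p * dfun A H p v" if p: "p \<in> U" for p v
  proof -
    let ?v = "v - (dfun A H p v / dfun A H p (Y p)) *\<^sub>R Y p"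
    have pY: "dfun A H p (Y p) \<noteq> 0" using HY[of p] p by (simp add: U_def)
    then have "dfun A H p ?v = 0" by (simp add: linear_diff[OF lH] linear_scale[OF lH])
    moreover have "rigid ?X H (level H (H p))" using rig U_level[OF p] by blast
    ultimately have "dfun A K p ?v = 0"
      using U_level[OF p] K1 Kinv unfolding rigid_def by blast
    then show ?thesis by (simp add: linear_diff[OF lK] linear_scale[OF lK] c_def)
  qed
  have Uinv: "flow A ?X t p \<in> U" if p: "p \<in> U" for t p
  proof -
    have "ham_flow A \<omega> H t p \<in> level H (H p)"
      by (rule component_invariant[OF \<omega> H comp]) (use U_level[OF p] in auto)
    then show ?thesis using Hinv p by (simp add: U_def level_def ham_flow_def)
  qed
  have cinv: "c (flow A ?X t p) = c p" if p: "p \<in> U" for t p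
  proof -
    let ?q = "flow A ?X t p" and ?w = "tangent_map A (flow A ?X t) p (Y p)"
    have "dfun A K ?q ?w = dfun A K p (Y p)" by (rule invariant_dfun[OF X K1 open_UNIV]) (use Kinv in auto)
    moreover have "dfun A H ?q ?w = dfun A H p (Y p)" by (rule invariant_dfun[OF X H1 open_UNIV]) (use Hinv in auto)
    ultimately have "c ?q * dfun A H p (Y p) = c p * dfun A H p (Y p)"
      using K_c[OF Uinv[OF p], of t ?w] K_c[OF p, of "Y p"] by simp
    then show ?thesis using HY[of p] p by (simp add: U_def)
  qed
  have c_C1: "Ck_fun A (Suc 0) U c"
  proof -
    have KY: "Ck_fun A (Suc 0) U (\<lambda>p. dfun A K p (Y p))" and HY': "Ck_fun A (Suc 0) U (\<lambda>p. dfun A H p (Y p))"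
      using dfun_field_C1[OF K2 open_UNIV Y] dfun_field_C1[OF H open_UNIV Y] Ck_fun_subset by blast+
    have nz: "dfun A H p (Y p) \<noteq> 0" if "p \<in> U" for p using HY[of p] that by (simp add: U_def)
    have "Ck_fun A (Suc 0) U (\<lambda>p. inverse (dfun A H p (Y p)))"
    proof (rule C1_fun_compose[OF HY' U, where \<phi> = inverse and \<phi>' = "\<lambda>x. - (inverse x * inverse x)"])
      show "(inverse has_real_derivative - (inverse (dfun A H p (Y p)) * inverse (dfun A H p (Y p)))) (at (dfun A H p (Y p)))"
        if "p \<in> U" for p
        using DERIV_inverse[OF nz[OF that]] by (simp add: power2_eq_square numeral_2_eq_2)
      show "continuous_on ((\<lambda>p. dfun A H p (Y p)) ` U) (\<lambda>x. - (inverse x * inverse x))"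
        using nz by (intro continuous_intros) auto
    qed
    from C1_fun_mult[OF KY this] show ?thesis by (simp add: c_def[abs_def] divide_inverse)
  qed
  have EU: "level H e \<subseteq> U" using V(2) by (auto simp: U_def level_def)
  have "c constant_on (H -` {e} \<inter> tube \<delta>)"
  proof (rule constant_on_level[OF H1 open_tube _ c_C1 U])
    show "connected (H -` {e} \<inter> tube \<delta>)" using in_components_connected[OF comp[OF V(2)]] by (simp add: level_def)
    show "H -` {e} \<inter> tube \<delta> \<subseteq> U" using EU by (simp add: level_def)
    show "\<exists>v. dfun A H p v \<noteq> 0" if "p \<in> H -` {e} \<inter> tube \<delta>" for p
      using HY[of p] that by (intro exI[of _ "Y p"]) auto
    show "dfun A c p v = 0" if p: "p \<in> H -` {e} \<inter> tube \<delta>" and v: "dfun A H p v = 0" for p v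
    proof -
      have "p \<in> level H e" using p by (simp add: level_def)
      with rig[OF V(2)] EU U c_C1 Uinv cinv v show ?thesis unfolding rigid_def by blast
    qed
  qed
  then obtain k where k: "\<And>p. p \<in> level H e \<Longrightarrow> c p = k" by (auto simp: constant_on_def level_def)
  have "Z p = k *\<^sub>R ?X p" if p: "p \<in> level H e" for p
    unfolding Z
  proof (rule ham_field_eqI[OF symplectic_bilinear[OF \<omega>] symplectic_nondeg[OF \<omega>]])
    fix v
    have "bilinear (\<omega> p)" using symplectic_bilinear[OF \<omega>] by (simp add: smooth_bilinear_field_def)
    then have "\<omega> p (k *\<^sub>R ?X p) v = k * dfun A H p v" using ham_dfun[OF \<omega> H] by (simp add: bilinear_lmul)
    then show "\<omega> p (k *\<^sub>R ?X p) v = dfun A K p v" using K_c[OF subsetD[OF EU p], of v] k[OF p] by simp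
  qed
  then show "\<exists>c. \<forall>p\<in>level H e. Z p = c *\<^sub>R ham_field A \<omega> H p" by blast
qed

end

section \<open>Trivial centralizers near an Anosov energy level\<close>

context closed_manifold
begin

text \<open>On a compact manifold the \<open>C\<^sup>2\<close> topology has a decreasing sequence of open neighbourhoods of a
  function that forces \<open>C\<^sup>2\<close> convergence.\<close>

lemma C2_neighbourhoods:
  assumes r: "2 \<le> r" and H0: "H0 \<in> Cr_functions A r"
  obtains U :: "nat \<Rightarrow> ('a \<Rightarrow> real) set" where "\<And>m. openin (Cr_topology A r) (U m)" "\<And>m. H0 \<in> U m"
    "\<And>m H. H \<in> U m \<Longrightarrow> Ck_fun A 2 UNIV H" "\<And>Hs. (\<And>m. Hs m \<in> U m) \<Longrightarrow> C2_converges Hs H0"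
proof -
  have C2: "Ck_fun A 2 UNIV H" if "H \<in> Cr_functions A r" for H
    using that r by (simp add: Cr_functions_def numeral_eq_enat)
  have "\<exists>\<rho>. 0 < \<rho> \<and> cball (chart_map (chart_at A p) p) \<rho> \<subseteq> chart_img (chart_at A p)" for p
    by (rule cball_in_chart[OF chart_at, of p]) (rule exI, rule conjI)
  then obtain \<rho> where \<rho>: "\<And>p. 0 < \<rho> p" "\<And>p. cball (chart_map (chart_at A p) p) (\<rho> p) \<subseteq> chart_img (chart_at A p)"
    by metis
  define K where "K p = chart_inv (chart_at A p) ` cball (chart_map (chart_at A p) p) (\<rho> p)" for p
  define W where "W p = {q \<in> chart_dom (chart_at A p). chart_map (chart_at A p) q \<in> ball (chart_map (chart_at A p) p) (\<rho> p / 2)}" for p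
  have W: "open (W p)" "p \<in> W p" for p
    unfolding W_def using open_chart_ball[OF chart_at, of "\<rho> p / 2" p] \<rho>(1)[of p] by simp_all
  obtain F where F: "finite F" "UNIV \<subseteq> (\<Union>p\<in>F. W p)"
    by (rule compactE_image[OF compact_UNIV, of UNIV W]) (use W in auto)
  then have Fne: "F \<noteq> {}" by auto
  have K: "compact (K p)" "K p \<subseteq> chart_dom (chart_at A p)" for p
    unfolding K_def
    using compact_continuous_image[OF continuous_on_subset[OF continuous_chart_inv[OF chart_at(1)] \<rho>(2)] compact_cball]
      chart_inv_in[OF chart_at(1)] \<rho>(2)[of p] by blast+
  define U where "U m = (\<Inter>p\<in>F. Cr_nbhd A r H0 (chart_at A p) (K p) 2 (inverse (real (Suc m))))" for m
  show thesis
  proof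
    show "openin (Cr_topology A r) (U m)" for m
      unfolding U_def
    proof (rule openin_Inter)
      fix S assume "S \<in> (\<lambda>p. Cr_nbhd A r H0 (chart_at A p) (K p) 2 (inverse (real (Suc m)))) ` F"
      then obtain p where S: "S = Cr_nbhd A r H0 (chart_at A p) (K p) 2 (inverse (real (Suc m)))" by blast
      show "openin (Cr_topology A r) S"
        unfolding S Cr_topology_def
      proof (rule topology_generated_by_Basis, intro CollectI exI conjI)
        show "enat 2 \<le> r" using r by (simp add: numeral_eq_enat)
      qed (use H0 chart_at(1) K in auto)
    qed (use F(1) Fne in auto)
    show "H0 \<in> U m" for m using H0 by (auto simp: U_def Cr_nbhd_def)
    have mem: "H \<in> Cr_functions A r" if "H \<in> U m" for H m using that Fne by (auto simp: U_def Cr_nbhd_def)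
    show "Ck_fun A 2 UNIV H" if "H \<in> U m" for H m by (rule C2[OF mem[OF that]])
    fix Hs :: "nat \<Rightarrow> 'a \<Rightarrow> real" assume Hs: "\<And>m. Hs m \<in> U m"
    show "C2_converges Hs H0"
      unfolding C2_converges_def
    proof (intro conjI allI)
      show "Ck_fun A 2 UNIV (Hs n)" for n by (rule C2[OF mem[OF Hs]])
      show "Ck_fun A 2 UNIV H0" by (rule C2[OF H0])
      fix q
      obtain p where p: "p \<in> F" "q \<in> W p" using F(2) by blast
      let ?c = "chart_at A p"
      have sub: "cball (chart_map ?c q) (\<rho> p / 2) \<subseteq> cball (chart_map ?c p) (\<rho> p)"
      proof
        fix y assume "y \<in> cball (chart_map ?c q) (\<rho> p / 2)"
        then have "dist (chart_map ?c p) (chart_map ?c q) + dist (chart_map ?c q) y \<le> \<rho> p" using p(2) by (simp add: W_def)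
        then show "y \<in> cball (chart_map ?c p) (\<rho> p)" using dist_triangle[of "chart_map ?c p" y "chart_map ?c q"] by simp
      qed
      have "C2_limit (\<lambda>n. Hs n \<circ> chart_inv ?c) (H0 \<circ> chart_inv ?c) (cball (chart_map ?c q) (\<rho> p / 2))"
        unfolding C2_limit_def
      proof (intro allI impI)
        fix e :: real assume "0 < e"
        have "\<forall>\<^sub>F n in sequentially. inverse (real (Suc n)) < e"
          by (rule order_tendstoD(2)[OF LIMSEQ_inverse_real_of_nat \<open>0 < e\<close>])
        then show "\<forall>\<^sub>F n in sequentially. \<forall>y\<in>cball (chart_map ?c q) (\<rho> p / 2). \<forall>vs. set vs \<subseteq> Basis \<and> length vs \<le> 2 \<longrightarrow>
           \<bar>iter_deriv vs (Hs n \<circ> chart_inv ?c) y - iter_deriv vs (H0 \<circ> chart_inv ?c) y\<bar> < e"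
        proof eventually_elim
          case (elim n)
          show ?case
          proof (intro ballI allI impI)
            fix y vs assume y: "y \<in> cball (chart_map ?c q) (\<rho> p / 2)" and vs: "set vs \<subseteq> (Basis :: 'e set) \<and> length vs \<le> 2"
            have y': "y \<in> cball (chart_map ?c p) (\<rho> p)" using y sub by blast
            then have "chart_inv ?c y \<in> K p" by (simp add: K_def)
            moreover have "chart_map ?c (chart_inv ?c y) = y" using y' \<rho>(2) chart_map_inv[OF chart_at(1)] by blast
            moreover have "Hs n \<in> Cr_nbhd A r H0 ?c (K p) 2 (inverse (real (Suc n)))" using Hs[of n] p(1) by (auto simp: U_def)
            ultimately have "\<bar>iter_deriv vs (Hs n \<circ> chart_inv ?c) y - iter_deriv vs (H0 \<circ> chart_inv ?c) y\<bar> < inverse (real (Suc n))"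
              using vs unfolding Cr_nbhd_def by fastforce
            then show "\<bar>iter_deriv vs (Hs n \<circ> chart_inv ?c) y - iter_deriv vs (H0 \<circ> chart_inv ?c) y\<bar> < e" using elim by linarith
          qed
        qed
      qed
      moreover have "cball (chart_map ?c q) (\<rho> p / 2) \<subseteq> chart_img ?c" using sub \<rho>(2) by blast
      moreover have "q \<in> chart_dom ?c" using p(2) by (simp add: W_def)
      moreover have "0 < \<rho> p / 2" using \<rho>(1)[of p] by simp
      ultimately show "\<exists>c\<in>A. \<exists>r>0. q \<in> chart_dom c \<and> cball (chart_map c q) r \<subseteq> chart_img c \<and>
        C2_limit (\<lambda>n. Hs n \<circ> chart_inv c) (H0 \<circ> chart_inv c) (cball (chart_map c q) r)"
        using chart_at(1)[of p] by blast
    qed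
  qed
qed

end

context anosov_collar
begin

lemma rigid_eventually:
  assumes conv: "C2_converges Hs H0" and es: "es \<longlonglongrightarrow> e0" and N: "open N" "E0 \<subseteq> N" "N \<subseteq> tube \<delta>"
  shows "\<forall>\<^sub>F n in sequentially. (\<forall>p\<in>ctube \<delta>. 1 / 2 < dfun A (Hs n) p (Y p)) \<and> is_continuation N (Hs n) (es n) (level (Hs n) (es n)) \<and>
    level (Hs n) (es n) \<in> components (Hs n -` {es n}) \<and> rigid (ham_field A \<omega> (Hs n)) (Hs n) (level (Hs n) (es n))"
proof -
  obtain d1 where d1: "0 < d1" "\<And>p t. p \<in> E0 \<Longrightarrow> \<bar>t\<bar> \<le> d1 \<Longrightarrow> \<psi> t p \<in> N"
    by (rule flow_stays[OF Y E0_closed N(1,2)]) blast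
  define d where "d = min d1 (\<delta> / 2)"
  have d: "0 < d" "d < \<delta>" using d1 \<delta> by (auto simp: d_def)
  have dN: "ctube d \<subseteq> N" using d1(2) by (auto simp: ctube_def d_def)
  have C1: "Ck_fun A (Suc 0) UNIV (Hs n)" for n using Ck_fun_mono[OF C2_converges_C2(1)[OF conv]] by simp
  have "\<forall>\<^sub>F n in sequentially. \<forall>p. \<bar>Hs n p - H0 p\<bar> < d / 2" by (rule C2_converges_uniform[OF conv]) (use d in simp)
  moreover have "\<forall>\<^sub>F n in sequentially. \<bar>es n - e0\<bar> < d / 2"
    using tendstoD[OF es, of "d / 2"] d by (simp add: dist_real_def)
  ultimately have near: "\<forall>\<^sub>F n in sequentially. (\<forall>p\<in>ctube \<delta>. 1 / 2 < dfun A (Hs n) p (Y p)) \<and> (\<forall>p. \<bar>Hs n p - H0 p\<bar> < d / 2) \<and> \<bar>es n - e0\<bar> < d / 2"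
    using transversal_eventually[OF conv] by eventually_elim blast
  have rigid: "\<forall>\<^sub>F n in sequentially. rigid (ham_field A \<omega> (Hs n)) (Hs n) (level (Hs n) (es n))"
  proof (rule ccontr)
    assume neg: "\<not> ?thesis"
    obtain s :: "nat \<Rightarrow> nat" where s: "strict_mono s" "\<forall>n. \<not> rigid (ham_field A \<omega> (Hs (s n))) (Hs (s n)) (level (Hs (s n)) (es (s n)))"
      using not_eventually_sequentiallyD[OF neg] by blast
    obtain m where m: "\<And>n. m \<le> n \<Longrightarrow> (\<forall>p\<in>ctube \<delta>. 1 / 2 < dfun A (Hs n) p (Y p)) \<and> (\<forall>p. \<bar>Hs n p - H0 p\<bar> < d / 2) \<and> \<bar>es n - e0\<bar> < d / 2"
      using near unfolding eventually_sequentially by blast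
    define q where "q n = s (n + m)" for n
    have q: "strict_mono q" using s(1) by (simp add: q_def strict_mono_def)
    have "m \<le> q n" for n using seq_suble[OF s(1), of "n + m"] by (simp add: q_def)
    note near = m[OF this]
    have comp: "level (Hs (q n)) (es (q n)) \<in> components (Hs (q n) -` {es (q n)})"
      and cmp: "compact (level (Hs (q n)) (es (q n)))" for n
      using near[of n] level_component[OF C1 _ _ _ d] level_compact[OF C1 _ _ _ d] by blast+
    show False
    proof (rule sequence_of_non_rigid_levels_absurd[of "\<lambda>n. Hs (q n)" "\<lambda>n. es (q n)"])
      show "C2_converges (\<lambda>n. Hs (q n)) H0" by (rule C2_converges_subseq[OF conv q])
      show "(\<lambda>n. es (q n)) \<longlonglongrightarrow> e0" using LIMSEQ_subseq_LIMSEQ[OF es q] by (simp add: o_def)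
      show "closed (level (Hs (q n)) (es (q n)))" for n by (rule compact_imp_closed[OF cmp])
      show "ham_flow A \<omega> (Hs (q n)) t p \<in> level (Hs (q n)) (es (q n))" if "p \<in> level (Hs (q n)) (es (q n))" for n p t
        by (rule component_invariant[OF \<omega> C2_converges_C2(1)[OF conv] comp that])
      show "\<not> rigid (ham_field A \<omega> (Hs (q n))) (Hs (q n)) (level (Hs (q n)) (es (q n)))" for n using s(2) by (simp add: q_def)
    qed (use near in blast)
  qed
  from near rigid show ?thesis
  proof eventually_elim
    case (elim n)
    then show ?case using level_component[OF C1 _ _ _ d] level_continuation[OF C1 _ _ _ d dN N(3)] by blast
  qed
qed

end

theorem corollary6:
  fixes A :: "('a::t2_space, 'e::euclidean_space) chart set"
    and \<omega> g :: "'a \<Rightarrow> 'e \<Rightarrow> 'e \<Rightarrow> real"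
    and n :: nat and r :: enat
    and H0 :: "'a \<Rightarrow> real" and e0 :: real and E0 :: "'a set"
  assumes "2 \<le> n" and "DIM('e) = 2 * n"
    and "compact (UNIV :: 'a set)" and "connected (UNIV :: 'a set)"
    and "smooth_atlas A" and "symplectic_form A \<omega>" and "riemannian_metric A g"
    and "2 \<le> r" and "H0 \<in> Cr_functions A r"
    and "E0 \<in> components (H0 -` {e0})"
    and "anosov_on A \<omega> g H0 E0"
  shows "\<exists>N0. tubular_neighborhood A E0 N0 \<and>
           (\<forall>N. tubular_neighborhood A E0 N \<and> N \<subseteq> N0 \<longrightarrow>
             (\<exists>U V. openin (Cr_topology A r) U \<and> H0 \<in> U \<and> open V \<and> e0 \<in> V \<and>
               (\<forall>H\<in>U. \<forall>e\<in>V. \<exists>E. is_continuation N H e E \<and>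
                  trivial_centralizer_on A \<omega> H E)))"
proof -
  note \<omega> = assms(6) and g = assms(7)
  interpret closed_manifold A by unfold_locales (use assms in auto)
  obtain UU where UU: "\<And>m. openin (Cr_topology A r) (UU m)" "\<And>m. H0 \<in> UU m"
    "\<And>m H. H \<in> UU m \<Longrightarrow> Ck_fun A 2 UNIV H" "\<And>Hs. (\<And>m. Hs m \<in> UU m) \<Longrightarrow> C2_converges Hs H0"
    by (rule C2_neighbourhoods[OF assms(8,9)]) blast
  have H0: "Ck_fun A 2 UNIV H0" by (rule UU(3)[OF UU(2)])
  have H0_cont: "continuous_on UNIV H0"
    by (rule continuous_at_imp_continuous_on) (use C1_fun_isCont[OF Ck_fun_mono[OF H0] open_UNIV] in auto)
  have E0: "closed E0" by (rule closed_components[OF closed_vimage[OF closed_singleton H0_cont] assms(10)])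
  have regular: "\<exists>v. dfun A H0 p v \<noteq> 0" if "p \<in> E0" for p
  proof (rule ccontr)
    assume neg: "\<not> ?thesis"
    have bl: "bilinear (\<omega> p)" using symplectic_bilinear[OF \<omega>] by (simp add: smooth_bilinear_field_def)
    have "ham_field A \<omega> H0 p = 0"
    proof (rule ham_field_eqI[OF symplectic_bilinear[OF \<omega>] symplectic_nondeg[OF \<omega>]])
      show "\<omega> p 0 v = dfun A H0 p v" for v using neg bilinear_lzero[OF bl, of v] by (metis (full_types))
    qed
    then show False using assms(11) that by (simp add: anosov_on_def)
  qed
  have "\<exists>Y Q. C1_field Y \<and> open Q \<and> E0 \<subseteq> Q \<and> (\<forall>p\<in>Q. dfun A H0 p (Y p) = 1)"
    by (rule unit_speed_field[OF g H0 E0 regular]) auto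
  then obtain Y Q where Y: "C1_field Y" and Q: "open Q" "E0 \<subseteq> Q" and unit: "\<And>p. p \<in> Q \<Longrightarrow> dfun A H0 p (Y p) = 1"
    by auto
  obtain \<delta> where \<delta>: "0 < \<delta>" "\<And>p t. p \<in> E0 \<Longrightarrow> \<bar>t\<bar> \<le> \<delta> \<Longrightarrow> flow A Y t p \<in> Q"
    by (rule flow_stays[OF Y E0 Q]) blast
  interpret anosov_collar A H0 e0 E0 Y Q \<delta> \<omega> g
    by unfold_locales (use assms H0 Y Q unit \<delta> in \<open>auto simp: anosov_on_def\<close>)
  show ?thesis
  proof (intro exI[of _ "tube \<delta>"] conjI allI impI)
    show "tubular_neighborhood A E0 (tube \<delta>)" by (rule tubular_neighborhood_tube)
    fix N assume N: "tubular_neighborhood A E0 N \<and> N \<subseteq> tube \<delta>"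
    then have N': "open N" "E0 \<subseteq> N" "N \<subseteq> tube \<delta>" by (auto simp: tubular_neighborhood_def)
    define good where "good H e \<longleftrightarrow> (\<forall>p\<in>ctube \<delta>. 1 / 2 < dfun A H p (Y p)) \<and> is_continuation N H e (level H e) \<and>
      level H e \<in> components (H -` {e}) \<and> rigid (ham_field A \<omega> H) H (level H e)" for H e
    have "\<exists>m. \<forall>H\<in>UU m. \<forall>e. \<bar>e - e0\<bar> < inverse (real (Suc m)) \<longrightarrow> good H e"
    proof (rule ccontr)
      assume "\<not> ?thesis"
      then have "\<forall>m. \<exists>H e. H \<in> UU m \<and> \<bar>e - e0\<bar> < inverse (real (Suc m)) \<and> \<not> good H e" by blast
      then obtain Hs es where s: "\<And>m. Hs m \<in> UU m" "\<And>m. \<bar>es m - e0\<bar> < inverse (real (Suc m))" "\<And>m. \<not> good (Hs m) (es m)" by metis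
      have "(\<lambda>m. es m - e0) \<longlonglongrightarrow> 0"
        by (rule Lim_null_comparison[OF _ LIMSEQ_inverse_real_of_nat]) (use s(2) in \<open>simp add: less_imp_le\<close>)
      then have "es \<longlonglongrightarrow> e0" by (rule LIM_zero_cancel)
      from rigid_eventually[OF UU(4)[OF s(1)] this N'] have "\<forall>\<^sub>F n in sequentially. good (Hs n) (es n)"
        by (simp add: good_def)
      then show False using s(3) by (auto simp: eventually_sequentially)
    qed
    then obtain m where m: "\<And>H e. H \<in> UU m \<Longrightarrow> \<bar>e - e0\<bar> < inverse (real (Suc m)) \<Longrightarrow> good H e" by blast
    let ?V = "ball e0 (inverse (real (Suc m)))"
    have V: "e \<in> ?V \<longleftrightarrow> \<bar>e - e0\<bar> < inverse (real (Suc m))" for e by (simp add: dist_real_def abs_minus_commute)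
    show "\<exists>U V. openin (Cr_topology A r) U \<and> H0 \<in> U \<and> open V \<and> e0 \<in> V \<and>
       (\<forall>H\<in>U. \<forall>e\<in>V. \<exists>E. is_continuation N H e E \<and> trivial_centralizer_on A \<omega> H E)"
    proof (intro exI[of _ "UU m"] exI[of _ ?V] conjI ballI)
      fix H e assume H: "H \<in> UU m" and e: "e \<in> ?V"
      have good: "good H e'" if "e' \<in> ?V" for e' using m[OF H] that V by blast
      have "trivial_centralizer_on A \<omega> H (level H e)"
        by (rule trivial_centralizer[OF \<omega> UU(3)[OF H] _ open_ball e]) (use good e in \<open>auto simp: good_def\<close>)
      then show "\<exists>E. is_continuation N H e E \<and> trivial_centralizer_on A \<omega> H E"
        using good[OF e] by (auto simp: good_def)
    qed (use UU in auto)
  qed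
qed

end
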